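(* Let $G_1,G_2$ be real reductive Lie groups, let $K_i\subset G_i$ be a maximal compact subgroup and let $\mathfrak{g}_i$ be the complexified Lie algebra of $G_i$ ($i=1,2$). Let $M$ be an irreducible admissible $(\mathfrak{g}_1\times\mathfrak{g}_2,K_1\times K_2)$-module. Then there exist irreducible admissible $(\mathfrak{g}_i,K_i)$-modules $M_i$ ($i=1,2$) such that $M\simeq M_1\otimes M_2$ as $(\mathfrak{g}_1\times\mathfrak{g}_2,K_1\times K_2)$-modules.
   Context: Let $G$ be a real reductive group, $K\subset G$ a maximal compact subgroup, and $\mathfrak{g},\mathfrak{k}$ the complexified Lie algebras of $G,K$. A $(\mathfrak{g},K)$-module is a complex vector space $\pi$ that is a $\mathfrak{g}$-module with a locally finite (continuous) action of $K$ such that the two induced actions of $\mathfrak{k}$ coincide and $\pi(\mathrm{Ad}(k)X)=\pi(k)\pi(X)\pi(k^{-1})$ for all $k\in K$, $X\in\mathfrak{g}$. A finitely generated $(\mathfrak{g},K)$-module is called admissible (a Harish-Chandra module) if every irreducible representation of $K$ appears in it with finite (or zero) multiplicity. Irreducible means nonzero with no proper nonzero $(\mathfrak{g},K)$-submodules. $M_1\otimes M_2$ is the algebraic tensor product over $\mathbb{C}$, with $(\mathfrak{g}_1,K_1)$ acting on the first factor and $(\mathfrak{g}_2,K_2)$ acting on the second. *)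

theory Defs
  imports
    "HOL-Algebra.AbelCoset"
    "HOL-Algebra.Module"
    "HOL-Analysis.Abstract_Euclidean_Space"
    "HOL-Analysis.Abstract_Topological_Spaces"
    "Jordan_Normal_Form.Determinant"
begin

hide_const (open) Multiset.mult Polynomial.smult

section \<open>Smooth manifolds\<close>

text \<open>Local coordinates take values in \<^const>\<open>Euclidean_space\<close>, the sequences supported on
  the first \<open>n\<close> indices, so that the dimension is a number (possibly \<open>0\<close>, as for finite groups).
  The set \<open>U\<close> below is always open in \<open>Euclidean_space n\<close>; the functions are only relevant on
  \<open>U\<close>.\<close>

primrec C_on :: "nat \<Rightarrow> nat \<Rightarrow> (nat \<Rightarrow> real) set \<Rightarrow> ((nat \<Rightarrow> real) \<Rightarrow> real) \<Rightarrow> bool" where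
  "C_on n 0 U f \<longleftrightarrow> continuous_map (subtopology (Euclidean_space n) U) euclideanreal f"
| "C_on n (Suc k) U f \<longleftrightarrow>
     continuous_map (subtopology (Euclidean_space n) U) euclideanreal f \<and>
     (\<forall>i<n. \<exists>f'. (\<forall>x\<in>U. ((\<lambda>t. f (x(i := t))) has_real_derivative f' x) (at (x i))) \<and> C_on n k U f')"

definition smooth_on :: "nat \<Rightarrow> (nat \<Rightarrow> real) set \<Rightarrow> ((nat \<Rightarrow> real) \<Rightarrow> real) \<Rightarrow> bool" where
  "smooth_on n U f \<longleftrightarrow> (\<forall>k. C_on n k U f)"

record 'a manifold =
  mtop :: "'a topology"
  mdim :: nat
  matlas :: "('a set \<times> ('a \<Rightarrow> nat \<Rightarrow> real)) set"

definition smooth_manifold :: "'a manifold \<Rightarrow> bool" where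
  "smooth_manifold M \<longleftrightarrow>
     Hausdorff_space (mtop M) \<and> second_countable (mtop M) \<and>
     (\<Union>(U, \<phi>)\<in>matlas M. U) = topspace (mtop M) \<and>
     (\<forall>(U, \<phi>)\<in>matlas M. openin (mtop M) U \<and> openin (Euclidean_space (mdim M)) (\<phi> ` U) \<and>
        homeomorphic_map (subtopology (mtop M) U)
          (subtopology (Euclidean_space (mdim M)) (\<phi> ` U)) \<phi>) \<and>
     (\<forall>(U, \<phi>)\<in>matlas M. \<forall>(V, \<psi>)\<in>matlas M. \<forall>i<mdim M.
        smooth_on (mdim M) (\<phi> ` (U \<inter> V)) (\<lambda>x. \<psi> (inv_into U \<phi> x) i))"

definition smooth_map :: "'a manifold \<Rightarrow> 'b manifold \<Rightarrow> ('a \<Rightarrow> 'b) \<Rightarrow> bool" where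
  "smooth_map M N F \<longleftrightarrow>
     continuous_map (mtop M) (mtop N) F \<and>
     (\<forall>(U, \<phi>)\<in>matlas M. \<forall>(V, \<psi>)\<in>matlas N. \<forall>i<mdim N.
        smooth_on (mdim M) (\<phi> ` (U \<inter> F -` V)) (\<lambda>x. \<psi> (F (inv_into U \<phi> x)) i))"

definition prod_manifold :: "'a manifold \<Rightarrow> 'b manifold \<Rightarrow> ('a \<times> 'b) manifold" where
  "prod_manifold M N =
     \<lparr>mtop = prod_topology (mtop M) (mtop N),
      mdim = mdim M + mdim N,
      matlas = {(U \<times> V, \<lambda>(x, y) i. if i < mdim M then \<phi> x i else \<psi> y (i - mdim M)) | U \<phi> V \<psi>.
                 (U, \<phi>) \<in> matlas M \<and> (V, \<psi>) \<in> matlas N}\<rparr>"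

definition smooth_functions :: "'a manifold \<Rightarrow> ('a \<Rightarrow> real) set" where
  "smooth_functions M =
     {f \<in> extensional (topspace (mtop M)).
        \<forall>(U, \<phi>)\<in>matlas M. smooth_on (mdim M) (\<phi> ` U) (\<lambda>x. f (inv_into U \<phi> x))}"


section \<open>Lie groups and their Lie algebras\<close>

record 'a lie_group = "'a monoid" +
  mfd :: "'a manifold"

abbreviation gtop :: "'a lie_group \<Rightarrow> 'a topology" where
  "gtop G \<equiv> mtop (mfd G)"

definition is_lie_group :: "'a lie_group \<Rightarrow> bool" where
  "is_lie_group G \<longleftrightarrow>
     group G \<and> smooth_manifold (mfd G) \<and> topspace (gtop G) = carrier G \<and>
     smooth_map (prod_manifold (mfd G) (mfd G)) (mfd G) (\<lambda>(x, y). x \<otimes>\<^bsub>G\<^esub> y) \<and>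
     smooth_map (mfd G) (mfd G) (\<lambda>x. inv\<^bsub>G\<^esub> x)"

text \<open>In all module records built below, the ring multiplication and unit inherited from
  \<^typ>\<open>'a ring\<close> are junk.\<close>

record ('r, 'x) lie_algebra = "('r, 'x) module" +
  bracket :: "'x \<Rightarrow> 'x \<Rightarrow> 'x"

abbreviation C_inf :: "'a lie_group \<Rightarrow> ('a \<Rightarrow> real) set" where
  "C_inf G \<equiv> smooth_functions (mfd G)"

type_synonym 'a derivation = "('a \<Rightarrow> real) \<Rightarrow> ('a \<Rightarrow> real)"

text \<open>Vector fields are derivations of the algebra of smooth functions.\<close>

definition left_invariant_fields :: "'a lie_group \<Rightarrow> 'a derivation set" where
  "left_invariant_fields G =
     {X \<in> C_inf G \<rightarrow>\<^sub>E C_inf G.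
        (\<forall>f\<in>C_inf G. \<forall>h\<in>C_inf G.
           X (\<lambda>x\<in>carrier G. f x + h x) = (\<lambda>x\<in>carrier G. X f x + X h x) \<and>
           X (\<lambda>x\<in>carrier G. f x * h x) = (\<lambda>x\<in>carrier G. X f x * h x + f x * X h x)) \<and>
        (\<forall>c. \<forall>f\<in>C_inf G. X (\<lambda>x\<in>carrier G. c * f x) = (\<lambda>x\<in>carrier G. c * X f x)) \<and>
        (\<forall>g\<in>carrier G. \<forall>f\<in>C_inf G.
           X (\<lambda>x\<in>carrier G. f (g \<otimes>\<^bsub>G\<^esub> x)) = (\<lambda>x\<in>carrier G. X f (g \<otimes>\<^bsub>G\<^esub> x)))}"

definition Lie :: "'a lie_group \<Rightarrow> (real, 'a derivation) lie_algebra" where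
  "Lie G =
     \<lparr>carrier = left_invariant_fields G, mult = undefined, one = undefined,
      zero = (\<lambda>f\<in>C_inf G. \<lambda>x\<in>carrier G. 0),
      add = (\<lambda>X Y. \<lambda>f\<in>C_inf G. \<lambda>x\<in>carrier G. X f x + Y f x),
      smult = (\<lambda>c X. \<lambda>f\<in>C_inf G. \<lambda>x\<in>carrier G. c * X f x),
      bracket = (\<lambda>X Y. \<lambda>f\<in>C_inf G. \<lambda>x\<in>carrier G. X (Y f) x - Y (X f) x)\<rparr>"

text \<open>The push-forward of a vector field under conjugation by \<open>g\<close>.\<close>

definition Ad :: "'a lie_group \<Rightarrow> 'a \<Rightarrow> 'a derivation \<Rightarrow> 'a derivation" where
  "Ad G g X =
     (\<lambda>f\<in>C_inf G. \<lambda>x\<in>carrier G.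
        X (\<lambda>y\<in>carrier G. f (g \<otimes>\<^bsub>G\<^esub> y \<otimes>\<^bsub>G\<^esub> inv\<^bsub>G\<^esub> g)) (inv\<^bsub>G\<^esub> g \<otimes>\<^bsub>G\<^esub> x \<otimes>\<^bsub>G\<^esub> g))"

text \<open>\<open>\<gamma>\<close> is the one-parameter subgroup \<open>t \<mapsto> exp (tX)\<close>: a homomorphism
  that is an integral curve of \<open>X\<close>.\<close>

definition one_parameter_subgroup :: "'a lie_group \<Rightarrow> (real \<Rightarrow> 'a) \<Rightarrow> 'a derivation \<Rightarrow> bool" where
  "one_parameter_subgroup G \<gamma> X \<longleftrightarrow>
     X \<in> carrier (Lie G) \<and> \<gamma> \<in> hom \<lparr>carrier = UNIV, mult = (+), one = 0\<rparr> G \<and>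
     (\<forall>f\<in>C_inf G. \<forall>t. ((\<lambda>s. f (\<gamma> s)) has_real_derivative X f (\<gamma> t)) (at t))"

text \<open>The pair \<open>(X, Y)\<close> stands for \<open>X + \<i> Y\<close>.\<close>

definition complexification :: "(real, 'x) lie_algebra \<Rightarrow> (complex, 'x \<times> 'x) lie_algebra" where
  "complexification L =
     \<lparr>carrier = carrier L \<times> carrier L, mult = undefined, one = undefined,
      zero = (\<zero>\<^bsub>L\<^esub>, \<zero>\<^bsub>L\<^esub>),
      add = (\<lambda>(X, Y) (X', Y'). (X \<oplus>\<^bsub>L\<^esub> X', Y \<oplus>\<^bsub>L\<^esub> Y')),
      smult = (\<lambda>c (X, Y). (Re c \<odot>\<^bsub>L\<^esub> X \<oplus>\<^bsub>L\<^esub> (- Im c) \<odot>\<^bsub>L\<^esub> Y, Re c \<odot>\<^bsub>L\<^esub> Y \<oplus>\<^bsub>L\<^esub> Im c \<odot>\<^bsub>L\<^esub> X)),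
      bracket = (\<lambda>(X, Y) (X', Y').
         (bracket L X X' \<oplus>\<^bsub>L\<^esub> (- 1) \<odot>\<^bsub>L\<^esub> bracket L Y Y', bracket L X Y' \<oplus>\<^bsub>L\<^esub> bracket L Y X'))\<rparr>"

definition lie_product ::
  "('r, 'x) lie_algebra \<Rightarrow> ('r, 'y) lie_algebra \<Rightarrow> ('r, 'x \<times> 'y) lie_algebra" where
  "lie_product L L' =
     \<lparr>carrier = carrier L \<times> carrier L', mult = undefined, one = undefined,
      zero = (\<zero>\<^bsub>L\<^esub>, \<zero>\<^bsub>L'\<^esub>),
      add = (\<lambda>(X, Y) (X', Y'). (X \<oplus>\<^bsub>L\<^esub> X', Y \<oplus>\<^bsub>L'\<^esub> Y')),
      smult = (\<lambda>c (X, Y). (c \<odot>\<^bsub>L\<^esub> X, c \<odot>\<^bsub>L'\<^esub> Y)),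
      bracket = (\<lambda>(X, Y) (X', Y'). (bracket L X X', bracket L' Y Y'))\<rparr>"

definition compact_subgroup :: "'a lie_group \<Rightarrow> 'a set \<Rightarrow> bool" where
  "compact_subgroup G K \<longleftrightarrow> subgroup K G \<and> compactin (gtop G) K"

definition maximal_compact_subgroup :: "'a lie_group \<Rightarrow> 'a set \<Rightarrow> bool" where
  "maximal_compact_subgroup G K \<longleftrightarrow>
     compact_subgroup G K \<and> (\<forall>K'. compact_subgroup G K' \<and> K \<subseteq> K' \<longrightarrow> K' = K)"


section \<open>Real reductive groups\<close>

text \<open>Following Wallach (\<open>Real Reductive Groups I\<close>, 2.1): \<open>G\<close> is a finite covering group of an
  open subgroup of the group of real points of a reductive linear algebraic group
  defined over the reals.\<close>

definition GL :: "nat \<Rightarrow> 'f::field mat monoid" where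
  "GL n = \<lparr>carrier = {A \<in> carrier_mat n n. det A \<noteq> 0}, mult = (*), one = 1\<^sub>m n\<rparr>"

inductive_set mat_polynomials :: "nat \<Rightarrow> complex set \<Rightarrow> (complex mat \<Rightarrow> complex) set"
  for n :: nat and C :: "complex set" where
  const: "c \<in> C \<Longrightarrow> (\<lambda>A. c) \<in> mat_polynomials n C"
| entry: "i < n \<Longrightarrow> j < n \<Longrightarrow> (\<lambda>A. A $$ (i, j)) \<in> mat_polynomials n C"
| add: "p \<in> mat_polynomials n C \<Longrightarrow> q \<in> mat_polynomials n C \<Longrightarrow>
    (\<lambda>A. p A + q A) \<in> mat_polynomials n C"
| mult: "p \<in> mat_polynomials n C \<Longrightarrow> q \<in> mat_polynomials n C \<Longrightarrow>
    (\<lambda>A. p A * q A) \<in> mat_polynomials n C"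

definition algebraic_set :: "nat \<Rightarrow> complex set \<Rightarrow> complex mat set \<Rightarrow> bool" where
  "algebraic_set n C S \<longleftrightarrow>
     (\<exists>F. finite F \<and> F \<subseteq> mat_polynomials n C \<and> S = {A \<in> carrier (GL n). \<forall>p\<in>F. p A = 0})"

definition zariski_connected :: "nat \<Rightarrow> complex mat set \<Rightarrow> bool" where
  "zariski_connected n S \<longleftrightarrow>
     \<not> (\<exists>S1 S2. algebraic_set n UNIV S1 \<and> algebraic_set n UNIV S2 \<and>
          S1 \<noteq> {} \<and> S2 \<noteq> {} \<and> S1 \<inter> S2 = {} \<and> S1 \<union> S2 = S)"

definition unipotent :: "nat \<Rightarrow> complex mat \<Rightarrow> bool" where
  "unipotent n A \<longleftrightarrow> (A - 1\<^sub>m n) ^\<^sub>m n = 0\<^sub>m n n"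

text \<open>The last condition says that the unipotent radical is trivial.\<close>

definition reductive_algebraic_group_over_R :: "nat \<Rightarrow> complex mat set \<Rightarrow> bool" where
  "reductive_algebraic_group_over_R n H \<longleftrightarrow>
     subgroup H (GL n) \<and> algebraic_set n \<real> H \<and>
     (\<forall>U. U \<lhd> (GL n)\<lparr>carrier := H\<rparr> \<and> algebraic_set n UNIV U \<and> zariski_connected n U \<and>
          (\<forall>A\<in>U. unipotent n A) \<longrightarrow> U = {1\<^sub>m n})"

definition real_points :: "nat \<Rightarrow> complex mat set \<Rightarrow> real mat set" where
  "real_points n H = {A \<in> carrier_mat n n. map_mat complex_of_real A \<in> H}"

definition mat_topology :: "nat \<Rightarrow> real mat topology" where
  "mat_topology n = pullback_topology (carrier_mat n n)
     (\<lambda>A (i, j). if i < n \<and> j < n then A $$ (i, j) else 0) (powertop_real UNIV)"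

definition finite_covering_map :: "'a topology \<Rightarrow> 'b topology \<Rightarrow> ('a \<Rightarrow> 'b) \<Rightarrow> bool" where
  "finite_covering_map X Y p \<longleftrightarrow>
     continuous_map X Y p \<and> p ` topspace X = topspace Y \<and>
     (\<forall>y\<in>topspace Y. \<exists>U. openin Y U \<and> y \<in> U \<and>
        (\<exists>\<V>. finite \<V> \<and> pairwise disjnt \<V> \<and> \<Union>\<V> = {x \<in> topspace X. p x \<in> U} \<and>
           (\<forall>V\<in>\<V>. openin X V \<and> homeomorphic_map (subtopology X V) (subtopology Y U) p)))"

definition real_reductive_group :: "'a lie_group \<Rightarrow> bool" where
  "real_reductive_group G \<longleftrightarrow>
     is_lie_group G \<and>
     (\<exists>n H G0 p. reductive_algebraic_group_over_R n H \<and> subgroup G0 (GL n) \<and>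
        openin (subtopology (mat_topology n) (real_points n H)) G0 \<and>
        p \<in> hom G ((GL n)\<lparr>carrier := G0\<rparr>) \<and>
        finite_covering_map (gtop G) (subtopology (mat_topology n) G0) p)"


section \<open>Complex vector spaces\<close>

definition complex_ring :: "complex ring" where
  "complex_ring = \<lparr>carrier = UNIV, mult = (*), one = 1, zero = 0, add = (+)\<rparr>"

definition complex_line :: "(complex, complex) module" where
  "complex_line = \<lparr>carrier = UNIV, mult = (*), one = 1, zero = 0, add = (+), smult = (*)\<rparr>"

abbreviation complex_space :: "(complex, 'v, 'z) module_scheme \<Rightarrow> bool" where
  "complex_space V \<equiv> module complex_ring V"

abbreviation subspace_of :: "'v set \<Rightarrow> (complex, 'v, 'z) module_scheme \<Rightarrow> bool" where
  "subspace_of W V \<equiv> submodule W complex_ring V"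

definition linear_map ::
  "(complex, 'v, 'y) module_scheme \<Rightarrow> (complex, 'w, 'z) module_scheme \<Rightarrow> ('v \<Rightarrow> 'w) \<Rightarrow> bool" where
  "linear_map V W f \<longleftrightarrow>
     f \<in> carrier V \<rightarrow> carrier W \<and>
     (\<forall>v\<in>carrier V. \<forall>v'\<in>carrier V. f (v \<oplus>\<^bsub>V\<^esub> v') = f v \<oplus>\<^bsub>W\<^esub> f v') \<and>
     (\<forall>c. \<forall>v\<in>carrier V. f (c \<odot>\<^bsub>V\<^esub> v) = c \<odot>\<^bsub>W\<^esub> f v)"

definition complex_span :: "(complex, 'v, 'z) module_scheme \<Rightarrow> 'v set \<Rightarrow> 'v set" where
  "complex_span V B = \<Inter>{W. subspace_of W V \<and> B \<subseteq> W}"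

definition finite_dim :: "(complex, 'v, 'z) module_scheme \<Rightarrow> 'v set \<Rightarrow> bool" where
  "finite_dim V W \<longleftrightarrow> (\<exists>B. finite B \<and> B \<subseteq> carrier V \<and> W = complex_span V B)"


section \<open>Representations of compact groups\<close>

record ('k, 'v) k_rep = "(complex, 'v) module" +
  kact :: "'k \<Rightarrow> 'v \<Rightarrow> 'v"

definition k_subspace :: "'k monoid \<Rightarrow> ('k, 'v, 'z) k_rep_scheme \<Rightarrow> 'v set \<Rightarrow> bool" where
  "k_subspace K V W \<longleftrightarrow> subspace_of W V \<and> (\<forall>k\<in>carrier K. \<forall>w\<in>W. kact V k w \<in> W)"

text \<open>Locally finite continuous representations. Continuity refers to the usual topology of
  the finite-dimensional invariant subspaces, which is the one generated by the linear
  functionals, and every functional on a subspace extends to \<open>V\<close>.\<close>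

definition k_module :: "'k monoid \<Rightarrow> 'k topology \<Rightarrow> ('k, 'v, 'z) k_rep_scheme \<Rightarrow> bool" where
  "k_module K T V \<longleftrightarrow>
     complex_space V \<and>
     (\<forall>k\<in>carrier K. linear_map V V (kact V k)) \<and>
     (\<forall>v\<in>carrier V. kact V \<one>\<^bsub>K\<^esub> v = v) \<and>
     (\<forall>k\<in>carrier K. \<forall>k'\<in>carrier K. \<forall>v\<in>carrier V.
        kact V (k \<otimes>\<^bsub>K\<^esub> k') v = kact V k (kact V k' v)) \<and>
     (\<forall>v\<in>carrier V. \<exists>W. k_subspace K V W \<and> finite_dim V W \<and> v \<in> W) \<and>
     (\<forall>v\<in>carrier V. \<forall>f. linear_map V complex_line f \<longrightarrow>
        continuous_map T euclidean (\<lambda>k. f (kact V k v)))"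

definition irreducible_k_module ::
  "'k monoid \<Rightarrow> 'k topology \<Rightarrow> ('k, 'v, 'z) k_rep_scheme \<Rightarrow> bool" where
  "irreducible_k_module K T V \<longleftrightarrow>
     k_module K T V \<and> carrier V \<noteq> {\<zero>\<^bsub>V\<^esub>} \<and>
     (\<forall>W. k_subspace K V W \<longrightarrow> W = {\<zero>\<^bsub>V\<^esub>} \<or> W = carrier V)"

text \<open>The vector space \<open>Hom\<^sub>K(\<rho>, V)\<close>; its dimension is the multiplicity of \<open>\<rho>\<close> in \<open>V\<close>.\<close>

definition k_hom_space ::
  "'k monoid \<Rightarrow> ('k, 'w, 'y) k_rep_scheme \<Rightarrow> ('k, 'v, 'z) k_rep_scheme \<Rightarrow> (complex, 'w \<Rightarrow> 'v) module"
  where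
  "k_hom_space K \<rho> V =
     \<lparr>carrier = {f \<in> extensional (carrier \<rho>). linear_map \<rho> V f \<and>
        (\<forall>k\<in>carrier K. \<forall>w\<in>carrier \<rho>. f (kact \<rho> k w) = kact V k (f w))},
      mult = undefined, one = undefined,
      zero = (\<lambda>w\<in>carrier \<rho>. \<zero>\<^bsub>V\<^esub>),
      add = (\<lambda>f h. \<lambda>w\<in>carrier \<rho>. f w \<oplus>\<^bsub>V\<^esub> h w),
      smult = (\<lambda>c f. \<lambda>w\<in>carrier \<rho>. c \<odot>\<^bsub>V\<^esub> f w)\<rparr>"

text \<open>Irreducible representations of a compact group are finite-dimensional, so, up to
  isomorphism, all of them have carriers inside the type of complex sequences.\<close>

definition finite_multiplicities ::
  "'k monoid \<Rightarrow> 'k topology \<Rightarrow> ('k, 'v, 'z) k_rep_scheme \<Rightarrow> bool" where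
  "finite_multiplicities K T V \<longleftrightarrow>
     (\<forall>\<rho> :: ('k, nat \<Rightarrow> complex) k_rep.
        irreducible_k_module K T \<rho> \<and> finite_dim \<rho> (carrier \<rho>) \<longrightarrow>
        finite_dim (k_hom_space K \<rho> V) (carrier (k_hom_space K \<rho> V)))"


section \<open>Pairs and their modules\<close>

text \<open>The data of a pair \<open>(\<gg>, K)\<close> entering into the definition of a \<open>(\<gg>, K)\<close>-module. The set
  \<open>tangents\<close> encodes the inclusion of the real Lie algebra of \<open>K\<close> into \<open>\<gg>\<close>: it consists of all
  \<open>(\<gamma>, X)\<close> where \<open>\<gamma>\<close> is a one-parameter subgroup of \<open>K\<close> and \<open>X \<in> \<gg>\<close> its velocity.\<close>

record ('x, 'k) gk_pair =
  alg :: "(complex, 'x) lie_algebra"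
  grp :: "'k monoid"
  ktop :: "'k topology"
  adj :: "'k \<Rightarrow> 'x \<Rightarrow> 'x"
  tangents :: "((real \<Rightarrow> 'k) \<times> 'x) set"

definition pair_of :: "'a lie_group \<Rightarrow> 'a set \<Rightarrow> ('a derivation \<times> 'a derivation, 'a) gk_pair" where
  "pair_of G K =
     \<lparr>alg = complexification (Lie G),
      grp = \<lparr>carrier = K, mult = mult G, one = one G\<rparr>,
      ktop = subtopology (gtop G) K,
      adj = (\<lambda>k (X, Y). (Ad G k X, Ad G k Y)),
      tangents = {(\<gamma>, (X, \<zero>\<^bsub>Lie G\<^esub>)) | \<gamma> X. one_parameter_subgroup G \<gamma> X \<and> range \<gamma> \<subseteq> K}\<rparr>"

definition pair_product ::
  "('x, 'k) gk_pair \<Rightarrow> ('y, 'l) gk_pair \<Rightarrow> ('x \<times> 'y, 'k \<times> 'l) gk_pair" where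
  "pair_product P Q =
     \<lparr>alg = lie_product (alg P) (alg Q),
      grp = grp P \<times>\<times> grp Q,
      ktop = prod_topology (ktop P) (ktop Q),
      adj = (\<lambda>(k, l) (X, Y). (adj P k X, adj Q l Y)),
      tangents = {(\<lambda>t. (\<gamma> t, \<delta> t), (X, Y)) | \<gamma> \<delta> X Y.
                    (\<gamma>, X) \<in> tangents P \<and> (\<delta>, Y) \<in> tangents Q}\<rparr>"

record ('x, 'k, 'v) gk_rep = "('k, 'v) k_rep" +
  gact :: "'x \<Rightarrow> 'v \<Rightarrow> 'v"

text \<open>The last condition says that the action of the Lie algebra of \<open>K\<close> obtained by
  differentiating the action of \<open>K\<close> is the restriction of the action of \<open>\<gg>\<close>. It is imposed on
  the real Lie algebra of \<open>K\<close>; both actions of the complexified Lie algebra are the complex-linear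
  extensions.\<close>

definition gk_module :: "('x, 'k) gk_pair \<Rightarrow> ('x, 'k, 'v) gk_rep \<Rightarrow> bool" where
  "gk_module P V \<longleftrightarrow>
     k_module (grp P) (ktop P) V \<and>
     (\<forall>X\<in>carrier (alg P). linear_map V V (gact V X)) \<and>
     (\<forall>X\<in>carrier (alg P). \<forall>Y\<in>carrier (alg P). \<forall>v\<in>carrier V.
        gact V (X \<oplus>\<^bsub>alg P\<^esub> Y) v = gact V X v \<oplus>\<^bsub>V\<^esub> gact V Y v) \<and>
     (\<forall>c. \<forall>X\<in>carrier (alg P). \<forall>v\<in>carrier V. gact V (c \<odot>\<^bsub>alg P\<^esub> X) v = c \<odot>\<^bsub>V\<^esub> gact V X v) \<and>
     (\<forall>X\<in>carrier (alg P). \<forall>Y\<in>carrier (alg P). \<forall>v\<in>carrier V.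
        gact V (bracket (alg P) X Y) v = gact V X (gact V Y v) \<ominus>\<^bsub>V\<^esub> gact V Y (gact V X v)) \<and>
     (\<forall>k\<in>carrier (grp P). \<forall>X\<in>carrier (alg P). \<forall>v\<in>carrier V.
        gact V (adj P k X) v = kact V k (gact V X (kact V (inv\<^bsub>grp P\<^esub> k) v))) \<and>
     (\<forall>(\<gamma>, X)\<in>tangents P. \<forall>v\<in>carrier V. \<forall>f. linear_map V complex_line f \<longrightarrow>
        ((\<lambda>t. f (kact V (\<gamma> t) v)) has_vector_derivative f (gact V X v)) (at 0))"

definition gk_submodule :: "('x, 'k) gk_pair \<Rightarrow> ('x, 'k, 'v) gk_rep \<Rightarrow> 'v set \<Rightarrow> bool" where
  "gk_submodule P V W \<longleftrightarrow>
     k_subspace (grp P) V W \<and> (\<forall>X\<in>carrier (alg P). \<forall>w\<in>W. gact V X w \<in> W)"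

definition irreducible_gk_module :: "('x, 'k) gk_pair \<Rightarrow> ('x, 'k, 'v) gk_rep \<Rightarrow> bool" where
  "irreducible_gk_module P V \<longleftrightarrow>
     gk_module P V \<and> carrier V \<noteq> {\<zero>\<^bsub>V\<^esub>} \<and>
     (\<forall>W. gk_submodule P V W \<longrightarrow> W = {\<zero>\<^bsub>V\<^esub>} \<or> W = carrier V)"

definition finitely_generated :: "('x, 'k) gk_pair \<Rightarrow> ('x, 'k, 'v) gk_rep \<Rightarrow> bool" where
  "finitely_generated P V \<longleftrightarrow>
     (\<exists>B. finite B \<and> B \<subseteq> carrier V \<and> (\<forall>W. gk_submodule P V W \<and> B \<subseteq> W \<longrightarrow> W = carrier V))"

definition admissible :: "('x, 'k) gk_pair \<Rightarrow> ('x, 'k, 'v) gk_rep \<Rightarrow> bool" where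
  "admissible P V \<longleftrightarrow>
     gk_module P V \<and> finitely_generated P V \<and> finite_multiplicities (grp P) (ktop P) V"

definition gk_isomorphic ::
  "('x, 'k) gk_pair \<Rightarrow> ('x, 'k, 'v) gk_rep \<Rightarrow> ('x, 'k, 'w) gk_rep \<Rightarrow> bool" where
  "gk_isomorphic P V W \<longleftrightarrow>
     (\<exists>T. bij_betw T (carrier V) (carrier W) \<and> linear_map V W T \<and>
        (\<forall>k\<in>carrier (grp P). \<forall>v\<in>carrier V. T (kact V k v) = kact W k (T v)) \<and>
        (\<forall>X\<in>carrier (alg P). \<forall>v\<in>carrier V. T (gact V X v) = gact W X (T v)))"


section \<open>Tensor products\<close>

text \<open>The tensor product is the quotient of the free vector space on the set of pairs by the
  bilinearity relations.\<close>

definition free_space :: "'p set \<Rightarrow> (complex, 'p \<Rightarrow> complex) module" where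
  "free_space S =
     \<lparr>carrier = {\<phi>. finite {p. \<phi> p \<noteq> 0} \<and> {p. \<phi> p \<noteq> 0} \<subseteq> S}, mult = undefined, one = undefined,
      zero = (\<lambda>p. 0), add = (\<lambda>\<phi> \<psi> p. \<phi> p + \<psi> p), smult = (\<lambda>c \<phi> p. c * \<phi> p)\<rparr>"

definition single :: "'p \<Rightarrow> 'p \<Rightarrow> complex" where
  "single p = (\<lambda>q. if q = p then 1 else 0)"

text \<open>The linear map with \<open>single p \<mapsto> h p\<close>.\<close>

definition free_extension :: "('p \<Rightarrow> 'q \<Rightarrow> complex) \<Rightarrow> ('p \<Rightarrow> complex) \<Rightarrow> 'q \<Rightarrow> complex" where
  "free_extension h \<phi> = (\<lambda>q. \<Sum>p | \<phi> p \<noteq> 0. \<phi> p * h p q)"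

abbreviation tensor_free ::
  "(complex, 'v, 'y) module_scheme \<Rightarrow> (complex, 'w, 'z) module_scheme \<Rightarrow>
   (complex, 'v \<times> 'w \<Rightarrow> complex) module" where
  "tensor_free V W \<equiv> free_space (carrier V \<times> carrier W)"

definition tensor_relations ::
  "(complex, 'v, 'y) module_scheme \<Rightarrow> (complex, 'w, 'z) module_scheme \<Rightarrow> ('v \<times> 'w \<Rightarrow> complex) set"
  where
  "tensor_relations V W = complex_span (tensor_free V W)
     ({\<lambda>p. single (v \<oplus>\<^bsub>V\<^esub> v', w) p - single (v, w) p - single (v', w) p | v v' w.
         v \<in> carrier V \<and> v' \<in> carrier V \<and> w \<in> carrier W} \<union>
      {\<lambda>p. single (v, w \<oplus>\<^bsub>W\<^esub> w') p - single (v, w) p - single (v, w') p | v w w'.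
         v \<in> carrier V \<and> w \<in> carrier W \<and> w' \<in> carrier W} \<union>
      {\<lambda>p. single (c \<odot>\<^bsub>V\<^esub> v, w) p - c * single (v, w) p | c v w.
         v \<in> carrier V \<and> w \<in> carrier W} \<union>
      {\<lambda>p. single (v, c \<odot>\<^bsub>W\<^esub> w) p - c * single (v, w) p | c v w.
         v \<in> carrier V \<and> w \<in> carrier W})"

text \<open>The map \<open>x + N \<mapsto> h x + N\<close> on cosets, for linear \<open>h\<close> preserving \<open>N\<close> (the union is over
  equal cosets).\<close>

definition coset_map ::
  "(complex, 'v, 'z) module_scheme \<Rightarrow> 'v set \<Rightarrow> ('v \<Rightarrow> 'v) \<Rightarrow> 'v set \<Rightarrow> 'v set" where
  "coset_map F N h A = (\<Union>x\<in>A. N +>\<^bsub>F\<^esub> h x)"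

definition gk_tensor ::
  "('x, 'k, 'v) gk_rep \<Rightarrow> ('y, 'l, 'w) gk_rep \<Rightarrow>
   ('x \<times> 'y, 'k \<times> 'l, ('v \<times> 'w \<Rightarrow> complex) set) gk_rep" where
  "gk_tensor V W =
     (let F = tensor_free V W; N = tensor_relations V W in
      \<lparr>carrier = a_rcosets\<^bsub>F\<^esub> N, mult = undefined, one = undefined,
       zero = N, add = (<+>\<^bsub>F\<^esub>), smult = (\<lambda>c. coset_map F N ((\<odot>\<^bsub>F\<^esub>) c)),
       kact = (\<lambda>(k, l). coset_map F N
         (free_extension (\<lambda>(v, w). single (kact V k v, kact W l w)))),
       gact = (\<lambda>(X, Y). coset_map F N
         (free_extension (\<lambda>(v, w) p. single (gact V X v, w) p + single (v, gact W Y w) p)))\<rparr>)"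

end

theory Submission
  imports Defs "HOL-Library.Function_Algebras" "HOL-Computational_Algebra.Fundamental_Theorem_Algebra"
begin

hide_const (open) Multiset.mult Polynomial.smult

text \<open>Let \<open>E \<subseteq> M\<close> be an irreducible \<open>K\<^sub>1 \<times> K\<^sub>2\<close>-submodule, \<open>\<rho> \<subseteq> E\<close> an irreducible \<open>K\<^sub>1\<close>-submodule and
  \<open>\<sigma> = Hom(\<rho>, E)\<close>, so that \<open>E = \<sigma> \<otimes> \<rho>\<close>. The \<open>(\<gg>\<^sub>1, K\<^sub>1)\<close>-module \<open>N = Hom(\<sigma>, M)\<close> contains \<open>\<rho>\<close> with at most
  the multiplicity of \<open>E\<close> in \<open>M\<close>, which is finite. Every nonzero \<open>(\<gg>\<^sub>1, K\<^sub>1)\<close>-submodule of \<open>M\<close> contains \<open>\<rho>\<close>,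
  because the submodules without \<open>\<rho>\<close> add up to a submodule stable under both factors (this needs
  complete reducibility under the compact group \<open>K\<^sub>1\<close>, which comes from a fixed point of a bounded
  action in place of the Haar measure). A submodule of \<open>N\<close> that contains \<open>\<rho>\<close> with the least
  multiplicity has an irreducible submodule \<open>Y\<close>; Schur's lemma holds for \<open>Y\<close>, since endomorphisms act on the
  finite-dimensional space \<open>Hom(\<rho>, Y)\<close>. Hence \<open>M = X \<otimes> Y\<close> for \<open>X = Hom(Y, M)\<close>, and irreducibility and
  finite multiplicities pass from \<open>M\<close> to \<open>X\<close> and \<open>Y\<close>. All Hom spaces are realized inside \<open>M\<close> by
  evaluation at a nonzero vector.\<close>

text \<open>The obstacle is that finiteness is given for \<open>K1 \<times> K2\<close> only: in
  \<open>M\<close> a single \<open>K1\<close>-type \<rho> may occur infinitely often, beside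
  infinitely many \<open>K2\<close>-types. Passing to \<open>N\<close> fixes one
  \<open>K2\<close>-type and thereby makes the count finite. This number does the work that finite
  length or countable dimension does elsewhere: it stops the descent to an irreducible submodule,
  since every nonzero submodule has a positive share of it, and it supplies the space in which an
  endomorphism has an eigenvector. The algebra knows neither groups nor Lie algebras. It speaks of
  sets of linear operators on one ambient vector space, so that modules, hom spaces and tensor
  factors are all subspaces of it; a module record is embedded in a space of functions for this
  purpose. The analysis on Lie groups serves the passage from the product to a factor along
  \<open>(k, 1)\<close> and \<open>(X, 0)\<close>: the zero vector field is a function restricted to
  smooth arguments, so even its invariance under \<open>Ad\<close> requires that conjugation
  preserves smooth functions.\<close>

section \<open>Fixed points of bounded actions\<close>

text \<open>Let \<open>q x\<close> be the supremum of the squared norms along the orbit of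
  \<open>x\<close>. It does not increase under the action, and the parallelogram law makes it
  uniformly convex: near-minimizers of \<open>q\<close> on \<open>S\<close> are close together, so a
  minimizing sequence converges to a minimizer, and two minimizers coincide. Hence the minimizer is
  fixed by every \<open>k\<close>. Midpoints take the place of convex combinations, so the action
  may be affine.\<close>

lemma bounded_group_fixed_point:
  fixes I :: "'i set" and act :: "'k \<Rightarrow> ('i \<Rightarrow> complex) \<Rightarrow> 'i \<Rightarrow> complex"
  assumes finI: "finite I" and K: "K \<noteq> {}" and S: "S \<noteq> {}"
    and supp: "\<And>x i. x \<in> S \<Longrightarrow> i \<notin> I \<Longrightarrow> x i = 0"
    and mid: "\<And>x y. x \<in> S \<Longrightarrow> y \<in> S \<Longrightarrow> (\<lambda>i. (x i + y i) / 2) \<in> S"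
    and closed: "\<And>X x. (\<And>n::nat. X n \<in> S) \<Longrightarrow> (\<And>i. (\<lambda>n. X n i) \<longlonglongrightarrow> x i) \<Longrightarrow> x \<in> S"
    and act_S: "\<And>k x. k \<in> K \<Longrightarrow> x \<in> S \<Longrightarrow> act k x \<in> S"
    and act_mid: "\<And>k x y. k \<in> K \<Longrightarrow> x \<in> S \<Longrightarrow> y \<in> S \<Longrightarrow>
        act k (\<lambda>i. (x i + y i) / 2) = (\<lambda>i. (act k x i + act k y i) / 2)"
    and lips: "\<And>k x y. k \<in> K \<Longrightarrow> x \<in> S \<Longrightarrow> y \<in> S \<Longrightarrow>
        (\<Sum>i\<in>I. (cmod (act k x i - act k y i))\<^sup>2) \<le> C * (\<Sum>i\<in>I. (cmod (x i - y i))\<^sup>2)"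
    and bdd: "\<And>x. x \<in> S \<Longrightarrow> \<exists>D. \<forall>k\<in>K. (\<Sum>i\<in>I. (cmod (act k x i))\<^sup>2) \<le> D"
    and comp: "\<And>h k. h \<in> K \<Longrightarrow> k \<in> K \<Longrightarrow> \<exists>m\<in>K. \<forall>x\<in>S. act h (act k x) = act m x"
    and inv: "\<And>k. k \<in> K \<Longrightarrow> \<exists>h\<in>K. \<forall>x\<in>S. act h (act k x) = x"
  shows "\<exists>x\<in>S. \<forall>k\<in>K. act k x = x"
proof -
  define N :: "('i \<Rightarrow> complex) \<Rightarrow> real" where "N x = (\<Sum>i\<in>I. (cmod (x i))\<^sup>2)" for x
  \<comment> \<open>\<open>C\<close> may be zero or negative, while the divisions by
    \<open>4 * D\<close> below need a positive constant.\<close>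
  define D where "D = max C 1"
  have D: "D > 0" "D \<ge> C" by (auto simp: D_def)
  have N0: "N x \<ge> 0" for x unfolding N_def by (intro sum_nonneg) auto
  have lips': "N (\<lambda>i. act k x i - act k y i) \<le> D * N (\<lambda>i. x i - y i)" if "k \<in> K" "x \<in> S" "y \<in> S" for k x y
    using lips[OF that] mult_right_mono[OF D(2) N0[of "\<lambda>i. x i - y i"]] unfolding N_def by linarith
  \<comment> \<open>The parallelogram law, solved for the midpoint; it is the source of the
    convexity of \<open>q\<close>.\<close>
  have par: "N (\<lambda>i. (x i + y i) / 2) = (N x + N y) / 2 - N (\<lambda>i. x i - y i) / 4" for x y
  proof -
    have *: "(cmod ((a + b) / 2))\<^sup>2 = ((cmod a)\<^sup>2 + (cmod b)\<^sup>2) / 2 - (cmod (a - b))\<^sup>2 / 4" for a b :: complex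
    proof -
      have "(cmod (a + b))\<^sup>2 + (cmod (a - b))\<^sup>2 = 2 * (cmod a)\<^sup>2 + 2 * (cmod b)\<^sup>2"
        by (simp only: cmod_power2) (simp add: power2_eq_square algebra_simps)
      then show ?thesis by (simp add: norm_divide power_divide, argo)
    qed
    show ?thesis unfolding N_def * by (simp add: sum.distrib sum_subtractf sum_divide_distrib[symmetric])
  qed
  define q where "q x = (SUP k\<in>K. N (act k x))" for x
  have bddq: "bdd_above ((\<lambda>k. N (act k x)) ` K)" if "x \<in> S" for x
    using bdd[OF that] unfolding N_def bdd_above_def by auto
  have q_ge: "N (act k x) \<le> q x" if "k \<in> K" "x \<in> S" for k x
    unfolding q_def by (rule cSUP_upper[OF that(1) bddq[OF that(2)]])
  have q_le: "q x \<le> c" if "\<And>k. k \<in> K \<Longrightarrow> N (act k x) \<le> c" for x c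
    unfolding q_def by (rule cSUP_least[OF K that])
  have q0: "q x \<ge> 0" if "x \<in> S" for x
    using K q_ge[OF _ that] N0 order_trans by blast
  define m where "m = (INF x\<in>S. q x)"
  have bddm: "bdd_below (q ` S)" using q0 by (auto simp: bdd_below_def)
  have m_le: "m \<le> q x" if "x \<in> S" for x
    unfolding m_def by (rule cINF_lower[OF bddm that])
  \<comment> \<open>The Lipschitz bound for an inverse of \<open>k\<close> bounds the distances of
    the images from below, uniformly in \<open>k\<close>.\<close>
  have lower: "N (\<lambda>i. x i - y i) \<le> D * N (\<lambda>i. act k x i - act k y i)" if k: "k \<in> K" and "x \<in> S" "y \<in> S" for k x y
  proof -
    obtain h where h: "h \<in> K" "\<forall>x\<in>S. act h (act k x) = x" using inv[OF k] by blast
    show ?thesis using lips'[OF h(1) act_S[OF k that(2)] act_S[OF k that(3)]] h(2) that by simp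
  qed
  \<comment> \<open>The gain in the parallelogram law is at least a fixed multiple of the squared
    distance of \<open>x\<close> and \<open>y\<close> for every \<open>k\<close>, so it survives the
    supremum over \<open>k\<close>.\<close>
  have key: "m \<le> (q x + q y) / 2 - N (\<lambda>i. x i - y i) / (4 * D)" if x: "x \<in> S" and y: "y \<in> S" for x y
  proof -
    have "q (\<lambda>i. (x i + y i) / 2) \<le> (q x + q y) / 2 - N (\<lambda>i. x i - y i) / (4 * D)"
    proof (rule q_le)
      fix k assume k: "k \<in> K"
      have "N (\<lambda>i. x i - y i) / (4 * D) \<le> N (\<lambda>i. act k x i - act k y i) / 4"
        using lower[OF k x y] D by (simp add: field_simps)
      then show "N (act k (\<lambda>i. (x i + y i) / 2)) \<le> (q x + q y) / 2 - N (\<lambda>i. x i - y i) / (4 * D)"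
        unfolding act_mid[OF k x y] par using q_ge[OF k x] q_ge[OF k y] by argo
    qed
    then show ?thesis using m_le[OF mid[OF x y]] by linarith
  qed
  have "\<exists>x\<in>S. q x < m + 1 / real (Suc n)" for n
  proof -
    have "Inf (q ` S) < m + 1 / real (Suc n)" unfolding m_def by simp
    then show ?thesis using S cInf_lessD[of "q ` S"] by auto
  qed
  then obtain X where X: "\<And>n. X n \<in> S" "\<And>n. q (X n) < m + 1 / real (Suc n)" by metis
  \<comment> \<open>Both points exceed the infimum \<open>m\<close> by little, and by
    \<open>key\<close> their squared distance is at most \<open>4 * D\<close> times the mean of the
    excesses.\<close>
  have NX: "N (\<lambda>i. X a i - X b i) \<le> 4 * D * ((1 / real (Suc a) + 1 / real (Suc b)) / 2)" for a b
  proof -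
    have "N (\<lambda>i. X a i - X b i) / (4 * D) \<le> (1 / real (Suc a) + 1 / real (Suc b)) / 2"
      using key[OF X(1)[of a] X(1)[of b]] X(2)[of a] X(2)[of b] by argo
    then show ?thesis using D by (simp add: field_simps)
  qed
  have coord: "(cmod (x i))\<^sup>2 \<le> N x" if "i \<in> I" for i x
    unfolding N_def by (rule member_le_sum[OF that _ finI]) auto
  have "Cauchy (\<lambda>n. X n i)" if i: "i \<in> I" for i
  proof (rule metric_CauchyI)
    fix e :: real assume e: "e > 0"
    obtain M where M: "4 * D / e\<^sup>2 < real M" using reals_Archimedean2 by blast
    have Mp: "real (Suc M) > 0" "4 * D < e\<^sup>2 * real (Suc M)"
    proof -
      have "4 * D < real M * e\<^sup>2" using M e by (simp add: pos_divide_less_eq)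
      also have "\<dots> \<le> e\<^sup>2 * real (Suc M)" by (simp add: algebra_simps)
      finally show "4 * D < e\<^sup>2 * real (Suc M)" .
    qed simp
    have "dist (X a i) (X b i) < e" if "a \<ge> M" "b \<ge> M" for a b
    proof -
      have "1 / real (Suc a) \<le> 1 / real (Suc M)" "1 / real (Suc b) \<le> 1 / real (Suc M)"
        using that by (auto simp: field_simps)
      then have "(1 / real (Suc a) + 1 / real (Suc b)) / 2 \<le> 1 / real (Suc M)" by argo
      then have "4 * D * ((1 / real (Suc a) + 1 / real (Suc b)) / 2) \<le> 4 * D * (1 / real (Suc M))"
        using D by (intro mult_left_mono) auto
      also have "\<dots> < e\<^sup>2" using Mp by (simp add: field_simps)
      finally have "(cmod (X a i - X b i))\<^sup>2 < e\<^sup>2"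
        using coord[OF i, of "\<lambda>i. X a i - X b i"] NX[of a b] by linarith
      then show ?thesis using e by (simp add: dist_norm power_less_imp_less_base)
    qed
    then show "\<exists>M. \<forall>a\<ge>M. \<forall>b\<ge>M. dist (X a i) (X b i) < e" by blast
  qed
  then have "\<exists>l. (\<lambda>n. X n i) \<longlonglongrightarrow> l" for i
    by (cases "i \<in> I") (auto simp: Cauchy_convergent_iff convergent_def supp[OF X(1)])
  then obtain x where x: "\<And>i. (\<lambda>n. X n i) \<longlonglongrightarrow> x i" by metis
  have xS: "x \<in> S" by (rule closed[OF X(1) x])
  have Nlim: "(\<lambda>n. N (\<lambda>i. x i - X n i)) \<longlonglongrightarrow> 0"
  proof -
    have "(\<lambda>n. \<Sum>i\<in>I. (cmod (x i - X n i))\<^sup>2) \<longlonglongrightarrow> (\<Sum>i\<in>I. (cmod (x i - x i))\<^sup>2)"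
      by (intro tendsto_sum tendsto_power tendsto_norm tendsto_diff tendsto_const x)
    then show ?thesis unfolding N_def by simp
  qed
  \<comment> \<open>For each single \<open>k\<close> the number \<open>N (act k x)\<close> is the
    limit of \<open>N (act k (X n))\<close>, which is at most \<open>q (X n)\<close>; so
    \<open>q\<close> does not jump up in the limit.\<close>
  have qx: "q x \<le> m"
  proof (rule q_le)
    fix k assume k: "k \<in> K"
    have lim0: "(\<lambda>n. N (\<lambda>i. act k x i - act k (X n) i)) \<longlonglongrightarrow> 0"
    proof (rule tendsto_sandwich[of "\<lambda>_. 0" _ _ "\<lambda>n. D * N (\<lambda>i. x i - X n i)"])
      show "(\<lambda>n. D * N (\<lambda>i. x i - X n i)) \<longlonglongrightarrow> 0" using tendsto_mult_right_zero[OF Nlim] by simp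
    qed (auto simp: N0 intro!: always_eventually lips'[OF k xS X(1)])
    have "(\<lambda>n. act k (X n) i) \<longlonglongrightarrow> act k x i" if i: "i \<in> I" for i
    proof -
      have "(\<lambda>n. (cmod (act k x i - act k (X n) i))\<^sup>2) \<longlonglongrightarrow> 0"
        by (rule tendsto_sandwich[OF _ _ tendsto_const lim0])
          (auto intro!: always_eventually coord[OF i, of "\<lambda>i. act k x i - act k (X _) i"])
      then have "(\<lambda>n. sqrt ((cmod (act k x i - act k (X n) i))\<^sup>2)) \<longlonglongrightarrow> sqrt 0"
        by (rule tendsto_real_sqrt)
      then have "(\<lambda>n. act k x i - act k (X n) i) \<longlonglongrightarrow> 0"
        by (simp add: tendsto_norm_zero_iff)
      then show ?thesis using tendsto_diff[OF tendsto_const[of "act k x i"]] by fastforce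
    qed
    then have "(\<lambda>n. N (act k (X n))) \<longlonglongrightarrow> N (act k x)"
      unfolding N_def by (intro tendsto_sum tendsto_power tendsto_norm)
    moreover have "(\<lambda>n. m + 1 / real (Suc n)) \<longlonglongrightarrow> m + 0"
      by (intro tendsto_add tendsto_const LIMSEQ_Suc[OF lim_1_over_n])
    ultimately have "N (act k x) \<le> m + 0"
      by (rule LIMSEQ_le) (use order.trans[OF q_ge[OF k X(1)] less_imp_le[OF X(2)]] in blast)
    then show "N (act k x) \<le> m" by simp
  qed
  show ?thesis
  proof (intro bexI[OF _ xS] ballI ext)
    fix k i assume k: "k \<in> K"
    \<comment> \<open>The orbit of \<open>act k x\<close> lies in that of \<open>x\<close>, so
      \<open>act k x\<close> is a second minimizer, and \<open>key\<close> forces it to equal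
      \<open>x\<close>.\<close>
    have "q (act k x) \<le> m"
    proof (rule q_le)
      fix h assume "h \<in> K"
      then obtain j where "j \<in> K" "\<forall>x\<in>S. act h (act k x) = act j x" using comp k by blast
      then show "N (act h (act k x)) \<le> m" using q_ge[of j x] qx xS by simp
    qed
    then have "N (\<lambda>i. act k x i - x i) / (4 * D) \<le> 0"
      using key[OF act_S[OF k xS] xS] qx by argo
    then have n0: "N (\<lambda>i. act k x i - x i) \<le> 0" using D by (simp add: divide_le_0_iff)
    show "act k x i = x i"
    proof (cases "i \<in> I")
      case True
      then show ?thesis using coord[OF True, of "\<lambda>i. act k x i - x i"] n0
        by (smt (verit) eq_iff_diff_eq_0 norm_eq_zero zero_eq_power2 zero_le_power2)
    next
      case False
      then show ?thesis using supp[OF xS] supp[OF act_S[OF k xS]] by simp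
    qed
  qed
qed

section \<open>Complex linear algebra\<close>

text \<open>The extension of \<open>f\<close> from a basis of \<open>W\<close> agrees with
  \<open>f\<close> on a subspace that contains the basis. In this way a map that is defined by
  choice and linear only on a subspace becomes an operator of the whole space.\<close>

lemma (in vector_space_pair) linear_extend_from_subspace:
  assumes W: "vs1.subspace W"
    and add: "\<And>x y. x \<in> W \<Longrightarrow> y \<in> W \<Longrightarrow> f (x + y) = f x + f y"
    and scale: "\<And>c x. x \<in> W \<Longrightarrow> f (c *a x) = c *b f x"
  shows "\<exists>g. Vector_Spaces.linear s1 s2 g \<and> (\<forall>x\<in>W. g x = f x)"
proof -
  obtain B where B: "B \<subseteq> W" "vs1.independent B" "W \<subseteq> vs1.span B"
    using vs1.maximal_independent_subset by blast
  obtain g where g: "Vector_Spaces.linear s1 s2 g" "\<forall>x\<in>B. g x = f x"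
    using linear_independent_extend[OF B(2)] by blast
  interpret g: Vector_Spaces.linear s1 s2 g by fact
  have f0: "f 0 = 0" using scale[of 0 0] vs1.subspace_0[OF W] by simp
  have "vs1.subspace {x \<in> W. g x = f x}"
    by (rule vs1.subspaceI)
      (auto simp: f0 g.zero g.add add g.scale scale vs1.subspace_0[OF W] vs1.subspace_add[OF W] vs1.subspace_scale[OF W])
  then have "vs1.span B \<subseteq> {x \<in> W. g x = f x}"
    using B(1) g(2) by (intro vs1.span_minimal) auto
  then show ?thesis using g(1) B(3) by auto
qed

lemmas vs_linear_iff = Vector_Spaces.linear_iff

locale complex_vs = vector_space scale for scale :: "complex \<Rightarrow> 'u::ab_group_add \<Rightarrow> 'u" (infixr "*\<^sub>C" 75)
begin

text \<open>A plain predicate: \<open>Vector_Spaces.linear\<close> carries the vector space axioms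
  of both sides, which would have to be discharged at every use.\<close>

definition lin :: "('u \<Rightarrow> 'u) \<Rightarrow> bool" where
  "lin f \<longleftrightarrow> (\<forall>x y. f (x + y) = f x + f y) \<and> (\<forall>c x. f (c *\<^sub>C x) = c *\<^sub>C f x)"

definition functional :: "('u \<Rightarrow> complex) \<Rightarrow> bool" where
  "functional f \<longleftrightarrow> (\<forall>x y. f (x + y) = f x + f y) \<and> (\<forall>c x. f (c *\<^sub>C x) = c * f x)"

lemma vector_space_complex: "vector_space ((*) :: complex \<Rightarrow> complex \<Rightarrow> complex)"
  by unfold_locales (auto simp: algebra_simps)

lemma vsp: "vector_space_pair scale scale" ..

lemma vspc: "vector_space_pair scale ((*) :: complex \<Rightarrow> complex \<Rightarrow> complex)"
  using vector_space_complex by (intro vector_space_pair.intro vector_space_axioms)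

lemma linear_iff_lin: "Vector_Spaces.linear scale scale f \<longleftrightarrow> lin f"
  unfolding vs_linear_iff lin_def using vector_space_axioms by blast

lemma linear_iff_functional: "Vector_Spaces.linear scale (*) f \<longleftrightarrow> functional f"
  unfolding vs_linear_iff functional_def using vector_space_axioms vector_space_complex by blast

lemma lin_add: "lin f \<Longrightarrow> f (x + y) = f x + f y"
  and lin_scale: "lin f \<Longrightarrow> f (c *\<^sub>C x) = c *\<^sub>C f x"
  by (auto simp: lin_def)

lemma lin_0: "lin f \<Longrightarrow> f 0 = 0"
  using lin_scale[of f 0 0] by simp

lemma lin_neg: "lin f \<Longrightarrow> f (- x) = - f x"
  using lin_scale[of f "- 1" x] by simp

lemma lin_diff: "lin f \<Longrightarrow> f (x - y) = f x - f y"
  using lin_add[of f x "- y"] lin_neg by simp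

lemma lin_sum: "lin f \<Longrightarrow> f (sum g A) = (\<Sum>a\<in>A. f (g a))"
  by (induction A rule: infinite_finite_induct) (auto simp: lin_0 lin_add)

lemma functional_0: "functional f \<Longrightarrow> f 0 = 0"
  unfolding functional_def by (metis mult_zero_left scale_zero_left)

lemma functional_sum: "functional f \<Longrightarrow> f (sum g A) = (\<Sum>a\<in>A. f (g a))"
  by (induction A rule: infinite_finite_induct) (simp_all add: functional_0 functional_def)

lemma lin_compose: "lin f \<Longrightarrow> lin g \<Longrightarrow> lin (\<lambda>x. f (g x))"
  by (simp add: lin_def)

lemma lin_plus: "lin f \<Longrightarrow> lin g \<Longrightarrow> lin (\<lambda>x. f x + g x)"
  by (simp add: lin_def scale_right_distrib add_ac)

lemma lin_times: "lin f \<Longrightarrow> lin (\<lambda>x. c *\<^sub>C f x)"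
  by (simp add: lin_def scale_right_distrib mult.commute)

lemma lin_zero: "lin (\<lambda>x. 0)"
  and lin_ident: "lin (\<lambda>x. x)"
  by (simp_all add: lin_def)

lemma lin_minus: "lin f \<Longrightarrow> lin g \<Longrightarrow> lin (\<lambda>x. f x - g x)"
  by (simp add: lin_def scale_right_diff_distrib)

lemma subspace_eq: "lin f \<Longrightarrow> lin g \<Longrightarrow> subspace {x. f x = g x}"
  by (rule subspaceI) (auto simp: lin_0 lin_add lin_scale)

lemma subspace_vimage: "lin f \<Longrightarrow> subspace W \<Longrightarrow> subspace {x. f x \<in> W}"
  by (rule subspaceI) (auto simp: lin_0 lin_add lin_scale subspace_0 subspace_add subspace_scale)

lemma subspace_image: "lin f \<Longrightarrow> subspace W \<Longrightarrow> subspace (f ` W)"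
  using vector_space_pair.linear_subspace_image[OF vsp] by (simp add: linear_iff_lin)

lemma span_eq_on: "lin f \<Longrightarrow> lin g \<Longrightarrow> (\<And>x. x \<in> B \<Longrightarrow> f x = g x) \<Longrightarrow> x \<in> span B \<Longrightarrow> f x = g x"
  using span_minimal[OF _ subspace_eq, of B f g] by auto

lemma span_image_subset: "lin f \<Longrightarrow> (\<And>x. x \<in> B \<Longrightarrow> f x \<in> W) \<Longrightarrow> subspace W \<Longrightarrow> x \<in> span B \<Longrightarrow> f x \<in> W"
  using span_minimal[OF _ subspace_vimage, of B f W] by auto

lemma lin_extend:
  assumes W: "subspace W"
    and add: "\<And>x y. x \<in> W \<Longrightarrow> y \<in> W \<Longrightarrow> f (x + y) = f x + f y"
    and scale: "\<And>c x. x \<in> W \<Longrightarrow> f (c *\<^sub>C x) = c *\<^sub>C f x"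
  obtains g where "lin g" "\<And>x. x \<in> W \<Longrightarrow> g x = f x"
  using vector_space_pair.linear_extend_from_subspace[OF vsp W, of f] add scale that unfolding linear_iff_lin by metis

lemma functional_extend:
  assumes W: "subspace W"
    and add: "\<And>x y. x \<in> W \<Longrightarrow> y \<in> W \<Longrightarrow> f (x + y) = f x + f y"
    and scale: "\<And>c x. x \<in> W \<Longrightarrow> f (c *\<^sub>C x) = c * f x"
  obtains g where "functional g" "\<And>x. x \<in> W \<Longrightarrow> g x = f x"
  using vector_space_pair.linear_extend_from_subspace[OF vspc W, of f] add scale that unfolding linear_iff_functional by metis

lemma left_inverse_on:
  assumes "lin f" "subspace V" "\<And>x. x \<in> V \<Longrightarrow> f x = 0 \<Longrightarrow> x = 0"
  obtains g where "lin g" "\<And>x. g x \<in> V" "\<And>x. x \<in> V \<Longrightarrow> g (f x) = x"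
proof -
  have "inj_on f V"
    using assms by (intro inj_onI) (metis eq_iff_diff_eq_0 lin_diff subspace_diff)
  then show ?thesis
    using vector_space_pair.linear_exists_left_inverse_on[OF vsp, of f V] assms(1,2) that
    unfolding linear_iff_lin by (metis UNIV_I image_subset_iff)
qed

lemma basis_obtain:
  assumes "subspace W"
  obtains B where "B \<subseteq> W" "independent B" "span B = W"
  using maximal_independent_subset[of W] span_minimal[OF _ assms] by (metis subset_antisym)

lemma coordinates:
  assumes C: "independent C"
  obtains r where "\<And>c. c \<in> C \<Longrightarrow> functional (r c)" "\<And>c d. c \<in> C \<Longrightarrow> d \<in> C \<Longrightarrow> r c d = (if c = d then 1 else 0)"
    "\<And>v. finite C \<Longrightarrow> v \<in> span C \<Longrightarrow> (\<Sum>c\<in>C. r c v *\<^sub>C c) = v"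
proof -
  have "\<exists>g. functional g \<and> (\<forall>d\<in>C. g d = (if c = d then 1 else 0))" if "c \<in> C" for c
    using vector_space_pair.linear_independent_extend[OF vspc C, of "\<lambda>d. if c = d then 1 else 0"]
    by (simp add: linear_iff_functional)
  then obtain r where r: "\<And>c. c \<in> C \<Longrightarrow> functional (r c)"
    "\<And>c d. c \<in> C \<Longrightarrow> d \<in> C \<Longrightarrow> r c d = (if c = d then 1 else 0)" by metis
  have "(\<Sum>c\<in>C. r c v *\<^sub>C c) = v" if fin: "finite C" and v: "v \<in> span C" for v
  proof (rule span_eq_on[OF _ lin_ident _ v])
    show "lin (\<lambda>v. \<Sum>c\<in>C. r c v *\<^sub>C c)"
      using r(1) by (simp add: lin_def functional_def scale_left_distrib sum.distrib scale_sum_right)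
    fix d assume d: "d \<in> C"
    have "(\<Sum>c\<in>C. r c d *\<^sub>C c) = (\<Sum>c\<in>C. (if c = d then 1 else 0) *\<^sub>C c)"
      using r(2) d by (intro sum.cong) auto
    also have "\<dots> = (\<Sum>c\<in>C. if c = d then d else 0)" by (intro sum.cong) auto
    finally show "(\<Sum>c\<in>C. r c d *\<^sub>C c) = d" using fin d by simp
  qed
  then show ?thesis using that r by blast
qed

text \<open>An algebraic Hahn-Banach theorem: membership in a subspace can be tested by functionals.
  It serves for closedness under limits, for irreducibility of hom spaces and for the relations of a
  tensor product.\<close>

lemma separate:
  assumes W: "subspace W" and v: "v \<notin> W"
  obtains g where "functional g" "\<And>x. x \<in> W \<Longrightarrow> g x = 0" "g v = 1"
proof -
  obtain B where B: "B \<subseteq> W" "independent B" "span B = W" using basis_obtain[OF W] .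
  have "independent (insert v B)" using v B by (intro independent_insertI) auto
  then obtain g where g: "functional g" "\<forall>x\<in>insert v B. g x = (if x = v then 1 else 0)"
    using vector_space_pair.linear_independent_extend[OF vspc, of "insert v B" "\<lambda>x. if x = v then 1 else 0"]
    unfolding linear_iff_functional by blast
  have g0: "g 0 = 0" by (rule functional_0[OF g(1)])
  have "span B \<subseteq> {x. g x = 0}"
  proof (rule span_minimal)
    show "B \<subseteq> {x. g x = 0}" using g(2) B v span_base by auto
    show "subspace {x. g x = 0}" using g(1) g0 by (intro subspaceI) (auto simp: functional_def)
  qed
  then show ?thesis using that[of g] g B by auto
qed

text \<open>The image of \<open>p\<close> is a model of the quotient by \<open>W\<close> inside the
  same space.\<close>

lemma kernel_projection:
  assumes W: "subspace W"
  obtains p where "lin p" "\<And>x. p x = 0 \<longleftrightarrow> x \<in> W"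
proof -
  obtain B where B: "B \<subseteq> W" "independent B" "span B = W" using basis_obtain[OF W] .
  define E where "E = extend_basis B"
  have E: "B \<subseteq> E" "independent E" "span E = UNIV"
    using extend_basis_superset independent_extend_basis span_extend_basis B(2) by (auto simp: E_def)
  obtain p where p: "lin p" "\<forall>x\<in>E. p x = (if x \<in> B then 0 else x)"
    using vector_space_pair.linear_independent_extend[OF vsp E(2), of "\<lambda>x. if x \<in> B then 0 else x"]
    by (auto simp: linear_iff_lin)
  have pW: "p x = 0" if "x \<in> W" for x
    by (rule span_eq_on[OF p(1) lin_zero, of B]) (use p E B that in auto)
  have "x - p x \<in> W" for x
    by (rule span_image_subset[OF lin_minus[OF lin_ident p(1)], of E])
      (use p E B W in \<open>auto intro: subspace_0\<close>)
  then have "p x = 0 \<Longrightarrow> x \<in> W" for x by (metis diff_zero)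
  then show ?thesis using that p(1) pW by blast
qed

text \<open>Phrased for arbitrary sets and by inclusion in a span, so that it passes to subsets; on
  a subspace it is finite dimension.\<close>

definition fd :: "'u set \<Rightarrow> bool" where
  "fd V \<longleftrightarrow> (\<exists>B. finite B \<and> V \<subseteq> span B)"

lemma fd_subset: "fd V \<Longrightarrow> W \<subseteq> V \<Longrightarrow> fd W"
  by (auto simp: fd_def)

lemma fd_span: "finite B \<Longrightarrow> fd (span B)"
  by (auto simp: fd_def)

lemma fd_independent_finite: "fd V \<Longrightarrow> independent B \<Longrightarrow> B \<subseteq> V \<Longrightarrow> finite B"
  unfolding fd_def using independent_span_bound by blast

lemma fd_basis:
  assumes "fd V" "subspace V"
  obtains C where "finite C" "independent C" "C \<subseteq> V" "span C = V"
  using basis_obtain[OF assms(2)] fd_independent_finite[OF assms(1)] by metis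

lemma dim_strict_mono:
  assumes "fd V'" "subspace V" "subspace V'" "V \<subseteq> V'" "V \<noteq> V'"
  shows "dim V < dim V'"
proof -
  obtain B where B: "B \<subseteq> V" "independent B" "span B = V" using basis_obtain[OF assms(2)] .
  obtain v where v: "v \<in> V'" "v \<notin> V" using assms by auto
  have i: "independent (insert v B)" using v B by (intro independent_insertI) auto
  have f: "finite (insert v B)" by (rule fd_independent_finite[OF assms(1) i]) (use v B assms in auto)
  obtain C where C: "insert v B \<subseteq> C" "C \<subseteq> V'" "independent C" "V' \<subseteq> span C"
    using maximal_independent_subset_extend[OF _ i, of V'] v B assms(4) by auto
  have fC: "finite C" by (rule fd_independent_finite[OF assms(1) C(3,2)])
  have "dim V = card B" using B basis_card_eq_dim[of B V] by auto
  also have "\<dots> < card (insert v B)" using f v B span_base by (subst card_insert_disjoint) auto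
  also have "\<dots> \<le> card C" by (rule card_mono[OF fC C(1)])
  also have "\<dots> = dim V'" using basis_card_eq_dim[OF C(2) C(4) C(3)] .
  finally show ?thesis .
qed

text \<open>\<open>f\<close> is linear on \<open>D\<close> only. It is extended to an operator with
  a left inverse on \<open>D\<close>, and the left inverse carries a finite set that spans
  \<open>E\<close> to one that spans \<open>D\<close>.\<close>

lemma fd_injective:
  assumes D: "subspace D" and E: "fd E"
    and add: "\<And>x y. x \<in> D \<Longrightarrow> y \<in> D \<Longrightarrow> f (x + y) = f x + f y"
    and scale: "\<And>c x. x \<in> D \<Longrightarrow> f (c *\<^sub>C x) = c *\<^sub>C f x"
    and im: "\<And>x. x \<in> D \<Longrightarrow> f x \<in> E" and inj: "\<And>x. x \<in> D \<Longrightarrow> f x = 0 \<Longrightarrow> x = 0"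
  shows "fd D"
proof -
  obtain g where g: "lin g" "\<And>x. x \<in> D \<Longrightarrow> g x = f x" using lin_extend[OF D, of f] add scale by blast
  obtain h where h: "lin h" "\<And>x. x \<in> D \<Longrightarrow> h (g x) = x"
    using left_inverse_on[OF g(1) D] g(2) inj by metis
  obtain B where B: "finite B" "E \<subseteq> span B" using E by (auto simp: fd_def)
  have "D \<subseteq> span (h ` B)"
  proof
    fix x assume x: "x \<in> D"
    have "g x \<in> span B" using im[OF x] g(2)[OF x] B by auto
    then have "h (g x) \<in> span (h ` B)"
      by (rule span_image_subset[OF h(1), rotated 2]) (auto intro: span_base)
    then show "x \<in> span (h ` B)" using h(2)[OF x] by simp
  qed
  then show ?thesis using B(1) unfolding fd_def by blast
qed

text \<open>\<open>card B + 1\<close> vectors in the span of \<open>B\<close> are dependent. The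
  family may repeat: two equal members give the relation with coefficients \<open>1\<close> and
  \<open>-1\<close>, which is why coefficients belong to indices and not to vectors.\<close>

lemma fd_dependent_family:
  assumes D: "fd D" and v: "\<And>i::nat. v i \<in> D"
  obtains c :: "nat \<Rightarrow> complex" and n where "(\<Sum>i\<le>n. c i *\<^sub>C v i) = 0" "\<exists>i\<le>n. c i \<noteq> 0"
proof -
  obtain B where B: "finite B" "D \<subseteq> span B" using D by (auto simp: fd_def)
  define n where "n = card B"
  have "\<exists>c. (\<Sum>i\<le>n. c i *\<^sub>C v i) = 0 \<and> (\<exists>i\<le>n. c i \<noteq> 0)"
  proof (cases "inj_on v {..n}")
    case True
    have "dependent (v ` {..n})"
    proof (rule ccontr)
      assume "\<not> dependent (v ` {..n})"
      then have "card (v ` {..n}) \<le> card B"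
        using independent_span_bound[OF B(1), of "v ` {..n}"] v B(2) by blast
      then show False using True by (simp add: card_image n_def)
    qed
    then obtain u where u: "\<exists>x\<in>v ` {..n}. u x \<noteq> 0" "(\<Sum>x\<in>v ` {..n}. u x *\<^sub>C x) = 0"
      by (subst (asm) dependent_finite) auto
    have "(\<Sum>i\<le>n. u (v i) *\<^sub>C v i) = 0" using u(2) by (simp add: sum.reindex[OF True])
    then show ?thesis using u(1) by (intro exI[of _ "\<lambda>i. u (v i)"]) auto
  next
    case False
    then obtain i j where ij: "i \<le> n" "j \<le> n" "i \<noteq> j" "v i = v j" by (auto simp: inj_on_def)
    let ?c = "\<lambda>k. (if k = i then 1 else 0) - (if k = j then 1 else 0) :: complex"
    have "(\<Sum>k\<le>n. ?c k *\<^sub>C v k) = (\<Sum>k\<le>n. (if k = i then v k else 0) - (if k = j then v k else 0))"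
      by (intro sum.cong) auto
    also have "\<dots> = 0" using ij by (simp add: sum_subtractf)
    finally show ?thesis using ij by (intro exI[of _ ?c]) auto
  qed
  then show ?thesis using that by blast
qed

text \<open>Among the nonzero polynomials \<open>p\<close> such that \<open>p(f)\<close> kills some
  nonzero vector of \<open>D\<close>, take one of least degree; there is one, since the powers of
  \<open>f\<close> on a single vector are dependent. It has a root \<open>z\<close>, and with
  \<open>p = (X - z) q\<close> the vector \<open>w = q(f) v\<close> is nonzero by minimality and
  satisfies \<open>f w = z w\<close>.\<close>

lemma eigenvector_exists:
  assumes D: "fd D" "subspace D" and nz: "D \<noteq> {0}" and f: "lin f" and im: "\<And>x. x \<in> D \<Longrightarrow> f x \<in> D"
  obtains c v where "v \<in> D" "v \<noteq> 0" "f v = c *\<^sub>C v"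
proof -
  \<comment> \<open>\<open>pv p v\<close> is the value of the polynomial \<open>p\<close> at the
    operator \<open>f\<close>, applied to \<open>v\<close>.\<close>
  define pv where "pv p v = (\<Sum>i\<le>degree p. coeff p i *\<^sub>C (f ^^ i) v)" for p v
  have pv: "pv p v = (\<Sum>i\<le>N. coeff p i *\<^sub>C (f ^^ i) v)" if "degree p \<le> N" for p v N
    unfolding pv_def using that
    by (intro sum.mono_neutral_left) (auto simp: coeff_eq_0)
  have im': "(f ^^ i) x \<in> D" if "x \<in> D" for i x
    using that by (induction i) (auto intro: im)
  obtain v0 where v0: "v0 \<in> D" "v0 \<noteq> 0" using nz subspace_0[OF D(2)] by auto
  obtain c n where cn: "(\<Sum>i\<le>n. c i *\<^sub>C (f ^^ i) v0) = 0" "\<exists>i\<le>n. c i \<noteq> (0::complex)"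
    using fd_dependent_family[OF D(1), of "\<lambda>i. (f ^^ i) v0"] im'[OF v0(1)] by blast
  define p0 where "p0 = (\<Sum>i\<le>n. monom (c i) i)"
  have cp: "coeff p0 i = (if i \<le> n then c i else 0)" for i
    by (simp add: p0_def coeff_sum)
  have "degree p0 \<le> n" by (rule degree_le) (simp add: cp)
  then have "pv p0 v0 = 0" using cn(1) by (simp add: pv[of p0 n] cp)
  moreover have "p0 \<noteq> 0" using cn(2) cp by (metis coeff_0)
  ultimately have ex: "\<exists>d p v. p \<noteq> 0 \<and> v \<in> D \<and> v \<noteq> 0 \<and> pv p v = 0 \<and> degree p = d"
    using v0 by blast
  obtain d where "(\<exists>p v. p \<noteq> 0 \<and> v \<in> D \<and> v \<noteq> 0 \<and> pv p v = 0 \<and> degree p = d)"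
    and dmin: "\<And>e. e < d \<Longrightarrow> \<not> (\<exists>p v. p \<noteq> 0 \<and> v \<in> D \<and> v \<noteq> 0 \<and> pv p v = 0 \<and> degree p = e)"
    using exists_least_iff[of "\<lambda>d. \<exists>p v. p \<noteq> 0 \<and> v \<in> D \<and> v \<noteq> 0 \<and> pv p v = 0 \<and> degree p = d"] ex by blast
  then obtain p v where p: "p \<noteq> 0" "v \<in> D" "v \<noteq> 0" "pv p v = 0" "degree p = d" by blast
  have "\<not> constant (poly p)"
  proof
    assume "constant (poly p)"
    then have d0: "degree p = 0" by (simp add: constant_degree)
    then have "coeff p 0 *\<^sub>C v = 0" using p(4) by (simp add: pv_def)
    then show False using p d0 by (metis leading_coeff_0_iff scale_eq_0_iff)
  qed
  then obtain z where "poly p z = 0" using fundamental_theorem_of_algebra by blast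
  then obtain q where q: "p = [:-z, 1:] * q" by (metis dvdE poly_eq_0_iff_dvd)
  have q0: "q \<noteq> 0" using p(1) q by auto
  have dq: "degree p = Suc (degree q)" unfolding q using q0 by (subst degree_mult_eq) auto
  define w where "w = pv q v"
  have wD: "w \<in> D" unfolding w_def pv_def by (intro subspace_sum[OF D(2)] subspace_scale[OF D(2)] im' p(2))
  have w0: "w \<noteq> 0" using dmin[of "degree q"] q0 p dq unfolding w_def by auto
  have cpq: "coeff p i = (case i of 0 \<Rightarrow> 0 | Suc j \<Rightarrow> coeff q j) - z * coeff q i" for i
    unfolding q by (simp add: coeff_pCons split: nat.splits)
  let ?g = "\<lambda>i. case i of 0 \<Rightarrow> 0 | Suc j \<Rightarrow> coeff q j"
  have "pv p v = (\<Sum>i\<le>Suc (degree q). coeff p i *\<^sub>C (f ^^ i) v)"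
    by (rule pv) (simp add: dq)
  also have "\<dots> = (\<Sum>i\<le>Suc (degree q). ?g i *\<^sub>C (f ^^ i) v - z *\<^sub>C coeff q i *\<^sub>C (f ^^ i) v)"
    by (intro sum.cong) (simp_all only: cpq scale_left_diff_distrib scale_scale)
  also have "\<dots> = (\<Sum>i\<le>Suc (degree q). ?g i *\<^sub>C (f ^^ i) v) - z *\<^sub>C (\<Sum>i\<le>Suc (degree q). coeff q i *\<^sub>C (f ^^ i) v)"
    by (simp only: sum_subtractf scale_sum_right)
  also have "(\<Sum>i\<le>Suc (degree q). coeff q i *\<^sub>C (f ^^ i) v) = w"
    unfolding w_def by (rule pv[symmetric]) simp
  \<comment> \<open>The coefficients \<open>?g\<close> are those of \<open>q\<close> shifted by one:
    the term at \<open>0\<close> vanishes, and the shift of the exponent takes one \<open>f\<close>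
    out of the sum.\<close>
  also have "(\<Sum>i\<le>Suc (degree q). ?g i *\<^sub>C (f ^^ i) v) = f w"
    unfolding w_def pv_def by (subst sum.atMost_Suc_shift) (simp add: lin_sum[OF f] lin_scale[OF f])
  finally have "f w = z *\<^sub>C w" using p(4) by simp
  then show ?thesis using that wD w0 by blast
qed

end

section \<open>Irreducible sets of operators and tensor products\<close>

context complex_vs begin

definition stable :: "('u \<Rightarrow> 'u) set \<Rightarrow> 'u set \<Rightarrow> bool" where
  "stable P W \<longleftrightarrow> subspace W \<and> (\<forall>p\<in>P. \<forall>w\<in>W. p w \<in> W)"

definition irred :: "('u \<Rightarrow> 'u) set \<Rightarrow> 'u set \<Rightarrow> bool" where
  "irred P W \<longleftrightarrow> stable P W \<and> W \<noteq> {0} \<and> (\<forall>X. stable P X \<and> X \<subseteq> W \<longrightarrow> X = {0} \<or> X = W)"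

text \<open>\<open>f\<close> is an operator of the whole ambient space, but only its restriction to
  \<open>W\<close> counts: maps that agree on \<open>W\<close> stand for the same
  homomorphism.\<close>

definition equivariant :: "('u \<Rightarrow> 'u) set \<Rightarrow> 'u set \<Rightarrow> 'u set \<Rightarrow> ('u \<Rightarrow> 'u) \<Rightarrow> bool" where
  "equivariant P W M f \<longleftrightarrow> lin f \<and> (\<forall>w\<in>W. f w \<in> M) \<and> (\<forall>p\<in>P. \<forall>w\<in>W. f (p w) = p (f w))"

definition hom_values :: "('u \<Rightarrow> 'u) set \<Rightarrow> 'u set \<Rightarrow> 'u set \<Rightarrow> 'u \<Rightarrow> 'u set" where
  "hom_values P W M w0 = {f w0 | f. equivariant P W M f}"

text \<open>Inverse of evaluation at \<open>w0\<close>. Read with two arguments,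
  \<open>hom_of P W M w0 m w\<close> is the pairing of the hom space with \<open>W\<close>, from
  which the tensor products below are built. For irreducible \<open>W\<close> and nonzero
  \<open>w0\<close> its values on \<open>W\<close> do not depend on the choice.\<close>

definition hom_of :: "('u \<Rightarrow> 'u) set \<Rightarrow> 'u set \<Rightarrow> 'u set \<Rightarrow> 'u \<Rightarrow> 'u \<Rightarrow> 'u \<Rightarrow> 'u" where
  "hom_of P W M w0 m = (SOME f. equivariant P W M f \<and> f w0 = m)"

lemma irred_stable: "irred P W \<Longrightarrow> stable P W"
  by (simp add: irred_def)

lemma irred_subspace: "irred P W \<Longrightarrow> subspace W"
  by (simp add: irred_def stable_def)

lemma irred_nonzero: "irred P W \<Longrightarrow> W \<noteq> {0}"
  by (simp add: irred_def)

lemma irred_cases: "irred P W \<Longrightarrow> stable P X \<Longrightarrow> X \<subseteq> W \<Longrightarrow> X = {0} \<or> X = W"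
  by (simp add: irred_def)

lemma subspace_nonzero:
  assumes "subspace W" "W \<noteq> {0}"
  obtains w where "w \<in> W" "w \<noteq> 0"
  using subspace_0[OF assms(1)] assms(2) by blast

lemma irred_nonzero_element:
  assumes "irred P W"
  obtains w where "w \<in> W" "w \<noteq> 0"
  using subspace_nonzero[OF irred_subspace[OF assms] irred_nonzero[OF assms]] by blast

lemma stable_Un: "stable (P \<union> Q) W \<longleftrightarrow> stable P W \<and> stable Q W"
  by (auto simp: stable_def)

lemma stable_mono: "stable P W \<Longrightarrow> Q \<subseteq> P \<Longrightarrow> stable Q W"
  by (auto simp: stable_def)

lemma stable_subspace: "stable P W \<Longrightarrow> subspace W"
  by (auto simp: stable_def)

lemma stable_app: "stable P W \<Longrightarrow> p \<in> P \<Longrightarrow> w \<in> W \<Longrightarrow> p w \<in> W"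
  by (auto simp: stable_def)

lemma stable_Int: "stable P V \<Longrightarrow> stable P W \<Longrightarrow> stable P (V \<inter> W)"
  by (auto simp: stable_def subspace_inter)

lemma stable_zero: "\<forall>p\<in>P. lin p \<Longrightarrow> stable P {0}"
  by (auto simp: stable_def lin_0)

lemma stable_span:
  assumes "\<forall>p\<in>P. lin p" "\<And>p x. p \<in> P \<Longrightarrow> x \<in> S \<Longrightarrow> p x \<in> span S"
  shows "stable P (span S)"
  unfolding stable_def using assms by (auto intro: span_image_subset)

lemma stable_vimage:
  assumes "equivariant P W M f" "stable P W" "stable P X"
  shows "stable P {w \<in> W. f w \<in> X}"
proof -
  have "subspace (W \<inter> {w. f w \<in> X})"
    using assms by (intro subspace_inter subspace_vimage) (auto simp: stable_def equivariant_def)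
  then show ?thesis using assms by (auto simp: stable_def equivariant_def Int_def)
qed

lemma stable_image:
  assumes "equivariant P W M f" "stable P W"
  shows "stable P (f ` W)"
  using assms subspace_image[of f W] unfolding stable_def equivariant_def by (auto simp: image_iff) metis

lemma equivariant_lin: "equivariant P W M f \<Longrightarrow> lin f"
  by (simp add: equivariant_def)

lemma equivariant_in: "equivariant P W M f \<Longrightarrow> w \<in> W \<Longrightarrow> f w \<in> M"
  by (simp add: equivariant_def)

lemma equivariant_app: "equivariant P W M f \<Longrightarrow> p \<in> P \<Longrightarrow> w \<in> W \<Longrightarrow> f (p w) = p (f w)"
  by (simp add: equivariant_def)

lemma equivariant_mono:
  "equivariant P W M f \<Longrightarrow> Q \<subseteq> P \<Longrightarrow> V \<subseteq> W \<Longrightarrow> M \<subseteq> N \<Longrightarrow> equivariant Q V N f"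
  unfolding equivariant_def by (meson subsetD)

lemma equivariant_ident: "W \<subseteq> M \<Longrightarrow> equivariant P W M (\<lambda>x. x)"
  by (auto simp: equivariant_def lin_ident)

lemma equivariant_diff:
  assumes "\<forall>p\<in>P. lin p" "subspace M" "equivariant P W M f" "equivariant P W M g"
  shows "equivariant P W M (\<lambda>x. f x - g x)"
  using assms unfolding equivariant_def by (auto intro: lin_minus subspace_diff simp: lin_diff)

lemma equivariant_plus:
  assumes "\<forall>p\<in>P. lin p" "subspace M" "equivariant P W M f" "equivariant P W M g"
  shows "equivariant P W M (\<lambda>x. f x + g x)"
  using assms unfolding equivariant_def by (auto intro: lin_plus subspace_add simp: lin_add)

lemma equivariant_times:
  assumes "\<forall>p\<in>P. lin p" "subspace M" "equivariant P W M f"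
  shows "equivariant P W M (\<lambda>x. c *\<^sub>C f x)"
  using assms unfolding equivariant_def by (auto intro: lin_times subspace_scale simp: lin_scale)

lemma equivariant_compose:
  assumes "equivariant P W M f" "lin b" "\<And>m. m \<in> M \<Longrightarrow> b m \<in> N" "\<And>p m. p \<in> P \<Longrightarrow> m \<in> M \<Longrightarrow> b (p m) = p (b m)"
  shows "equivariant P W N (\<lambda>x. b (f x))"
  using assms unfolding equivariant_def by (auto intro: lin_compose)

text \<open>The kernel is stable, hence all of \<open>W\<close> once it contains \<open>w0\<close>.
  This is the injectivity of evaluation at \<open>w0\<close> on homomorphisms.\<close>

lemma irred_kernel:
  assumes "irred P W" "\<forall>p\<in>P. lin p" "equivariant P W M f" "w0 \<in> W" "w0 \<noteq> 0" "f w0 = 0" "w \<in> W"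
  shows "f w = 0"
proof -
  have "stable P {w \<in> W. f w \<in> {0}}"
    using assms by (intro stable_vimage stable_zero) (auto simp: irred_def)
  then have "{w \<in> W. f w \<in> {0}} = W" using assms by (auto simp: irred_def)
  then show ?thesis using assms by auto
qed

lemma subspace_hom_values:
  assumes "\<forall>p\<in>P. lin p" "subspace M"
  shows "subspace (hom_values P W M w0)"
proof (rule subspaceI)
  have "equivariant P W M (\<lambda>x. 0)" using assms subspace_0[OF assms(2)] by (auto simp: equivariant_def lin_zero lin_0)
  then show "0 \<in> hom_values P W M w0" unfolding hom_values_def by fastforce
next
  fix x y assume "x \<in> hom_values P W M w0" "y \<in> hom_values P W M w0"
  then show "x + y \<in> hom_values P W M w0"
    unfolding hom_values_def using equivariant_plus[OF assms] by fastforce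
next
  fix c x assume "x \<in> hom_values P W M w0"
  then show "c *\<^sub>C x \<in> hom_values P W M w0"
    unfolding hom_values_def using equivariant_times[OF assms] by fastforce
qed

lemma hom_values_subset: "w0 \<in> W \<Longrightarrow> hom_values P W M w0 \<subseteq> M"
  by (auto simp: hom_values_def equivariant_def)

lemma hom_values_mono: "M \<subseteq> N \<Longrightarrow> hom_values P W M w0 \<subseteq> hom_values P W N w0"
  unfolding hom_values_def using equivariant_mono by blast

lemma base_in_hom_values: "W \<subseteq> M \<Longrightarrow> w0 \<in> hom_values P W M w0"
  unfolding hom_values_def using equivariant_ident[of W M P] by fastforce

lemma hom_of:
  assumes "m \<in> hom_values P W M w0"
  shows "equivariant P W M (hom_of P W M w0 m)" "hom_of P W M w0 m w0 = m"
proof -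
  have "\<exists>f. equivariant P W M f \<and> f w0 = m" using assms by (auto simp: hom_values_def)
  from someI_ex[OF this] show "equivariant P W M (hom_of P W M w0 m)" "hom_of P W M w0 m w0 = m"
    by (auto simp: hom_of_def)
qed

text \<open>An eigenvector in \<open>D\<close> with eigenvalue \<open>c\<close> lies in the kernel
  of \<open>f - c\<close>, which is then all of \<open>W\<close>. Finiteness is placed on a subspace
  preserved by every endomorphism, so that \<open>W\<close> may be infinite-dimensional.\<close>

lemma schur:
  assumes irr: "irred P W" and P: "\<forall>p\<in>P. lin p"
    and D: "fd D" "subspace D" "D \<noteq> {0}" "D \<subseteq> W"
    and inv: "\<And>f x. equivariant P W W f \<Longrightarrow> x \<in> D \<Longrightarrow> f x \<in> D"
    and f: "equivariant P W W f"
  shows "\<exists>c. \<forall>w\<in>W. f w = c *\<^sub>C w"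
proof -
  obtain c v where v: "v \<in> D" "v \<noteq> 0" "f v = c *\<^sub>C v"
    by (rule eigenvector_exists[OF D(1-3) equivariant_lin[OF f] inv[OF f]])
  have "equivariant P W W (\<lambda>x. c *\<^sub>C x)"
    by (rule equivariant_times[OF P irred_subspace[OF irr] equivariant_ident[OF order_refl]])
  then have *: "equivariant P W W (\<lambda>x. f x - c *\<^sub>C x)"
    by (rule equivariant_diff[OF P irred_subspace[OF irr] f])
  have "f w = c *\<^sub>C w" if "w \<in> W" for w
    using irred_kernel[OF irr P * _ v(2) _ that] v D(4) by auto
  then show ?thesis by blast
qed

lemma irred_exists:
  assumes "stable P V" "fd V" "V \<noteq> {0}"
  obtains E where "irred P E" "E \<subseteq> V"
proof -
  have ex: "\<exists>d E. stable P E \<and> E \<noteq> {0} \<and> E \<subseteq> V \<and> dim E = d" using assms by blast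
  obtain d where "\<exists>E. stable P E \<and> E \<noteq> {0} \<and> E \<subseteq> V \<and> dim E = d"
    and dmin: "\<And>e. e < d \<Longrightarrow> \<not> (\<exists>E. stable P E \<and> E \<noteq> {0} \<and> E \<subseteq> V \<and> dim E = e)"
    using exists_least_iff[of "\<lambda>d. \<exists>E. stable P E \<and> E \<noteq> {0} \<and> E \<subseteq> V \<and> dim E = d"] ex by blast
  then obtain E where E: "stable P E" "E \<noteq> {0}" "E \<subseteq> V" "dim E = d" by blast
  have "X = {0} \<or> X = E" if "stable P X" "X \<subseteq> E" for X
  proof (rule ccontr)
    assume n: "\<not> (X = {0} \<or> X = E)"
    have "dim X < dim E"
      by (rule dim_strict_mono[OF fd_subset[OF assms(2) E(3)] stable_subspace[OF that(1)] stable_subspace[OF E(1)] that(2)])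
        (use n in blast)
    moreover have "X \<subseteq> V" using that(2) E(3) by blast
    ultimately show False using dmin[of "dim X"] n that(1) E(4) by blast
  qed
  then have "irred P E" using E(1,2) unfolding irred_def by blast
  then show ?thesis using that E(3) by blast
qed

section \<open>Internal tensor products\<close>

definition bilin :: "('u \<Rightarrow> 'u \<Rightarrow> 'u) \<Rightarrow> 'u set \<Rightarrow> 'u set \<Rightarrow> bool" where
  "bilin t X Y \<longleftrightarrow>
     (\<forall>y\<in>Y. (\<forall>x\<in>X. \<forall>x'\<in>X. t (x + x') y = t x y + t x' y) \<and> (\<forall>c. \<forall>x\<in>X. t (c *\<^sub>C x) y = c *\<^sub>C t x y)) \<and>
     (\<forall>x\<in>X. (\<forall>y\<in>Y. \<forall>y'\<in>Y. t x (y + y') = t x y + t x y') \<and> (\<forall>c. \<forall>y\<in>Y. t x (c *\<^sub>C y) = c *\<^sub>C t x y))"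

text \<open>Generation and the universal property together say that \<open>t\<close> makes
  \<open>M\<close> a tensor product of \<open>X\<close> and \<open>Y\<close>. The test forms take
  values in the ambient space, which is enough: a scalar form can be multiplied by a fixed nonzero
  vector.\<close>

definition tensor :: "('u \<Rightarrow> 'u \<Rightarrow> 'u) \<Rightarrow> 'u set \<Rightarrow> 'u set \<Rightarrow> 'u set \<Rightarrow> bool" where
  "tensor t X Y M \<longleftrightarrow> subspace X \<and> subspace Y \<and> bilin t X Y \<and> span {t x y | x y. x \<in> X \<and> y \<in> Y} = M \<and>
     (\<forall>\<beta>. bilin \<beta> X Y \<longrightarrow> (\<exists>g. lin g \<and> (\<forall>x\<in>X. \<forall>y\<in>Y. g (t x y) = \<beta> x y)))"

lemma bilinD:
  assumes "bilin t X Y" "x \<in> X" "y \<in> Y"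
  shows "x' \<in> X \<Longrightarrow> t (x + x') y = t x y + t x' y" "t (c *\<^sub>C x) y = c *\<^sub>C t x y"
    "y' \<in> Y \<Longrightarrow> t x (y + y') = t x y + t x y'" "t x (c *\<^sub>C y) = c *\<^sub>C t x y"
  using assms by (simp_all add: bilin_def)

lemma bilin_swap: "bilin t X Y \<Longrightarrow> bilin (\<lambda>y x. t x y) Y X"
  by (simp add: bilin_def)

lemma tensor_swap:
  assumes "tensor t X Y M"
  shows "tensor (\<lambda>y x. t x y) Y X M"
proof -
  have "{t x y | y x. y \<in> Y \<and> x \<in> X} = {t x y | x y. x \<in> X \<and> y \<in> Y}" by blast
  moreover have "\<exists>g. lin g \<and> (\<forall>x\<in>Y. \<forall>y\<in>X. g (t y x) = \<beta> x y)" if "bilin \<beta> Y X" for \<beta>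
    using assms bilin_swap[OF that] unfolding tensor_def by blast
  ultimately show ?thesis using assms bilin_swap unfolding tensor_def by auto
qed

lemma tensor_lift:
  assumes "tensor t X Y M" "bilin \<beta> X Y"
  obtains g where "lin g" "\<And>x y. x \<in> X \<Longrightarrow> y \<in> Y \<Longrightarrow> g (t x y) = \<beta> x y"
  using assms unfolding tensor_def by blast

lemma bilinI:
  assumes "\<And>x x' y. x \<in> X \<Longrightarrow> x' \<in> X \<Longrightarrow> y \<in> Y \<Longrightarrow> t (x + x') y = t x y + t x' y"
    "\<And>c x y. x \<in> X \<Longrightarrow> y \<in> Y \<Longrightarrow> t (c *\<^sub>C x) y = c *\<^sub>C t x y"
    "\<And>x y y'. x \<in> X \<Longrightarrow> y \<in> Y \<Longrightarrow> y' \<in> Y \<Longrightarrow> t x (y + y') = t x y + t x y'"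
    "\<And>c x y. x \<in> X \<Longrightarrow> y \<in> Y \<Longrightarrow> t x (c *\<^sub>C y) = c *\<^sub>C t x y"
  shows "bilin t X Y"
  using assms by (simp add: bilin_def)

lemma bilin_coordinates:
  assumes "functional f" "functional g"
  shows "bilin (\<lambda>x y. (f x * g y) *\<^sub>C e) X Y"
  using assms by (intro bilinI) (auto simp: functional_def algebra_simps)

text \<open>Functionals equal to \<open>1\<close> at \<open>x\<close> and at \<open>y\<close>
  multiply to a bilinear form that does not vanish at \<open>(x, y)\<close>, and this form factors
  through \<open>t\<close>.\<close>

lemma tensor_nonzero:
  assumes "tensor t X Y M" "x \<in> X" "y \<in> Y" "x \<noteq> 0" "y \<noteq> 0"
  shows "t x y \<noteq> 0"
proof
  assume z: "t x y = 0"
  obtain f where f: "functional f" "f x = 1" using separate[of "{0}" x] assms(4) by auto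
  obtain g where g: "functional g" "g y = 1" using separate[of "{0}" y] assms(5) by auto
  obtain h where h: "lin h" "\<And>a b. a \<in> X \<Longrightarrow> b \<in> Y \<Longrightarrow> h (t a b) = (f a * g b) *\<^sub>C y"
    by (rule tensor_lift[OF assms(1) bilin_coordinates[OF f(1) g(1), of y]]) blast
  show False using h(2)[OF assms(2,3)] z f g assms(5) lin_0[OF h(1)] by simp
qed

text \<open>One argument at a time is extended from a spanning set to its span. The lemma serves
  both to compare maps on products with bilinear forms and to bound the span of products.\<close>

lemma bilin_in_subspace:
  assumes t: "bilin t X Y" and sub: "subspace X" "subspace Y"
    and B: "B \<subseteq> X" "X \<subseteq> span B" and C: "C \<subseteq> Y" "Y \<subseteq> span C"
    and V: "subspace V" and BC: "\<And>b c. b \<in> B \<Longrightarrow> c \<in> C \<Longrightarrow> t b c \<in> V" and xy: "x \<in> X" "y \<in> Y"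
  shows "t x y \<in> V"
proof -
  have t0: "t x 0 = 0" "t 0 y = 0" if "x \<in> X" "y \<in> Y" for x y
    using bilinD(2,4)[OF t that, of 0]
      bilinD(4)[OF t that(1) subspace_0[OF sub(2)], of 0] bilinD(2)[OF t subspace_0[OF sub(1)] that(2), of 0] by simp_all
  have 1: "t b y \<in> V" if b: "b \<in> B" and y: "y \<in> Y" for b y
  proof -
    have bX: "b \<in> X" using b B(1) by blast
    have "subspace {y \<in> Y. t b y \<in> V}"
    proof (rule subspaceI)
      show "0 \<in> {y \<in> Y. t b y \<in> V}" using t0(1)[OF bX y] subspace_0[OF V] subspace_0[OF sub(2)] by simp
      show "u + v \<in> {y \<in> Y. t b y \<in> V}" if "u \<in> {y \<in> Y. t b y \<in> V}" "v \<in> {y \<in> Y. t b y \<in> V}" for u v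
        using that bilinD(3)[OF t bX, of u v] subspace_add[OF V] subspace_add[OF sub(2)] by simp
      show "c *\<^sub>C u \<in> {y \<in> Y. t b y \<in> V}" if "u \<in> {y \<in> Y. t b y \<in> V}" for c u
        using that bilinD(4)[OF t bX, of u c] subspace_scale[OF V] subspace_scale[OF sub(2)] by simp
    qed
    then have "span C \<subseteq> {y \<in> Y. t b y \<in> V}" using BC b C(1) by (intro span_minimal) auto
    then show ?thesis using y C(2) by auto
  qed
  have "subspace {x \<in> X. t x y \<in> V}"
  proof (rule subspaceI)
    show "0 \<in> {x \<in> X. t x y \<in> V}" using t0(2)[OF xy] subspace_0[OF V] subspace_0[OF sub(1)] by simp
    show "u + v \<in> {x \<in> X. t x y \<in> V}" if "u \<in> {x \<in> X. t x y \<in> V}" "v \<in> {x \<in> X. t x y \<in> V}" for u v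
      using that bilinD(1)[OF t _ xy(2), of u v] subspace_add[OF V] subspace_add[OF sub(1)] by simp
    show "c *\<^sub>C u \<in> {x \<in> X. t x y \<in> V}" if "u \<in> {x \<in> X. t x y \<in> V}" for c u
      using that bilinD(2)[OF t _ xy(2), of u c] subspace_scale[OF V] subspace_scale[OF sub(1)] by simp
  qed
  then have "span B \<subseteq> {x \<in> X. t x y \<in> V}" using 1 xy(2) B(1) by (intro span_minimal) auto
  then show ?thesis using xy B(2) by auto
qed

end

section \<open>Tensor factorization along a hom space when all endomorphisms are scalar\<close>

locale scalar_endo = complex_vs scale for scale :: "complex \<Rightarrow> 'u::ab_group_add \<Rightarrow> 'u" (infixr "*\<^sub>C" 75) +
  fixes P :: "('u \<Rightarrow> 'u) set" and W M :: "'u set" and w0 :: 'u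
  assumes P: "\<forall>p\<in>P. lin p" and irr: "irred P W" and M: "subspace M" and WM: "W \<subseteq> M"
    and w0: "w0 \<in> W" "w0 \<noteq> 0"
    and endo: "\<And>f. equivariant P W W f \<Longrightarrow> \<exists>c. \<forall>w\<in>W. f w = c *\<^sub>C w"
begin

abbreviation "X \<equiv> hom_values P W M w0"
abbreviation "t \<equiv> hom_of P W M w0"

lemma W: "subspace W" "stable P W"
  using irr by (auto simp: irred_def stable_def)

lemma X: "subspace X" "w0 \<in> X"
  by (rule subspace_hom_values[OF P M], rule base_in_hom_values[OF WM])

lemma t: "m \<in> X \<Longrightarrow> equivariant P W M (t m)" "m \<in> X \<Longrightarrow> t m w0 = m"
  by (rule hom_of, assumption)+

text \<open>A homomorphism is determined on the irreducible \<open>W\<close> by its value at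
  \<open>w0\<close>, so every identity for \<open>t\<close> reduces to one between elements of
  \<open>X\<close>.\<close>

lemma unique:
  assumes "equivariant P W M f" "f w0 = m" "w \<in> W"
  shows "t m w = f w" "m \<in> X"
proof -
  show m: "m \<in> X" using assms by (auto simp: hom_values_def)
  have "t m w - f w = 0"
    by (rule irred_kernel[OF irr P equivariant_diff[OF P M t(1)[OF m] assms(1)] w0])
      (use t(2)[OF m] assms in auto)
  then show "t m w = f w" by simp
qed

lemma t_base: "w \<in> W \<Longrightarrow> t w0 w = w"
  by (rule unique(1)[OF equivariant_ident[OF WM]]) auto

lemma t_bilin: "bilin t X W"
proof (rule bilinI)
  fix m m' w assume "m \<in> X" "m' \<in> X" "w \<in> W"
  then show "t (m + m') w = t m w + t m' w"
    using unique(1)[OF equivariant_plus[OF P M t(1) t(1)]] t(2) by auto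
next
  fix c m w assume "m \<in> X" "w \<in> W"
  then show "t (c *\<^sub>C m) w = c *\<^sub>C t m w"
    using unique(1)[OF equivariant_times[OF P M t(1)]] t(2) by auto
qed (auto dest!: t(1) equivariant_lin simp: lin_add lin_scale)

text \<open>Composition with \<open>b\<close> acts on the hom space; under evaluation at
  \<open>w0\<close> this action is \<open>b\<close> itself.\<close>

lemma t_commute:
  assumes b: "lin b" "\<And>m. m \<in> M \<Longrightarrow> b m \<in> M" "\<And>p m. p \<in> P \<Longrightarrow> m \<in> M \<Longrightarrow> b (p m) = p (b m)" and m: "m \<in> X"
  shows "b m \<in> X" "w \<in> W \<Longrightarrow> t (b m) w = b (t m w)"
proof -
  note e = equivariant_compose[OF t(1)[OF m] b]
  show "b m \<in> X" using unique(2)[OF e _ w0(1)] t(2)[OF m] by auto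
  show "w \<in> W \<Longrightarrow> t (b m) w = b (t m w)" using unique(1)[OF e] t(2)[OF m] by auto
qed

text \<open>The images of independent homomorphisms form a direct sum. In the inductive step, the
  \<open>y\<close> for which \<open>t n y\<close> lies in the sum of the images of the
  \<open>t m\<close> with \<open>m \<in> B\<close> form a stable subspace of \<open>W\<close>. If it
  were all of \<open>W\<close>, the components would depend on \<open>y\<close> through
  endomorphisms of \<open>W\<close>, hence through scalars, and \<open>n\<close> would be a linear
  combination of the elements of \<open>B\<close>.\<close>

lemma t_independent:
  assumes "finite B" "independent B" "B \<subseteq> X" "\<And>m. m \<in> B \<Longrightarrow> x m \<in> W" "(\<Sum>m\<in>B. t m (x m)) = 0" "m \<in> B"
  shows "x m = 0"
  using assms
proof (induction B arbitrary: x m)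
  case empty
  then show ?case by simp
next
  case (insert n B)
  have iB: "independent B" using insert.prems(1) independent_mono by blast
  have B: "B \<subseteq> X" and n: "n \<in> X" using insert.prems(2) by auto
  note IH = insert.IH[OF iB B]
  have lt: "lin (t m)" if "m \<in> X" for m using t(1)[OF that] equivariant_lin by blast
  have tp: "t m (p w) = p (t m w)" if "m \<in> X" "p \<in> P" "w \<in> W" for m p w
    using t(1)[OF that(1)] equivariant_app that by blast
  \<comment> \<open>A relation in which \<open>t n y\<close> is cancelled by the images of the
    vectors \<open>z m\<close>; by the induction hypothesis \<open>y\<close> determines
    \<open>z\<close> on \<open>B\<close>.\<close>
  define R where "R y z \<longleftrightarrow> (\<forall>m\<in>B. z m \<in> W) \<and> (\<Sum>m\<in>B. t m (z m)) + t n y = 0" for y z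
  have R_add: "R (y + y') (\<lambda>m. z m + z' m)" if "R y z" "R y' z'" for y y' z z'
  proof -
    have "(\<Sum>m\<in>B. t m (z m + z' m)) = (\<Sum>m\<in>B. t m (z m)) + (\<Sum>m\<in>B. t m (z' m))"
      using lt B by (simp add: sum.distrib[symmetric] lin_add subset_iff cong: sum.cong)
    then have "(\<Sum>m\<in>B. t m (z m + z' m)) + t n (y + y')
        = ((\<Sum>m\<in>B. t m (z m)) + t n y) + ((\<Sum>m\<in>B. t m (z' m)) + t n y')"
      using lin_add[OF lt[OF n]] by (simp add: algebra_simps)
    then show ?thesis using that subspace_add[OF W(1)] unfolding R_def by auto
  qed
  have R_scale: "R (c *\<^sub>C y) (\<lambda>m. c *\<^sub>C z m)" if "R y z" for c y z
  proof -
    have "(\<Sum>m\<in>B. t m (c *\<^sub>C z m)) = c *\<^sub>C (\<Sum>m\<in>B. t m (z m))"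
      using lt B by (simp add: scale_sum_right lin_scale subset_iff cong: sum.cong)
    then have "(\<Sum>m\<in>B. t m (c *\<^sub>C z m)) + t n (c *\<^sub>C y) = c *\<^sub>C ((\<Sum>m\<in>B. t m (z m)) + t n y)"
      using lin_scale[OF lt[OF n]] by (simp add: algebra_simps)
    then show ?thesis using that subspace_scale[OF W(1)] unfolding R_def by auto
  qed
  have R_app: "R (p y) (\<lambda>m. p (z m))" if "R y z" "p \<in> P" "y \<in> W" for p y z
  proof -
    have "(\<Sum>m\<in>B. t m (p (z m))) = (\<Sum>m\<in>B. p (t m (z m)))"
      using tp B that unfolding R_def by (intro sum.cong) auto
    then have "(\<Sum>m\<in>B. t m (p (z m))) + t n (p y) = p ((\<Sum>m\<in>B. t m (z m)) + t n y)"
      using tp[OF n that(2,3)] P that(2) by (simp add: lin_add lin_sum)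
    then show ?thesis using that stable_app[OF W(2)] P lin_0 unfolding R_def by auto
  qed
  have R_unique: "z m = z' m" if "R y z" "R y z'" "m \<in> B" for y z z' m
  proof -
    have "R (y + (- 1) *\<^sub>C y) (\<lambda>m. z m + (- 1) *\<^sub>C z' m)" by (intro R_add R_scale that)
    then have "(\<Sum>m\<in>B. t m (z m - z' m)) = 0" "\<forall>m\<in>B. z m - z' m \<in> W"
      using lin_0[OF lt[OF n]] unfolding R_def by auto
    then have "z m - z' m = 0" using IH[of "\<lambda>m. z m - z' m" m] that(3) by auto
    then show ?thesis by simp
  qed
  have xn: "x n = 0"
  proof (rule ccontr)
    assume xn: "x n \<noteq> 0"
    have R0: "R (x n) x" using insert.prems(3,4) insert.hyps unfolding R_def by (simp add: add.commute)
    let ?Q = "{y \<in> W. \<exists>z. R y z}"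
    have "(\<Sum>m\<in>B. t m 0) = 0" using lin_0[OF lt] B by (intro sum.neutral) blast
    then have R00: "R 0 (\<lambda>m. 0)"
      using lin_0[OF lt[OF n]] subspace_0[OF W(1)] unfolding R_def by simp
    have "stable P ?Q"
      unfolding stable_def
    proof (intro conjI ballI subspaceI)
      show "0 \<in> ?Q" using R00 subspace_0[OF W(1)] by blast
      show "u + v \<in> ?Q" if "u \<in> ?Q" "v \<in> ?Q" for u v using that R_add subspace_add[OF W(1)] by blast
      show "c *\<^sub>C u \<in> ?Q" if "u \<in> ?Q" for c u using that R_scale subspace_scale[OF W(1)] by blast
      show "p u \<in> ?Q" if "p \<in> P" "u \<in> ?Q" for p u using that R_app stable_app[OF W(2)] by blast
    qed
    then have "?Q = {0} \<or> ?Q = W" by (rule irred_cases[OF irr]) blast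
    moreover have "x n \<in> ?Q" using R0 insert.prems(3) by auto
    ultimately have "?Q = W" using xn by blast
    then have "\<forall>y. \<exists>z. y \<in> W \<longrightarrow> R y z" by blast
    then obtain z where z: "\<And>y. y \<in> W \<Longrightarrow> R y (z y)" by metis
    have "\<exists>c. \<forall>y\<in>W. z y m = c *\<^sub>C y" if m: "m \<in> B" for m
    proof -
      obtain g where g: "lin g" "\<And>y. y \<in> W \<Longrightarrow> g y = z y m"
      proof (rule lin_extend[OF W(1), of "\<lambda>y. z y m"])
        fix y y' assume "y \<in> W" "y' \<in> W"
        then show "z (y + y') m = z y m + z y' m"
          using R_unique[OF z R_add[OF z z]] W(1) m subspace_add by blast
      next
        fix c y assume "y \<in> W"
        then show "z (c *\<^sub>C y) m = c *\<^sub>C z y m"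
          using R_unique[OF z R_scale[OF z]] W(1) m subspace_scale by blast
      qed blast
      have "equivariant P W W g"
        unfolding equivariant_def
      proof (intro conjI ballI)
        fix y assume y: "y \<in> W"
        then show "g y \<in> W" using z[OF y] g(2) m unfolding R_def by auto
        fix p assume p: "p \<in> P"
        then show "g (p y) = p (g y)"
          using R_unique[OF z R_app[OF z p y]] stable_app[OF W(2) p y] g(2) m y by auto
      qed (rule g(1))
      then show ?thesis using endo[of g] g(2) by auto
    qed
    then obtain c where c: "\<And>m y. m \<in> B \<Longrightarrow> y \<in> W \<Longrightarrow> z y m = c m *\<^sub>C y" by metis
    \<comment> \<open>At \<open>w0\<close> the relation between homomorphisms becomes a linear
      relation between the elements of \<open>insert n B\<close>, with coefficient \<open>1\<close>
      at \<open>n\<close>.\<close>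
    have "(\<Sum>m\<in>B. t m (c m *\<^sub>C w0)) + t n w0 = 0"
      using z[OF w0(1)] c w0(1) unfolding R_def by (auto cong: sum.cong)
    then have *: "(\<Sum>m\<in>B. c m *\<^sub>C m) + n = 0"
      using lt t(2) B n by (simp add: lin_scale subset_iff cong: sum.cong)
    have "(\<Sum>m\<in>insert n B. (if m = n then 1 else c m) *\<^sub>C m) = n + (\<Sum>m\<in>B. (if m = n then 1 else c m) *\<^sub>C m)"
      using insert.hyps by simp
    also have "(\<Sum>m\<in>B. (if m = n then 1 else c m) *\<^sub>C m) = (\<Sum>m\<in>B. c m *\<^sub>C m)"
      using insert.hyps by (intro sum.cong) auto
    finally show False
      using * independentD[OF insert.prems(1), of "insert n B" "\<lambda>m. if m = n then 1 else c m" n] insert.hyps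
      by (simp add: add.commute)
  qed
  show ?case
  proof (cases "m = n")
    case False
    then show ?thesis
      using insert.prems insert.hyps xn lin_0[OF lt[OF n]] by (intro IH[of x]) auto
  qed (use xn in simp)
qed

text \<open>Grouping the pairs by their first component leaves one vector of \<open>W\<close> for
  each homomorphism. These vectors vanish by \<open>t_independent\<close>, and then their
  coefficients vanish by independence of \<open>C\<close>.\<close>

lemma t_pairs:
  assumes B: "independent B" "B \<subseteq> X" and C: "independent C" "C \<subseteq> W"
    and A: "finite A" "A \<subseteq> B \<times> C" "(\<Sum>p\<in>A. c p *\<^sub>C t (fst p) (snd p)) = 0" and p: "p \<in> A"
  shows "c p = 0"
proof -
  \<comment> \<open>Coefficients extended by zero, so that the sum over \<open>A\<close> becomes a
    sum over the rectangle \<open>?B \<times> ?C\<close>.\<close>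
  define d where "d p = (if p \<in> A then c p else 0)" for p
  let ?B = "fst ` A" and ?C = "snd ` A"
  have fin: "finite ?B" "finite ?C" using A(1) by auto
  have sub: "?B \<subseteq> B" "?C \<subseteq> C" using A(2) by auto
  have lt: "lin (t m)" if "m \<in> ?B" for m using t(1) that sub B(2) equivariant_lin by blast
  have "(\<Sum>p\<in>?B \<times> ?C. d p *\<^sub>C t (fst p) (snd p)) = (\<Sum>p\<in>A. c p *\<^sub>C t (fst p) (snd p))"
  proof (rule sum.mono_neutral_cong_right)
    show "A \<subseteq> ?B \<times> ?C" by force
  qed (use fin in \<open>auto simp: d_def\<close>)
  then have "(\<Sum>m\<in>?B. \<Sum>w\<in>?C. d (m, w) *\<^sub>C t m w) = 0"
    using A(3) by (simp add: sum.cartesian_product case_prod_unfold)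
  then have 0: "(\<Sum>m\<in>?B. t m (\<Sum>w\<in>?C. d (m, w) *\<^sub>C w)) = 0"
    using lt by (simp add: lin_sum lin_scale cong: sum.cong)
  have "(\<Sum>w\<in>?C. d (fst p, w) *\<^sub>C w) = 0"
    by (rule t_independent[OF fin(1) independent_mono[OF B(1) sub(1)] _ _ 0])
      (use sub B C p W(1) in \<open>auto intro!: subspace_sum subspace_scale\<close>)
  then have "d (fst p, snd p) = 0"
    by (rule independentD[OF C(1) fin(2) sub(2)]) (use p in simp)
  then show ?thesis using p by (simp add: d_def)
qed

text \<open>Products of basis vectors are independent and pairwise distinct, so a linear map may be
  prescribed on them; it agrees with \<beta> on all other products by bilinearity.\<close>

lemma t_lift:
  assumes \<beta>: "bilin \<beta> X W"
  shows "\<exists>g. lin g \<and> (\<forall>m\<in>X. \<forall>w\<in>W. g (t m w) = \<beta> m w)"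
proof -
  obtain B where B: "B \<subseteq> X" "independent B" "span B = X" using basis_obtain[OF X(1)] .
  obtain C where C: "C \<subseteq> W" "independent C" "span C = W" using basis_obtain[OF W(1)] .
  let ?t = "\<lambda>p. t (fst p) (snd p)"
  have inj: "inj_on ?t (B \<times> C)"
  proof (rule inj_onI, rule ccontr)
    fix p q assume pq: "p \<in> B \<times> C" "q \<in> B \<times> C" "?t p = ?t q" "p \<noteq> q"
    have "(\<Sum>r\<in>{p, q}. (if r = p then 1 else - 1) *\<^sub>C ?t r) = 0" using pq(3,4) by auto
    moreover have "{p, q} \<subseteq> B \<times> C" using pq(1,2) by blast
    ultimately have "(if p = p then 1 else - 1 :: complex) = 0"
      using t_pairs[OF B(2,1) C(2,1), of "{p, q}" "\<lambda>r. if r = p then 1 else - 1" p] by blast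
    then show False by simp
  qed
  have ind: "independent (?t ` (B \<times> C))"
  proof
    assume "dependent (?t ` (B \<times> C))"
    then obtain T u v where T: "finite T" "T \<subseteq> ?t ` (B \<times> C)" "(\<Sum>v\<in>T. u v *\<^sub>C v) = 0" "v \<in> T" "u v \<noteq> 0"
      unfolding dependent_explicit by blast
    then obtain A where A: "A \<subseteq> B \<times> C" "finite A" "T = ?t ` A" using finite_subset_image[OF T(1,2)] by blast
    have "inj_on ?t A" using inj A(1) inj_on_subset by blast
    then have "(\<Sum>p\<in>A. u (?t p) *\<^sub>C ?t p) = 0" using T(3) A(3) by (simp add: sum.reindex)
    then have "u (?t p) = 0" if "p \<in> A" for p using t_pairs[OF B(2,1) C(2,1) A(2,1), of "\<lambda>p. u (?t p)"] that by simp
    then show False using T(4,5) A(3) by auto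
  qed
  \<comment> \<open>\<open>the_inv_into\<close> recovers the pair of basis vectors from its
    product.\<close>
  obtain g where g: "lin g" "\<forall>x\<in>?t ` (B \<times> C). g x = (\<lambda>p. \<beta> (fst p) (snd p)) (the_inv_into (B \<times> C) ?t x)"
    using vector_space_pair.linear_independent_extend[OF vsp ind,
        of "\<lambda>x. (\<lambda>p. \<beta> (fst p) (snd p)) (the_inv_into (B \<times> C) ?t x)"]
    unfolding linear_iff_lin by blast
  have gBC: "g (t b c) = \<beta> b c" if "b \<in> B" "c \<in> C" for b c
  proof -
    have bc: "(b, c) \<in> B \<times> C" using that by blast
    then have "g (?t (b, c)) = (\<lambda>p. \<beta> (fst p) (snd p)) (the_inv_into (B \<times> C) ?t (?t (b, c)))" using g(2) by blast
    then show ?thesis unfolding the_inv_into_f_f[OF inj bc] by simp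
  qed
  have "bilin (\<lambda>m w. g (t m w) - \<beta> m w) X W"
    by (intro bilinI) (simp_all add: bilinD[OF t_bilin] bilinD[OF \<beta>] lin_add[OF g(1)] lin_scale[OF g(1)] scale_right_diff_distrib)
  then have "g (t m w) - \<beta> m w \<in> {0}" if "m \<in> X" "w \<in> W" for m w
    by (rule bilin_in_subspace[OF _ X(1) W(1) B(1) _ C(1)]) (use B C gBC that in auto)
  then show ?thesis using g(1) by auto
qed

text \<open>For a nonzero \<open>Q\<close>-stable part \<open>Y\<close> of \<open>X\<close>, the
  products \<open>t m w\<close> with \<open>m \<in> Y\<close> span a subspace stable under
  \<open>P\<close> and \<open>Q\<close>, hence all of \<open>M\<close>. For \<open>Y = X\<close>
  this is generation. For a proper \<open>Y\<close> it contradicts the universal property, so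
  \<open>X\<close> is irreducible.\<close>

theorem tensor_hom_values:
  assumes Q: "\<forall>q\<in>Q. lin q" and com: "\<And>p q m. p \<in> P \<Longrightarrow> q \<in> Q \<Longrightarrow> m \<in> M \<Longrightarrow> q (p m) = p (q m)"
    and irrM: "irred (P \<union> Q) M"
  shows "tensor t X W M" "irred Q X"
    "\<And>q m w. q \<in> Q \<Longrightarrow> m \<in> X \<Longrightarrow> w \<in> W \<Longrightarrow> q (t m w) = t (q m) w"
proof -
  have stM: "stable P M" "stable Q M" using irrM by (auto simp: irred_def stable_Un)
  have qX: "q m \<in> X" "w \<in> W \<Longrightarrow> t (q m) w = q (t m w)" if "q \<in> Q" "m \<in> X" for q m w
    using t_commute[of q m] Q that stable_app[OF stM(2)] com by auto
  then show "\<And>q m w. q \<in> Q \<Longrightarrow> m \<in> X \<Longrightarrow> w \<in> W \<Longrightarrow> q (t m w) = t (q m) w" by simp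
  have all: "span {t m w | m w. m \<in> Y \<and> w \<in> W} = M" if Y: "stable Q Y" "Y \<subseteq> X" "Y \<noteq> {0}" for Y
  proof -
    let ?S = "{t m w | m w. m \<in> Y \<and> w \<in> W}"
    have SM: "span ?S \<subseteq> M" using Y(2) t(1) equivariant_in by (intro span_minimal M) blast
    have "stable (P \<union> Q) (span ?S)"
    proof (rule stable_span)
      show "\<forall>p\<in>P \<union> Q. lin p" using P Q by auto
      fix p x assume p: "p \<in> P \<union> Q" and "x \<in> ?S"
      then obtain m w where x: "x = t m w" "m \<in> Y" "w \<in> W" by auto
      then have mX: "m \<in> X" using Y(2) by auto
      show "p x \<in> span ?S"
      proof (cases "p \<in> P")
        case True
        then have "p x = t m (p w)" using equivariant_app[OF t(1)[OF mX] True] x by auto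
        then show ?thesis using x stable_app[OF W(2) True] by (auto intro!: span_base)
      next
        case False
        then have "p x = t (p m) w" using p qX(2)[OF _ mX] x by auto
        then show ?thesis using x False p stable_app[OF Y(1)] by (auto intro!: span_base)
      qed
    qed
    moreover have "span ?S \<noteq> {0}"
    proof -
      obtain m where m: "m \<in> Y" "m \<noteq> 0" using subspace_nonzero[OF stable_subspace[OF Y(1)] Y(3)] by blast
      have "t m w0 \<in> ?S" using m(1) w0(1) by blast
      then have "t m w0 \<in> span ?S" by (rule span_base)
      moreover have "t m w0 = m" by (rule t(2)) (use m(1) Y(2) in blast)
      ultimately have "m \<in> span ?S" by simp
      then show ?thesis using m(2) by auto
    qed
    ultimately show ?thesis using irred_cases[OF irrM _ SM] by blast
  qed
  have QX: "stable Q X" using X(1) qX(1) by (auto simp: stable_def)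
  have X0: "X \<noteq> {0}" using X(2) w0(2) by auto
  show tens: "tensor t X W M"
    unfolding tensor_def using X(1) W(1) t_bilin all[OF QX order_refl X0] t_lift by blast
  show "irred Q X"
    unfolding irred_def
  proof (intro conjI allI impI QX X0)
    fix Y assume Y: "stable Q Y \<and> Y \<subseteq> X"
    show "Y = {0} \<or> Y = X"
    proof (rule ccontr)
      assume n: "\<not> (Y = {0} \<or> Y = X)"
      then obtain n where n: "n \<in> X" "n \<notin> Y" "Y \<noteq> {0}" using Y by blast
      obtain f where f: "functional f" "\<And>x. x \<in> Y \<Longrightarrow> f x = 0" "f n = 1"
        using separate[OF stable_subspace n(2)] Y by blast
      \<comment> \<open>The form behind \<open>f \<otimes> id\<close>, which kills the products with
        \<open>Y\<close>, hence all of \<open>M\<close>, but sends \<open>t n w0\<close> to the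
        nonzero \<open>w0\<close>.\<close>
      have "bilin (\<lambda>m w. f m *\<^sub>C w) X W"
        using f(1) by (intro bilinI) (auto simp: functional_def algebra_simps)
      then obtain g where g: "lin g" "\<And>m w. m \<in> X \<Longrightarrow> w \<in> W \<Longrightarrow> g (t m w) = f m *\<^sub>C w"
        by (rule tensor_lift[OF tens]) blast
      have "t n w0 \<in> M" using equivariant_in[OF t(1)[OF n(1)] w0(1)] .
      then have "t n w0 \<in> span {t m w | m w. m \<in> Y \<and> w \<in> W}" using all[of Y] Y n(3) by auto
      then have "g (t n w0) = 0"
        by (rule span_eq_on[OF g(1) lin_zero, rotated]) (use g(2) f(2) Y in auto)
      then show False using g(2)[OF n(1) w0(1)] f(3) w0(2) by simp
    qed
  qed
qed

end

section \<open>Lifting of equivariant maps under a group with bounded orbits\<close>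

lemma finite_uniform_bound:
  fixes f :: "'a \<Rightarrow> 'k \<Rightarrow> real"
  assumes "finite A" "\<And>a. a \<in> A \<Longrightarrow> \<exists>D. \<forall>k\<in>K. f a k \<le> D"
  obtains D where "D \<ge> 0" "\<And>a k. a \<in> A \<Longrightarrow> k \<in> K \<Longrightarrow> f a k \<le> D"
proof -
  obtain d where d: "\<And>a k. a \<in> A \<Longrightarrow> k \<in> K \<Longrightarrow> f a k \<le> d a" using assms(2) by metis
  have "f a k \<le> (\<Sum>a\<in>A. \<bar>d a\<bar>)" if "a \<in> A" "k \<in> K" for a k
    using d[OF that] member_le_sum[OF that(1), of "\<lambda>a. \<bar>d a\<bar>"] assms(1) by force
  then show ?thesis using that[of "\<Sum>a\<in>A. \<bar>d a\<bar>"] by (auto intro: sum_nonneg)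
qed

context complex_vs begin

lemma functional_add: "functional f \<Longrightarrow> f (x + y) = f x + f y"
  and functional_scale: "functional f \<Longrightarrow> f (c *\<^sub>C x) = c * f x"
  by (auto simp: functional_def)

lemma functional_diff: "functional f \<Longrightarrow> f (x - y) = f x - f y"
  unfolding functional_def by (metis add_diff_cancel_right' diff_add_cancel)

text \<open>The linear maps \<psi> from \<rho> to \<open>V\<close> with the required congruence
  modulo \<open>W\<close> form a nonempty affine space, on which \<open>K\<close> acts by
  conjugation. The matrix coefficients of \<open>K\<close> on \<rho> and on \<open>V\<close> are
  bounded, so the action is uniformly Lipschitz and has a fixed point, which is an equivariant
  \<psi>. Inverses and products in \<open>K\<close> are given on \<open>M\<close> only, because a
  group element determines an operator of the ambient space only there.\<close>

lemma equivariant_lift: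
  assumes linK: "\<forall>k\<in>K. lin k" and Kne: "K \<noteq> {}"
    and inv: "\<And>k. k \<in> K \<Longrightarrow> \<exists>h\<in>K. \<forall>v\<in>M. h (k v) = v \<and> k (h v) = v"
    and mul: "\<And>h k. h \<in> K \<Longrightarrow> k \<in> K \<Longrightarrow> \<exists>m\<in>K. \<forall>v\<in>M. m v = h (k v)"
    and bdd: "\<And>v f. v \<in> M \<Longrightarrow> functional f \<Longrightarrow> \<exists>D. \<forall>k\<in>K. cmod (f (k v)) \<le> D"
    and \<rho>: "stable K \<rho>" "fd \<rho>" "\<rho> \<subseteq> M" and V: "stable K V" "fd V" "V \<subseteq> M"
    and W: "stable K W" "W \<subseteq> M"
    and b: "lin b" "\<And>k v. k \<in> K \<Longrightarrow> v \<in> M \<Longrightarrow> b (k v) = k (b v)"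
    and \<phi>: "equivariant K \<rho> M \<phi>" "\<And>r. r \<in> \<rho> \<Longrightarrow> \<exists>v\<in>V. \<phi> r - b v \<in> W"
  shows "\<exists>\<psi>. equivariant K \<rho> V \<psi> \<and> (\<forall>r\<in>\<rho>. \<phi> r - b (\<psi> r) \<in> W)"
proof -
  obtain ki where ki: "\<And>k. k \<in> K \<Longrightarrow> ki k \<in> K" "\<And>k v. k \<in> K \<Longrightarrow> v \<in> M \<Longrightarrow> ki k (k v) = v"
    "\<And>k v. k \<in> K \<Longrightarrow> v \<in> M \<Longrightarrow> k (ki k v) = v"
    using inv by metis
  obtain B where B: "finite B" "independent B" "B \<subseteq> \<rho>" "span B = \<rho>"
    using fd_basis[OF \<rho>(2) stable_subspace[OF \<rho>(1)]] by metis
  obtain C where C: "finite C" "independent C" "C \<subseteq> V" "span C = V"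
    using fd_basis[OF V(2) stable_subspace[OF V(1)]] by metis
  obtain rB where rB: "\<And>c. c \<in> B \<Longrightarrow> functional (rB c)"
    "\<And>c d. c \<in> B \<Longrightarrow> d \<in> B \<Longrightarrow> rB c d = (if c = d then 1 else 0)"
    using coordinates[OF B(2)] by metis
  obtain rC where rC: "\<And>c. c \<in> C \<Longrightarrow> functional (rC c)"
    "\<And>c d. c \<in> C \<Longrightarrow> d \<in> C \<Longrightarrow> rC c d = (if c = d then 1 else 0)"
    "\<And>v. v \<in> V \<Longrightarrow> (\<Sum>c\<in>C. rC c v *\<^sub>C c) = v"
    using coordinates[OF C(2)] C(1,4) by metis
  have sV: "subspace V" and sW: "subspace W" and s\<rho>: "subspace \<rho>"
    using V W \<rho> by (auto simp: stable_def)
  have ki_\<rho>: "ki k r \<in> \<rho>" if "k \<in> K" "r \<in> \<rho>" for k r using stable_app[OF \<rho>(1) ki(1)] that by blast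
  \<comment> \<open>The linear map with matrix \<open>x\<close> in the bases \<open>B\<close> of
    \<rho> and \<open>C\<close> of \<open>V\<close>; in its body \<open>b\<close> is a basis vector
    and not the operator \<open>b\<close> of the statement.\<close>
  define psi where "psi x u = (\<Sum>b\<in>B. rB b u *\<^sub>C (\<Sum>c\<in>C. x (c, b) *\<^sub>C c))" for x :: "'u \<times> 'u \<Rightarrow> complex" and u
  have psi_lin: "lin (psi x)" for x
    unfolding psi_def lin_def using rB(1)
    by (simp add: functional_def scale_left_distrib sum.distrib scale_sum_right del: scale_scale add: scale_scale[symmetric])
  have psi_V: "psi x u \<in> V" for x u
    unfolding psi_def using C(3) by (intro subspace_sum[OF sV] subspace_scale[OF sV]) auto
  have psi_B: "psi x b' = (\<Sum>c\<in>C. x (c, b') *\<^sub>C c)" if "b' \<in> B" for x b'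
  proof -
    have "psi x b' = (\<Sum>b\<in>B. if b = b' then (\<Sum>c\<in>C. x (c, b) *\<^sub>C c) else 0)"
      unfolding psi_def using rB(2) that by (intro sum.cong) auto
    then show ?thesis using that B(1) by simp
  qed
  have psi_comb: "psi (\<lambda>i. s * x i + s' * y i) u = s *\<^sub>C psi x u + s' *\<^sub>C psi y u" for x y s s' u
    unfolding psi_def by (simp add: scale_left_distrib sum.distrib scale_sum_right scale_right_distrib mult.left_commute)
  have coord: "rC c (psi x b') = x (c, b')" if "c \<in> C" "b' \<in> B" for c b' x
  proof -
    have "rC c (psi x b') = (\<Sum>d\<in>C. rC c (x (d, b') *\<^sub>C d))"
      unfolding psi_B[OF that(2)] by (rule functional_sum[OF rC(1)[OF that(1)]])
    also have "\<dots> = (\<Sum>d\<in>C. if d = c then x (c, b') else 0)"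
      using rC(1,2) that(1) by (intro sum.cong) (auto simp: functional_def)
    finally show ?thesis using that C(1) by simp
  qed
  define I where "I = C \<times> B"
  define S where "S = {x. (\<forall>i. i \<notin> I \<longrightarrow> x i = 0) \<and> (\<forall>r\<in>\<rho>. \<phi> r - b (psi x r) \<in> W)}"
  have SI: "x \<in> S" if "\<And>i. i \<notin> I \<Longrightarrow> x i = 0" "\<And>r. r \<in> B \<Longrightarrow> \<phi> r - b (psi x r) \<in> W" for x
  proof -
    have "lin (\<lambda>r. \<phi> r - b (psi x r))"
      by (intro lin_minus lin_compose[OF b(1)] psi_lin equivariant_lin[OF \<phi>(1)])
    then have "\<phi> r - b (psi x r) \<in> W" if "r \<in> \<rho>" for r
      by (rule span_image_subset[where B = B]) (use \<open>\<And>r. r \<in> B \<Longrightarrow> \<phi> r - b (psi x r) \<in> W\<close> sW B(4) that in auto)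
    then show ?thesis unfolding S_def using that by auto
  qed
  \<comment> \<open>The matrix of the conjugate of \<open>psi x\<close> by \<open>k\<close>, where
    \<open>ki k\<close> inverts \<open>k\<close> on \<open>M\<close>; zero off \<open>I\<close>, as
    \<open>S\<close> demands.\<close>
  define act where "act k x = (\<lambda>(c, b). if (c, b) \<in> I then rC c (k (psi x (ki k b))) else 0)" for k x
  have act_out: "act k x i = 0" if "i \<notin> I" for k x i
    using that by (cases i) (simp add: act_def)
  have psi_act: "psi (act k x) r = k (psi x (ki k r))" if k: "k \<in> K" and r: "r \<in> \<rho>" for k x r
  proof -
    have "lin k" "lin (ki k)" using linK k ki(1)[OF k] by blast+
    then have *: "lin (\<lambda>r. k (psi x (ki k r)))"
      by (rule lin_compose[OF _ lin_compose[OF psi_lin]])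
    show ?thesis
    proof (rule span_eq_on[OF psi_lin * , of B])
      fix d assume d: "d \<in> B"
      have "k (psi x (ki k d)) \<in> V" using stable_app[OF V(1) k psi_V] .
      then show "psi (act k x) d = k (psi x (ki k d))"
        unfolding psi_B[OF d] using rC(3)[of "k (psi x (ki k d))"] d by (simp add: act_def I_def cong: sum.cong)
    qed (use r B in auto)
  qed
  have ext_eq: "x = y" if "\<And>i. i \<notin> I \<Longrightarrow> x i = 0" "\<And>i. i \<notin> I \<Longrightarrow> y i = 0" "\<And>r. r \<in> \<rho> \<Longrightarrow> psi x r = psi y r" for x y
  proof
    fix i show "x i = y i"
    proof (cases "i \<in> I")
      case True
      then obtain c d where i: "i = (c, d)" "c \<in> C" "d \<in> B" by (auto simp: I_def)
      then show ?thesis using coord[OF i(2,3), of x] coord[OF i(2,3), of y] that(3)[of d] B(3) by auto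
    qed (use that in auto)
  qed
  have S_out: "x i = 0" if "x \<in> S" "i \<notin> I" for x i using that unfolding S_def by blast
  \<comment> \<open>\<open>D1\<close> and \<open>D2\<close> bound all matrix entries of the elements
    of \<open>K\<close> on \<rho> and on \<open>V\<close>.\<close>
  obtain D1 where D1: "D1 \<ge> 0" "\<And>p k. p \<in> B \<times> B \<Longrightarrow> k \<in> K \<Longrightarrow> cmod (rB (fst p) (k (snd p))) \<le> D1"
    by (rule finite_uniform_bound[of "B \<times> B" K "\<lambda>p k. cmod (rB (fst p) (k (snd p)))"])
      (use B \<rho>(3) rB(1) in \<open>auto intro!: bdd\<close>)
  obtain D2 where D2: "D2 \<ge> 0" "\<And>p k. p \<in> C \<times> C \<Longrightarrow> k \<in> K \<Longrightarrow> cmod (rC (fst p) (k (snd p))) \<le> D2"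
    by (rule finite_uniform_bound[of "C \<times> C" K "\<lambda>p k. cmod (rC (fst p) (k (snd p)))"])
      (use C V(3) rC(1) in \<open>auto intro!: bdd\<close>)
  define N where "N x = (\<Sum>i\<in>I. (cmod (x i))\<^sup>2)" for x :: "'u \<times> 'u \<Rightarrow> complex"
  \<comment> \<open>An entry of \<open>act k x\<close> is at most \<open>D1 * D2\<close> times the
    sum of the absolute values of the entries of \<open>x\<close>. By Cauchy-Schwarz the square of
    that sum is at most \<open>card I\<close> times \<open>N x\<close>, and there are
    \<open>card I\<close> entries to add up.\<close>
  define L where "L = real (card I) * ((D1 * D2)\<^sup>2 * real (card I))"
  have finI: "finite I" using B C by (simp add: I_def)
  have N_act: "N (act k x) \<le> L * N x" if k: "k \<in> K" for k x
  proof -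
    have lk: "lin k" using linK k by blast
    have "(cmod (act k x (c, d)))\<^sup>2 \<le> (D1 * D2)\<^sup>2 * real (card I) * N x" if c: "c \<in> C" and d: "d \<in> B" for c d
    proof -
      have "act k x (c, d) = rC c (k (psi x (ki k d)))" using c d by (simp add: act_def I_def)
      also have "\<dots> = (\<Sum>b\<in>B. rB b (ki k d) * (\<Sum>e\<in>C. x (e, b) * rC c (k e)))"
        unfolding psi_def
        by (simp add: lin_sum[OF lk] lin_scale[OF lk] functional_sum[OF rC(1)[OF c]] functional_scale[OF rC(1)[OF c]])
      finally have "cmod (act k x (c, d)) \<le> (\<Sum>b\<in>B. cmod (rB b (ki k d)) * (\<Sum>e\<in>C. cmod (x (e, b)) * cmod (rC c (k e))))"
        by (auto intro!: sum_norm_le simp: norm_mult intro!: mult_left_mono)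
      also have "\<dots> \<le> (\<Sum>b\<in>B. D1 * (\<Sum>e\<in>C. cmod (x (e, b)) * D2))"
        using D1 D2 d c k ki(1)[OF k]
        by (intro sum_mono mult_mono sum_nonneg mult_left_mono) (auto simp: D1(2)[of "(_, d)", simplified])
      also have "\<dots> = D1 * D2 * (\<Sum>b\<in>B. \<Sum>e\<in>C. cmod (x (e, b)))"
        by (simp add: sum_distrib_left sum_distrib_right mult_ac)
      also have "(\<Sum>b\<in>B. \<Sum>e\<in>C. cmod (x (e, b))) = (\<Sum>i\<in>I. cmod (x i))"
        unfolding I_def by (subst sum.swap) (simp add: sum.cartesian_product case_prod_unfold)
      finally have "(cmod (act k x (c, d)))\<^sup>2 \<le> (D1 * D2 * (\<Sum>i\<in>I. cmod (x i)))\<^sup>2"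
        by (intro power_mono) auto
      also have "\<dots> = (D1 * D2)\<^sup>2 * (\<Sum>i\<in>I. cmod (x i))\<^sup>2" by (simp add: power_mult_distrib)
      also have "\<dots> \<le> (D1 * D2)\<^sup>2 * ((\<Sum>i\<in>I. (cmod (x i))\<^sup>2) * real (card I))"
        by (intro mult_left_mono sum_squared_le_sum_of_squares finI) auto
      finally show ?thesis by (simp add: N_def mult_ac)
    qed
    then have "N (act k x) \<le> (\<Sum>i\<in>I. (D1 * D2)\<^sup>2 * real (card I) * N x)"
      unfolding N_def[of "act k x"] by (intro sum_mono) (auto simp: I_def)
    then show ?thesis by (simp add: L_def mult_ac)
  qed
  have act_comb: "act k (\<lambda>i. s * x i + s' * y i) = (\<lambda>i. s * act k x i + s' * act k y i)" if "k \<in> K" for k s s' x y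
  proof -
    have "rC c (k (psi (\<lambda>i. s * x i + s' * y i) u)) = s * rC c (k (psi x u)) + s' * rC c (k (psi y u))"
      if "c \<in> C" for c u
    proof -
      have lk: "lin k" using linK \<open>k \<in> K\<close> by blast
      show ?thesis unfolding psi_comb
        by (simp add: lin_add[OF lk] lin_scale[OF lk] functional_add[OF rC(1)[OF that]] functional_scale[OF rC(1)[OF that]])
    qed
    then show ?thesis by (auto simp: act_def I_def)
  qed
  have "\<exists>x\<in>S. \<forall>k\<in>K. act k x = x"
  proof (rule bounded_group_fixed_point[OF finI Kne, where C = L])
    \<comment> \<open>Solutions chosen at the basis vectors alone extend linearly to a point of
      \<open>S\<close>.\<close>
    obtain v where v: "\<And>r. r \<in> \<rho> \<Longrightarrow> v r \<in> V \<and> \<phi> r - b (v r) \<in> W" using \<phi>(2) by metis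
    let ?x = "\<lambda>(c, d). if (c, d) \<in> I then rC c (v d) else 0"
    have "psi ?x d = v d" if "d \<in> B" for d
      unfolding psi_B[OF that] using rC(3)[of "v d"] v[of d] B(3) that by (auto simp: I_def cong: sum.cong)
    then have "?x \<in> S" using v B(3) by (intro SI) auto
    then show "S \<noteq> {}" by blast
  next
    fix x y assume x: "x \<in> S" and y: "y \<in> S"
    show "(\<lambda>i. (x i + y i) / 2) \<in> S"
    proof (rule SI)
      fix r assume "r \<in> B"
      then have r: "r \<in> \<rho>" using B(3) by auto
      have e: "(\<lambda>i. (x i + y i) / 2) = (\<lambda>i. (1/2) * x i + (1/2) * y i)" by (simp add: add_divide_distrib)
      have "\<phi> r = (1/2) *\<^sub>C \<phi> r + (1/2) *\<^sub>C \<phi> r" by (simp add: scale_left_distrib[symmetric])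
      then have "\<phi> r - b (psi (\<lambda>i. (x i + y i) / 2) r)
          = (1/2) *\<^sub>C (\<phi> r - b (psi x r)) + (1/2) *\<^sub>C (\<phi> r - b (psi y r))"
        unfolding e psi_comb lin_add[OF b(1)] lin_scale[OF b(1)] scale_right_diff_distrib
        by (metis add_diff_add)
      also have "\<dots> \<in> W" using x y r unfolding S_def by (intro subspace_add[OF sW] subspace_scale[OF sW]) auto
      finally show "\<phi> r - b (psi (\<lambda>i. (x i + y i) / 2) r) \<in> W" .
    qed (use S_out[OF x] S_out[OF y] in simp)
    fix k assume k: "k \<in> K"
    show "act k (\<lambda>i. (x i + y i) / 2) = (\<lambda>i. (act k x i + act k y i) / 2)"
      using act_comb[OF k, of "1/2" x "1/2" y] by (simp add: add_divide_distrib)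
    have "act k (\<lambda>i. x i - y i) = (\<lambda>i. act k x i - act k y i)"
      using act_comb[OF k, of 1 x "-1" y] by simp
    then show "(\<Sum>i\<in>I. (cmod (act k x i - act k y i))\<^sup>2) \<le> L * (\<Sum>i\<in>I. (cmod (x i - y i))\<^sup>2)"
      using N_act[OF k, of "\<lambda>i. x i - y i"] by (simp add: N_def)
  next
    fix X x assume X: "\<And>n::nat. X n \<in> S" and lim: "\<And>i. (\<lambda>n. X n i) \<longlonglongrightarrow> x i"
    show "x \<in> S"
    proof (rule SI)
      show "x i = 0" if "i \<notin> I" for i
      proof (rule LIMSEQ_unique[OF lim])
        show "(\<lambda>n. X n i) \<longlonglongrightarrow> 0" using S_out[OF X that] by simp
      qed
      fix r assume r: "r \<in> B"
      show "\<phi> r - b (psi x r) \<in> W"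
      proof (rule ccontr)
        assume "\<phi> r - b (psi x r) \<notin> W"
        then obtain g where g: "functional g" "\<And>v. v \<in> W \<Longrightarrow> g v = 0" "g (\<phi> r - b (psi x r)) = 1"
          using separate[OF sW] by blast
        \<comment> \<open>A functional that vanishes on \<open>W\<close> is, on the maps
          \<open>psi y\<close>, a constant plus a finite sum in the coordinates of \<open>y\<close>;
          so membership in \<open>W\<close> survives coordinatewise limits.\<close>
        have e: "g (\<phi> r - b (psi y r)) = g (\<phi> r) - (\<Sum>c\<in>C. y (c, r) * g (b c))" for y
          unfolding psi_B[OF r] functional_diff[OF g(1)] lin_sum[OF b(1)] functional_sum[OF g(1)] lin_scale[OF b(1)]
          using g(1) by (simp add: functional_def)
        have "(\<lambda>n. g (\<phi> r - b (psi (X n) r))) \<longlonglongrightarrow> g (\<phi> r - b (psi x r))"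
          unfolding e by (intro tendsto_diff tendsto_const tendsto_sum tendsto_mult lim)
        moreover have "g (\<phi> r - b (psi (X n) r)) = 0" for n
          using X[of n] r B(3) by (intro g(2)) (auto simp: S_def)
        ultimately have "(\<lambda>n. 0) \<longlonglongrightarrow> g (\<phi> r - b (psi x r))" by simp
        then have "g (\<phi> r - b (psi x r)) = 0" by (rule LIMSEQ_unique[OF _ tendsto_const])
        then show False using g(3) by simp
      qed
    qed
  next
    fix k x assume k: "k \<in> K" and x: "x \<in> S"
    show "act k x \<in> S"
    proof (rule SI[OF act_out])
      fix r assume "r \<in> B"
      then have r: "r \<in> \<rho>" using B(3) by auto
      have "\<phi> r = k (\<phi> (ki k r))"
        using equivariant_app[OF \<phi>(1) k ki_\<rho>[OF k r]] ki(3)[OF k, of r] \<rho>(3) r by auto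
      moreover have "b (psi (act k x) r) = k (b (psi x (ki k r)))"
        unfolding psi_act[OF k r] using b(2)[OF k] psi_V V(3) by blast
      ultimately have "\<phi> r - b (psi (act k x) r) = k (\<phi> (ki k r) - b (psi x (ki k r)))"
        using linK k by (simp add: lin_diff)
      also have "\<dots> \<in> W" using x ki_\<rho>[OF k r] by (intro stable_app[OF W(1) k]) (auto simp: S_def)
      finally show "\<phi> r - b (psi (act k x) r) \<in> W" .
    qed
  next
    fix h k assume h: "h \<in> K" and k: "k \<in> K"
    obtain m where m: "m \<in> K" "\<And>v. v \<in> M \<Longrightarrow> m v = h (k v)" using mul[OF h k] by blast
    have "act h (act k x) = act m x" if "x \<in> S" for x
    proof (rule ext_eq[OF act_out act_out])
      fix r assume r: "r \<in> \<rho>"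
      have "ki k (ki h r) \<in> \<rho>" using ki_\<rho> h k r by blast
      then have "ki m (m (ki k (ki h r))) = ki k (ki h r)" using ki(2)[OF m(1)] \<rho>(3) by blast
      moreover have "m (ki k (ki h r)) = r"
        using m(2) ki(3)[OF k, of "ki h r"] ki(3)[OF h, of r] ki_\<rho> h k r \<rho>(3) by (metis subsetD)
      ultimately have "ki m r = ki k (ki h r)" by simp
      then show "psi (act h (act k x)) r = psi (act m x) r"
        using psi_act h k m r ki_\<rho>[OF h r] psi_V V(3) by (metis subsetD)
    qed
    then show "\<exists>m\<in>K. \<forall>x\<in>S. act h (act k x) = act m x" using m(1) by blast
  next
    fix k assume k: "k \<in> K"
    have "act (ki k) (act k x) = x" if "x \<in> S" for x
    proof (rule ext_eq[OF act_out S_out[OF that]])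
      fix r assume r: "r \<in> \<rho>"
      have kr: "k r \<in> \<rho>" using stable_app[OF \<rho>(1) k r] .
      have "ki (ki k) r = ki (ki k) (ki k (k r))" using ki(2)[OF k] r \<rho>(3) by (metis subsetD)
      also have "\<dots> = k r" using ki(2)[OF ki(1)[OF k]] kr \<rho>(3) by (metis subsetD)
      finally have e: "ki (ki k) r = k r" .
      then show "psi (act (ki k) (act k x)) r = psi x r"
        using psi_act[OF ki(1)[OF k] r] psi_act[OF k kr] ki(2)[OF k] r \<rho>(3) psi_V V(3) by (metis subsetD)
    qed
    then show "\<exists>h\<in>K. \<forall>x\<in>S. act h (act k x) = x" using ki(1)[OF k] by blast
  next
    fix x assume "x \<in> S"
    show "\<exists>D. \<forall>k\<in>K. (\<Sum>i\<in>I. (cmod (act k x i))\<^sup>2) \<le> D" using N_act unfolding N_def by blast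
  qed (use S_out in auto)
  then obtain x where x: "x \<in> S" "\<And>k. k \<in> K \<Longrightarrow> act k x = x" by blast
  have "equivariant K \<rho> V (psi x)"
    unfolding equivariant_def
  proof (intro conjI ballI psi_lin psi_V)
    fix k r assume k: "k \<in> K" and r: "r \<in> \<rho>"
    have "psi (act k x) (k r) = k (psi x (ki k (k r)))" by (rule psi_act[OF k stable_app[OF \<rho>(1) k r]])
    then show "psi x (k r) = k (psi x r)" using x(2)[OF k] ki(2)[OF k, of r] r \<rho>(3) by auto
  qed
  then show ?thesis using x(1) unfolding S_def by blast
qed

end

section \<open>Finite-dimensional stable subspaces and multiplicities in a tensor factor\<close>

context complex_vs begin

lemma fd_Un_span:
  assumes "fd V" "fd W"
  shows "fd {v + w | v w. v \<in> V \<and> w \<in> W}"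
proof -
  obtain B C where "finite B" "V \<subseteq> span B" "finite C" "W \<subseteq> span C" using assms by (auto simp: fd_def)
  then have "{v + w | v w. v \<in> V \<and> w \<in> W} \<subseteq> span (B \<union> C)"
    using span_mono[of B "B \<union> C"] span_mono[of C "B \<union> C"] by (auto intro!: span_add)
  then show ?thesis using \<open>finite B\<close> \<open>finite C\<close> unfolding fd_def by blast
qed

lemma stable_sum:
  assumes "\<forall>p\<in>P. lin p" "stable P V" "stable P W"
  shows "stable P {v + w | v w. v \<in> V \<and> w \<in> W}"
  unfolding stable_def
proof (intro conjI ballI)
  show "subspace {v + w | v w. v \<in> V \<and> w \<in> W}"
    by (intro subspace_sums) (use assms in \<open>auto simp: stable_def\<close>)
  fix p u assume "p \<in> P" "u \<in> {v + w | v w. v \<in> V \<and> w \<in> W}"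
  then show "p u \<in> {v + w | v w. v \<in> V \<and> w \<in> W}"
    using assms stable_app lin_add by fastforce
qed

lemma locally_finite_cover:
  assumes P: "\<forall>p\<in>P. lin p" and M: "subspace M"
    and loc: "\<And>v. v \<in> M \<Longrightarrow> \<exists>V. stable P V \<and> fd V \<and> V \<subseteq> M \<and> v \<in> V"
    and F: "finite F" "F \<subseteq> M"
  shows "\<exists>V. stable P V \<and> fd V \<and> V \<subseteq> M \<and> F \<subseteq> V"
  using F
proof (induction F)
  case empty
  have "fd {0}" using fd_span[of "{}"] by simp
  then show ?case using stable_zero[OF P] subspace_0[OF M] by (intro exI[of _ "{0}"]) auto
next
  case (insert x F)
  obtain V where V: "stable P V" "fd V" "V \<subseteq> M" "F \<subseteq> V" using insert.IH insert.prems by blast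
  obtain U where U: "stable P U" "fd U" "U \<subseteq> M" "x \<in> U" using loc[of x] insert.prems by blast
  let ?S = "{u + v | u v. u \<in> U \<and> v \<in> V}"
  have z: "0 \<in> V" "0 \<in> U" using V(1) U(1) stable_subspace subspace_0 by blast+
  have "x + 0 \<in> ?S" using U(4) z(1) by blast
  moreover have "0 + y \<in> ?S" if "y \<in> F" for y using that V(4) z(2) by blast
  moreover have "?S \<subseteq> M" using U(3) V(3) subspace_add[OF M] by blast
  ultimately have "insert x F \<subseteq> ?S" "?S \<subseteq> M" by auto
  then show ?case using stable_sum[OF P U(1) V(1)] fd_Un_span[OF U(2) V(2)] by (intro exI[of _ ?S] conjI)
qed

lemma tensorD:
  assumes "tensor t X Y M"
  shows "subspace X" "subspace Y" "bilin t X Y" "span {t x y | x y. x \<in> X \<and> y \<in> Y} = M"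
  using assms unfolding tensor_def by blast+

text \<open>The map \<open>f \<mapsto> f \<otimes> id\<close> restricted to an irreducible \<open>E \<subseteq> X \<otimes> \<tau>\<close> embeds \<open>Hom(\<tau>, Y)\<close> into
  \<open>Hom(E, M)\<close>; the tensor product of irreducible representations need not be known to be irreducible.\<close>

lemma fd_hom_values_factor:
  assumes tens: "tensor t X Y M" and K1: "\<forall>k\<in>K1. lin k" and K2: "\<forall>k\<in>K2. lin k"
    and t1: "\<And>k x y. k \<in> K1 \<Longrightarrow> x \<in> X \<Longrightarrow> y \<in> Y \<Longrightarrow> k (t x y) = t x (k y)"
    and t2: "\<And>k x y. k \<in> K2 \<Longrightarrow> x \<in> X \<Longrightarrow> y \<in> Y \<Longrightarrow> k (t x y) = t (k x) y"
    and V: "stable K2 V" "fd V" "V \<noteq> {0}" "V \<subseteq> X"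
    and \<tau>: "irred K1 \<tau>" "fd \<tau>" "\<tau> \<subseteq> Y" and r: "r \<in> \<tau>" "r \<noteq> 0"
    and mult: "\<And>E e. irred (K1 \<union> K2) E \<Longrightarrow> fd E \<Longrightarrow> E \<subseteq> M \<Longrightarrow> e \<in> E \<Longrightarrow> e \<noteq> 0 \<Longrightarrow>
      fd (hom_values (K1 \<union> K2) E M e)"
  shows "fd (hom_values K1 \<tau> Y r)"
proof -
  note sub = tensorD(1-3)[OF tens] and M = tensorD(4)[OF tens]
  have sM: "subspace M" unfolding M[symmetric] by (rule subspace_span)
  have tM: "t x y \<in> M" if "x \<in> X" "y \<in> Y" for x y
    unfolding M[symmetric] by (rule span_base) (use that in blast)
  have st\<tau>: "stable K1 \<tau>" by (rule irred_stable[OF \<tau>(1)])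
  \<comment> \<open>The products that span \<open>V \<otimes> \<tau>\<close>, a finite-dimensional
    stable space in which an irreducible \<open>E\<close> is found.\<close>
  let ?Z = "{t x y | x y. x \<in> V \<and> y \<in> \<tau>}"
  have Z: "stable (K1 \<union> K2) (span ?Z)"
  proof (rule stable_span)
    fix p u assume p: "p \<in> K1 \<union> K2" and "u \<in> ?Z"
    then obtain x y where u: "u = t x y" "x \<in> V" "y \<in> \<tau>" by auto
    then have xy: "x \<in> X" "y \<in> Y" using V(4) \<tau>(3) by auto
    have "p u \<in> ?Z"
    proof (cases "p \<in> K1")
      case True
      then show ?thesis using u t1[OF True xy] stable_app[OF st\<tau> True u(3)] by blast
    next
      case False
      then have "p \<in> K2" using p by blast
      then show ?thesis using u t2[OF _ xy, of p] stable_app[OF V(1) _ u(2), of p] by blast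
    qed
    then show "p u \<in> span ?Z" by (rule span_base)
  qed (use K1 K2 in auto)
  have Zfd: "fd (span ?Z)"
  proof -
    obtain B where B: "finite B" "independent B" "B \<subseteq> V" "span B = V"
      using fd_basis[OF V(2) stable_subspace[OF V(1)]] by metis
    obtain C where C: "finite C" "independent C" "C \<subseteq> \<tau>" "span C = \<tau>"
      using fd_basis[OF \<tau>(2) stable_subspace[OF st\<tau>]] by metis
    let ?T = "(\<lambda>p. t (fst p) (snd p)) ` (B \<times> C)"
    have bV: "bilin t V \<tau>" using sub(3) V(4) \<tau>(3) unfolding bilin_def by (meson subsetD)
    have BC: "t b c \<in> span ?T" if "b \<in> B" "c \<in> C" for b c
      using span_base[OF imageI[of "(b, c)" "B \<times> C" "\<lambda>p. t (fst p) (snd p)"]] that by simp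
    have VB: "V \<subseteq> span B" "\<tau> \<subseteq> span C" using B(4) C(4) by simp_all
    have "t x y \<in> span ?T" if "x \<in> V" "y \<in> \<tau>" for x y
      by (rule bilin_in_subspace[OF bV stable_subspace[OF V(1)] stable_subspace[OF st\<tau>] B(3) VB(1) C(3) VB(2)
            subspace_span BC that])
    then have "?Z \<subseteq> span ?T" by blast
    then have "span ?Z \<subseteq> span ?T" by (rule span_minimal[OF _ subspace_span])
    moreover have "finite ?T" using B(1) C(1) by blast
    ultimately show ?thesis unfolding fd_def by blast
  qed
  have "span ?Z \<noteq> {0}"
  proof -
    obtain x where x: "x \<in> V" "x \<noteq> 0" using subspace_nonzero[OF stable_subspace[OF V(1)] V(3)] by blast
    have "t x r \<in> ?Z" using x r by blast
    then have "t x r \<in> span ?Z" by (rule span_base)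
    moreover have "t x r \<noteq> 0" using tensor_nonzero[OF tens, of x r] x r V(4) \<tau>(3) by auto
    ultimately show ?thesis by auto
  qed
  then obtain E where E: "irred (K1 \<union> K2) E" "E \<subseteq> span ?Z" using irred_exists[OF Z Zfd] by blast
  have "?Z \<subseteq> M" using tM V(4) \<tau>(3) by blast
  then have ZM: "span ?Z \<subseteq> M" by (rule span_minimal[OF _ sM])
  have stE: "stable (K1 \<union> K2) E" using E(1) by (auto simp: irred_def)
  obtain e where e: "e \<in> E" "e \<noteq> 0"
    using irred_nonzero_element[OF E(1)] by blast
  let ?D = "hom_values K1 \<tau> Y r"
  let ?f = "hom_of K1 \<tau> Y r"
  have f: "equivariant K1 \<tau> Y (?f d)" "?f d r = d" if "d \<in> ?D" for d using hom_of[OF that] by auto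
  have "\<exists>g. lin g \<and> (\<forall>x\<in>X. \<forall>y\<in>\<tau>. g (t x y) = t x (?f d y))" if d: "d \<in> ?D" for d
  proof -
    have dY: "?f d y \<in> Y" if "y \<in> \<tau>" for y using equivariant_in[OF f(1)[OF d] that] .
    have ld: "lin (?f d)" using equivariant_lin[OF f(1)[OF d]] .
    \<comment> \<open>\<open>?f d\<close> is known to map only \<tau> into \<open>Y\<close>;
      composed with the projection \<open>p\<close> onto \<tau> it gives a bilinear form on all of
      \<open>X \<times> Y\<close>, as the universal property requires.\<close>
    obtain p where p: "lin p" "\<And>x. p x \<in> \<tau>" "\<And>x. x \<in> \<tau> \<Longrightarrow> p x = x"
      by (rule left_inverse_on[OF lin_ident stable_subspace[OF st\<tau>]]) auto
    have "bilin (\<lambda>x y. t x (?f d (p y))) X Y"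
      by (intro bilinI)
        (simp_all add: bilinD[OF sub(3)] dY p(2) lin_add[OF ld] lin_scale[OF ld] lin_add[OF p(1)] lin_scale[OF p(1)])
    then obtain g where "lin g" "\<And>x y. x \<in> X \<Longrightarrow> y \<in> Y \<Longrightarrow> g (t x y) = t x (?f d (p y))"
      by (rule tensor_lift[OF tens]) blast
    then show ?thesis using p(3) \<tau>(3) by (intro exI[of _ g]) auto
  qed
  then obtain F where F: "\<And>d. d \<in> ?D \<Longrightarrow> lin (F d)"
    "\<And>d x y. d \<in> ?D \<Longrightarrow> x \<in> X \<Longrightarrow> y \<in> \<tau> \<Longrightarrow> F d (t x y) = t x (?f d y)" by metis
  have sD: "subspace ?D" by (rule subspace_hom_values[OF K1 sub(2)])
  have uniq: "?f d y = g y" if "d \<in> ?D" "equivariant K1 \<tau> Y g" "g r = d" "y \<in> \<tau>" for d g y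
    using irred_kernel[OF \<tau>(1) K1 equivariant_diff[OF K1 sub(2) f(1)[OF that(1)] that(2)] r] f(2)[OF that(1)] that by auto
  show ?thesis
  \<comment> \<open>\<open>d\<close> is sent to the value at \<open>e\<close> of \<open>F d\<close>,
    the extension of \<open>id \<otimes> ?f d\<close>; these values lie in the hom values of
    \<open>E\<close>, which are finite-dimensional by \<open>mult\<close>.\<close>
  proof (rule fd_injective[OF sD mult[OF E(1) fd_subset[OF Zfd E(2)] _ e], of "\<lambda>d. F d e"])
    show "E \<subseteq> M" using E(2) ZM by auto
    have eZ: "e \<in> span ?Z" using e E by auto
    fix d assume d: "d \<in> ?D"
    note ld = equivariant_lin[OF f(1)[OF d]]
    {
      fix d' assume d': "d' \<in> ?D"
      have "?f (d + d') y = ?f d y + ?f d' y" if "y \<in> \<tau>" for y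
        using uniq[OF subspace_add[OF sD d d'] equivariant_plus[OF K1 sub(2) f(1)[OF d] f(1)[OF d']] _ that]
          f(2) d d' by simp
      then have "F (d + d') u = F d u + F d' u" if "u \<in> ?Z" for u
        using that F(2) d d' subspace_add[OF sD d d'] V(4) sub(3) equivariant_in[OF f(1)] unfolding bilin_def
        by (auto simp: subset_iff)
      then show "F (d + d') e = F d e + F d' e"
        using span_eq_on[OF F(1)[OF subspace_add[OF sD d d']] lin_plus[OF F(1)[OF d] F(1)[OF d']] _ eZ] by blast
    }
    {
      fix c
      have "?f (c *\<^sub>C d) y = c *\<^sub>C ?f d y" if "y \<in> \<tau>" for y
        using uniq[OF subspace_scale[OF sD d] equivariant_times[OF K1 sub(2) f(1)[OF d]] _ that] f(2) d by simp
      then have "F (c *\<^sub>C d) u = c *\<^sub>C F d u" if "u \<in> ?Z" for u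
        using that F(2) d subspace_scale[OF sD d] V(4) sub(3) equivariant_in[OF f(1)] unfolding bilin_def
        by (auto simp: subset_iff)
      then show "F (c *\<^sub>C d) e = c *\<^sub>C F d e"
        using span_eq_on[OF F(1)[OF subspace_scale[OF sD d]] lin_times[OF F(1)[OF d]] _ eZ] by blast
    }
    have "equivariant (K1 \<union> K2) E M (F d)"
      unfolding equivariant_def
    proof (intro conjI ballI F(1)[OF d])
      fix u assume "u \<in> E"
      then have uZ: "u \<in> span ?Z" using E(2) by auto
      show "F d u \<in> M"
        by (rule span_image_subset[OF F(1)[OF d] _ sM uZ])
          (use F(2)[OF d] V(4) equivariant_in[OF f(1)[OF d]] tM in auto)
      fix p assume p: "p \<in> K1 \<union> K2"
      then have lp: "lin p" using K1 K2 by auto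
      show "F d (p u) = p (F d u)"
      proof (rule span_eq_on[OF lin_compose[OF F(1)[OF d] lp] lin_compose[OF lp F(1)[OF d]] _ uZ])
        fix z assume "z \<in> ?Z"
        then obtain x y where z: "z = t x y" "x \<in> V" "y \<in> \<tau>" by auto
        then have xy: "x \<in> X" "y \<in> Y" "?f d y \<in> Y" using V(4) \<tau>(3) equivariant_in[OF f(1)[OF d]] by auto
        show "F d (p z) = p (F d z)"
        proof (cases "p \<in> K1")
          case True
          then show ?thesis
            using z xy t1[OF True] F(2)[OF d] stable_app[OF st\<tau> True] equivariant_app[OF f(1)[OF d] True] by auto
        next
          case False
          then have pK: "p \<in> K2" using p by auto
          have px: "p x \<in> X" using stable_app[OF V(1) pK z(2)] V(4) by auto
          have "F d (p z) = F d (t (p x) y)" using t2[OF pK xy(1,2)] z(1) by simp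
          also have "\<dots> = t (p x) (?f d y)" by (rule F(2)[OF d px z(3)])
          also have "\<dots> = p (t x (?f d y))" using t2[OF pK xy(1,3)] by simp
          finally show ?thesis using F(2)[OF d xy(1) z(3)] z(1) by simp
        qed
      qed
    qed
    then show "F d e \<in> hom_values (K1 \<union> K2) E M e" by (auto simp: hom_values_def)
    show "d = 0" if F0: "F d e = 0"
    proof (rule ccontr)
      assume d0: "d \<noteq> 0"
      have "x = 0" if x: "x \<in> \<tau>" "?f d x = 0" for x
        using irred_kernel[OF \<tau>(1) K1 f(1)[OF d] x(1) _ x(2) r(1)] f(2)[OF d] d0 by auto
      \<comment> \<open>If \<open>d\<close> is nonzero, \<open>?f d\<close> is injective on \<tau>.
        With a left inverse \<open>h\<close> the operator \<open>id \<otimes> h\<close> recovers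
        \<open>e\<close> from \<open>F d e\<close>, so the latter cannot vanish.\<close>
      then obtain h where h: "lin h" "\<And>x. h x \<in> \<tau>" "\<And>x. x \<in> \<tau> \<Longrightarrow> h (?f d x) = x"
        using left_inverse_on[OF ld stable_subspace[OF st\<tau>]] by metis
      have "bilin (\<lambda>x y. t x (h y)) X Y"
      proof (rule bilinI)
        have hY: "h y \<in> Y" for y using h(2) \<tau>(3) by blast
        show "t (x + x') (h y) = t x (h y) + t x' (h y)" if "x \<in> X" "x' \<in> X" for x x' y
          using bilinD(1)[OF sub(3) that(1) hY that(2)] .
        show "t (c *\<^sub>C x) (h y) = c *\<^sub>C t x (h y)" if "x \<in> X" for c x y
          using bilinD(2)[OF sub(3) that hY] .
        show "t x (h (y + y')) = t x (h y) + t x (h y')" if "x \<in> X" for x y y'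
          using bilinD(3)[OF sub(3) that hY hY] by (simp add: lin_add[OF h(1)])
        show "t x (h (c *\<^sub>C y)) = c *\<^sub>C t x (h y)" if "x \<in> X" for c x y
          using bilinD(4)[OF sub(3) that hY] by (simp add: lin_scale[OF h(1)])
      qed
      then obtain g where g: "lin g" "\<And>x y. x \<in> X \<Longrightarrow> y \<in> Y \<Longrightarrow> g (t x y) = t x (h y)"
        by (rule tensor_lift[OF tens]) blast
      have "g (F d e) = e"
        by (rule span_eq_on[OF lin_compose[OF g(1) F(1)[OF d]] lin_ident _ eZ])
          (use g(2) F(2)[OF d] h(3) V(4) equivariant_in[OF f(1)[OF d]] in auto)
      then show False using F0 lin_0[OF g(1)] e(2) by simp
    qed
  qed
qed

end

section \<open>Factorization for two commuting sets of operators\<close>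

lemma (in scalar_endo) tensor_hom_values_ball:
  assumes Q: "\<forall>q\<in>Q. lin q" and com: "\<forall>p\<in>P. \<forall>q\<in>Q. \<forall>m\<in>M. q (p m) = p (q m)"
    and irrM: "irred (P \<union> Q) M"
  shows "tensor t X W M" "irred Q X"
    "\<And>q m w. q \<in> Q \<Longrightarrow> m \<in> X \<Longrightarrow> w \<in> W \<Longrightarrow> q (t m w) = t (q m) w"
proof -
  have c: "q (p m) = p (q m)" if "p \<in> P" "q \<in> Q" "m \<in> M" for p q m using com that by blast
  show "tensor t X W M" by (rule tensor_hom_values(1)[OF Q _ irrM]) (rule c)
  show "irred Q X" by (rule tensor_hom_values(2)[OF Q _ irrM]) (rule c)
  show "q (t m w) = t (q m) w" if "q \<in> Q" "m \<in> X" "w \<in> W" for q m w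
    by (rule tensor_hom_values(3)[OF Q _ irrM that]) (rule c)
qed

lemma (in complex_vs) hom_valuesI: "equivariant P W M f \<Longrightarrow> f w0 \<in> hom_values P W M w0"
  by (auto simp: hom_values_def)

text \<open>\<open>A\<close> and \<open>B\<close> stand for the operators of the two factors,
  \<open>K1\<close> and \<open>K2\<close> for those of the compact groups. Compactness of
  \<open>K1\<close> enters as \<open>bdd\<close>, local finiteness as \<open>loc\<close>,
  admissibility as \<open>mult\<close>. The group laws \<open>inv\<close> and \<open>mul\<close> are
  stated on \<open>M\<close>, since the operators will be extensions that are determined only
  there.\<close>

locale commuting_pair = complex_vs scale for scale :: "complex \<Rightarrow> 'u::ab_group_add \<Rightarrow> 'u" (infixr "*\<^sub>C" 75) +
  fixes A B K1 K2 :: "('u \<Rightarrow> 'u) set" and M :: "'u set"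
  assumes linA: "\<forall>a\<in>A. lin a" and linB: "\<forall>b\<in>B. lin b"
    and K1A: "K1 \<subseteq> A" and K2B: "K2 \<subseteq> B"
    and com: "\<And>a b m. a \<in> A \<Longrightarrow> b \<in> B \<Longrightarrow> m \<in> M \<Longrightarrow> b (a m) = a (b m)"
    and irrM: "irred (A \<union> B) M"
    and K1ne: "K1 \<noteq> {}"
    and inv: "\<And>k. k \<in> K1 \<Longrightarrow> \<exists>h\<in>K1. \<forall>v\<in>M. h (k v) = v \<and> k (h v) = v"
    and mul: "\<And>h k. h \<in> K1 \<Longrightarrow> k \<in> K1 \<Longrightarrow> \<exists>m\<in>K1. \<forall>v\<in>M. m v = h (k v)"
    and bdd: "\<And>v f. v \<in> M \<Longrightarrow> functional f \<Longrightarrow> \<exists>D. \<forall>k\<in>K1. cmod (f (k v)) \<le> D"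
    and loc: "\<And>v. v \<in> M \<Longrightarrow> \<exists>V. stable (K1 \<union> K2) V \<and> fd V \<and> V \<subseteq> M \<and> v \<in> V"
    and mult: "\<And>E e. irred (K1 \<union> K2) E \<Longrightarrow> fd E \<Longrightarrow> E \<subseteq> M \<Longrightarrow> e \<in> E \<Longrightarrow> e \<noteq> 0 \<Longrightarrow>
      fd (hom_values (K1 \<union> K2) E M e)"
begin

lemma linK: "\<forall>k\<in>K1. lin k" "\<forall>k\<in>K2. lin k" "\<forall>k\<in>K1 \<union> K2. lin k"
  using linA linB K1A K2B by auto

lemma stM: "stable A M" "stable B M" "stable K1 M" "stable K2 M" "subspace M"
  using irrM K1A K2B unfolding irred_def stable_def by auto

text \<open>Complete reducibility under \<open>K1\<close> enters only here: the \<open>A\<close>-submodules without \<open>\<rho>\<close> are closed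
  under sums and under \<open>B\<close>.\<close>

lemma hom_values_sum_zero:
  assumes \<rho>: "irred K1 \<rho>" "fd \<rho>" "\<rho> \<subseteq> M" "r0 \<in> \<rho>" "r0 \<noteq> 0"
    and W: "stable A W" "W \<subseteq> M" "hom_values K1 \<rho> W r0 = {0}"
    and W': "stable A W'" "W' \<subseteq> M" "hom_values K1 \<rho> W' r0 = {0}"
    and b: "lin b" "\<And>m. m \<in> M \<Longrightarrow> b m \<in> M" "\<And>k m. k \<in> K1 \<Longrightarrow> m \<in> M \<Longrightarrow> b (k m) = k (b m)"
  shows "hom_values K1 \<rho> {b v + w | v w. v \<in> W \<and> w \<in> W'} r0 = {0}"
proof -
  let ?S = "{b v + w | v w. v \<in> W \<and> w \<in> W'}"
  have sub: "subspace W" "subspace W'" "stable K1 W" "stable K1 W'" "stable K1 \<rho>" "subspace \<rho>"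
    using W W' \<rho>(1) K1A by (auto simp: stable_def irred_def)
  have SM: "?S \<subseteq> M" using W(2) W'(2) b(2) subspace_add[OF stM(5)] by blast
  have "f r0 = 0" if f: "equivariant K1 \<rho> ?S f" for f
  proof -
    obtain C where C: "finite C" "independent C" "C \<subseteq> \<rho>" "span C = \<rho>"
      using fd_basis[OF \<rho>(2) sub(6)] by metis
    have "\<exists>v\<in>W. f c - b v \<in> W'" if "c \<in> C" for c
    proof -
      have "f c \<in> ?S" using equivariant_in[OF f] C(3) that by blast
      then obtain v w where "f c = b v + w" "v \<in> W" "w \<in> W'" by blast
      then show ?thesis by (intro bexI[of _ v]) auto
    qed
    then obtain vv where vv: "\<And>c. c \<in> C \<Longrightarrow> vv c \<in> W \<and> f c - b (vv c) \<in> W'" by metis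
    have "\<exists>V. stable K1 V \<and> fd V \<and> V \<subseteq> M \<and> vv ` C \<subseteq> V"
    proof (rule locally_finite_cover[OF linK(1) stM(5)])
      fix v assume "v \<in> M"
      then obtain V where "stable (K1 \<union> K2) V \<and> fd V \<and> V \<subseteq> M \<and> v \<in> V" using loc by blast
      then show "\<exists>V. stable K1 V \<and> fd V \<and> V \<subseteq> M \<and> v \<in> V" unfolding stable_Un by blast
    qed (use C vv W in auto)
    then obtain V where V: "stable K1 V" "fd V" "V \<subseteq> M" "vv ` C \<subseteq> V" by blast
    \<comment> \<open>The part of \<open>W\<close> in a finite-dimensional \<open>K1\<close>-stable
      space. It still reaches the values of \<open>f\<close> on a basis of \<rho>, hence on \<rho>,
      and gives the lifting lemma a finite-dimensional target.\<close>
    define U where "U = V \<inter> W"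
    have U: "stable K1 U" "fd U" "U \<subseteq> M" "U \<subseteq> W"
      unfolding U_def using V sub stable_Int fd_subset[of V] by auto
    have sU: "subspace U" by (rule stable_subspace[OF U(1)])
    have "subspace {v + w | v w. v \<in> b ` U \<and> w \<in> W'}"
      by (rule subspace_sums[OF subspace_image[OF b(1) sU] sub(2)])
    then have "span C \<subseteq> {u. f u \<in> {v + w | v w. v \<in> b ` U \<and> w \<in> W'}}"
    proof (intro span_minimal subspace_vimage[OF equivariant_lin[OF f]] subsetI CollectI)
      fix c assume c: "c \<in> C"
      have "f c = b (vv c) + (f c - b (vv c))" by simp
      moreover have "vv c \<in> U" using vv[OF c] V(4) c by (auto simp: U_def)
      ultimately show "\<exists>v w. f c = v + w \<and> v \<in> b ` U \<and> w \<in> W'" using vv[OF c] by blast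
    qed
    then have all: "f r \<in> {v + w | v w. v \<in> b ` U \<and> w \<in> W'}" if "r \<in> \<rho>" for r
      using that C(4) by blast
    have ex: "\<exists>v\<in>U. f r - b v \<in> W'" if r: "r \<in> \<rho>" for r
    proof -
      obtain u w where "f r = b u + w" "u \<in> U" "w \<in> W'" using all[OF r] by blast
      then show ?thesis by (intro bexI[of _ u]) simp_all
    qed
    have "\<exists>\<psi>. equivariant K1 \<rho> U \<psi> \<and> (\<forall>r\<in>\<rho>. f r - b (\<psi> r) \<in> W')"
    proof (rule equivariant_lift[where K = K1 and M = M and \<rho> = \<rho> and V = U and W = W' and b = b and \<phi> = f])
      show "\<exists>h\<in>K1. \<forall>v\<in>M. h (k v) = v \<and> k (h v) = v" if "k \<in> K1" for k using inv[OF that] .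
      show "\<exists>m\<in>K1. \<forall>v\<in>M. m v = h (k v)" if "h \<in> K1" "k \<in> K1" for h k using mul[OF that] .
      show "\<exists>D. \<forall>k\<in>K1. cmod (f (k v)) \<le> D" if "v \<in> M" "functional f" for v f using bdd[OF that] .
      show "b (k v) = k (b v)" if "k \<in> K1" "v \<in> M" for k v using b(3)[OF that] .
      show "equivariant K1 \<rho> M f" by (rule equivariant_mono[OF f order_refl order_refl SM])
    qed (fact linK(1) K1ne sub(4,5) \<rho>(2,3) U(1-3) W'(2) b(1) | rule ex, assumption)+
    then obtain g where g: "equivariant K1 \<rho> U g" "\<And>r. r \<in> \<rho> \<Longrightarrow> f r - b (g r) \<in> W'"
      by blast
    \<comment> \<open>As \<open>W\<close> does not contain \<rho>, the lift \<open>g\<close>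
      vanishes at \<open>r0\<close>; the remainder of \<open>f\<close> is a homomorphism into
      \<open>W'\<close> and vanishes there for the same reason.\<close>
    have "g r0 \<in> hom_values K1 \<rho> W r0"
      by (rule hom_valuesI[OF equivariant_mono[OF g(1) order_refl order_refl U(4)]])
    then have g0: "g r0 = 0" using W(3) by auto
    have "equivariant K1 \<rho> M (\<lambda>x. b (g x))"
      by (rule equivariant_compose[OF equivariant_mono[OF g(1) order_refl order_refl U(3)] b])
    then have "equivariant K1 \<rho> M (\<lambda>x. f x - b (g x))"
      by (rule equivariant_diff[OF linK(1) stM(5) equivariant_mono[OF f order_refl order_refl SM]])
    then have "equivariant K1 \<rho> W' (\<lambda>x. f x - b (g x))"
      using g(2) by (simp add: equivariant_def)
    from hom_valuesI[OF this, of r0] have "f r0 - b (g r0) \<in> hom_values K1 \<rho> W' r0" .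
    then show ?thesis using W'(3) g0 lin_0[OF b(1)] by auto
  qed
  moreover have "0 \<in> hom_values K1 \<rho> ?S r0"
  proof (rule subspace_0[OF subspace_hom_values[OF linK(1)]])
    show "subspace ?S"
      using subspace_sums[OF subspace_image[OF b(1) sub(1)] sub(2)] by (rule back_subst[of subspace]) blast
  qed
  ultimately show ?thesis unfolding hom_values_def by blast
qed

text \<open>The family \<open>G\<close> of submodules without \<rho> is closed under sums of two, so
  its union is already a submodule and no infinite sums arise. A nonzero \<open>W\<close> in
  \<open>G\<close> would make this union equal to \<open>M\<close>; then \<open>r0\<close> would lie
  in a single member, which would contain \<rho> because \<rho> is irreducible.\<close>

lemma submodule_contains_type:
  assumes \<rho>: "irred K1 \<rho>" "fd \<rho>" "\<rho> \<subseteq> M" "r0 \<in> \<rho>" "r0 \<noteq> 0"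
    and W: "stable A W" "W \<subseteq> M" "W \<noteq> {0}"
  shows "hom_values K1 \<rho> W r0 \<noteq> {0}"
proof
  assume W0: "hom_values K1 \<rho> W r0 = {0}"
  define G where "G = {W. stable A W \<and> W \<subseteq> M \<and> hom_values K1 \<rho> W r0 = {0}}"
  have WG: "W \<in> G" using W W0 by (simp add: G_def)
  have zG: "{0} \<in> G"
    using stable_zero[OF linA] stM(5) subspace_0 hom_values_subset[OF \<rho>(4), of K1 "{0}"]
      subspace_0[OF subspace_hom_values[OF linK(1), of "{0}" \<rho> r0]]
    by (auto simp: G_def)
  have cl: "{b v + w | v w. v \<in> V \<and> w \<in> U} \<in> G"
    if VU: "V \<in> G" "U \<in> G" and b: "lin b" "\<And>m. m \<in> M \<Longrightarrow> b m \<in> M" "\<And>a m. a \<in> A \<Longrightarrow> m \<in> M \<Longrightarrow> b (a m) = a (b m)" for b V U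
  proof -
    have V: "stable A V" "V \<subseteq> M" "hom_values K1 \<rho> V r0 = {0}"
      and U: "stable A U" "U \<subseteq> M" "hom_values K1 \<rho> U r0 = {0}"
      using VU by (auto simp: G_def)
    let ?S = "{b v + w | v w. v \<in> V \<and> w \<in> U}"
    have e: "?S = {v + w | v w. v \<in> b ` V \<and> w \<in> U}" by blast
    have "equivariant A V M b" using V(2) b by (auto simp: equivariant_def)
    then have "stable A ?S" unfolding e by (intro stable_sum[OF linA] stable_image[OF _ V(1)] U(1))
    moreover have "?S \<subseteq> M" using V(2) U(2) b(2) subspace_add[OF stM(5)] by blast
    moreover have "hom_values K1 \<rho> ?S r0 = {0}"
      using K1A by (intro hom_values_sum_zero[OF \<rho> V U b(1,2)] b(3)) auto
    ultimately show ?thesis by (simp add: G_def)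
  qed
  have add: "x + y \<in> \<Union>G" if xy: "x \<in> \<Union>G" "y \<in> \<Union>G" for x y
  proof -
    obtain V U where VU: "V \<in> G" "U \<in> G" "x \<in> V" "y \<in> U" using xy by blast
    have "{v + w | v w. v \<in> V \<and> w \<in> U} \<in> G" using cl[OF VU(1,2) lin_ident] by simp
    then show ?thesis using VU(3,4) by blast
  qed
  have appB: "b x \<in> \<Union>G" if xb: "x \<in> \<Union>G" "b \<in> B" for x b
  proof -
    obtain V where V: "V \<in> G" "x \<in> V" using xb by blast
    \<comment> \<open>With \<open>{0}\<close> as second summand the closure property says that
      \<open>b\<close> maps a member of \<open>G\<close> onto a member.\<close>
    have "{b v + w | v w. v \<in> V \<and> w \<in> {0}} \<in> G"
      using linB stable_app[OF stM(2)] com xb(2) by (intro cl[OF V(1) zG]) auto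
    moreover have "b x \<in> {b v + w | v w. v \<in> V \<and> w \<in> {0}}" using V(2) by force
    ultimately show ?thesis by blast
  qed
  have "stable (A \<union> B) (\<Union>G)"
    unfolding stable_def
  proof (intro conjI ballI subspaceI add)
    show "0 \<in> \<Union>G" using zG by blast
    show "c *\<^sub>C x \<in> \<Union>G" if x: "x \<in> \<Union>G" for c x
    proof -
      obtain V where V: "V \<in> G" "x \<in> V" using x by blast
      have "subspace V" using V(1) unfolding G_def stable_def by blast
      then show ?thesis using subspace_scale[of V x c] V by blast
    qed
    fix p x assume p: "p \<in> A \<union> B" and x: "x \<in> \<Union>G"
    show "p x \<in> \<Union>G"
    proof (cases "p \<in> B")
      case False
      obtain V where V: "V \<in> G" "x \<in> V" using x by blast
      have "stable A V" using V(1) unfolding G_def by blast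
      then show ?thesis using stable_app[of A V p x] V False p by blast
    qed (rule appB[OF x])
  qed
  moreover have "\<Union>G \<subseteq> M" by (auto simp: G_def)
  moreover have "\<Union>G \<noteq> {0}"
  proof -
    obtain w where "w \<in> W" "w \<noteq> 0" using subspace_nonzero[OF stable_subspace[OF W(1)] W(3)] by blast
    then show ?thesis using WG by blast
  qed
  ultimately have "\<Union>G = M" using irred_cases[OF irrM] by blast
  then obtain V where V: "V \<in> G" "r0 \<in> V" using \<rho>(3,4) by blast
  have "stable A V" using V(1) unfolding G_def by blast
  then have stV: "stable K1 V" by (rule stable_mono[OF _ K1A])
  have "\<rho> \<inter> V = {0} \<or> \<rho> \<inter> V = \<rho>"
    by (rule irred_cases[OF \<rho>(1) stable_Int[OF irred_stable[OF \<rho>(1)] stV]]) blast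
  then have "\<rho> \<subseteq> V" using \<rho>(4,5) V(2) by blast
  then have "r0 \<in> hom_values K1 \<rho> V r0" by (rule base_in_hom_values)
  then show False using V(1) \<rho>(5) unfolding G_def by blast
qed

text \<open>In \<open>t x y\<close> the first argument runs over the hom space \<open>X\<close>, on
  which \<open>B\<close> acts, and the second over \<open>Y\<close>, on which \<open>A\<close> acts.
  Both factors stay inside \<open>M\<close>, so that they can be pulled back to its carrier; the
  last two clauses are the source of their finite multiplicities.\<close>

theorem factorization:
  "\<exists>t X Y. tensor t X Y M \<and> irred A Y \<and> irred B X \<and> X \<subseteq> M \<and> Y \<subseteq> M \<and>
     (\<forall>a\<in>A. \<forall>x\<in>X. \<forall>y\<in>Y. a (t x y) = t x (a y)) \<and> (\<forall>b\<in>B. \<forall>x\<in>X. \<forall>y\<in>Y. b (t x y) = t (b x) y) \<and>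
     (\<forall>\<tau> r. irred K1 \<tau> \<longrightarrow> fd \<tau> \<longrightarrow> \<tau> \<subseteq> Y \<longrightarrow> r \<in> \<tau> \<longrightarrow> r \<noteq> 0 \<longrightarrow> fd (hom_values K1 \<tau> Y r)) \<and>
     (\<forall>\<tau> r. irred K2 \<tau> \<longrightarrow> fd \<tau> \<longrightarrow> \<tau> \<subseteq> X \<longrightarrow> r \<in> \<tau> \<longrightarrow> r \<noteq> 0 \<longrightarrow> fd (hom_values K2 \<tau> X r))"
proof -
  have comK: "b (a m) = a (b m)" if "a \<in> K1" "b \<in> K2" "m \<in> M" for a b m
    using com that K1A K2B by blast
  obtain v0 where v0: "v0 \<in> M" "v0 \<noteq> 0" using irred_nonzero_element[OF irrM] by blast
  obtain V0 where V0: "stable (K1 \<union> K2) V0" "fd V0" "V0 \<subseteq> M" "v0 \<in> V0" using loc[OF v0(1)] by blast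
  have "V0 \<noteq> {0}" using V0(4) v0(2) by auto
  then obtain E where E: "irred (K1 \<union> K2) E" "E \<subseteq> V0" using irred_exists[OF V0(1,2)] by blast
  have EM: "E \<subseteq> M" and Efd: "fd E" using E V0 fd_subset by auto
  have stE: "stable K1 E" "stable K2 E" "subspace E"
    using irred_stable[OF E(1)] irred_subspace[OF E(1)] unfolding stable_Un by blast+
  obtain \<rho> where \<rho>: "irred K1 \<rho>" "\<rho> \<subseteq> E" using irred_exists[OF stE(1) Efd irred_nonzero[OF E(1)]] by blast
  have \<rho>fd: "fd \<rho>" using \<rho>(2) Efd fd_subset by blast
  note st\<rho> = irred_stable[OF \<rho>(1)] irred_subspace[OF \<rho>(1)]
  obtain r0 where r0: "r0 \<in> \<rho>" "r0 \<noteq> 0" using irred_nonzero_element[OF \<rho>(1)] by blast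
  note \<rho>ne = irred_nonzero[OF \<rho>(1)]
  \<comment> \<open>\<rho> is finite-dimensional, so it serves itself as the subspace that
    \<open>schur\<close> asks for; likewise \<sigma> below.\<close>
  interpret r: scalar_endo scale K1 \<rho> E r0
    by unfold_locales (use linK \<rho> r0 stE(3) in \<open>auto intro: schur[OF \<rho>(1) linK(1) \<rho>fd st\<rho>(2) \<rho>ne] equivariant_in\<close>)
  let ?\<sigma> = "hom_values K1 \<rho> E r0"
  have cE: "\<forall>p\<in>K1. \<forall>q\<in>K2. \<forall>m\<in>E. q (p m) = p (q m)" using comK EM by blast
  note rE = r.tensor_hom_values_ball[OF linK(2) cE E(1)]
  have \<sigma>E: "?\<sigma> \<subseteq> E" by (rule hom_values_subset[OF r0(1)])
  have \<sigma>fd: "fd ?\<sigma>" using \<sigma>E Efd fd_subset by blast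
  note st\<sigma> = irred_stable[OF rE(2)] irred_subspace[OF rE(2)]
  note \<sigma>ne = irred_nonzero[OF rE(2)]
  \<comment> \<open>\<open>r0\<close> also lies in \<sigma>, as the value of the inclusion of \<rho>
    in \<open>E\<close>; it is the base vector of both hom spaces.\<close>
  interpret s: scalar_endo scale K2 ?\<sigma> M r0
    by unfold_locales (use linK rE(2) r0 stM(5) \<sigma>E EM r.X(2) in
        \<open>auto intro: schur[OF rE(2) linK(2) \<sigma>fd st\<sigma>(2) \<sigma>ne] equivariant_in\<close>)
  let ?N = "hom_values K2 ?\<sigma> M r0"
  have A_N: "a m \<in> ?N" "w \<in> ?\<sigma> \<Longrightarrow> s.t (a m) w = a (s.t m w)" if "a \<in> A" "m \<in> ?N" for a m w
    using s.t_commute[of a m] that linA stable_app[OF stM(1)] com K2B by (metis subsetD)+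
  have NM: "?N \<subseteq> M" by (rule hom_values_subset[OF r.X(2)])
  have stN: "stable A ?N" using s.X(1) A_N(1) by (auto simp: stable_def)
  have NK1: "stable K1 ?N" using stN K1A stable_mono by blast
  let ?P = "hom_values K1 \<rho> ?N r0"
  \<comment> \<open>Currying: a map from \<rho> to \<open>Hom(\<sigma>, M)\<close> is a map from
    \<open>E = \<sigma> \<otimes> \<rho>\<close> to \<open>M\<close>. Its value at \<open>r0\<close>
    is the same vector, because \<open>r.t r0 r0 = r0\<close>.\<close>
  have "?P \<subseteq> hom_values (K1 \<union> K2) E M r0"
  proof
    fix p assume "p \<in> ?P"
    then obtain g where g: "equivariant K1 \<rho> ?N g" "p = g r0" by (auto simp: hom_values_def)
    note lg = equivariant_lin[OF g(1)]
    have gN: "g y \<in> ?N" if "y \<in> \<rho>" for y using equivariant_in[OF g(1) that] .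
    have "bilin (\<lambda>x y. s.t (g y) x) ?\<sigma> \<rho>"
      using s.t_bilin gN lin_add[OF lg] lin_scale[OF lg] st\<rho>(2) st\<sigma>(2) subspace_add subspace_scale
      by (auto simp: bilin_def)
    then obtain F where F: "lin F" "\<And>x y. x \<in> ?\<sigma> \<Longrightarrow> y \<in> \<rho> \<Longrightarrow> F (r.t x y) = s.t (g y) x"
      by (rule tensor_lift[OF rE(1)]) blast
    have Esp: "E = span {r.t x y | x y. x \<in> ?\<sigma> \<and> y \<in> \<rho>}" using rE(1) by (simp add: tensor_def)
    have "equivariant (K1 \<union> K2) E M F"
      unfolding equivariant_def
    proof (intro conjI ballI F(1))
      fix u assume "u \<in> E"
      then have u: "u \<in> span {r.t x y | x y. x \<in> ?\<sigma> \<and> y \<in> \<rho>}" using Esp by simp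
      show "F u \<in> M"
        by (rule span_image_subset[OF F(1) _ stM(5) u]) (use F(2) s.t(1) gN equivariant_in in force)
      fix k assume k: "k \<in> K1 \<union> K2"
      then have lk: "lin k" using linK(3) by blast
      show "F (k u) = k (F u)"
      proof (rule span_eq_on[OF lin_compose[OF F(1) lk] lin_compose[OF lk F(1)] _ u])
        fix z assume "z \<in> {r.t x y | x y. x \<in> ?\<sigma> \<and> y \<in> \<rho>}"
        then obtain x y where z: "z = r.t x y" "x \<in> ?\<sigma>" "y \<in> \<rho>" by blast
        show "F (k z) = k (F z)"
        proof (cases "k \<in> K1")
          case True
          have "k z = r.t x (k y)" using equivariant_app[OF r.t(1)[OF z(2)] True z(3)] z(1) by simp
          then have "F (k z) = s.t (g (k y)) x" using F(2)[OF z(2) stable_app[OF st\<rho>(1) True z(3)]] by simp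
          also have "\<dots> = s.t (k (g y)) x" using equivariant_app[OF g(1) True z(3)] by simp
          also have "\<dots> = k (s.t (g y) x)" using A_N(2)[OF _ gN[OF z(3)] z(2)] K1A True by auto
          finally show ?thesis using F(2)[OF z(2,3)] z(1) by simp
        next
          case False
          then have k2: "k \<in> K2" using k by blast
          have "k z = r.t (k x) y" using rE(3)[OF k2 z(2,3)] z(1) by simp
          then have "F (k z) = s.t (g y) (k x)" using F(2)[OF stable_app[OF st\<sigma>(1) k2 z(2)] z(3)] by simp
          also have "\<dots> = k (s.t (g y) x)" using equivariant_app[OF s.t(1)[OF gN[OF z(3)]] k2 z(2)] .
          finally show ?thesis using F(2)[OF z(2,3)] z(1) by simp
        qed
      qed
    qed
    moreover have "F r0 = p"
      using F(2)[OF r.X(2) r0(1)] r.t_base[OF r0(1)] s.t(2)[OF gN[OF r0(1)]] g(2) by simp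
    ultimately show "p \<in> hom_values (K1 \<union> K2) E M r0" by (auto simp: hom_values_def)
  qed
  moreover have "fd (hom_values (K1 \<union> K2) E M r0)"
    using mult[OF E(1) Efd EM] r0 \<rho>(2) by blast
  ultimately have Pfd: "fd ?P" using fd_subset by blast
  have r0N: "r0 \<in> ?N" by (rule s.X(2))
  define good where "good W \<longleftrightarrow> stable A W \<and> W \<subseteq> ?N \<and> W \<noteq> {0}" for W
  have "good ?N" using stN r0N r0(2) unfolding good_def by auto
  then have "\<exists>d W. good W \<and> dim (hom_values K1 \<rho> W r0) = d" by blast
  then obtain d where "\<exists>W. good W \<and> dim (hom_values K1 \<rho> W r0) = d"
    and dmin: "\<And>e. e < d \<Longrightarrow> \<not> (\<exists>W. good W \<and> dim (hom_values K1 \<rho> W r0) = e)"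
    using exists_least_iff[of "\<lambda>d. \<exists>W. good W \<and> dim (hom_values K1 \<rho> W r0) = d"] by blast
  then obtain W where W: "good W" "dim (hom_values K1 \<rho> W r0) = d" by blast
  have \<rho>M: "\<rho> \<subseteq> M" using \<rho>(2) EM by blast
  note has_type = submodule_contains_type[OF \<rho>(1) \<rho>fd \<rho>M r0]
  have sW: "subspace W" "stable A W" "W \<subseteq> M" using W(1) NM unfolding good_def stable_def by auto
  have shv: "subspace (hom_values K1 \<rho> U r0)" if "subspace U" for U by (rule subspace_hom_values[OF linK(1) that])
  have WN: "W \<noteq> {0}" "W \<subseteq> ?N" using W(1) by (simp_all add: good_def)
  have WP: "hom_values K1 \<rho> W r0 \<subseteq> ?P" by (rule hom_values_mono[OF WN(2)])
  obtain p where p: "p \<in> hom_values K1 \<rho> W r0" "p \<noteq> 0"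
    using subspace_nonzero[OF shv[OF sW(1)] has_type[OF sW(2,3) WN(1)]] by blast
  \<comment> \<open>Generated by one value \<open>p\<close> of a homomorphism from \<rho>. By
    minimality of \<open>d\<close> a nonzero submodule of \<open>Y\<close> has the same hom values
    as \<open>W\<close>, so it contains \<open>p\<close> and with it \<open>Y\<close>.\<close>
  define Y where "Y = \<Inter>{U. stable A U \<and> U \<subseteq> W \<and> p \<in> U}"
  have pW: "p \<in> W" using hom_values_subset[OF r0(1)] p(1) by blast
  have YW: "Y \<subseteq> W" using sW(2) pW unfolding Y_def by blast
  have pY: "p \<in> Y" unfolding Y_def by blast
  have stY: "stable A Y"
    unfolding stable_def
  proof (intro conjI ballI)
    show "subspace Y" unfolding Y_def by (rule subspace_Inter) (simp add: stable_def)
    fix a y assume "a \<in> A" "y \<in> Y"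
    then show "a y \<in> Y" unfolding Y_def stable_def by blast
  qed
  have irrY: "irred A Y"
    unfolding irred_def
  proof (intro conjI allI impI stY)
    show "Y \<noteq> {0}" using pY p(2) by auto
    fix U assume U: "stable A U \<and> U \<subseteq> Y"
    show "U = {0} \<or> U = Y"
    proof (rule ccontr)
      assume n: "\<not> (U = {0} \<or> U = Y)"
      then have "U \<subseteq> ?N" using U YW WN(2) by blast
      then have g: "good U" using U n unfolding good_def by blast
      have UW: "hom_values K1 \<rho> U r0 \<subseteq> hom_values K1 \<rho> W r0" using U YW by (intro hom_values_mono) blast
      have "hom_values K1 \<rho> U r0 = hom_values K1 \<rho> W r0"
      proof (rule ccontr)
        assume "hom_values K1 \<rho> U r0 \<noteq> hom_values K1 \<rho> W r0"
        then have "dim (hom_values K1 \<rho> U r0) < d"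
          unfolding W(2)[symmetric] using dim_strict_mono[OF fd_subset[OF Pfd WP] shv shv[OF sW(1)] UW] U
          by (simp add: stable_def)
        then show False using dmin g by blast
      qed
      then have "p \<in> U" using p(1) hom_values_subset[OF r0(1)] by blast
      then have "Y \<subseteq> U" using U YW unfolding Y_def by blast
      then show False using n U by blast
    qed
  qed
  have YM: "Y \<subseteq> M" using YW sW(3) by blast
  have sY: "subspace Y" using stY stable_subspace by blast
  let ?D = "hom_values K1 \<rho> Y r0"
  have DP: "?D \<subseteq> ?P" using YW WN(2) by (intro hom_values_mono) blast
  have DY: "?D \<subseteq> Y" by (rule hom_values_subset[OF r0(1)])
  have Dne: "?D \<noteq> {0}" using has_type[OF stY YM irred_nonzero[OF irrY]] .
  \<comment> \<open>Composition with \<open>f\<close> turns homomorphisms from \<rho> into such, so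
    every endomorphism of \<open>Y\<close> preserves the space of their values; this is the
    finite-dimensional subspace for \<open>schur\<close>.\<close>
  have Dinv: "f x \<in> ?D" if f: "equivariant A Y Y f" and x: "x \<in> ?D" for f x
  proof -
    obtain g where g: "equivariant K1 \<rho> Y g" "x = g r0" using x by (auto simp: hom_values_def)
    have "equivariant K1 \<rho> Y (\<lambda>x. f (g x))"
      using equivariant_compose[OF g(1) equivariant_lin[OF f]] equivariant_in[OF f] equivariant_app[OF f] K1A by blast
    then show ?thesis using g(2) by (auto simp: hom_values_def)
  qed
  have endo: "\<exists>c. \<forall>w\<in>Y. f w = c *\<^sub>C w" if f: "equivariant A Y Y f" for f
    by (rule schur[OF irrY linA fd_subset[OF Pfd DP] shv[OF sY] Dne DY _ f]) (rule Dinv)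
  interpret y: scalar_endo scale A Y M p
    by unfold_locales (fact linA irrY stM(5) YM pY p(2) endo)+
  have cM: "\<forall>p\<in>A. \<forall>q\<in>B. \<forall>m\<in>M. q (p m) = p (q m)" using com by blast
  note fin = y.tensor_hom_values_ball[OF linB cM irrM]
  let ?X = "hom_values A Y M p"
  have XM: "?X \<subseteq> M" by (rule hom_values_subset[OF pY])
  have tA: "a (y.t x z) = y.t x (a z)" if "a \<in> A" "x \<in> ?X" "z \<in> Y" for a x z
    using equivariant_app[OF y.t(1)[OF that(2)] that(1,3)] by simp
  \<comment> \<open>To bound multiplicities in one factor, a finite-dimensional stable subspace of
    the other one is needed as a companion.\<close>
  have locU: "\<exists>V. stable K V \<and> fd V \<and> V \<noteq> {0} \<and> V \<subseteq> U"
    if U: "stable K U" "U \<subseteq> M" "U \<noteq> {0}" "K \<subseteq> K1 \<union> K2" for K U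
  proof -
    obtain u where u: "u \<in> U" "u \<noteq> 0" using subspace_nonzero[OF stable_subspace[OF U(1)] U(3)] by blast
    obtain V where V: "stable (K1 \<union> K2) V" "fd V" "V \<subseteq> M" "u \<in> V" using loc u(1) U(2) by blast
    have "stable K (V \<inter> U)" by (rule stable_Int[OF stable_mono[OF V(1) U(4)] U(1)])
    then show ?thesis using fd_subset[OF V(2), of "V \<inter> U"] V(4) u by blast
  qed
  have stX: "stable K2 ?X" "?X \<noteq> {0}" using stable_mono[OF irred_stable[OF fin(2)] K2B] irred_nonzero[OF fin(2)] by blast+
  have stY1: "stable K1 Y" "Y \<noteq> {0}" using stable_mono[OF stY K1A] irred_nonzero[OF irrY] by blast+
  obtain V2 where V2: "stable K2 V2" "fd V2" "V2 \<noteq> {0}" "V2 \<subseteq> ?X"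
    using locU[OF stX(1) XM stX(2)] by blast
  obtain V1 where V1: "stable K1 V1" "fd V1" "V1 \<noteq> {0}" "V1 \<subseteq> Y"
    using locU[OF stY1(1) YM stY1(2)] by blast
  have "fd (hom_values K1 \<tau> Y r)" if "irred K1 \<tau>" "fd \<tau>" "\<tau> \<subseteq> Y" "r \<in> \<tau>" "r \<noteq> 0" for \<tau> r
    by (rule fd_hom_values_factor[OF fin(1) linK(1,2) tA fin(3) V2 that mult]) (use K1A K2B in auto)
  \<comment> \<open>The factors exchange roles: \<open>tensor_swap\<close> transposes
    \<open>t\<close>, and \<open>mult\<close> is read with \<open>K2 \<union> K1\<close>.\<close>
  moreover have "fd (hom_values K2 \<tau> ?X r)" if "irred K2 \<tau>" "fd \<tau>" "\<tau> \<subseteq> ?X" "r \<in> \<tau>" "r \<noteq> 0" for \<tau> r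
    by (rule fd_hom_values_factor[OF tensor_swap[OF fin(1)] linK(2,1) fin(3) tA V1 that mult[unfolded Un_commute[of K1]]])
      (use K1A K2B in auto)
  ultimately show ?thesis
    using fin irrY XM YM tA by (intro exI[of _ y.t] exI[of _ ?X] exI[of _ Y]) simp
qed

end

section \<open>Smooth functions on Lie groups\<close>

text \<open>The topology is that of an infinite product, where a basic open set restricts each
  coordinate to an open set. The coordinates from \<open>n\<close> on are zero and satisfy their
  restrictions by themselves, so a cube in the first \<open>n\<close> coordinates remains.\<close>

lemma Euclidean_space_box:
  assumes "openin (Euclidean_space n) U" "x \<in> U"
  shows "\<exists>d>0. \<forall>y. (\<forall>i\<ge>n. y i = 0) \<longrightarrow> (\<forall>i<n. \<bar>y i - x i\<bar> < d) \<longrightarrow> y \<in> U"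
proof -
  obtain T where T: "openin (powertop_real UNIV) T" "U = T \<inter> {y. \<forall>i\<ge>n. y i = 0}"
    using assms(1) unfolding Euclidean_space_def openin_subtopology by auto
  obtain B where B: "finite {i. B i \<noteq> UNIV}" "\<And>i. open (B i)" "x \<in> Pi\<^sub>E UNIV B" "Pi\<^sub>E UNIV B \<subseteq> T"
    using T assms(2) unfolding openin_product_topology_alt by fastforce
  have "\<exists>d>0. \<forall>y. \<bar>y - x i\<bar> < d \<longrightarrow> y \<in> B i" for i
    using B(2)[of i] B(3) unfolding open_dist by (auto simp: dist_real_def PiE_iff)
  then obtain d where d: "\<And>i. d i > 0" "\<And>i y. \<bar>y - x i\<bar> < d i \<Longrightarrow> y \<in> B i" by metis
  \<comment> \<open>The element \<open>1\<close> keeps the minimum meaningful for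
    \<open>n = 0\<close>.\<close>
  define e where "e = Min (insert 1 (d ` {..<n}))"
  have e: "e > 0" "\<And>i. i < n \<Longrightarrow> e \<le> d i" using d(1) by (auto simp: e_def)
  have "y \<in> U" if y: "\<forall>i\<ge>n. y i = 0" "\<forall>i<n. \<bar>y i - x i\<bar> < e" for y
  proof -
    have "y i \<in> B i" for i
    proof (cases "i < n")
      case True
      then show ?thesis using y(2) e(2)[of i] by (intro d(2)) force
    next
      case False
      then have "y i = x i" using y(1) assms(2) T(2) by auto
      then show ?thesis using d(1)[of i] d(2)[of "x i" i] by simp
    qed
    then show ?thesis using B(4) y(1) T(2) by blast
  qed
  then show ?thesis using e(1) by blast
qed

lemma continuous_map_box:
  assumes U: "openin (Euclidean_space n) U" and x: "x \<in> U"
    and f: "continuous_map (subtopology (Euclidean_space n) U) euclideanreal f" and e: "e > 0"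
  shows "\<exists>d>0. \<forall>y. (\<forall>i\<ge>n. y i = 0) \<longrightarrow> (\<forall>i<n. \<bar>y i - x i\<bar> < d) \<longrightarrow> y \<in> U \<and> \<bar>f y - f x\<bar> < e"
proof -
  let ?S = "{y \<in> topspace (subtopology (Euclidean_space n) U). f y \<in> ball (f x) e}"
  have "openin (subtopology (Euclidean_space n) U) ?S"
    using f unfolding continuous_map by (auto intro: openin_continuous_map_preimage[OF f])
  then have "openin (Euclidean_space n) ?S" using U by (rule openin_trans_full)
  moreover have "x \<in> ?S" using x openin_subset[OF U] e by auto
  ultimately have "\<exists>d>0. \<forall>y. (\<forall>i\<ge>n. y i = 0) \<longrightarrow> (\<forall>i<n. \<bar>y i - x i\<bar> < d) \<longrightarrow> y \<in> ?S"
    by (rule Euclidean_space_box)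
  moreover have "y \<in> U \<and> \<bar>f y - f x\<bar> < e" if "y \<in> ?S" for y
    using that by (auto simp: dist_real_def abs_minus_commute)
  ultimately show ?thesis by meson
qed

lemma in_Euclidean_space_upd:
  assumes "openin (Euclidean_space n) U" "x \<in> U" "i < n"
  shows "\<forall>\<^sub>F t in nhds (x i). x(i := t) \<in> U"
proof -
  obtain d where d: "d > 0" "\<And>y. \<forall>i\<ge>n. y i = 0 \<Longrightarrow> \<forall>i<n. \<bar>y i - x i\<bar> < d \<Longrightarrow> y \<in> U"
    using Euclidean_space_box[OF assms(1,2)] by blast
  have x0: "\<forall>i\<ge>n. x i = 0"
    using assms(2) openin_subset[OF assms(1)] by (auto simp: topspace_Euclidean_space)
  have "x(i := t) \<in> U" if "dist t (x i) < d" for t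
    using that x0 assms(3) d(1) by (intro d(2)) (auto simp: dist_real_def)
  then show ?thesis unfolding eventually_nhds_metric using d(1) by blast
qed

text \<open>A line through a point of \<open>U\<close> may leave \<open>U\<close>, so
  \<open>f\<close> and \<open>g\<close> agree along it only near that point. Openness of
  \<open>U\<close> makes this enough for the partial derivatives.\<close>

lemma C_on_cong:
  assumes "openin (Euclidean_space n) U" "\<And>x. x \<in> U \<Longrightarrow> f x = g x" "C_on n k U f"
  shows "C_on n k U g"
proof (cases k)
  case 0
  then show ?thesis using assms(2,3) by (auto intro: continuous_map_eq)
next
  case (Suc l)
  have cont: "continuous_map (subtopology (Euclidean_space n) U) euclideanreal g"
    using assms(2,3) Suc by (auto intro: continuous_map_eq)
  have "((\<lambda>t. g (x(i := t))) has_real_derivative D) (at (x i))"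
    if "((\<lambda>t. f (x(i := t))) has_real_derivative D) (at (x i))" "i < n" "x \<in> U" for x i D
  proof -
    have "\<forall>\<^sub>F t in nhds (x i). f (x(i := t)) = g (x(i := t))"
      using in_Euclidean_space_upd[OF assms(1) that(3,2)] by eventually_elim (rule assms(2))
    from DERIV_cong_ev[OF refl this refl, of D] show ?thesis using that(1) by simp
  qed
  then show ?thesis using assms(3) cont unfolding Suc C_on.simps by metis
qed

lemma C_on_continuous: "C_on n k U f \<Longrightarrow> continuous_map (subtopology (Euclidean_space n) U) euclideanreal f"
  by (cases k) auto

lemma C_on_Suc_imp: "C_on n (Suc k) U f \<Longrightarrow> C_on n k U f"
proof (induction k arbitrary: f)
  case (Suc k)
  then show ?case by (subst C_on.simps) (metis C_on.simps(2))
qed simp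

text \<open>The partial derivatives supplied on the small sets have to be glued. The derivative at a
  point is unique, so they all agree with one function on \<open>U\<close>, to which the induction
  hypothesis applies.\<close>

lemma C_on_local:
  assumes "openin (Euclidean_space n) U"
    and "\<And>x. x \<in> U \<Longrightarrow> \<exists>V. openin (Euclidean_space n) V \<and> x \<in> V \<and> V \<subseteq> U \<and> C_on n k V f"
  shows "C_on n k U f"
proof -
  have cont: "continuous_map (subtopology (Euclidean_space n) U) euclideanreal f"
    if loc: "\<And>x. x \<in> U \<Longrightarrow> \<exists>V. openin (Euclidean_space n) V \<and> x \<in> V \<and> V \<subseteq> U \<and> C_on n k V f" for k f
    unfolding continuous_map_def
  proof (intro conjI allI impI)
    fix S :: "real set" assume S: "openin euclideanreal S"
    let ?P = "\<lambda>W. {x \<in> topspace (subtopology (Euclidean_space n) W). f x \<in> S}"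
    have "openin (Euclidean_space n) (?P U)"
      unfolding openin_subopen[of _ "?P U"]
    proof
      fix x assume "x \<in> ?P U"
      then have x: "x \<in> U" "f x \<in> S" by auto
      obtain V where V: "openin (Euclidean_space n) V" "x \<in> V" "V \<subseteq> U" "C_on n k V f" using loc[OF x(1)] by blast
      have "openin (subtopology (Euclidean_space n) V) (?P V)"
        by (rule openin_continuous_map_preimage[OF C_on_continuous[OF V(4)] S])
      then have "openin (Euclidean_space n) (?P V)" using V(1) by (rule openin_trans_full)
      moreover have "x \<in> ?P V" using x V(2) openin_subset[OF V(1)] by auto
      moreover have "?P V \<subseteq> ?P U" using V(3) by auto
      ultimately show "\<exists>T. openin (Euclidean_space n) T \<and> x \<in> T \<and> T \<subseteq> ?P U" by blast
    qed
    then show "openin (subtopology (Euclidean_space n) U) (?P U)"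
      by (auto simp: openin_open_subtopology[OF assms(1)])
  qed auto
  show ?thesis using assms(2)
  proof (induction k arbitrary: f)
    case 0
    then show ?case using cont[of 0 f] by auto
  next
    case (Suc k)
    show ?case unfolding C_on.simps
    proof (intro conjI allI impI)
      show "continuous_map (subtopology (Euclidean_space n) U) euclideanreal f" by (rule cont[OF Suc.prems])
      fix i assume i: "i < n"
      \<comment> \<open>A choice independent of the neighbourhood; \<open>uniq\<close> identifies it
        with each local derivative.\<close>
      define f' where "f' x = (SOME D. ((\<lambda>t. f (x(i := t))) has_real_derivative D) (at (x i)))" for x
      have uniq: "f' x = D" if "((\<lambda>t. f (x(i := t))) has_real_derivative D) (at (x i))" for x D
        unfolding f'_def using that by (rule some_equality) (rule DERIV_unique[OF _ that])
      have "\<exists>V. openin (Euclidean_space n) V \<and> x \<in> V \<and> V \<subseteq> U \<and> C_on n k V f' \<and>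
        ((\<lambda>t. f (x(i := t))) has_real_derivative f' x) (at (x i))" if xU: "x \<in> U" for x
      proof -
        obtain V where V: "openin (Euclidean_space n) V" "x \<in> V" "V \<subseteq> U" "C_on n (Suc k) V f" using Suc.prems[OF xU] by blast
        then obtain h where h: "\<forall>x\<in>V. ((\<lambda>t. f (x(i := t))) has_real_derivative h x) (at (x i))" "C_on n k V h"
          using i unfolding C_on.simps by blast
        have eq: "h y = f' y" if "y \<in> V" for y using h(1) uniq that by metis
        show ?thesis using V C_on_cong[OF V(1) eq h(2)] h(1) eq by metis
      qed
      then show "\<exists>f'. (\<forall>x\<in>U. ((\<lambda>t. f (x(i := t))) has_real_derivative f' x) (at (x i))) \<and> C_on n k U f'"
        using Suc.IH[of f'] by blast
    qed
  qed
qed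

lemma C_on_const: "C_on n k U (\<lambda>x. c)"
proof (induction k arbitrary: c)
  case (Suc k)
  then show ?case by (auto intro!: exI[of _ "\<lambda>x. 0"])
qed simp

lemma C_on_add: "C_on n k U f \<Longrightarrow> C_on n k U g \<Longrightarrow> C_on n k U (\<lambda>x. f x + g x)"
proof (induction k arbitrary: f g)
  case 0
  then show ?case by (auto intro: continuous_map_add)
next
  case (Suc k)
  show ?case unfolding C_on.simps
  proof (intro conjI allI impI)
    show "continuous_map (subtopology (Euclidean_space n) U) euclideanreal (\<lambda>x. f x + g x)"
      using Suc.prems by (auto intro: continuous_map_add)
    fix i assume i: "i < n"
    obtain f' where f': "\<forall>x\<in>U. ((\<lambda>t. f (x(i := t))) has_real_derivative f' x) (at (x i))" "C_on n k U f'"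
      using Suc.prems(1) i unfolding C_on.simps by blast
    obtain g' where g': "\<forall>x\<in>U. ((\<lambda>t. g (x(i := t))) has_real_derivative g' x) (at (x i))" "C_on n k U g'"
      using Suc.prems(2) i unfolding C_on.simps by blast
    show "\<exists>h. (\<forall>x\<in>U. ((\<lambda>t. f (x(i := t)) + g (x(i := t))) has_real_derivative h x) (at (x i))) \<and> C_on n k U h"
      using f' g' Suc.IH by (intro exI[of _ "\<lambda>x. f' x + g' x"]) (auto intro: DERIV_add)
  qed
qed

lemma C_on_mult: "C_on n k U f \<Longrightarrow> C_on n k U g \<Longrightarrow> C_on n k U (\<lambda>x. f x * g x)"
proof (induction k arbitrary: f g)
  case 0
  then show ?case by (auto intro: continuous_map_real_mult)
next
  case (Suc k)
  show ?case unfolding C_on.simps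
  proof (intro conjI allI impI)
    show "continuous_map (subtopology (Euclidean_space n) U) euclideanreal (\<lambda>x. f x * g x)"
      using Suc.prems by (auto intro: continuous_map_real_mult)
    fix i assume i: "i < n"
    obtain f' where f': "\<forall>x\<in>U. ((\<lambda>t. f (x(i := t))) has_real_derivative f' x) (at (x i))" "C_on n k U f'"
      using Suc.prems(1) i unfolding C_on.simps by blast
    obtain g' where g': "\<forall>x\<in>U. ((\<lambda>t. g (x(i := t))) has_real_derivative g' x) (at (x i))" "C_on n k U g'"
      using Suc.prems(2) i unfolding C_on.simps by blast
    have D: "((\<lambda>t. f (x(i := t)) * g (x(i := t))) has_real_derivative (f' x * g x + g' x * f x)) (at (x i))" if "x \<in> U" for x
      using DERIV_mult[OF f'(1)[rule_format, OF that] g'(1)[rule_format, OF that]] by simp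
    have E: "C_on n k U (\<lambda>x. f' x * g x + g' x * f x)"
      using f'(2) g'(2) C_on_Suc_imp[OF Suc.prems(1)] C_on_Suc_imp[OF Suc.prems(2)] by (intro C_on_add Suc.IH)
    show "\<exists>h. (\<forall>x\<in>U. ((\<lambda>t. f (x(i := t)) * g (x(i := t))) has_real_derivative h x) (at (x i))) \<and> C_on n k U h"
      by (rule exI[of _ "\<lambda>x. f' x * g x + g' x * f x"], intro conjI ballI D E)
  qed
qed

lemma C_on_sum: "(\<And>j. j \<in> J \<Longrightarrow> C_on n k U (f j)) \<Longrightarrow> C_on n k U (\<lambda>x. \<Sum>j\<in>J. f j x)"
  by (induction J rule: infinite_finite_induct) (auto intro: C_on_const C_on_add)

text \<open>The increment of \<open>h\<close> is telescoped over the coordinates; each term is treated by the mean value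
  theorem and the continuity of the partial derivatives.\<close>

lemma chain_rule_partials:
  fixes y :: "real \<Rightarrow> nat \<Rightarrow> real"
  assumes V: "openin (Euclidean_space m) V"
    and h: "\<And>j z. j < m \<Longrightarrow> z \<in> V \<Longrightarrow> ((\<lambda>t. h (z(j := t))) has_real_derivative h' j z) (at (z j))"
    and h': "\<And>j. j < m \<Longrightarrow> continuous_map (subtopology (Euclidean_space m) V) euclideanreal (h' j)"
    and y0: "y t0 \<in> V" and yz: "\<And>t j. j \<ge> m \<Longrightarrow> y t j = 0"
    and dy: "\<And>j. j < m \<Longrightarrow> ((\<lambda>t. y t j) has_real_derivative d j) (at t0)"
  shows "((\<lambda>t. h (y t)) has_real_derivative (\<Sum>j<m. h' j (y t0) * d j)) (at t0)"
proof -
  \<comment> \<open>The first \<open>p\<close> coordinates have moved from \<open>y t0\<close> to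
    \<open>y t\<close>, so consecutive points differ in one coordinate.\<close>
  define z where "z p t j = (if j < p then y t j else y t0 j)" for p t and j :: nat
  have step: "((\<lambda>t. h (z (Suc p) t) - h (z p t)) has_real_derivative (h' p (y t0) * d p)) (at t0)" if p: "p < m" for p
  proof -
    define \<phi> where "\<phi> t = h (z (Suc p) t) - h (z p t)" for t
    \<comment> \<open>The difference quotient in coordinate \<open>p\<close>, with the partial
      derivative as its value where this coordinate has not moved; so \<phi> is \<theta> times the
      increment in every case.\<close>
    define \<theta> where "\<theta> t = (if y t p = y t0 p then h' p (y t0) else \<phi> t / (y t p - y t0 p))" for t
    have zS: "z (Suc p) t = (z p t)(p := y t p)" and z0: "z p t = (z p t)(p := y t0 p)" for t
      by (auto simp: z_def fun_eq_iff)
    have \<phi>\<theta>: "\<phi> t = \<theta> t * (y t p - y t0 p)" for t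
    proof (cases "y t p = y t0 p")
      case True
      then have "z (Suc p) t = z p t" using zS[of t] z0[of t] by simp
      then show ?thesis using True by (simp add: \<phi>_def)
    qed (simp add: \<theta>_def)
    have lim: "(\<theta> \<longlongrightarrow> h' p (y t0)) (at t0)"
    proof (rule tendstoI)
      fix e :: real assume e: "e > 0"
      obtain b where b: "b > 0" "\<And>w. \<forall>i\<ge>m. w i = 0 \<Longrightarrow> \<forall>i<m. \<bar>w i - y t0 i\<bar> < b \<Longrightarrow> w \<in> V \<and> \<bar>h' p w - h' p (y t0)\<bar> < e"
        using continuous_map_box[OF V y0 h'[OF p] e] by blast
      have "\<forall>\<^sub>F t in at t0. \<forall>j\<in>{..<m}. \<bar>y t j - y t0 j\<bar> < b"
      proof (rule eventually_ball_finite)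
        show "\<forall>j\<in>{..<m}. \<forall>\<^sub>F t in at t0. \<bar>y t j - y t0 j\<bar> < b"
        proof
          fix j assume "j \<in> {..<m}"
          then have "((\<lambda>t. y t j) \<longlongrightarrow> y t0 j) (at t0)" using DERIV_isCont[OF dy] by (auto simp: isCont_def)
          from tendstoD[OF this b(1)] show "\<forall>\<^sub>F t in at t0. \<bar>y t j - y t0 j\<bar> < b" by (simp add: dist_real_def)
        qed
      qed simp
      then show "\<forall>\<^sub>F t in at t0. dist (\<theta> t) (h' p (y t0)) < e"
      proof eventually_elim
        case (elim t)
        \<comment> \<open>The line between the two points in coordinate \<open>p\<close>; the
          intermediate point of the mean value theorem stays in the box, where \<open>h' p\<close>
          is within \<open>e\<close> of its value at \<open>y t0\<close>.\<close>
        define F where "F s = h ((z p t)(p := s))" for s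
        have box: "(z p t)(p := s) \<in> V \<and> \<bar>h' p ((z p t)(p := s)) - h' p (y t0)\<bar> < e"
          if "\<bar>s - y t0 p\<bar> < b" for s
          using that p yz b(1) elim by (intro b(2)) (auto simp: z_def)
        have F: "(F has_real_derivative h' p ((z p t)(p := s))) (at s)" if "\<bar>s - y t0 p\<bar> < b" for s
          using h[OF p, of "(z p t)(p := s)"] box[OF that] by (simp add: F_def[abs_def])
        have yb: "\<bar>y t p - y t0 p\<bar> < b" using elim p by auto
        have \<phi>F: "\<phi> t = F (y t p) - F (y t0 p)" unfolding \<phi>_def F_def using zS[of t] z0[of t] by simp
        show ?case
        proof (cases "y t p" "y t0 p" rule: linorder_cases)
          case less
          have "\<exists>s. y t p < s \<and> s < y t0 p \<and> F (y t0 p) - F (y t p) = (y t0 p - y t p) * h' p ((z p t)(p := s))"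
            by (rule MVT2[OF less F]) (use yb in linarith)
          then obtain s where s: "y t p < s" "s < y t0 p" "F (y t0 p) - F (y t p) = (y t0 p - y t p) * h' p ((z p t)(p := s))"
            by blast
          have "\<theta> t = h' p ((z p t)(p := s))" unfolding \<theta>_def \<phi>F using s less by (simp add: field_simps)
          moreover have "\<bar>s - y t0 p\<bar> < b" using s yb by auto
          ultimately show ?thesis using box by (simp add: dist_real_def)
        next
          case equal
          then show ?thesis using e by (simp add: \<theta>_def)
        next
          case greater
          have "\<exists>s. y t0 p < s \<and> s < y t p \<and> F (y t p) - F (y t0 p) = (y t p - y t0 p) * h' p ((z p t)(p := s))"
            by (rule MVT2[OF greater F]) (use yb in linarith)
          then obtain s where s: "y t0 p < s" "s < y t p" "F (y t p) - F (y t0 p) = (y t p - y t0 p) * h' p ((z p t)(p := s))"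
            by blast
          have "\<theta> t = h' p ((z p t)(p := s))" unfolding \<theta>_def \<phi>F using s greater by (simp add: field_simps)
          moreover have "\<bar>s - y t0 p\<bar> < b" using s yb by auto
          ultimately show ?thesis using box by (simp add: dist_real_def)
        qed
      qed
    qed
    have "((\<lambda>t. \<theta> t * ((y t p - y t0 p) / (t - t0))) \<longlongrightarrow> h' p (y t0) * d p) (at t0)"
      using dy[OF p] by (intro tendsto_mult lim) (simp add: has_field_derivative_iff)
    moreover have "\<phi> t0 = 0" using \<phi>\<theta>[of t0] by simp
    ultimately have "(\<phi> has_real_derivative (h' p (y t0) * d p)) (at t0)"
      unfolding has_field_derivative_iff using \<phi>\<theta> by simp
    then show ?thesis by (simp add: \<phi>_def[abs_def])
  qed
  have tel: "h (y t) = h (y t0) + (\<Sum>p<m. h (z (Suc p) t) - h (z p t))" for t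
  proof -
    have "z m t = y t" "z 0 t = y t0" using yz by (auto simp: z_def fun_eq_iff)
    then show ?thesis using sum_lessThan_telescope[of "\<lambda>p. h (z p t)" m] by simp
  qed
  have "((\<lambda>t. h (y t0) + (\<Sum>p<m. h (z (Suc p) t) - h (z p t))) has_real_derivative 0 + (\<Sum>j<m. h' j (y t0) * d j)) (at t0)"
    using step by (intro DERIV_add DERIV_const DERIV_sum) auto
  moreover have "(\<lambda>t. h (y t)) = (\<lambda>t. h (y t0) + (\<Sum>p<m. h (z (Suc p) t) - h (z p t)))"
    using tel by (rule ext)
  ultimately show ?thesis by simp
qed

lemma continuous_map_coordinates:
  assumes "\<And>j. j < m \<Longrightarrow> continuous_map X euclideanreal (g j)"
  shows "continuous_map X (Euclidean_space m) (\<lambda>x j. if j < m then g j x else 0)"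
  unfolding Euclidean_space_def continuous_map_in_subtopology continuous_map_componentwise_UNIV
  using assms by auto

text \<open>By the chain rule a partial derivative of the composite is a sum of products of
  \<open>h' j\<close> after the inner map with \<open>g' j\<close>. The induction hypothesis holds
  for all outer functions, hence for the \<open>h' j\<close>. The value \<open>0\<close> from index
  \<open>m\<close> on places the inner map in \<open>Euclidean_space m\<close>.\<close>

lemma C_on_compose:
  assumes V: "openin (Euclidean_space m) V" and h: "C_on m k V h" and g: "\<And>j. j < m \<Longrightarrow> C_on n k U (g j)"
    and im: "\<And>x. x \<in> U \<Longrightarrow> (\<lambda>j. if j < m then g j x else 0) \<in> V"
  shows "C_on n k U (\<lambda>x. h (\<lambda>j. if j < m then g j x else 0))"
  using h g
proof (induction k arbitrary: h)
  case (0 h)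
  have "continuous_map (subtopology (Euclidean_space n) U) (subtopology (Euclidean_space m) V) (\<lambda>x j. if j < m then g j x else 0)"
    unfolding continuous_map_in_subtopology using C_on_continuous[OF 0(2)] im by (auto intro!: continuous_map_coordinates)
  then show ?case using continuous_map_compose[OF _ C_on_continuous[OF 0(1)]] by (simp add: o_def)
next
  case (Suc k h)
  let ?G = "\<lambda>x j. if j < m then g j x else 0"
  have "continuous_map (subtopology (Euclidean_space n) U) (subtopology (Euclidean_space m) V) ?G"
    unfolding continuous_map_in_subtopology using C_on_continuous[OF Suc.prems(2)] im by (auto intro!: continuous_map_coordinates)
  then have cont: "continuous_map (subtopology (Euclidean_space n) U) euclideanreal (\<lambda>x. h (?G x))"
    using continuous_map_compose[OF _ C_on_continuous[OF Suc.prems(1)]] by (simp add: o_def)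
  have "\<exists>h'. (\<forall>z\<in>V. ((\<lambda>t. h (z(j := t))) has_real_derivative h' z) (at (z j))) \<and> C_on m k V h'" if "j < m" for j
    using Suc.prems(1) that unfolding C_on.simps by blast
  then obtain h' where h'_all: "\<And>j. j < m \<Longrightarrow>
      (\<forall>z\<in>V. ((\<lambda>t. h (z(j := t))) has_real_derivative h' j z) (at (z j))) \<and> C_on m k V (h' j)"
    by metis
  have h': "((\<lambda>t. h (z(j := t))) has_real_derivative h' j z) (at (z j))" if "j < m" "z \<in> V" for j z
    using h'_all[OF that(1)] that(2) by blast
  have h'2: "C_on m k V (h' j)" if "j < m" for j using h'_all[OF that] by blast
  show ?case unfolding C_on.simps
  proof (intro conjI cont allI impI)
    fix i assume i: "i < n"
    have "\<exists>g'. (\<forall>x\<in>U. ((\<lambda>t. g j (x(i := t))) has_real_derivative g' x) (at (x i))) \<and> C_on n k U g'" if "j < m" for j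
      using Suc.prems(2)[OF that] i unfolding C_on.simps by blast
    then obtain g' where g'_all: "\<And>j. j < m \<Longrightarrow>
        (\<forall>x\<in>U. ((\<lambda>t. g j (x(i := t))) has_real_derivative g' j x) (at (x i))) \<and> C_on n k U (g' j)"
      by metis
    have g': "((\<lambda>t. g j (x(i := t))) has_real_derivative g' j x) (at (x i))" if "j < m" "x \<in> U" for j x
      using g'_all[OF that(1)] that(2) by blast
    have g'2: "C_on n k U (g' j)" if "j < m" for j using g'_all[OF that] by blast
    have D: "((\<lambda>t. h (?G (x(i := t)))) has_real_derivative (\<Sum>j<m. h' j (?G x) * g' j x)) (at (x i))" if x: "x \<in> U" for x
    proof -
      have "((\<lambda>t. h (?G (x(i := t)))) has_real_derivative (\<Sum>j<m. h' j (?G (x(i := x i))) * g' j x)) (at (x i))"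
      proof (rule chain_rule_partials[OF V h' C_on_continuous[OF h'2]])
        show "?G (x(i := x i)) \<in> V" unfolding fun_upd_triv by (rule im[OF x])
        show "((\<lambda>t. ?G (x(i := t)) j) has_real_derivative g' j x) (at (x i))" if j: "j < m" for j
          using g'[OF j x] j by simp
      qed auto
      then show ?thesis unfolding fun_upd_triv .
    qed
    have E: "C_on n k U (\<lambda>x. \<Sum>j<m. h' j (?G x) * g' j x)"
      using g'2 C_on_Suc_imp[OF Suc.prems(2)] by (intro C_on_sum C_on_mult Suc.IH h'2) auto
    show "\<exists>f'. (\<forall>x\<in>U. ((\<lambda>t. h (?G (x(i := t)))) has_real_derivative f' x) (at (x i))) \<and> C_on n k U f'"
      by (rule exI[of _ "\<lambda>x. \<Sum>j<m. h' j (?G x) * g' j x"], intro conjI ballI D E)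
  qed
qed

text \<open>A change of coordinate \<open>j\<close> changes only coordinate \<open>e j\<close> of
  \<open>P\<close>, so a partial derivative of the composite is the one of \<open>F\<close> in
  direction \<open>e j\<close>, again composed with \<open>P\<close>. In product charts the map
  \<open>x \<mapsto> (g, x)\<close> has this shape.\<close>

lemma C_on_reparametrize:
  assumes "C_on N k W F" and "\<And>x. x \<in> S \<Longrightarrow> P x \<in> W"
    and "continuous_map (subtopology (Euclidean_space m) S) (Euclidean_space N) P"
    and "\<And>j. j < m \<Longrightarrow> e j < N" and "\<And>j x t. j < m \<Longrightarrow> P (x(j := t)) = (P x)(e j := t)"
    and "\<And>j x. j < m \<Longrightarrow> P x (e j) = x j"
  shows "C_on m k S (\<lambda>x. F (P x))"
  using assms(1)
proof (induction k arbitrary: F)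
  have cont: "continuous_map (subtopology (Euclidean_space m) S) euclideanreal (\<lambda>x. F (P x))" if "C_on N k W F" for k F
  proof -
    have "continuous_map (subtopology (Euclidean_space m) S) (subtopology (Euclidean_space N) W) P"
      unfolding continuous_map_in_subtopology using assms(2,3) by auto
    from continuous_map_compose[OF this C_on_continuous[OF that]] show ?thesis by (simp add: o_def)
  qed
  case 0
  then show ?case using cont[OF 0] by simp
next
  case (Suc k)
  have cont: "continuous_map (subtopology (Euclidean_space m) S) euclideanreal (\<lambda>x. F (P x))"
  proof -
    have "continuous_map (subtopology (Euclidean_space m) S) (subtopology (Euclidean_space N) W) P"
      unfolding continuous_map_in_subtopology using assms(2,3) by auto
    from continuous_map_compose[OF this C_on_continuous[OF Suc.prems]] show ?thesis by (simp add: o_def)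
  qed
  show ?case unfolding C_on.simps
  proof (intro conjI cont allI impI)
    fix j assume j: "j < m"
    obtain F' where F': "\<forall>x\<in>W. ((\<lambda>t. F (x(e j := t))) has_real_derivative F' x) (at (x (e j)))" "C_on N k W F'"
      using Suc.prems assms(4)[OF j] unfolding C_on.simps by blast
    have D: "((\<lambda>t. F (P (x(j := t)))) has_real_derivative F' (P x)) (at (x j))" if "x \<in> S" for x
      using F'(1)[rule_format, OF assms(2)[OF that]] assms(5,6)[OF j] by simp
    show "\<exists>f'. (\<forall>x\<in>S. ((\<lambda>t. F (P (x(j := t)))) has_real_derivative f' x) (at (x j))) \<and> C_on m k S f'"
      by (rule exI[of _ "\<lambda>x. F' (P x)"], intro conjI ballI D Suc.IH F'(2))
  qed
qed

section \<open>Charts, smooth maps and the pull-back of smooth functions\<close>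

context
  fixes M :: "'a manifold" and U \<phi>
  assumes M: "smooth_manifold M" and chart: "(U, \<phi>) \<in> matlas M"
begin

lemma chart_open: "openin (mtop M) U" "openin (Euclidean_space (mdim M)) (\<phi> ` U)"
  and chart_homeo: "homeomorphic_map (subtopology (mtop M) U) (subtopology (Euclidean_space (mdim M)) (\<phi> ` U)) \<phi>"
  using M chart unfolding smooth_manifold_def by blast+

lemma chart_topspace: "topspace (subtopology (mtop M) U) = U"
  using openin_subset[OF chart_open(1)] by auto

lemma chart_inj: "inj_on \<phi> U"
  using homeomorphic_imp_injective_map[OF chart_homeo] unfolding chart_topspace .

lemma chart_inv: "u \<in> U \<Longrightarrow> inv_into U \<phi> (\<phi> u) = u"
  by (rule inv_into_f_f[OF chart_inj])

lemma chart_zero: "u \<in> U \<Longrightarrow> i \<ge> mdim M \<Longrightarrow> \<phi> u i = 0"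
  using openin_subset[OF chart_open(2)] by (auto simp: topspace_Euclidean_space)

lemma chart_image_open:
  assumes "openin (mtop M) W" "W \<subseteq> U"
  shows "openin (Euclidean_space (mdim M)) (\<phi> ` W)"
proof -
  have "openin (subtopology (mtop M) U) W" using assms chart_open(1) by (simp add: openin_open_subtopology)
  then have "openin (subtopology (Euclidean_space (mdim M)) (\<phi> ` U)) (\<phi> ` W)"
    using homeomorphic_imp_open_map[OF chart_homeo] unfolding open_map_def by blast
  then show ?thesis using chart_open(2) by (rule openin_trans_full)
qed

end

lemma chart_exists:
  assumes "smooth_manifold M" "x \<in> topspace (mtop M)"
  obtains U \<phi> where "(U, \<phi>) \<in> matlas M" "x \<in> U"
  using assms unfolding smooth_manifold_def by blast

lemma preimage_open:
  assumes "smooth_map M N F" "openin (mtop M) U" "openin (mtop N) V"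
  shows "openin (mtop M) (U \<inter> F -` V)"
proof -
  have "openin (mtop M) {x \<in> topspace (mtop M). F x \<in> V}"
    using assms(1,3) unfolding smooth_map_def by (auto intro: openin_continuous_map_preimage)
  then have "openin (mtop M) (U \<inter> {x \<in> topspace (mtop M). F x \<in> V})" using assms(2) by blast
  moreover have "U \<inter> {x \<in> topspace (mtop M). F x \<in> V} = U \<inter> F -` V"
    using openin_subset[OF assms(2)] by blast
  ultimately show ?thesis by simp
qed

text \<open>Smoothness is local, so near each point a single chart around the image suffices; there
  the composite is the chart expression of \<open>f\<close> after that of \<open>F\<close>.\<close>

lemma smooth_functions_compose:
  assumes M: "smooth_manifold M" and N: "smooth_manifold N" and F: "smooth_map M N F"
    and f: "f \<in> smooth_functions N"
  shows "(\<lambda>x\<in>topspace (mtop M). f (F x)) \<in> smooth_functions M"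
  unfolding smooth_functions_def
proof (intro CollectI conjI restrict_extensional ballI, clarify)
  fix U \<phi> assume U: "(U, \<phi>) \<in> matlas M"
  let ?f = "\<lambda>x. (\<lambda>x\<in>topspace (mtop M). f (F x)) (inv_into U \<phi> x)"
  have "C_on (mdim M) k (\<phi> ` U) ?f" for k
  proof (rule C_on_local[OF chart_open(2)[OF M U]])
    fix x assume "x \<in> \<phi> ` U"
    then obtain u where u: "u \<in> U" "x = \<phi> u" by blast
    have UM: "U \<subseteq> topspace (mtop M)" using openin_subset[OF chart_open(1)[OF M U]] .
    have "F u \<in> topspace (mtop N)"
      using F u(1) UM unfolding smooth_map_def continuous_map_def by blast
    then obtain V \<psi> where V: "(V, \<psi>) \<in> matlas N" "F u \<in> V" using chart_exists[OF N] by blast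
    let ?W = "U \<inter> F -` V"
    have op: "openin (Euclidean_space (mdim M)) (\<phi> ` ?W)"
      by (rule chart_image_open[OF M U preimage_open[OF F chart_open(1)[OF M U] chart_open(1)[OF N V(1)]]]) blast
    have fV: "C_on (mdim N) k (\<psi> ` V) (\<lambda>z. f (inv_into V \<psi> z))"
      using f V(1) unfolding smooth_functions_def smooth_on_def by blast
    have gV: "C_on (mdim M) k (\<phi> ` ?W) (\<lambda>x. \<psi> (F (inv_into U \<phi> x)) j)" if "j < mdim N" for j
      using F U V(1) that unfolding smooth_map_def smooth_on_def by blast
    \<comment> \<open>Chart values vanish from the dimension on, so cutting them off there, as
      \<open>C_on_compose\<close> expects, changes nothing.\<close>
    have eq: "(\<lambda>j. if j < mdim N then \<psi> (F (inv_into U \<phi> x)) j else 0) = \<psi> (F w)" if "w \<in> ?W" "x = \<phi> w" for x w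
    proof -
      have "inv_into U \<phi> x = w" unfolding that(2) by (rule chart_inv[OF M U]) (use that(1) in blast)
      then show ?thesis using chart_zero[OF N V(1), of "F w"] that(1) by (intro ext) auto
    qed
    have "C_on (mdim M) k (\<phi> ` ?W) (\<lambda>x. f (inv_into V \<psi> (\<lambda>j. if j < mdim N then \<psi> (F (inv_into U \<phi> x)) j else 0)))"
    proof (rule C_on_compose[OF chart_open(2)[OF N V(1)] fV gV])
      fix x assume "x \<in> \<phi> ` ?W"
      then obtain w where w: "w \<in> ?W" "x = \<phi> w" by blast
      show "(\<lambda>j. if j < mdim N then \<psi> (F (inv_into U \<phi> x)) j else 0) \<in> \<psi> ` V" unfolding eq[OF w] using w(1) by blast
    qed
    then have "C_on (mdim M) k (\<phi> ` ?W) ?f"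
    proof (rule C_on_cong[OF op, rotated])
      fix x assume "x \<in> \<phi> ` ?W"
      then obtain w where w: "w \<in> ?W" "x = \<phi> w" by blast
      have "F w \<in> V" "w \<in> topspace (mtop M)" using w(1) UM by auto
      then show "f (inv_into V \<psi> (\<lambda>j. if j < mdim N then \<psi> (F (inv_into U \<phi> x)) j else 0)) = ?f x"
        unfolding eq[OF w] using chart_inv[OF N V(1)] chart_inv[OF M U, of w] w by simp
    qed
    then show "\<exists>W. openin (Euclidean_space (mdim M)) W \<and> x \<in> W \<and> W \<subseteq> \<phi> ` U \<and> C_on (mdim M) k W ?f"
      using op u V(2) by (intro exI[of _ "\<phi> ` ?W"]) auto
  qed
  then show "smooth_on (mdim M) (\<phi> ` U) ?f" unfolding smooth_on_def by blast
qed

lemma smooth_functions_pointwise: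
  assumes M: "smooth_manifold M"
    and "\<And>U \<phi> k. (U, \<phi>) \<in> matlas M \<Longrightarrow> C_on (mdim M) k (\<phi> ` U) (\<lambda>x. h (inv_into U \<phi> x))"
  shows "(\<lambda>x\<in>topspace (mtop M). h x) \<in> smooth_functions M"
  unfolding smooth_functions_def
proof (intro CollectI conjI restrict_extensional ballI, clarify)
  fix U \<phi> assume U: "(U, \<phi>) \<in> matlas M"
  have "inv_into U \<phi> x \<in> topspace (mtop M)" if "x \<in> \<phi> ` U" for x
    using inv_into_into[OF that] openin_subset[OF chart_open(1)[OF M U]] by blast
  then show "smooth_on (mdim M) (\<phi> ` U) (\<lambda>x. (\<lambda>x\<in>topspace (mtop M). h x) (inv_into U \<phi> x))"
    unfolding smooth_on_def using C_on_cong[OF chart_open(2)[OF M U] _ assms(2)[OF U]] by simp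
qed

section \<open>Translations on a Lie group and the zero of its Lie algebra\<close>

context
  fixes G :: "'a lie_group"
  assumes G: "is_lie_group G"
begin

interpretation group G using G by (simp add: is_lie_group_def)

lemma lie_group_manifold: "smooth_manifold (mfd G)" and lie_group_topspace: "topspace (gtop G) = carrier G"
  using G by (auto simp: is_lie_group_def)

lemma mult_smooth: "smooth_map (prod_manifold (mfd G) (mfd G)) (mfd G) (\<lambda>(x, y). x \<otimes>\<^bsub>G\<^esub> y)"
  using G by (simp add: is_lie_group_def)

text \<open>Common to left and right translation: \<iota> will be \<open>x \<mapsto> (g, x)\<close>
  or \<open>x \<mapsto> (x, g)\<close>, and \<open>P\<close> its expression in charts, with
  coordinate \<open>j\<close> placed at \<open>e j\<close>. Smoothness of the multiplication passes
  to the translation by \<open>C_on_reparametrize\<close>.\<close>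

lemma translation_smooth_aux:
  assumes \<iota>: "continuous_map (gtop G) (prod_topology (gtop G) (gtop G)) \<iota>"
    and charts: "\<And>U \<phi>. (U, \<phi>) \<in> matlas (mfd G) \<Longrightarrow>
      \<exists>U1 \<phi>1 U2 \<phi>2 P e. (U1, \<phi>1) \<in> matlas (mfd G) \<and> (U2, \<phi>2) \<in> matlas (mfd G) \<and> (\<forall>u\<in>U. \<iota> u \<in> U1 \<times> U2) \<and>
        continuous_map (Euclidean_space (mdim (mfd G))) (Euclidean_space (mdim (mfd G) + mdim (mfd G))) P \<and>
        (\<forall>u\<in>U. P (\<phi> u) = (\<lambda>i. if i < mdim (mfd G) then \<phi>1 (fst (\<iota> u)) i else \<phi>2 (snd (\<iota> u)) (i - mdim (mfd G)))) \<and>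
        (\<forall>j<mdim (mfd G). e j < mdim (mfd G) + mdim (mfd G) \<and> (\<forall>x t. P (x(j := t)) = (P x)(e j := t)) \<and> (\<forall>x. P x (e j) = x j))"
  shows "smooth_map (mfd G) (mfd G) (\<lambda>x. (\<lambda>(x, y). x \<otimes>\<^bsub>G\<^esub> y) (\<iota> x))"
  unfolding smooth_map_def
proof (intro conjI ballI, goal_cases)
  case 1
  have "continuous_map (prod_topology (gtop G) (gtop G)) (gtop G) (\<lambda>(x, y). x \<otimes>\<^bsub>G\<^esub> y)"
    using mult_smooth unfolding smooth_map_def prod_manifold_def by simp
  from continuous_map_compose[OF \<iota> this] show ?case by (simp add: o_def)
next
  case (2 c)
  obtain U \<phi> where c: "c = (U, \<phi>)" by fastforce
  then have U: "(U, \<phi>) \<in> matlas (mfd G)" using 2 by simp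
  let ?n = "mdim (mfd G)"
  let ?m = "\<lambda>(x, y). x \<otimes>\<^bsub>G\<^esub> y"
  obtain U1 \<phi>1 U2 \<phi>2 P e where
    U12: "(U1, \<phi>1) \<in> matlas (mfd G)" "(U2, \<phi>2) \<in> matlas (mfd G)" "\<forall>u\<in>U. \<iota> u \<in> U1 \<times> U2"
    and P: "continuous_map (Euclidean_space ?n) (Euclidean_space (?n + ?n)) P"
      "\<forall>u\<in>U. P (\<phi> u) = (\<lambda>i. if i < ?n then \<phi>1 (fst (\<iota> u)) i else \<phi>2 (snd (\<iota> u)) (i - ?n))"
      "\<forall>j<?n. e j < ?n + ?n \<and> (\<forall>x t. P (x(j := t)) = (P x)(e j := t)) \<and> (\<forall>x. P x (e j) = x j)"
    using charts[OF U] by blast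
  let ?\<Phi> = "\<lambda>(x, y) i. if i < ?n then \<phi>1 x i else \<phi>2 y (i - ?n)"
  have \<Phi>: "(U1 \<times> U2, ?\<Phi>) \<in> matlas (prod_manifold (mfd G) (mfd G))"
    using U12 unfolding prod_manifold_def by auto
  have inj: "inj_on ?\<Phi> (U1 \<times> U2)"
  proof (rule inj_onI, clarify)
    fix x y x' y' assume xy: "x \<in> U1" "y \<in> U2" "x' \<in> U1" "y' \<in> U2"
      and e: "(\<lambda>i. if i < ?n then \<phi>1 x i else \<phi>2 y (i - ?n)) = (\<lambda>i. if i < ?n then \<phi>1 x' i else \<phi>2 y' (i - ?n))"
    \<comment> \<open>The product chart stores \<phi>1 below \<open>?n\<close> and \<phi>2 from
      \<open>?n\<close> on; the values of \<phi>1 from \<open>?n\<close> on are lost but known to be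
      zero.\<close>
    have "\<phi>1 x i = \<phi>1 x' i" for i
      using fun_cong[OF e, of i] chart_zero[OF lie_group_manifold U12(1)] xy by (cases "i < ?n") auto
    moreover have "\<phi>2 y i = \<phi>2 y' i" for i using fun_cong[OF e, of "i + ?n"] by simp
    ultimately show "x = x' \<and> y = y'"
      using xy chart_inj[OF lie_group_manifold U12(1)] chart_inj[OF lie_group_manifold U12(2)]
      by (metis ext inj_onD)
  qed
  show ?case unfolding c
  proof (clarify)
    fix V \<psi> i assume V: "(V, \<psi>) \<in> matlas (mfd G)" and i: "i < ?n"
    let ?W = "U \<inter> (\<lambda>x. ?m (\<iota> x)) -` V"
    have PW: "P (\<phi> u) = ?\<Phi> (\<iota> u)" "\<iota> u \<in> (U1 \<times> U2) \<inter> ?m -` V" if "u \<in> ?W" for u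
      using P(2) U12(3) that by (auto simp: case_prod_unfold)
    have "C_on ?n k (\<phi> ` ?W) (\<lambda>x. \<psi> (?m (\<iota> (inv_into U \<phi> x))) i)" for k
    proof (rule C_on_cong)
      show "openin (Euclidean_space ?n) (\<phi> ` ?W)"
      proof (rule chart_image_open[OF lie_group_manifold U])
        have "openin (gtop G) {x \<in> topspace (gtop G). ?m (\<iota> x) \<in> V}"
        proof (rule openin_continuous_map_preimage[OF _ chart_open(1)[OF lie_group_manifold V]])
          have "continuous_map (prod_topology (gtop G) (gtop G)) (gtop G) ?m"
            using mult_smooth unfolding smooth_map_def prod_manifold_def by simp
          from continuous_map_compose[OF \<iota> this] show "continuous_map (gtop G) (gtop G) (\<lambda>x. ?m (\<iota> x))" by (simp add: o_def)
        qed
        then have "openin (gtop G) (U \<inter> {x \<in> topspace (gtop G). ?m (\<iota> x) \<in> V})"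
          using chart_open(1)[OF lie_group_manifold U] by blast
        moreover have "U \<inter> {x \<in> topspace (gtop G). ?m (\<iota> x) \<in> V} = ?W"
          using openin_subset[OF chart_open(1)[OF lie_group_manifold U]] by blast
        ultimately show "openin (gtop G) ?W" by simp
      qed blast
      have "C_on (?n + ?n) k (?\<Phi> ` ((U1 \<times> U2) \<inter> ?m -` V)) (\<lambda>z. \<psi> (?m (inv_into (U1 \<times> U2) ?\<Phi> z)) i)"
        using mult_smooth \<Phi> V i unfolding smooth_map_def smooth_on_def prod_manifold_def by fastforce
      then show "C_on ?n k (\<phi> ` ?W) (\<lambda>x. \<psi> (?m (inv_into (U1 \<times> U2) ?\<Phi> (P x))) i)"
      proof (rule C_on_reparametrize[where e = e])
        show "P x \<in> ?\<Phi> ` ((U1 \<times> U2) \<inter> ?m -` V)" if "x \<in> \<phi> ` ?W" for x using that PW by blast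
      qed (use P(3) continuous_map_from_subtopology[OF P(1)] in auto)
      fix x assume "x \<in> \<phi> ` ?W"
      then obtain u where u: "u \<in> ?W" "x = \<phi> u" by blast
      have "inv_into (U1 \<times> U2) ?\<Phi> (P x) = \<iota> u"
        unfolding u(2) PW(1)[OF u(1)] by (rule inv_into_f_f[OF inj]) (use PW(2)[OF u(1)] in blast)
      moreover have "inv_into U \<phi> x = u" unfolding u(2) by (rule chart_inv[OF lie_group_manifold U]) (use u(1) in blast)
      ultimately show "\<psi> (?m (inv_into (U1 \<times> U2) ?\<Phi> (P x))) i = \<psi> (?m (\<iota> (inv_into U \<phi> x))) i" by simp
    qed
    then show "smooth_on ?n (\<phi> ` ?W) (\<lambda>x. \<psi> (?m (\<iota> (inv_into U \<phi> x))) i)" unfolding smooth_on_def by blast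
  qed
qed

end

context
  fixes G :: "'a lie_group"
  assumes G: "is_lie_group G"
begin

interpretation group G using G by (simp add: is_lie_group_def)

lemmas GM = lie_group_manifold[OF G] and GT = lie_group_topspace[OF G]

lemma continuous_pair_embedding:
  "continuous_map (Euclidean_space n) (Euclidean_space (n + n)) (\<lambda>x i. if i < n then a i else x (i - n))"
  (is ?A) "(\<And>i. i \<ge> n \<Longrightarrow> b i = 0) \<Longrightarrow>
    continuous_map (Euclidean_space n) (Euclidean_space (n + n)) (\<lambda>x i. if i < n then x i else b (i - n))"
  for n :: nat and a b :: "nat \<Rightarrow> real"
proof -
  have pr: "continuous_map (Euclidean_space n) euclideanreal (\<lambda>x. x i)" for i
    unfolding Euclidean_space_def by (intro continuous_map_from_subtopology continuous_map_product_projection) simp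
  show ?A
    unfolding Euclidean_space_def[of "n + n"] continuous_map_in_subtopology continuous_map_componentwise_UNIV
  proof (intro conjI allI)
    show "continuous_map (Euclidean_space n) euclideanreal (\<lambda>x. if k < n then a k else x (k - n))" for k
      using pr by (cases "k < n") auto
  qed (auto simp: topspace_Euclidean_space)
  show "continuous_map (Euclidean_space n) (Euclidean_space (n + n)) (\<lambda>x i. if i < n then x i else b (i - n))"
    if "\<And>i. i \<ge> n \<Longrightarrow> b i = 0"
    unfolding Euclidean_space_def[of "n + n"] continuous_map_in_subtopology continuous_map_componentwise_UNIV
  proof (intro conjI allI)
    show "continuous_map (Euclidean_space n) euclideanreal (\<lambda>x. if k < n then x k else b (k - n))" for k
      using pr by (cases "k < n") auto
  qed (use that in \<open>auto simp: topspace_Euclidean_space\<close>)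
qed

lemma left_translation_smooth:
  assumes g: "g \<in> carrier G"
  shows "smooth_map (mfd G) (mfd G) (\<lambda>x. g \<otimes>\<^bsub>G\<^esub> x)"
proof -
  let ?n = "mdim (mfd G)"
  obtain U0 \<phi>0 where U0: "(U0, \<phi>0) \<in> matlas (mfd G)" "g \<in> U0" using chart_exists[OF GM, of g] g GT by blast
  have "smooth_map (mfd G) (mfd G) (\<lambda>x. (\<lambda>(x, y). x \<otimes>\<^bsub>G\<^esub> y) (g, x))"
  proof (rule translation_smooth_aux[OF G])
    show "continuous_map (gtop G) (prod_topology (gtop G) (gtop G)) (Pair g)"
      using g GT by (intro continuous_map_pairedI) (auto simp: continuous_map_id[unfolded id_def])
    fix U \<phi> assume U: "(U, \<phi>) \<in> matlas (mfd G)"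
    show "\<exists>U1 \<phi>1 U2 \<phi>2 P e. (U1, \<phi>1) \<in> matlas (mfd G) \<and> (U2, \<phi>2) \<in> matlas (mfd G) \<and> (\<forall>u\<in>U. (g, u) \<in> U1 \<times> U2) \<and>
        continuous_map (Euclidean_space ?n) (Euclidean_space (?n + ?n)) P \<and>
        (\<forall>u\<in>U. P (\<phi> u) = (\<lambda>i. if i < ?n then \<phi>1 (fst (g, u)) i else \<phi>2 (snd (g, u)) (i - ?n))) \<and>
        (\<forall>j<?n. e j < ?n + ?n \<and> (\<forall>x t. P (x(j := t)) = (P x)(e j := t)) \<and> (\<forall>x. P x (e j) = x j))"
      \<comment> \<open>The constant first factor fills the coordinates below \<open>?n\<close>, so
        coordinate \<open>j\<close> of \<open>x\<close> becomes coordinate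
        \<open>?n + j\<close>.\<close>
      using U U0 continuous_pair_embedding(1)[of ?n "\<phi>0 g"]
      by (intro exI[of _ U0] exI[of _ \<phi>0] exI[of _ U] exI[of _ \<phi>]
          exI[of _ "\<lambda>x i. if i < ?n then \<phi>0 g i else x (i - ?n)"] exI[of _ "\<lambda>j. ?n + j"]) (auto simp: fun_eq_iff)
  qed
  then show ?thesis by simp
qed

lemma right_translation_smooth:
  assumes g: "g \<in> carrier G"
  shows "smooth_map (mfd G) (mfd G) (\<lambda>x. x \<otimes>\<^bsub>G\<^esub> g)"
proof -
  let ?n = "mdim (mfd G)"
  obtain U0 \<phi>0 where U0: "(U0, \<phi>0) \<in> matlas (mfd G)" "g \<in> U0" using chart_exists[OF GM, of g] g GT by blast
  have "smooth_map (mfd G) (mfd G) (\<lambda>x. (\<lambda>(x, y). x \<otimes>\<^bsub>G\<^esub> y) (x, g))"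
  proof (rule translation_smooth_aux[OF G])
    show "continuous_map (gtop G) (prod_topology (gtop G) (gtop G)) (\<lambda>x. (x, g))"
      using g GT by (intro continuous_map_pairedI) (auto simp: continuous_map_id[unfolded id_def])
    fix U \<phi> assume U: "(U, \<phi>) \<in> matlas (mfd G)"
    show "\<exists>U1 \<phi>1 U2 \<phi>2 P e. (U1, \<phi>1) \<in> matlas (mfd G) \<and> (U2, \<phi>2) \<in> matlas (mfd G) \<and> (\<forall>u\<in>U. (u, g) \<in> U1 \<times> U2) \<and>
        continuous_map (Euclidean_space ?n) (Euclidean_space (?n + ?n)) P \<and>
        (\<forall>u\<in>U. P (\<phi> u) = (\<lambda>i. if i < ?n then \<phi>1 (fst (u, g)) i else \<phi>2 (snd (u, g)) (i - ?n))) \<and>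
        (\<forall>j<?n. e j < ?n + ?n \<and> (\<forall>x t. P (x(j := t)) = (P x)(e j := t)) \<and> (\<forall>x. P x (e j) = x j))"
      using U U0 continuous_pair_embedding(2)[of ?n "\<phi>0 g"] chart_zero[OF GM U0]
      by (intro exI[of _ U] exI[of _ \<phi>] exI[of _ U0] exI[of _ \<phi>0]
          exI[of _ "\<lambda>x i. if i < ?n then x i else \<phi>0 g (i - ?n)"] exI[of _ "\<lambda>j. j"]) (auto simp: fun_eq_iff)
  qed
  then show ?thesis by simp
qed

lemma C_inf_left: "g \<in> carrier G \<Longrightarrow> f \<in> C_inf G \<Longrightarrow> (\<lambda>x\<in>carrier G. f (g \<otimes>\<^bsub>G\<^esub> x)) \<in> C_inf G"
  using smooth_functions_compose[OF GM GM left_translation_smooth] GT by simp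

lemma C_inf_right: "g \<in> carrier G \<Longrightarrow> f \<in> C_inf G \<Longrightarrow> (\<lambda>x\<in>carrier G. f (x \<otimes>\<^bsub>G\<^esub> g)) \<in> C_inf G"
  using smooth_functions_compose[OF GM GM right_translation_smooth] GT by simp

text \<open>\<open>Ad\<close> composes functions with conjugation, while a vector field is specified
  only on \<open>C_inf G\<close>; computing \<open>Ad\<close> on a field thus requires that
  conjugation, made of two translations, preserves \<open>C_inf G\<close>.\<close>

lemma C_inf_conjugate:
  assumes k: "k \<in> carrier G" and f: "f \<in> C_inf G"
  shows "(\<lambda>y\<in>carrier G. f (k \<otimes>\<^bsub>G\<^esub> y \<otimes>\<^bsub>G\<^esub> inv\<^bsub>G\<^esub> k)) \<in> C_inf G"
proof -
  have "(\<lambda>y\<in>carrier G. (\<lambda>y\<in>carrier G. f (y \<otimes>\<^bsub>G\<^esub> inv\<^bsub>G\<^esub> k)) (k \<otimes>\<^bsub>G\<^esub> y)) \<in> C_inf G"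
    by (rule C_inf_left[OF k C_inf_right[OF _ f]]) (use k in simp)
  moreover have "(\<lambda>y\<in>carrier G. (\<lambda>y\<in>carrier G. f (y \<otimes>\<^bsub>G\<^esub> inv\<^bsub>G\<^esub> k)) (k \<otimes>\<^bsub>G\<^esub> y)) =
      (\<lambda>y\<in>carrier G. f (k \<otimes>\<^bsub>G\<^esub> y \<otimes>\<^bsub>G\<^esub> inv\<^bsub>G\<^esub> k))"
    using k by (intro restrict_ext) simp
  ultimately show ?thesis by simp
qed

lemma C_inf_chart: "f \<in> C_inf G \<Longrightarrow> (U, \<phi>) \<in> matlas (mfd G) \<Longrightarrow> C_on (mdim (mfd G)) k (\<phi> ` U) (\<lambda>x. f (inv_into U \<phi> x))"
  unfolding smooth_functions_def smooth_on_def by blast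

lemma C_inf_extensional: "f \<in> C_inf G \<Longrightarrow> (\<lambda>x\<in>carrier G. f x) = f"
  unfolding smooth_functions_def using GT by (auto simp: extensional_restrict)

lemma C_inf_const: "(\<lambda>x\<in>carrier G. c) \<in> C_inf G"
  using smooth_functions_pointwise[OF GM, of "\<lambda>x. c"] C_on_const GT by simp

lemma C_inf_add: "f \<in> C_inf G \<Longrightarrow> h \<in> C_inf G \<Longrightarrow> (\<lambda>x\<in>carrier G. f x + h x) \<in> C_inf G"
  using smooth_functions_pointwise[OF GM, of "\<lambda>x. f x + h x"] C_on_add C_inf_chart GT by simp

lemma C_inf_mult: "f \<in> C_inf G \<Longrightarrow> h \<in> C_inf G \<Longrightarrow> (\<lambda>x\<in>carrier G. f x * h x) \<in> C_inf G"
  using smooth_functions_pointwise[OF GM, of "\<lambda>x. f x * h x"] C_on_mult C_inf_chart GT by simp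

lemma C_inf_scale: "f \<in> C_inf G \<Longrightarrow> (\<lambda>x\<in>carrier G. c * f x) \<in> C_inf G"
  using smooth_functions_pointwise[OF GM, of "\<lambda>x. c * f x"] C_on_mult[OF C_on_const] C_inf_chart GT by simp

lemma Lie_zero_app: "f \<in> C_inf G \<Longrightarrow> \<zero>\<^bsub>Lie G\<^esub> f = (\<lambda>x\<in>carrier G. 0)"
  by (simp add: Lie_def)

lemma Lie_carrier_app: "X \<in> carrier (Lie G) \<Longrightarrow> f \<in> C_inf G \<Longrightarrow> X f \<in> C_inf G"
  by (auto simp: Lie_def left_invariant_fields_def)

lemma Lie_zero_closed: "\<zero>\<^bsub>Lie G\<^esub> \<in> carrier (Lie G)"
proof -
  have "(\<lambda>f\<in>C_inf G. \<lambda>x\<in>carrier G. 0) \<in> left_invariant_fields G"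
    unfolding left_invariant_fields_def
    by (auto simp: C_inf_const C_inf_add C_inf_mult C_inf_scale C_inf_left intro!: restrict_ext)
  then show ?thesis by (simp add: Lie_def)
qed

lemma Lie_eqI:
  assumes "X \<in> extensional (C_inf G)" "Y \<in> extensional (C_inf G)" "\<And>f. f \<in> C_inf G \<Longrightarrow> X f = Y f"
  shows "X = Y"
  using assms by (rule extensionalityI)

lemma Lie_carrier_extensional: "X \<in> carrier (Lie G) \<Longrightarrow> X \<in> extensional (C_inf G)"
  by (auto simp: Lie_def left_invariant_fields_def PiE_def)

lemma Lie_add_zero:
  assumes X: "X \<in> carrier (Lie G)"
  shows "X \<oplus>\<^bsub>Lie G\<^esub> \<zero>\<^bsub>Lie G\<^esub> = X" "\<zero>\<^bsub>Lie G\<^esub> \<oplus>\<^bsub>Lie G\<^esub> X = X"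
proof -
  have e: "(\<lambda>x\<in>carrier G. X f x) = X f" if "f \<in> C_inf G" for f
    by (rule C_inf_extensional[OF Lie_carrier_app[OF X that]])
  have z: "(\<lambda>x\<in>carrier G. X f x + (if x \<in> carrier G then 0 else undefined)) = (\<lambda>x\<in>carrier G. X f x)"
    "(\<lambda>x\<in>carrier G. (if x \<in> carrier G then 0 else undefined) + X f x) = (\<lambda>x\<in>carrier G. X f x)" for f
    by (auto intro!: restrict_ext)
  show "X \<oplus>\<^bsub>Lie G\<^esub> \<zero>\<^bsub>Lie G\<^esub> = X" "\<zero>\<^bsub>Lie G\<^esub> \<oplus>\<^bsub>Lie G\<^esub> X = X"
    by (rule Lie_eqI[OF _ Lie_carrier_extensional[OF X]]; simp add: Lie_def z e)+
qed

lemma Lie_scale_zero: "c \<odot>\<^bsub>Lie G\<^esub> \<zero>\<^bsub>Lie G\<^esub> = \<zero>\<^bsub>Lie G\<^esub>"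
  by (rule Lie_eqI) (auto simp: Lie_def intro!: restrict_ext)

lemma Lie_bracket_zero:
  assumes X: "X \<in> carrier (Lie G)"
  shows "bracket (Lie G) X \<zero>\<^bsub>Lie G\<^esub> = \<zero>\<^bsub>Lie G\<^esub>" "bracket (Lie G) \<zero>\<^bsub>Lie G\<^esub> X = \<zero>\<^bsub>Lie G\<^esub>"
proof -
  \<comment> \<open>Homogeneity with the scalar \<open>0\<close>.\<close>
  have X0: "X (\<lambda>x\<in>carrier G. 0) = (\<lambda>x\<in>carrier G. 0)"
  proof -
    have "\<forall>c. \<forall>f\<in>C_inf G. X (\<lambda>x\<in>carrier G. c * f x) = (\<lambda>x\<in>carrier G. c * X f x)"
      using X by (simp add: Lie_def left_invariant_fields_def)
    from this[rule_format, OF C_inf_const[of 0], of 0] show ?thesis by simp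
  qed
  have XC: "X f \<in> C_inf G" if "f \<in> C_inf G" for f using Lie_carrier_app[OF X that] .
  show "bracket (Lie G) X \<zero>\<^bsub>Lie G\<^esub> = \<zero>\<^bsub>Lie G\<^esub>" "bracket (Lie G) \<zero>\<^bsub>Lie G\<^esub> X = \<zero>\<^bsub>Lie G\<^esub>"
    unfolding Lie_def by (auto simp: X0 XC intro!: restrict_ext)
qed

lemma Ad_zero:
  assumes "k \<in> carrier G"
  shows "Ad G k \<zero>\<^bsub>Lie G\<^esub> = \<zero>\<^bsub>Lie G\<^esub>"
  unfolding Ad_def using assms by (auto simp: Lie_def C_inf_conjugate intro!: restrict_ext)

lemma Ad_one:
  assumes X: "X \<in> carrier (Lie G)"
  shows "Ad G \<one>\<^bsub>G\<^esub> X = X"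
proof (rule Lie_eqI[OF _ Lie_carrier_extensional[OF X]])
  show "Ad G \<one>\<^bsub>G\<^esub> X \<in> extensional (C_inf G)" by (simp add: Ad_def)
  fix f assume f: "f \<in> C_inf G"
  have "(\<lambda>y\<in>carrier G. f (\<one>\<^bsub>G\<^esub> \<otimes>\<^bsub>G\<^esub> y \<otimes>\<^bsub>G\<^esub> inv\<^bsub>G\<^esub> \<one>\<^bsub>G\<^esub>)) = (\<lambda>y\<in>carrier G. f y)"
    by (intro restrict_ext) simp
  also have "\<dots> = f" by (rule C_inf_extensional[OF f])
  finally have e: "(\<lambda>y\<in>carrier G. f (\<one>\<^bsub>G\<^esub> \<otimes>\<^bsub>G\<^esub> y \<otimes>\<^bsub>G\<^esub> inv\<^bsub>G\<^esub> \<one>\<^bsub>G\<^esub>)) = f" .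
  have "Ad G \<one>\<^bsub>G\<^esub> X f = (\<lambda>x\<in>carrier G. X f x)"
    unfolding Ad_def restrict_apply'[OF f] e by (rule restrict_ext) simp
  then show "Ad G \<one>\<^bsub>G\<^esub> X f = X f" using C_inf_extensional[OF Lie_carrier_app[OF X f]] by simp
qed

text \<open>Paired with this constant curve, a one-parameter subgroup of one factor becomes one of
  the product.\<close>

lemma one_parameter_subgroup_trivial: "one_parameter_subgroup G (\<lambda>t. \<one>\<^bsub>G\<^esub>) \<zero>\<^bsub>Lie G\<^esub>"
  unfolding one_parameter_subgroup_def
  using Lie_zero_closed by (auto simp: hom_def Lie_zero_app)

end

section \<open>Vector spaces as spaces of functions\<close>

definition fscale :: "complex \<Rightarrow> ('i \<Rightarrow> complex) \<Rightarrow> 'i \<Rightarrow> complex" where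
  "fscale c f = (\<lambda>i. c * f i)"

lemma fscale_apply [simp]: "fscale c f i = c * f i"
  by (simp add: fscale_def)

global_interpretation fv: complex_vs "fscale :: complex \<Rightarrow> ('i \<Rightarrow> complex) \<Rightarrow> 'i \<Rightarrow> complex"
  by unfold_locales (simp_all add: fun_eq_iff algebra_simps)

text \<open>Carriers are subsets of arbitrary types, while the linear algebra above lives on a whole
  type; an embedding into functions passes from one to the other. Closure under the operations is
  part of it, so that it implies the module axioms.\<close>

definition emb :: "(complex, 'v, 'z) module_scheme \<Rightarrow> ('v \<Rightarrow> 'i \<Rightarrow> complex) \<Rightarrow> bool" where
  "emb V j \<longleftrightarrow> \<zero>\<^bsub>V\<^esub> \<in> carrier V \<and> j \<zero>\<^bsub>V\<^esub> = 0 \<and> inj_on j (carrier V) \<and>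
     (\<forall>v\<in>carrier V. \<forall>w\<in>carrier V. v \<oplus>\<^bsub>V\<^esub> w \<in> carrier V \<and> j (v \<oplus>\<^bsub>V\<^esub> w) = j v + j w) \<and>
     (\<forall>c. \<forall>v\<in>carrier V. c \<odot>\<^bsub>V\<^esub> v \<in> carrier V \<and> j (c \<odot>\<^bsub>V\<^esub> v) = fscale c (j v))"

lemma embD:
  assumes "emb V j"
  shows "\<zero>\<^bsub>V\<^esub> \<in> carrier V" "j \<zero>\<^bsub>V\<^esub> = 0" "inj_on j (carrier V)"
    "v \<in> carrier V \<Longrightarrow> w \<in> carrier V \<Longrightarrow> v \<oplus>\<^bsub>V\<^esub> w \<in> carrier V"
    "v \<in> carrier V \<Longrightarrow> w \<in> carrier V \<Longrightarrow> j (v \<oplus>\<^bsub>V\<^esub> w) = j v + j w"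
    "v \<in> carrier V \<Longrightarrow> c \<odot>\<^bsub>V\<^esub> v \<in> carrier V" "v \<in> carrier V \<Longrightarrow> j (c \<odot>\<^bsub>V\<^esub> v) = fscale c (j v)"
  using assms by (simp_all add: emb_def)

lemma emb_inj: "emb V j \<Longrightarrow> v \<in> carrier V \<Longrightarrow> w \<in> carrier V \<Longrightarrow> j v = j w \<Longrightarrow> v = w"
  using inj_onD[OF embD(3)] by metis

lemma complex_ring_cring: "cring complex_ring"
  by (rule cringI; (rule abelian_groupI)?; (rule comm_monoidI)?)
    (auto simp: complex_ring_def algebra_simps intro: exI[of _ "- _"])

lemma complex_ring_simps [simp]:
  "carrier complex_ring = UNIV" "x \<otimes>\<^bsub>complex_ring\<^esub> y = x * y" "\<one>\<^bsub>complex_ring\<^esub> = 1"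
  "\<zero>\<^bsub>complex_ring\<^esub> = 0" "x \<oplus>\<^bsub>complex_ring\<^esub> y = x + y"
  by (simp_all add: complex_ring_def)

text \<open>The axioms hold for functions and are pulled back along the injective \<open>j\<close>;
  the additive inverse is multiplication by \<open>-1\<close>.\<close>

lemma emb_module:
  assumes j: "emb V j"
  shows "complex_space V"
proof -
  note D = embD[OF j] and I = emb_inj[OF j]
  have "abelian_group V"
  proof (rule abelian_groupI)
    show "\<exists>y\<in>carrier V. y \<oplus>\<^bsub>V\<^esub> x = \<zero>\<^bsub>V\<^esub>" if "x \<in> carrier V" for x
    proof (rule bexI[of _ "(- 1) \<odot>\<^bsub>V\<^esub> x"])
      have "j ((- 1) \<odot>\<^bsub>V\<^esub> x \<oplus>\<^bsub>V\<^esub> x) = j \<zero>\<^bsub>V\<^esub>" by (simp add: D that fun_eq_iff)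
      then show "(- 1) \<odot>\<^bsub>V\<^esub> x \<oplus>\<^bsub>V\<^esub> x = \<zero>\<^bsub>V\<^esub>" by (rule I[rotated 2]) (simp_all add: D that)
    qed (simp add: D that)
  qed (simp_all add: D, (rule I; simp add: D add_ac)+)
  then show ?thesis
    by (rule moduleI[OF complex_ring_cring]) (simp_all add: D, (rule I; simp add: D fun_eq_iff algebra_simps)+)
qed

lemma subspace_of_iff:
  assumes V: "complex_space V"
  shows "subspace_of W V \<longleftrightarrow> W \<subseteq> carrier V \<and> \<zero>\<^bsub>V\<^esub> \<in> W \<and> (\<forall>v\<in>W. \<forall>w\<in>W. v \<oplus>\<^bsub>V\<^esub> w \<in> W) \<and> (\<forall>c. \<forall>v\<in>W. c \<odot>\<^bsub>V\<^esub> v \<in> W)"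
    (is "?A \<longleftrightarrow> ?B")
proof -
  interpret V: module complex_ring V by fact
  have l0: "(0::complex) \<odot>\<^bsub>V\<^esub> v = \<zero>\<^bsub>V\<^esub>" if "v \<in> carrier V" for v
    using V.smult_l_null[OF that] by simp
  show ?thesis
  proof
    assume A: ?A
    note E = V.submoduleE[OF A]
    obtain v where "v \<in> W" using E(2) by blast
    then have "\<zero>\<^bsub>V\<^esub> \<in> W" using E(4)[of 0 v] l0[of v] E(1) by auto
    then show ?B using E(1,4,5) by simp
  next
    assume B: ?B
    have "\<ominus>\<^bsub>V\<^esub> v = (- 1) \<odot>\<^bsub>V\<^esub> v" if v: "v \<in> carrier V" for v
    proof -
      have "(- 1) \<odot>\<^bsub>V\<^esub> v \<oplus>\<^bsub>V\<^esub> v = ((- 1) + 1) \<odot>\<^bsub>V\<^esub> v"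
        using V.smult_l_distr[of "- 1" 1 v] V.smult_one[OF v] v by simp
      also have "\<dots> = \<zero>\<^bsub>V\<^esub>" using l0[OF v] by simp
      finally show ?thesis using V.minus_equality[of "(- 1) \<odot>\<^bsub>V\<^esub> v" v] V.smult_closed[of "- 1" v] v by simp
    qed
    then show ?A using B by (intro V.submoduleI) auto
  qed
qed

text \<open>\<open>V\<close> is a quotient of the free space \<open>F\<close> on its elements, by
  the kernel \<open>K\<close> of the map \<open>p\<close> that evaluates formal sums.
  \<open>kernel_projection\<close> models this quotient inside the functions, and \<open>v\<close>
  goes to the class of \<open>single v\<close>.\<close>

lemma emb_exists:
  fixes V :: "(complex, 'v, 'z) module_scheme"
  assumes V: "complex_space V"
  obtains j :: "'v \<Rightarrow> 'v \<Rightarrow> complex" where "emb V j"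
proof -
  interpret V: module complex_ring V by fact
  have l0: "(0::complex) \<odot>\<^bsub>V\<^esub> v = \<zero>\<^bsub>V\<^esub>" if "v \<in> carrier V" for v
    using V.smult_l_null[OF that] by simp
  have cl: "c \<odot>\<^bsub>V\<^esub> v \<in> carrier V" if "v \<in> carrier V" for c v using V.smult_closed[of c v] that by simp
  define F where "F = {\<phi> :: 'v \<Rightarrow> complex. finite {v. \<phi> v \<noteq> 0} \<and> {v. \<phi> v \<noteq> 0} \<subseteq> carrier V}"
  define p where "p \<phi> = finsum V (\<lambda>v. \<phi> v \<odot>\<^bsub>V\<^esub> v) {v. \<phi> v \<noteq> 0}" for \<phi>
  have pA: "p \<phi> = finsum V (\<lambda>v. \<phi> v \<odot>\<^bsub>V\<^esub> v) A" if "finite A" "A \<subseteq> carrier V" "{v. \<phi> v \<noteq> 0} \<subseteq> A" for \<phi> A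
    unfolding p_def by (rule V.add.finprod_mono_neutral_cong_left) (use that l0 cl in auto)
  have p_add: "p (\<phi> + \<psi>) = p \<phi> \<oplus>\<^bsub>V\<^esub> p \<psi>" if "\<phi> \<in> F" "\<psi> \<in> F" for \<phi> \<psi>
  proof -
    let ?A = "{v. \<phi> v \<noteq> 0} \<union> {v. \<psi> v \<noteq> 0}"
    have A: "finite ?A" "?A \<subseteq> carrier V" using that by (auto simp: F_def)
    have "p (\<phi> + \<psi>) = finsum V (\<lambda>v. (\<phi> + \<psi>) v \<odot>\<^bsub>V\<^esub> v) ?A" by (rule pA[OF A]) auto
    also have "\<dots> = finsum V (\<lambda>v. \<phi> v \<odot>\<^bsub>V\<^esub> v \<oplus>\<^bsub>V\<^esub> \<psi> v \<odot>\<^bsub>V\<^esub> v) ?A"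
      by (rule V.finsum_cong') (use A cl V.smult_l_distr in auto)
    also have "\<dots> = finsum V (\<lambda>v. \<phi> v \<odot>\<^bsub>V\<^esub> v) ?A \<oplus>\<^bsub>V\<^esub> finsum V (\<lambda>v. \<psi> v \<odot>\<^bsub>V\<^esub> v) ?A"
      by (rule V.finsum_addf) (use A cl in auto)
    also have "\<dots> = p \<phi> \<oplus>\<^bsub>V\<^esub> p \<psi>" by (subst (1 2) pA[OF A]) auto
    finally show ?thesis .
  qed
  have p_scale: "p (fscale c \<phi>) = c \<odot>\<^bsub>V\<^esub> p \<phi>" if "\<phi> \<in> F" for c \<phi>
  proof -
    let ?A = "{v. \<phi> v \<noteq> 0}"
    have A: "finite ?A" "?A \<subseteq> carrier V" using that by (auto simp: F_def)
    have "p (fscale c \<phi>) = finsum V (\<lambda>v. fscale c \<phi> v \<odot>\<^bsub>V\<^esub> v) ?A" by (rule pA[OF A]) auto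
    also have "\<dots> = finsum V (\<lambda>v. c \<odot>\<^bsub>V\<^esub> (\<phi> v \<odot>\<^bsub>V\<^esub> v)) ?A"
      by (rule V.finsum_cong') (use A cl V.smult_assoc1 in auto)
    also have "\<dots> = c \<odot>\<^bsub>V\<^esub> finsum V (\<lambda>v. \<phi> v \<odot>\<^bsub>V\<^esub> v) ?A"
      by (rule V.finsum_smult_ldistr[symmetric]) (use A cl in auto)
    finally show ?thesis by (simp add: p_def)
  qed
  have sF: "single v \<in> F" if "v \<in> carrier V" for v using that by (auto simp: F_def single_def)
  have p_single: "p (single v) = v" if v: "v \<in> carrier V" for v
  proof -
    have "p (single v) = finsum V (\<lambda>w. single v w \<odot>\<^bsub>V\<^esub> w) {v}" by (rule pA) (use v in \<open>auto simp: single_def\<close>)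
    also have "\<dots> = 1 \<odot>\<^bsub>V\<^esub> v" using v cl by (subst V.finsum_insert) (auto simp: single_def)
    also have "\<dots> = v" using V.smult_one[OF v] by simp
    finally show ?thesis .
  qed
  have F_add: "\<phi> + \<psi> \<in> F" if "\<phi> \<in> F" "\<psi> \<in> F" for \<phi> \<psi>
  proof -
    have "{v. (\<phi> + \<psi>) v \<noteq> 0} \<subseteq> {v. \<phi> v \<noteq> 0} \<union> {v. \<psi> v \<noteq> 0}" by auto
    then show ?thesis using that unfolding F_def by (blast intro: finite_subset)
  qed
  have F_scale: "fscale c \<phi> \<in> F" if "\<phi> \<in> F" for c \<phi>
  proof -
    have "{v. fscale c \<phi> v \<noteq> 0} \<subseteq> {v. \<phi> v \<noteq> 0}" by auto
    then show ?thesis using that unfolding F_def by (blast intro: finite_subset)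
  qed
  have F0: "0 \<in> F" by (simp add: F_def)
  have p0: "p 0 = \<zero>\<^bsub>V\<^esub>" by (simp add: p_def)
  define K where "K = {\<phi> \<in> F. p \<phi> = \<zero>\<^bsub>V\<^esub>}"
  have K: "fv.subspace K"
  proof (rule fv.subspaceI)
    show "0 \<in> K" using F0 p0 by (simp add: K_def)
    show "\<phi> + \<psi> \<in> K" if "\<phi> \<in> K" "\<psi> \<in> K" for \<phi> \<psi>
      using that F_add p_add by (simp add: K_def)
    show "fscale c \<phi> \<in> K" if "\<phi> \<in> K" for c \<phi>
      using that F_scale p_scale V.smult_r_null[of c] by (simp add: K_def)
  qed
  obtain q where q: "fv.lin q" "\<And>x. q x = 0 \<longleftrightarrow> x \<in> K" using fv.kernel_projection[OF K] by blast
  have diff: "\<phi> - \<psi> \<in> K \<longleftrightarrow> p \<phi> = p \<psi>" if "\<phi> \<in> F" "\<psi> \<in> F" for \<phi> \<psi>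
  proof -
    have pc: "p x \<in> carrier V" if "x \<in> F" for x
      unfolding p_def by (rule V.finsum_closed) (use that cl in \<open>auto simp: F_def\<close>)
    have e: "\<phi> - \<psi> = \<phi> + fscale (- 1) \<psi>" by (simp add: fun_eq_iff)
    have m: "\<phi> - \<psi> \<in> F" unfolding e using that F_add F_scale by blast
    have s: "p \<phi> = p (\<phi> - \<psi>) \<oplus>\<^bsub>V\<^esub> p \<psi>" using p_add[OF m that(2)] by simp
    show ?thesis
    proof
      assume "\<phi> - \<psi> \<in> K"
      then show "p \<phi> = p \<psi>" using s pc[OF that(2)] by (simp add: K_def)
    next
      assume "p \<phi> = p \<psi>"
      then have "p (\<phi> - \<psi>) \<oplus>\<^bsub>V\<^esub> p \<psi> = \<zero>\<^bsub>V\<^esub> \<oplus>\<^bsub>V\<^esub> p \<psi>" using s pc[OF that(2)] by simp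
      then have "p (\<phi> - \<psi>) = \<zero>\<^bsub>V\<^esub>" using V.add.right_cancel[OF pc[OF that(2)] pc[OF m] V.zero_closed] by blast
      then show "\<phi> - \<psi> \<in> K" using m by (simp add: K_def)
    qed
  qed
  have eq: "q \<phi> = q \<psi>" if "\<phi> \<in> F" "\<psi> \<in> F" "p \<phi> = p \<psi>" for \<phi> \<psi>
    using diff[OF that(1,2)] that(3) q(2)[of "\<phi> - \<psi>"] fv.lin_diff[OF q(1), of \<phi> \<psi>] by simp
  have "emb V (\<lambda>v. q (single v))"
    unfolding emb_def
  proof (intro conjI ballI allI)
    show "\<zero>\<^bsub>V\<^esub> \<in> carrier V" by simp
    then show "q (single \<zero>\<^bsub>V\<^esub>) = 0" using q(2) sF p_single by (simp add: K_def)
    show "inj_on (\<lambda>v. q (single v)) (carrier V)"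
    proof (rule inj_onI)
      fix v w assume vw: "v \<in> carrier V" "w \<in> carrier V" "q (single v) = q (single w)"
      then have "single v - single w \<in> K" using q(2)[of "single v - single w"] fv.lin_diff[OF q(1)] by simp
      then show "v = w" using diff[OF sF sF] vw p_single by simp
    qed
    fix v w assume v: "v \<in> carrier V" and w: "w \<in> carrier V"
    show vw: "v \<oplus>\<^bsub>V\<^esub> w \<in> carrier V" using v w by simp
    show "q (single (v \<oplus>\<^bsub>V\<^esub> w)) = q (single v) + q (single w)"
      unfolding fv.lin_add[OF q(1), symmetric]
      by (rule eq) (simp_all add: sF F_add p_add p_single v w)
  next
    fix c v assume v: "v \<in> carrier V"
    show "c \<odot>\<^bsub>V\<^esub> v \<in> carrier V" by (rule cl[OF v])
    show "q (single (c \<odot>\<^bsub>V\<^esub> v)) = fscale c (q (single v))"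
      unfolding fv.lin_scale[OF q(1), symmetric]
      by (rule eq) (simp_all add: sF F_scale p_scale p_single v cl)
  qed
  then show ?thesis by (rule that)
qed

lemma emb_subspace:
  assumes j: "emb V j"
  shows "subspace_of W V \<longleftrightarrow> W \<subseteq> carrier V \<and> fv.subspace (j ` W)"
proof -
  note D = embD[OF j] and I = emb_inj[OF j]
  have "fv.subspace (j ` W) \<longleftrightarrow> \<zero>\<^bsub>V\<^esub> \<in> W \<and> (\<forall>v\<in>W. \<forall>w\<in>W. v \<oplus>\<^bsub>V\<^esub> w \<in> W) \<and> (\<forall>c. \<forall>v\<in>W. c \<odot>\<^bsub>V\<^esub> v \<in> W)"
    if W: "W \<subseteq> carrier V"
  proof -
    have mem: "j v \<in> j ` W \<longleftrightarrow> v \<in> W" if "v \<in> carrier V" for v using inj_on_image_mem_iff[OF D(3) that W] .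
    have 1: "j v + j w \<in> j ` W \<longleftrightarrow> v \<oplus>\<^bsub>V\<^esub> w \<in> W" if vw: "v \<in> W" "w \<in> W" for v w
    proof -
      have c: "v \<in> carrier V" "w \<in> carrier V" using vw W by blast+
      show ?thesis using mem[OF D(4)[OF c]] D(5)[OF c] by simp
    qed
    have 2: "fscale c (j v) \<in> j ` W \<longleftrightarrow> c \<odot>\<^bsub>V\<^esub> v \<in> W" if v: "v \<in> W" for v c
    proof -
      have vc: "v \<in> carrier V" using v W by blast
      show ?thesis using mem[OF D(6)[OF vc, of c]] D(7)[OF vc, of c] by simp
    qed
    have 3: "0 \<in> j ` W \<longleftrightarrow> \<zero>\<^bsub>V\<^esub> \<in> W" using mem[OF D(1)] D(2) by simp
    show ?thesis
    proof
      assume s: "fv.subspace (j ` W)"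
      have "\<zero>\<^bsub>V\<^esub> \<in> W" using fv.subspace_0[OF s] 3 by blast
      moreover have "v \<oplus>\<^bsub>V\<^esub> w \<in> W" if "v \<in> W" "w \<in> W" for v w
        using fv.subspace_add[OF s imageI[OF that(1)] imageI[OF that(2)]] 1[OF that] by blast
      moreover have "c \<odot>\<^bsub>V\<^esub> v \<in> W" if "v \<in> W" for c v
        using fv.subspace_scale[OF s imageI[OF that], of c] 2[OF that] by blast
      ultimately show "\<zero>\<^bsub>V\<^esub> \<in> W \<and> (\<forall>v\<in>W. \<forall>w\<in>W. v \<oplus>\<^bsub>V\<^esub> w \<in> W) \<and> (\<forall>c. \<forall>v\<in>W. c \<odot>\<^bsub>V\<^esub> v \<in> W)" by blast
    next
      assume R: "\<zero>\<^bsub>V\<^esub> \<in> W \<and> (\<forall>v\<in>W. \<forall>w\<in>W. v \<oplus>\<^bsub>V\<^esub> w \<in> W) \<and> (\<forall>c. \<forall>v\<in>W. c \<odot>\<^bsub>V\<^esub> v \<in> W)"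
      show "fv.subspace (j ` W)"
      proof (rule fv.subspaceI)
        show "0 \<in> j ` W" using R 3 by blast
        show "x + y \<in> j ` W" if xy: "x \<in> j ` W" "y \<in> j ` W" for x y
        proof -
          obtain v w where "x = j v" "y = j w" "v \<in> W" "w \<in> W" using xy by blast
          then show ?thesis using 1[of v w] R by simp
        qed
        show "fscale c x \<in> j ` W" if x: "x \<in> j ` W" for c x
        proof -
          obtain v where "x = j v" "v \<in> W" using x by blast
          then show ?thesis using 2[of v c] R by simp
        qed
      qed
    qed
  qed
  then show ?thesis unfolding subspace_of_iff[OF emb_module[OF j]] by blast
qed

lemma emb_finite_dim:
  assumes j: "emb V j" and W: "subspace_of W V"
  shows "finite_dim V W \<longleftrightarrow> fv.fd (j ` W)"
proof
  note WV = W[unfolded emb_subspace[OF j]]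
  {
    assume "finite_dim V W"
    then obtain B where B: "finite B" "B \<subseteq> carrier V" "W = complex_span V B" unfolding finite_dim_def by blast
    let ?X = "{v \<in> carrier V. j v \<in> fv.span (j ` B)}"
    have "subspace_of ?X V"
      unfolding subspace_of_iff[OF emb_module[OF j]]
      by (auto simp: embD[OF j] intro: fv.span_zero fv.span_add fv.span_scale)
    moreover have "B \<subseteq> ?X" using B(2) fv.span_base by blast
    ultimately have "W \<subseteq> ?X" using B(3) unfolding complex_span_def by blast
    then have "j ` W \<subseteq> fv.span (j ` B)" by blast
    then show "fv.fd (j ` W)" using B(1) unfolding fv.fd_def by blast
  }
  assume "fv.fd (j ` W)"
  moreover have "fv.subspace (j ` W)" using WV by blast
  ultimately obtain C where C': "finite C" "fv.independent C" "C \<subseteq> j ` W" "fv.span C = j ` W"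
    by (rule fv.fd_basis)
  note C = C'(1,3,4)
  obtain B where B: "B \<subseteq> W" "finite B" "C = j ` B" using finite_subset_image[OF C(1,2)] by blast
  have "W \<subseteq> X" if X: "subspace_of X V" "B \<subseteq> X" for X
  proof
    fix w assume w: "w \<in> W"
    have XV: "X \<subseteq> carrier V" "fv.subspace (j ` X)" using X(1) unfolding emb_subspace[OF j] by auto
    have "C \<subseteq> j ` X" unfolding B(3) using X(2) by (rule image_mono)
    then have "fv.span C \<subseteq> j ` X" using XV(2) by (rule fv.span_minimal)
    then have "j w \<in> j ` X" using C(3) w by blast
    then show "w \<in> X" using inj_on_image_mem_iff[OF embD(3)[OF j] _ XV(1)] w WV by blast
  qed
  then have "W = complex_span V B" unfolding complex_span_def using W B(1) by blast
  then show "finite_dim V W" unfolding finite_dim_def using B(1,2) WV by blast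
qed

lemma functional_pullback:
  assumes j: "emb V j" and g: "fv.functional g"
  shows "linear_map V complex_line (\<lambda>v. g (j v))"
  by (simp add: linear_map_def complex_line_def embD[OF j] fv.functional_add[OF g] fv.functional_scale[OF g])

text \<open>Continuity and derivatives of an action are tested by functionals on the whole module.
  Since a functional on a subspace extends, the tests pass to submodules and to copies of
  them.\<close>

lemma functional_extension:
  assumes j: "emb V j" and W: "subspace_of W V"
    and add: "\<And>v w. v \<in> W \<Longrightarrow> w \<in> W \<Longrightarrow> f (v \<oplus>\<^bsub>V\<^esub> w) = f v + f w"
    and scale: "\<And>c v. v \<in> W \<Longrightarrow> f (c \<odot>\<^bsub>V\<^esub> v) = c * f v"
  obtains g where "linear_map V complex_line g" "\<And>v. v \<in> W \<Longrightarrow> g v = f v"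
proof -
  have WV: "W \<subseteq> carrier V" "fv.subspace (j ` W)" using W unfolding emb_subspace[OF j] by auto
  have cl: "v \<oplus>\<^bsub>V\<^esub> w \<in> W" "c \<odot>\<^bsub>V\<^esub> v \<in> W" if "v \<in> W" "w \<in> W" for v w c
    using W that unfolding subspace_of_iff[OF emb_module[OF j]] by auto
  let ?i = "inv_into W j"
  have i: "?i (j v) = v" if "v \<in> W" for v using inv_into_f_f[OF inj_on_subset[OF embD(3)[OF j] WV(1)] that] .
  obtain g where g: "fv.functional g" "\<And>x. x \<in> j ` W \<Longrightarrow> g x = f (?i x)"
  proof (rule fv.functional_extend[OF WV(2), of "\<lambda>x. f (?i x)"])
    fix x y assume "x \<in> j ` W" "y \<in> j ` W"
    then obtain v w where vw: "x = j v" "y = j w" "v \<in> W" "w \<in> W" by blast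
    have c: "v \<in> carrier V" "w \<in> carrier V" using vw(3,4) WV(1) by blast+
    have "f (?i (x + y)) = f (?i (j (v \<oplus>\<^bsub>V\<^esub> w)))" unfolding vw(1,2) embD(5)[OF j c] ..
    also have "\<dots> = f v + f w" using i[OF cl(1)[OF vw(3,4)]] add[OF vw(3,4)] by simp
    finally show "f (?i (x + y)) = f (?i x) + f (?i y)" unfolding vw(1,2) i[OF vw(3)] i[OF vw(4)] .
  next
    fix c x assume "x \<in> j ` W"
    then obtain v where v: "x = j v" "v \<in> W" by blast
    have vc: "v \<in> carrier V" using v(2) WV(1) by blast
    have "f (?i (fscale c x)) = f (?i (j (c \<odot>\<^bsub>V\<^esub> v)))" unfolding v(1) embD(7)[OF j vc] ..
    also have "\<dots> = c * f v" using i[OF cl(2)[OF v(2) v(2)]] scale[OF v(2)] by simp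
    finally show "f (?i (fscale c x)) = c * f (?i x)" unfolding v(1) i[OF v(2)] .
  qed blast
  show ?thesis
    by (rule that[OF functional_pullback[OF j g(1)]]) (simp add: g(2) i)
qed

lemma a_inv_complex:
  assumes V: "complex_space V" and v: "v \<in> carrier V"
  shows "\<ominus>\<^bsub>V\<^esub> v = (- 1) \<odot>\<^bsub>V\<^esub> v"
proof -
  interpret V: module complex_ring V by fact
  have "(- 1) \<odot>\<^bsub>V\<^esub> v \<oplus>\<^bsub>V\<^esub> v = ((- 1) + 1) \<odot>\<^bsub>V\<^esub> v"
    using V.smult_l_distr[of "- 1" 1 v] V.smult_one[OF v] v by simp
  also have "\<dots> = \<zero>\<^bsub>V\<^esub>" using V.smult_l_null[OF v] by simp
  finally show ?thesis using V.minus_equality[of "(- 1) \<odot>\<^bsub>V\<^esub> v" v] V.smult_closed[of "- 1" v] v by simp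
qed

lemma linear_mapD:
  assumes "linear_map V W f"
  shows "v \<in> carrier V \<Longrightarrow> f v \<in> carrier W"
    "v \<in> carrier V \<Longrightarrow> w \<in> carrier V \<Longrightarrow> f (v \<oplus>\<^bsub>V\<^esub> w) = f v \<oplus>\<^bsub>W\<^esub> f w"
    "v \<in> carrier V \<Longrightarrow> f (c \<odot>\<^bsub>V\<^esub> v) = c \<odot>\<^bsub>W\<^esub> f v"
  using assms by (auto simp: linear_map_def)

lemma emb_subspaceD:
  assumes "emb V j" "subspace_of W V"
  shows "W \<subseteq> carrier V" "\<zero>\<^bsub>V\<^esub> \<in> W" "v \<in> W \<Longrightarrow> w \<in> W \<Longrightarrow> v \<oplus>\<^bsub>V\<^esub> w \<in> W" "v \<in> W \<Longrightarrow> c \<odot>\<^bsub>V\<^esub> v \<in> W"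
  using assms(2) unfolding subspace_of_iff[OF emb_module[OF assms(1)]] by blast+

lemma emb_carrier_subspace: "emb V j \<Longrightarrow> subspace_of (carrier V) V"
  using module.carrier_is_submodule[OF emb_module] .

lemma emb_preimage_subspace:
  assumes j: "emb V j" and X: "fv.subspace X"
  shows "subspace_of {v \<in> carrier V. j v \<in> X} V"
  unfolding subspace_of_iff[OF emb_module[OF j]]
  using embD[OF j] fv.subspace_0[OF X] fv.subspace_add[OF X] fv.subspace_scale[OF X] by auto

text \<open>Both embeddings use the same index type, since \<open>lin\<close> speaks of operators of
  one space. Off the image of the carrier the values of \<open>g\<close> are arbitrary.\<close>

lemma linear_map_lift:
  fixes j :: "'w \<Rightarrow> 'i \<Rightarrow> complex"
  assumes i: "emb V i" and j: "emb N j" and s: "linear_map V N s"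
  shows "\<exists>g. fv.lin g \<and> (\<forall>v\<in>carrier V. g (i v) = j (s v))"
proof -
  let ?C = "carrier V"
  have sC: "fv.subspace (i ` ?C)" using emb_carrier_subspace[OF i] unfolding emb_subspace[OF i] by blast
  let ?d = "inv_into ?C i"
  have d: "?d (i v) = v" if "v \<in> ?C" for v using inv_into_f_f[OF embD(3)[OF i] that] .
  obtain g where g: "fv.lin g" "\<And>x. x \<in> i ` ?C \<Longrightarrow> g x = j (s (?d x))"
  proof (rule fv.lin_extend[OF sC, of "\<lambda>x. j (s (?d x))"])
    fix x y assume "x \<in> i ` ?C" "y \<in> i ` ?C"
    then obtain v w where vw: "x = i v" "y = i w" "v \<in> ?C" "w \<in> ?C" by blast
    have e: "x + y = i (v \<oplus>\<^bsub>V\<^esub> w)" unfolding vw(1,2) embD(5)[OF i vw(3,4)] ..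
    show "j (s (?d (x + y))) = j (s (?d x)) + j (s (?d y))"
      unfolding e unfolding vw(1,2) d[OF vw(3)] d[OF vw(4)] d[OF embD(4)[OF i vw(3,4)]] linear_mapD(2)[OF s vw(3,4)]
      by (rule embD(5)[OF j linear_mapD(1)[OF s vw(3)] linear_mapD(1)[OF s vw(4)]])
  next
    fix c x assume "x \<in> i ` ?C"
    then obtain v where v: "x = i v" "v \<in> ?C" by blast
    have e: "fscale c x = i (c \<odot>\<^bsub>V\<^esub> v)" unfolding v(1) embD(7)[OF i v(2)] ..
    show "j (s (?d (fscale c x))) = fscale c (j (s (?d x)))"
      unfolding e unfolding v(1) d[OF v(2)] d[OF embD(6)[OF i v(2)]] linear_mapD(3)[OF s v(2)]
      by (rule embD(7)[OF j linear_mapD(1)[OF s v(2)]])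
  qed blast
  have "g (i v) = j (s v)" if "v \<in> ?C" for v using g(2)[OF imageI[OF that]] d[OF that] by simp
  then show ?thesis using g(1) by (intro exI[of _ g]) simp
qed

text \<open>All operators of the ambient space that induce some \<open>s \<in> S\<close> on the
  embedded carrier. One \<open>s\<close> may have many such extensions; they agree on the image of
  \<open>j\<close>.\<close>

definition lifts :: "('v \<Rightarrow> 'i \<Rightarrow> complex) \<Rightarrow> (complex, 'v, 'z) module_scheme \<Rightarrow> ('v \<Rightarrow> 'v) set \<Rightarrow> (('i \<Rightarrow> complex) \<Rightarrow> 'i \<Rightarrow> complex) set" where
  "lifts j V S = {g. fv.lin g \<and> (\<exists>s\<in>S. \<forall>v\<in>carrier V. g (j v) = j (s v))}"

lemma lifts_lin: "\<forall>g\<in>lifts j V S. fv.lin g"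
  by (simp add: lifts_def)

lemma lifts_Un: "lifts j V (S \<union> T) = lifts j V S \<union> lifts j V T"
  by (auto simp: lifts_def)

lemma lifts_exists:
  assumes j: "emb V j" and s: "linear_map V V s" "s \<in> S"
  obtains g where "g \<in> lifts j V S" "\<And>v. v \<in> carrier V \<Longrightarrow> g (j v) = j (s v)"
proof -
  have "\<exists>g. fv.lin g \<and> (\<forall>v\<in>carrier V. g (j v) = j (s v))" by (rule linear_map_lift[OF j j s(1)])
  then obtain g where g: "fv.lin g \<and> (\<forall>v\<in>carrier V. g (j v) = j (s v))" by (rule exE)
  show ?thesis by (rule that[of g]) (use g s(2) in \<open>simp_all add: lifts_def, blast\<close>)
qed

definition rstable :: "(complex, 'v, 'z) module_scheme \<Rightarrow> ('v \<Rightarrow> 'v) set \<Rightarrow> 'v set \<Rightarrow> bool" where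
  "rstable V S W \<longleftrightarrow> subspace_of W V \<and> (\<forall>s\<in>S. \<forall>w\<in>W. s w \<in> W)"

lemma stable_lifts:
  assumes j: "emb V j" and S: "\<forall>s\<in>S. linear_map V V s" and W: "W \<subseteq> carrier V"
  shows "fv.stable (lifts j V S) (j ` W) \<longleftrightarrow> rstable V S W"
proof
  have mem: "j v \<in> j ` W \<longleftrightarrow> v \<in> W" if "v \<in> carrier V" for v using inj_on_image_mem_iff[OF embD(3)[OF j] that W] .
  {
    assume st: "fv.stable (lifts j V S) (j ` W)"
    have "s w \<in> W" if s: "s \<in> S" and w: "w \<in> W" for s w
    proof -
      have ls: "linear_map V V s" using S s by blast
      obtain g where g: "g \<in> lifts j V S" "\<And>v. v \<in> carrier V \<Longrightarrow> g (j v) = j (s v)"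
        using lifts_exists[OF j ls s] by blast
      have wV: "w \<in> carrier V" using w W by blast
      have "g (j w) \<in> j ` W" by (rule fv.stable_app[OF st g(1)]) (use w in blast)
      then show ?thesis using g(2)[OF wV] mem[OF linear_mapD(1)[OF ls wV]] by simp
    qed
    then show "rstable V S W"
      using fv.stable_subspace[OF st] W unfolding rstable_def emb_subspace[OF j] by blast
  }
  assume r: "rstable V S W"
  then show "fv.stable (lifts j V S) (j ` W)"
    unfolding fv.stable_def rstable_def emb_subspace[OF j] lifts_def using W by auto
qed

lemma irred_lifts:
  assumes j: "emb V j" and S: "\<forall>s\<in>S. linear_map V V s" and W: "W \<subseteq> carrier V"
  shows "fv.irred (lifts j V S) (j ` W) \<longleftrightarrow>
    rstable V S W \<and> W \<noteq> {\<zero>\<^bsub>V\<^esub>} \<and> (\<forall>X. rstable V S X \<and> X \<subseteq> W \<longrightarrow> X = {\<zero>\<^bsub>V\<^esub>} \<or> X = W)"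
proof -
  have z: "j ` X = {0} \<longleftrightarrow> X = {\<zero>\<^bsub>V\<^esub>}" if "X \<subseteq> carrier V" for X
    using inj_on_image_eq_iff[OF embD(3)[OF j] that, of "{\<zero>\<^bsub>V\<^esub>}"] embD(1,2)[OF j] by simp
  have e: "j ` X = j ` W \<longleftrightarrow> X = W" if "X \<subseteq> carrier V" for X
    using inj_on_image_eq_iff[OF embD(3)[OF j] that W] .
  have "(\<forall>X. fv.stable (lifts j V S) X \<and> X \<subseteq> j ` W \<longrightarrow> X = {0} \<or> X = j ` W) \<longleftrightarrow>
      (\<forall>X. rstable V S X \<and> X \<subseteq> W \<longrightarrow> X = {\<zero>\<^bsub>V\<^esub>} \<or> X = W)" (is "?A \<longleftrightarrow> ?B")
  proof
    assume A: ?A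
    show ?B
    proof (intro allI impI)
      fix X assume X: "rstable V S X \<and> X \<subseteq> W"
      then have XV: "X \<subseteq> carrier V" using W by blast
      have "fv.stable (lifts j V S) (j ` X)" using stable_lifts[OF j S XV] X by blast
      moreover have "j ` X \<subseteq> j ` W" using X by blast
      ultimately have "j ` X = {0} \<or> j ` X = j ` W" using A by blast
      then show "X = {\<zero>\<^bsub>V\<^esub>} \<or> X = W" unfolding z[OF XV] e[OF XV] .
    qed
  next
    assume B: ?B
    show ?A
    proof (intro allI impI)
      fix Y assume Y: "fv.stable (lifts j V S) Y \<and> Y \<subseteq> j ` W"
      then obtain X where X: "X \<subseteq> W" "Y = j ` X" by (meson subset_imageE)
      then have XV: "X \<subseteq> carrier V" using W by blast
      have "rstable V S X" using stable_lifts[OF j S XV] Y X(2) by blast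
      then have "X = {\<zero>\<^bsub>V\<^esub>} \<or> X = W" using B X(1) by blast
      then show "Y = {0} \<or> Y = j ` W" unfolding X(2) z[OF XV] e[OF XV] .
    qed
  qed
  then show ?thesis unfolding fv.irred_def stable_lifts[OF j S W] z[OF W] by blast
qed

text \<open>Evaluation at a nonzero vector embeds \<open>Hom\<^sub>K(\<rho>, N)\<close> when \<open>\<rho>\<close> is irreducible.\<close>

lemma emb_hom:
  fixes \<rho> :: "('k, 'w, 'y) k_rep_scheme" and N :: "('k, 'v, 'z) k_rep_scheme"
  assumes \<rho>: "irreducible_k_module K T \<rho>" and j: "emb N j" and act: "\<forall>k\<in>carrier K. linear_map N N (kact N k)"
    and x0: "x0 \<in> carrier \<rho>" "x0 \<noteq> \<zero>\<^bsub>\<rho>\<^esub>"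
  shows "emb (k_hom_space K \<rho> N) (\<lambda>f. j (f x0))"
proof -
  have cs: "complex_space \<rho>" and ract: "\<And>k. k \<in> carrier K \<Longrightarrow> linear_map \<rho> \<rho> (kact \<rho> k)"
    using \<rho> unfolding irreducible_k_module_def k_module_def by auto
  obtain i :: "'w \<Rightarrow> 'w \<Rightarrow> complex" where i: "emb \<rho> i" by (rule emb_exists[OF cs])
  let ?H = "k_hom_space K \<rho> N"
  have H: "f \<in> carrier ?H \<longleftrightarrow> f \<in> extensional (carrier \<rho>) \<and> linear_map \<rho> N f \<and>
      (\<forall>k\<in>carrier K. \<forall>w\<in>carrier \<rho>. f (kact \<rho> k w) = kact N k (f w))" for f
    by (simp add: k_hom_space_def)
  note DN = embD[OF j] and DR = embD[OF i]
  show ?thesis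
    unfolding emb_def
  proof (intro conjI ballI allI)
    have 0: "kact N k \<zero>\<^bsub>N\<^esub> = \<zero>\<^bsub>N\<^esub>" if k: "k \<in> carrier K" for k
    proof (rule emb_inj[OF j])
      have l: "linear_map N N (kact N k)" using act k by blast
      have "kact N k (0 \<odot>\<^bsub>N\<^esub> \<zero>\<^bsub>N\<^esub>) = 0 \<odot>\<^bsub>N\<^esub> kact N k \<zero>\<^bsub>N\<^esub>" using linear_mapD(3)[OF l DN(1)] .
      moreover have "0 \<odot>\<^bsub>N\<^esub> \<zero>\<^bsub>N\<^esub> = \<zero>\<^bsub>N\<^esub>" by (rule emb_inj[OF j]) (simp_all add: DN fun_eq_iff)
      ultimately show "j (kact N k \<zero>\<^bsub>N\<^esub>) = j \<zero>\<^bsub>N\<^esub>"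
        using DN(7)[OF linear_mapD(1)[OF l DN(1)], of 0] DN(2) by (simp add: fun_eq_iff)
      show "kact N k \<zero>\<^bsub>N\<^esub> \<in> carrier N" by (rule linear_mapD(1)[OF l DN(1)])
    qed (rule DN(1))
    have z: "\<zero>\<^bsub>N\<^esub> \<oplus>\<^bsub>N\<^esub> \<zero>\<^bsub>N\<^esub> = \<zero>\<^bsub>N\<^esub>" "c \<odot>\<^bsub>N\<^esub> \<zero>\<^bsub>N\<^esub> = \<zero>\<^bsub>N\<^esub>" for c
      by (rule emb_inj[OF j]; simp add: DN fun_eq_iff)+
    have "(\<lambda>w\<in>carrier \<rho>. \<zero>\<^bsub>N\<^esub>) \<in> carrier ?H"
      unfolding H linear_map_def
      by (simp add: DN(1) DR(4,6) z 0 linear_mapD(1)[OF ract])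
    then show "\<zero>\<^bsub>?H\<^esub> \<in> carrier ?H" by (simp add: k_hom_space_def)
    show "j (\<zero>\<^bsub>?H\<^esub> x0) = 0" using x0 DN(2) by (simp add: k_hom_space_def)
    show "inj_on (\<lambda>f. j (f x0)) (carrier ?H)"
    proof (rule inj_onI)
      fix f h assume f: "f \<in> carrier ?H" and h: "h \<in> carrier ?H" and e: "j (f x0) = j (h x0)"
      have lf: "linear_map \<rho> N f" and lh: "linear_map \<rho> N h" using f h unfolding H by blast+
      have e0: "f x0 = h x0" by (rule emb_inj[OF j _ _ e]) (use linear_mapD(1)[OF lf x0(1)] linear_mapD(1)[OF lh x0(1)] in simp_all)
      \<comment> \<open>The equalizer of \<open>f\<close> and \<open>h\<close> is a
        subrepresentation that contains the nonzero \<open>x0\<close>.\<close>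
      let ?W = "{x \<in> carrier \<rho>. f x = h x}"
      have f0: "f \<zero>\<^bsub>\<rho>\<^esub> = \<zero>\<^bsub>N\<^esub>" if lf: "linear_map \<rho> N f" for f
      proof (rule emb_inj[OF j])
        have "\<zero>\<^bsub>\<rho>\<^esub> = 0 \<odot>\<^bsub>\<rho>\<^esub> \<zero>\<^bsub>\<rho>\<^esub>" by (rule emb_inj[OF i]) (simp_all add: DR fun_eq_iff)
        then have "f \<zero>\<^bsub>\<rho>\<^esub> = 0 \<odot>\<^bsub>N\<^esub> f \<zero>\<^bsub>\<rho>\<^esub>" using linear_mapD(3)[OF lf DR(1), of 0] by simp
        then show "j (f \<zero>\<^bsub>\<rho>\<^esub>) = j \<zero>\<^bsub>N\<^esub>"
          using DN(7)[OF linear_mapD(1)[OF lf DR(1)], of 0] DN(2) by (simp add: fun_eq_iff)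
      qed (use linear_mapD(1)[OF lf DR(1)] DN(1) in simp_all)
      have fk: "f (kact \<rho> k x) = kact N k (f x)" "h (kact \<rho> k x) = kact N k (h x)"
        if "k \<in> carrier K" "x \<in> carrier \<rho>" for k x using f h that unfolding H by blast+
      have "k_subspace K \<rho> ?W"
        unfolding k_subspace_def subspace_of_iff[OF cs]
        by (simp add: DR(1,4,6) f0[OF lf] f0[OF lh] linear_mapD(2,3)[OF lf] linear_mapD(2,3)[OF lh]
            linear_mapD(1)[OF ract] fk subset_iff)
      then have "?W = {\<zero>\<^bsub>\<rho>\<^esub>} \<or> ?W = carrier \<rho>" using \<rho> unfolding irreducible_k_module_def by blast
      then have "?W = carrier \<rho>" using x0 e0 by blast
      then have "f x = h x" if "x \<in> carrier \<rho>" for x using that by blast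
      moreover have "f \<in> extensional (carrier \<rho>)" "h \<in> extensional (carrier \<rho>)" using f h unfolding H by blast+
      ultimately show "f = h" by (intro extensionalityI[of f "carrier \<rho>" h])
    qed
    fix f h assume f: "f \<in> carrier ?H" and h: "h \<in> carrier ?H"
    have lf: "linear_map \<rho> N f" and lh: "linear_map \<rho> N h" using f h unfolding H by blast+
    show "f \<oplus>\<^bsub>?H\<^esub> h \<in> carrier ?H"
    proof -
      have "linear_map \<rho> N (\<lambda>w\<in>carrier \<rho>. f w \<oplus>\<^bsub>N\<^esub> h w)"
        unfolding linear_map_def
      proof (intro conjI ballI allI)
        show "(\<lambda>w\<in>carrier \<rho>. f w \<oplus>\<^bsub>N\<^esub> h w) \<in> carrier \<rho> \<rightarrow> carrier N"
          using linear_mapD(1)[OF lf] linear_mapD(1)[OF lh] DN(4) by auto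
        show "(\<lambda>w\<in>carrier \<rho>. f w \<oplus>\<^bsub>N\<^esub> h w) (v \<oplus>\<^bsub>\<rho>\<^esub> v') = (\<lambda>w\<in>carrier \<rho>. f w \<oplus>\<^bsub>N\<^esub> h w) v \<oplus>\<^bsub>N\<^esub> (\<lambda>w\<in>carrier \<rho>. f w \<oplus>\<^bsub>N\<^esub> h w) v'"
          if "v \<in> carrier \<rho>" "v' \<in> carrier \<rho>" for v v'
          by (rule emb_inj[OF j]) (simp_all add: that DR DN linear_mapD[OF lf] linear_mapD[OF lh] add_ac)
        show "(\<lambda>w\<in>carrier \<rho>. f w \<oplus>\<^bsub>N\<^esub> h w) (c \<odot>\<^bsub>\<rho>\<^esub> v) = c \<odot>\<^bsub>N\<^esub> (\<lambda>w\<in>carrier \<rho>. f w \<oplus>\<^bsub>N\<^esub> h w) v"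
          if "v \<in> carrier \<rho>" for c v
          by (rule emb_inj[OF j]) (simp_all add: that DR DN linear_mapD[OF lf] linear_mapD[OF lh] fun_eq_iff algebra_simps)
      qed
      moreover have "(\<lambda>w\<in>carrier \<rho>. f w \<oplus>\<^bsub>N\<^esub> h w) (kact \<rho> k w) = kact N k ((\<lambda>w\<in>carrier \<rho>. f w \<oplus>\<^bsub>N\<^esub> h w) w)"
        if "k \<in> carrier K" "w \<in> carrier \<rho>" for k w
        using that f h linear_mapD(1)[OF ract that(2)] linear_mapD(2)[OF bspec[OF act that(1)]]
          linear_mapD(1)[OF lf that(2)] linear_mapD(1)[OF lh that(2)] unfolding H by simp
      ultimately have "(\<lambda>w\<in>carrier \<rho>. f w \<oplus>\<^bsub>N\<^esub> h w) \<in> carrier ?H" unfolding H by simp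
      then show ?thesis by (simp add: k_hom_space_def)
    qed
    show "j ((f \<oplus>\<^bsub>?H\<^esub> h) x0) = j (f x0) + j (h x0)"
      using x0(1) linear_mapD(1)[OF lf x0(1)] linear_mapD(1)[OF lh x0(1)] by (simp add: k_hom_space_def DN)
  next
    fix c f assume f: "f \<in> carrier ?H"
    have lf: "linear_map \<rho> N f" using f unfolding H by blast
    show "c \<odot>\<^bsub>?H\<^esub> f \<in> carrier ?H"
    proof -
      have "linear_map \<rho> N (\<lambda>w\<in>carrier \<rho>. c \<odot>\<^bsub>N\<^esub> f w)"
        unfolding linear_map_def
      proof (intro conjI ballI allI)
        show "(\<lambda>w\<in>carrier \<rho>. c \<odot>\<^bsub>N\<^esub> f w) \<in> carrier \<rho> \<rightarrow> carrier N"
          using linear_mapD(1)[OF lf] DN(6) by auto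
        show "(\<lambda>w\<in>carrier \<rho>. c \<odot>\<^bsub>N\<^esub> f w) (v \<oplus>\<^bsub>\<rho>\<^esub> v') = (\<lambda>w\<in>carrier \<rho>. c \<odot>\<^bsub>N\<^esub> f w) v \<oplus>\<^bsub>N\<^esub> (\<lambda>w\<in>carrier \<rho>. c \<odot>\<^bsub>N\<^esub> f w) v'"
          if "v \<in> carrier \<rho>" "v' \<in> carrier \<rho>" for v v'
          by (rule emb_inj[OF j]) (simp_all add: that DR DN linear_mapD[OF lf] fun_eq_iff algebra_simps)
        show "(\<lambda>w\<in>carrier \<rho>. c \<odot>\<^bsub>N\<^esub> f w) (d \<odot>\<^bsub>\<rho>\<^esub> v) = d \<odot>\<^bsub>N\<^esub> (\<lambda>w\<in>carrier \<rho>. c \<odot>\<^bsub>N\<^esub> f w) v"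
          if "v \<in> carrier \<rho>" for d v
          by (rule emb_inj[OF j]) (simp_all add: that DR DN linear_mapD[OF lf] fun_eq_iff algebra_simps)
      qed
      moreover have "(\<lambda>w\<in>carrier \<rho>. c \<odot>\<^bsub>N\<^esub> f w) (kact \<rho> k w) = kact N k ((\<lambda>w\<in>carrier \<rho>. c \<odot>\<^bsub>N\<^esub> f w) w)"
        if "k \<in> carrier K" "w \<in> carrier \<rho>" for k w
        using that f linear_mapD(1)[OF ract that(2)] linear_mapD(3)[OF bspec[OF act that(1)]]
          linear_mapD(1)[OF lf that(2)] unfolding H by simp
      ultimately have "(\<lambda>w\<in>carrier \<rho>. c \<odot>\<^bsub>N\<^esub> f w) \<in> carrier ?H" unfolding H by simp
      then show ?thesis by (simp add: k_hom_space_def)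
    qed
    show "j ((c \<odot>\<^bsub>?H\<^esub> f) x0) = fscale c (j (f x0))"
      using x0(1) linear_mapD(1)[OF lf x0(1)] by (simp add: k_hom_space_def DN)
  qed
qed

section \<open>Restriction of modules along morphisms of pairs\<close>

text \<open>Pull-back along the group map \<open>e\<close> and the Lie algebra map \<open>a\<close>,
  cut down to \<open>W\<close>. The type of vectors is kept, so both tensor factors will live in the
  type of \<open>M\<close>.\<close>

definition sub_rep :: "('x, 'k, 'v) gk_rep \<Rightarrow> 'v set \<Rightarrow> ('l \<Rightarrow> 'k) \<Rightarrow> ('y \<Rightarrow> 'x) \<Rightarrow> ('y, 'l, 'v) gk_rep" where
  "sub_rep M W e a = \<lparr>carrier = W, mult = undefined, one = undefined, zero = \<zero>\<^bsub>M\<^esub>, add = add M, smult = smult M,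
     kact = (\<lambda>l. kact M (e l)), gact = (\<lambda>X. gact M (a X))\<rparr>"

lemma sub_rep_simps [simp]:
  "carrier (sub_rep M W e a) = W" "\<zero>\<^bsub>sub_rep M W e a\<^esub> = \<zero>\<^bsub>M\<^esub>" "v \<oplus>\<^bsub>sub_rep M W e a\<^esub> w = v \<oplus>\<^bsub>M\<^esub> w"
  "c \<odot>\<^bsub>sub_rep M W e a\<^esub> v = c \<odot>\<^bsub>M\<^esub> v" "kact (sub_rep M W e a) l = kact M (e l)"
  "gact (sub_rep M W e a) X = gact M (a X)"
  by (simp_all add: sub_rep_def)

lemma emb_sub_rep:
  assumes j: "emb M j" and W: "subspace_of W M"
  shows "emb (sub_rep M W e a) j"
proof -
  note D = emb_subspaceD[OF j W]
  have "v \<in> carrier M" if "v \<in> W" for v using D(1) that by blast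
  then show ?thesis
    unfolding emb_def using embD(2,5,7)[OF j] inj_on_subset[OF embD(3)[OF j] D(1)] D(2-4) by simp
qed

lemma subspace_of_sub_rep:
  assumes j: "emb M j" and W: "subspace_of W M"
  shows "subspace_of X (sub_rep M W e a) \<longleftrightarrow> subspace_of X M \<and> X \<subseteq> W"
proof -
  have "W \<subseteq> carrier M" using emb_subspaceD(1)[OF j W] .
  then show ?thesis
    unfolding emb_subspace[OF j] emb_subspace[OF emb_sub_rep[OF j W]] by auto
qed

lemma linear_map_sub_rep:
  assumes M: "linear_map M M s" and W: "W \<subseteq> carrier M" and s: "\<And>w. w \<in> W \<Longrightarrow> s w \<in> W"
  shows "linear_map (sub_rep M W e a) (sub_rep M W e a) s"
proof -
  have "v \<in> carrier M" if "v \<in> W" for v using W that by blast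
  then show ?thesis unfolding linear_map_def using linear_mapD(2,3)[OF M] s by auto
qed

text \<open>The compatibilities along which the clauses of \<open>gk_module\<close> pull back.
  Inverses are listed separately, as \<open>grp P\<close> is a bare monoid record here.\<close>

definition pair_mor :: "('y, 'l) gk_pair \<Rightarrow> ('x, 'k) gk_pair \<Rightarrow> ('l \<Rightarrow> 'k) \<Rightarrow> ('y \<Rightarrow> 'x) \<Rightarrow> bool" where
  "pair_mor P Q e a \<longleftrightarrow>
     e \<in> carrier (grp P) \<rightarrow> carrier (grp Q) \<and> e \<one>\<^bsub>grp P\<^esub> = \<one>\<^bsub>grp Q\<^esub> \<and>
     (\<forall>k\<in>carrier (grp P). \<forall>l\<in>carrier (grp P). e (k \<otimes>\<^bsub>grp P\<^esub> l) = e k \<otimes>\<^bsub>grp Q\<^esub> e l) \<and>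
     (\<forall>k\<in>carrier (grp P). inv\<^bsub>grp P\<^esub> k \<in> carrier (grp P) \<and> e (inv\<^bsub>grp P\<^esub> k) = inv\<^bsub>grp Q\<^esub> e k) \<and>
     continuous_map (ktop P) (ktop Q) e \<and> topspace (ktop P) \<subseteq> carrier (grp P) \<and>
     a \<in> carrier (alg P) \<rightarrow> carrier (alg Q) \<and>
     (\<forall>X\<in>carrier (alg P). \<forall>Y\<in>carrier (alg P). a (X \<oplus>\<^bsub>alg P\<^esub> Y) = a X \<oplus>\<^bsub>alg Q\<^esub> a Y) \<and>
     (\<forall>c. \<forall>X\<in>carrier (alg P). a (c \<odot>\<^bsub>alg P\<^esub> X) = c \<odot>\<^bsub>alg Q\<^esub> a X) \<and>
     (\<forall>X\<in>carrier (alg P). \<forall>Y\<in>carrier (alg P). a (bracket (alg P) X Y) = bracket (alg Q) (a X) (a Y)) \<and>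
     (\<forall>k\<in>carrier (grp P). \<forall>X\<in>carrier (alg P). a (adj P k X) = adj Q (e k) (a X)) \<and>
     (\<forall>\<gamma> X. (\<gamma>, X) \<in> tangents P \<longrightarrow>
       range \<gamma> \<subseteq> carrier (grp P) \<and> X \<in> carrier (alg P) \<and> (\<lambda>t. e (\<gamma> t), a X) \<in> tangents Q)"

abbreviation kmaps :: "('y, 'l) gk_pair \<Rightarrow> ('x, 'k, 'v) gk_rep \<Rightarrow> ('l \<Rightarrow> 'k) \<Rightarrow> ('v \<Rightarrow> 'v) set" where
  "kmaps P M e \<equiv> (\<lambda>l. kact M (e l)) ` carrier (grp P)"

abbreviation gmaps :: "('y, 'l) gk_pair \<Rightarrow> ('x, 'k, 'v) gk_rep \<Rightarrow> ('y \<Rightarrow> 'x) \<Rightarrow> ('v \<Rightarrow> 'v) set" where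
  "gmaps P M a \<equiv> (\<lambda>X. gact M (a X)) ` carrier (alg P)"

lemma rstableD:
  assumes "rstable M (kmaps P M e \<union> gmaps P M a) W"
  shows "subspace_of W M" "l \<in> carrier (grp P) \<Longrightarrow> w \<in> W \<Longrightarrow> kact M (e l) w \<in> W"
    "X \<in> carrier (alg P) \<Longrightarrow> w \<in> W \<Longrightarrow> gact M (a X) w \<in> W"
  using assms unfolding rstable_def ball_Un ball_simps by simp_all

lemma pair_morD:
  assumes "pair_mor P Q e a"
  shows "k \<in> carrier (grp P) \<Longrightarrow> e k \<in> carrier (grp Q)" "e \<one>\<^bsub>grp P\<^esub> = \<one>\<^bsub>grp Q\<^esub>"
    "k \<in> carrier (grp P) \<Longrightarrow> l \<in> carrier (grp P) \<Longrightarrow> e (k \<otimes>\<^bsub>grp P\<^esub> l) = e k \<otimes>\<^bsub>grp Q\<^esub> e l"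
    "k \<in> carrier (grp P) \<Longrightarrow> inv\<^bsub>grp P\<^esub> k \<in> carrier (grp P)"
    "k \<in> carrier (grp P) \<Longrightarrow> e (inv\<^bsub>grp P\<^esub> k) = inv\<^bsub>grp Q\<^esub> e k"
    "continuous_map (ktop P) (ktop Q) e" "topspace (ktop P) \<subseteq> carrier (grp P)"
    "X \<in> carrier (alg P) \<Longrightarrow> a X \<in> carrier (alg Q)"
    "X \<in> carrier (alg P) \<Longrightarrow> Y \<in> carrier (alg P) \<Longrightarrow> a (X \<oplus>\<^bsub>alg P\<^esub> Y) = a X \<oplus>\<^bsub>alg Q\<^esub> a Y"
    "X \<in> carrier (alg P) \<Longrightarrow> Y \<in> carrier (alg P) \<Longrightarrow> a (bracket (alg P) X Y) = bracket (alg Q) (a X) (a Y)"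
    "X \<in> carrier (alg P) \<Longrightarrow> a (c \<odot>\<^bsub>alg P\<^esub> X) = c \<odot>\<^bsub>alg Q\<^esub> a X"
    "k \<in> carrier (grp P) \<Longrightarrow> X \<in> carrier (alg P) \<Longrightarrow> a (adj P k X) = adj Q (e k) (a X)"
    "(\<gamma>, X) \<in> tangents P \<Longrightarrow> range \<gamma> \<subseteq> carrier (grp P)" "(\<gamma>, X) \<in> tangents P \<Longrightarrow> X \<in> carrier (alg P)"
    "(\<gamma>, X) \<in> tangents P \<Longrightarrow> (\<lambda>t. e (\<gamma> t), a X) \<in> tangents Q"
  using assms unfolding pair_mor_def Pi_iff by simp_all

lemma k_moduleD:
  assumes "k_module K T V"
  shows "complex_space V" "k \<in> carrier K \<Longrightarrow> linear_map V V (kact V k)" "v \<in> carrier V \<Longrightarrow> kact V \<one>\<^bsub>K\<^esub> v = v"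
    "k \<in> carrier K \<Longrightarrow> l \<in> carrier K \<Longrightarrow> v \<in> carrier V \<Longrightarrow> kact V (k \<otimes>\<^bsub>K\<^esub> l) v = kact V k (kact V l v)"
    "v \<in> carrier V \<Longrightarrow> \<exists>W. k_subspace K V W \<and> finite_dim V W \<and> v \<in> W"
    "v \<in> carrier V \<Longrightarrow> linear_map V complex_line f \<Longrightarrow> continuous_map T euclidean (\<lambda>k. f (kact V k v))"
  using assms unfolding k_module_def by simp_all

lemma gk_moduleD:
  assumes "gk_module P V"
  shows "k_module (grp P) (ktop P) V" "X \<in> carrier (alg P) \<Longrightarrow> linear_map V V (gact V X)"
    "X \<in> carrier (alg P) \<Longrightarrow> Y \<in> carrier (alg P) \<Longrightarrow> v \<in> carrier V \<Longrightarrow> gact V (X \<oplus>\<^bsub>alg P\<^esub> Y) v = gact V X v \<oplus>\<^bsub>V\<^esub> gact V Y v"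
    "X \<in> carrier (alg P) \<Longrightarrow> v \<in> carrier V \<Longrightarrow> gact V (c \<odot>\<^bsub>alg P\<^esub> X) v = c \<odot>\<^bsub>V\<^esub> gact V X v"
    "X \<in> carrier (alg P) \<Longrightarrow> Y \<in> carrier (alg P) \<Longrightarrow> v \<in> carrier V \<Longrightarrow>
      gact V (bracket (alg P) X Y) v = gact V X (gact V Y v) \<ominus>\<^bsub>V\<^esub> gact V Y (gact V X v)"
    "k \<in> carrier (grp P) \<Longrightarrow> X \<in> carrier (alg P) \<Longrightarrow> v \<in> carrier V \<Longrightarrow>
      gact V (adj P k X) v = kact V k (gact V X (kact V (inv\<^bsub>grp P\<^esub> k) v))"
    "(\<gamma>, X) \<in> tangents P \<Longrightarrow> v \<in> carrier V \<Longrightarrow> linear_map V complex_line f \<Longrightarrow>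
      ((\<lambda>t. f (kact V (\<gamma> t) v)) has_vector_derivative f (gact V X v)) (at 0)"
proof -
  have t: "\<forall>z\<in>tangents P. case z of (\<gamma>, X) \<Rightarrow> \<forall>v\<in>carrier V. \<forall>f. linear_map V complex_line f \<longrightarrow>
      ((\<lambda>t. f (kact V (\<gamma> t) v)) has_vector_derivative f (gact V X v)) (at 0)"
    using assms unfolding gk_module_def by (elim conjE)
  show "((\<lambda>t. f (kact V (\<gamma> t) v)) has_vector_derivative f (gact V X v)) (at 0)"
    if "(\<gamma>, X) \<in> tangents P" "v \<in> carrier V" "linear_map V complex_line f"
    using bspec[OF t that(1)] that(2,3) by simp
qed (use assms in \<open>simp_all add: gk_module_def\<close>)

lemma functional_extension_sub_rep:
  assumes j: "emb M j" and W: "subspace_of W M" and f: "linear_map (sub_rep M W e a) complex_line f"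
  shows "\<exists>g. linear_map M complex_line g \<and> (\<forall>v\<in>W. g v = f v)"
proof (rule functional_extension[OF j W, of f])
  show "f (v \<oplus>\<^bsub>M\<^esub> w) = f v + f w" if "v \<in> W" "w \<in> W" for v w
    using linear_mapD(2)[OF f, of v w] that by (simp add: complex_line_def)
  show "f (c \<odot>\<^bsub>M\<^esub> v) = c * f v" if "v \<in> W" for c v
    using linear_mapD(3)[OF f, of v c] that by (simp add: complex_line_def)
qed blast

text \<open>The algebraic identities restrict at once. Local finiteness comes from intersecting a
  finite-dimensional invariant subspace of \<open>M\<close> with \<open>W\<close>, continuity and
  derivatives from extending functionals on \<open>W\<close> to \<open>M\<close>.\<close>

lemma gk_module_sub_rep:
  fixes M :: "('x, 'k, 'v) gk_rep"
  assumes M: "gk_module Q M" and mor: "pair_mor P Q e a" and st: "rstable M (kmaps P M e \<union> gmaps P M a) W"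
  shows "gk_module P (sub_rep M W e a)"
proof -
  note GM = gk_moduleD[OF M] and KM = k_moduleD[OF gk_moduleD(1)[OF M]]
  obtain j :: "'v \<Rightarrow> 'v \<Rightarrow> complex" where j: "emb M j" by (rule emb_exists[OF KM(1)])
  note W = rstableD(1)[OF st] and sk = rstableD(2)[OF st] and sg = rstableD(3)[OF st]
  have WM: "W \<subseteq> carrier M" using emb_subspaceD(1)[OF j W] .
  then have Wc: "w \<in> carrier M" if "w \<in> W" for w using that by blast
  let ?N = "sub_rep M W e a"
  have jN: "emb ?N j" by (rule emb_sub_rep[OF j W])
  note cs = emb_module[OF jN]
  note e = pair_morD(1)[OF mor] and e1 = pair_morD(2)[OF mor] and em = pair_morD(3)[OF mor] and ei = pair_morD(4,5)[OF mor]
    and ec = pair_morD(6)[OF mor] and tp = pair_morD(7)[OF mor] and a = pair_morD(8)[OF mor] and aa = pair_morD(9,10)[OF mor]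
    and as = pair_morD(11)[OF mor] and ad = pair_morD(12)[OF mor] and tan = pair_morD(13-15)[OF mor]
  have lf: "\<exists>U. k_subspace (grp P) ?N U \<and> finite_dim ?N U \<and> v \<in> U" if v: "v \<in> W" for v
  proof -
    obtain U where U: "k_subspace (grp Q) M U" "finite_dim M U" "v \<in> U" using KM(5)[OF Wc[OF v]] by blast
    have Us: "subspace_of U M" and Uk: "\<And>k u. k \<in> carrier (grp Q) \<Longrightarrow> u \<in> U \<Longrightarrow> kact M k u \<in> U"
      using U(1) unfolding k_subspace_def by blast+
    have s: "subspace_of (U \<inter> W) M"
      unfolding subspace_of_iff[OF KM(1)]
      by (simp add: emb_subspaceD(2-4)[OF j Us] emb_subspaceD(2-4)[OF j W] le_infI1[OF emb_subspaceD(1)[OF j Us]])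
    have s': "subspace_of (U \<inter> W) ?N" unfolding subspace_of_sub_rep[OF j W] using s by blast
    have "fv.fd (j ` U)" using U(2) emb_finite_dim[OF j Us] by blast
    then have "fv.fd (j ` (U \<inter> W))" by (rule fv.fd_subset) blast
    then have "finite_dim ?N (U \<inter> W)" using emb_finite_dim[OF jN s'] by blast
    moreover have "k_subspace (grp P) ?N (U \<inter> W)" unfolding k_subspace_def using s' Uk[OF e] sk by simp
    ultimately show ?thesis using v U(3) by blast
  qed
  have cont: "continuous_map (ktop P) euclidean (\<lambda>k. f (kact ?N k v))"
    if v: "v \<in> W" and f: "linear_map ?N complex_line f" for v f
  proof -
    obtain g where g: "linear_map M complex_line g" "\<forall>v\<in>W. g v = f v"
      using functional_extension_sub_rep[OF j W f] by (elim exE conjE)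
    have "continuous_map (ktop P) euclidean ((\<lambda>k. g (kact M k v)) \<circ> e)"
      by (rule continuous_map_compose[OF ec KM(6)[OF Wc[OF v] g(1)]])
    then show ?thesis
      by (rule continuous_map_eq) (use g(2) sk v tp in \<open>auto simp: subset_iff\<close>)
  qed
  have der: "((\<lambda>t. f (kact ?N (\<gamma> t) v)) has_vector_derivative f (gact ?N X v)) (at 0)"
    if \<gamma>: "(\<gamma>, X) \<in> tangents P" and v: "v \<in> W" and f: "linear_map ?N complex_line f" for \<gamma> X v f
  proof -
    obtain g where g: "linear_map M complex_line g" "\<forall>v\<in>W. g v = f v"
      using functional_extension_sub_rep[OF j W f] by (elim exE conjE)
    have "((\<lambda>t. g (kact M (e (\<gamma> t)) v)) has_vector_derivative g (gact M (a X) v)) (at 0)"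
      by (rule GM(7)[OF tan(3)[OF \<gamma>] Wc[OF v] g(1)])
    moreover have "g (kact M (e (\<gamma> t)) v) = f (kact M (e (\<gamma> t)) v)" for t
      by (rule bspec[OF g(2), OF sk[OF _ v]]) (use tan(1)[OF \<gamma>] in blast)
    moreover have "g (gact M (a X) v) = f (gact M (a X) v)" by (rule bspec[OF g(2), OF sg[OF tan(2)[OF \<gamma>] v]])
    ultimately show ?thesis by simp
  qed
  have K: "k_module (grp P) (ktop P) ?N"
    unfolding k_module_def
  proof (intro conjI ballI allI impI)
    show "linear_map ?N ?N (kact ?N k)" if k: "k \<in> carrier (grp P)" for k
      unfolding sub_rep_simps by (rule linear_map_sub_rep[OF KM(2)[OF e[OF k]] WM sk[OF k]])
    show "kact ?N \<one>\<^bsub>grp P\<^esub> v = v" if "v \<in> carrier ?N" for v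
      using that KM(3)[OF Wc, of v] e1 by simp
    show "kact ?N (k \<otimes>\<^bsub>grp P\<^esub> l) v = kact ?N k (kact ?N l v)"
      if "k \<in> carrier (grp P)" "l \<in> carrier (grp P)" "v \<in> carrier ?N" for k l v
      using that em KM(4)[OF e e Wc] by simp
  qed (use cs lf cont in \<open>simp_all only: sub_rep_simps(1)\<close>)
  show ?thesis
    unfolding gk_module_def
  proof (intro conjI ballI allI impI)
    show "linear_map ?N ?N (gact ?N X)" if X: "X \<in> carrier (alg P)" for X
      unfolding sub_rep_simps by (rule linear_map_sub_rep[OF GM(2)[OF a[OF X]] WM sg[OF X]])
    show "gact ?N (X \<oplus>\<^bsub>alg P\<^esub> Y) v = gact ?N X v \<oplus>\<^bsub>?N\<^esub> gact ?N Y v"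
      if "X \<in> carrier (alg P)" "Y \<in> carrier (alg P)" "v \<in> carrier ?N" for X Y v
      using that aa GM(3)[OF a a Wc] by simp
    show "gact ?N (c \<odot>\<^bsub>alg P\<^esub> X) v = c \<odot>\<^bsub>?N\<^esub> gact ?N X v"
      if "X \<in> carrier (alg P)" "v \<in> carrier ?N" for c X v
      using that as GM(4)[OF a Wc] by simp
    show "gact ?N (bracket (alg P) X Y) v = gact ?N X (gact ?N Y v) \<ominus>\<^bsub>?N\<^esub> gact ?N Y (gact ?N X v)"
      if X: "X \<in> carrier (alg P)" and Y: "Y \<in> carrier (alg P)" and v: "v \<in> carrier ?N" for X Y v
    proof -
      have v': "v \<in> W" using v by simp
      let ?y = "gact M (a Y) (gact M (a X) v)"
      have y: "?y \<in> W" by (rule sg[OF Y sg[OF X v']])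
      \<comment> \<open>Subtraction in the smaller record uses an inverse taken within
        \<open>W\<close>; both inverses are multiplication by \<open>-1\<close>, hence
        equal.\<close>
      have "\<ominus>\<^bsub>?N\<^esub> ?y = \<ominus>\<^bsub>M\<^esub> ?y"
        using a_inv_complex[OF cs, of ?y] a_inv_complex[OF KM(1) Wc[OF y]] y by simp
      then show ?thesis using GM(5)[OF a[OF X] a[OF Y] Wc[OF v']] aa(2)[OF X Y] by (simp add: a_minus_def)
    qed
    show "gact ?N (adj P k X) v = kact ?N k (gact ?N X (kact ?N (inv\<^bsub>grp P\<^esub> k) v))"
      if "k \<in> carrier (grp P)" "X \<in> carrier (alg P)" "v \<in> carrier ?N" for k X v
      using that ad ei(2) GM(6)[OF e a Wc] by simp
    show "case z of (\<gamma>, X) \<Rightarrow> \<forall>v\<in>carrier ?N. \<forall>f. linear_map ?N complex_line f \<longrightarrow>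
        ((\<lambda>t. f (kact ?N (\<gamma> t) v)) has_vector_derivative f (gact ?N X v)) (at 0)"
      if z: "z \<in> tangents P" for z
    proof (cases z)
      case (Pair \<gamma> X)
      then show ?thesis using der[of \<gamma> X] z by simp
    qed
  qed (rule K)
qed

lemma irreducible_sub_rep:
  fixes M :: "('x, 'k, 'v) gk_rep"
  assumes M: "gk_module Q M" and mor: "pair_mor P Q e a" and st: "rstable M (kmaps P M e \<union> gmaps P M a) W"
    and nz: "W \<noteq> {\<zero>\<^bsub>M\<^esub>}"
    and irr: "\<forall>X. rstable M (kmaps P M e \<union> gmaps P M a) X \<and> X \<subseteq> W \<longrightarrow> X = {\<zero>\<^bsub>M\<^esub>} \<or> X = W"
  shows "irreducible_gk_module P (sub_rep M W e a)"
proof -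
  obtain j :: "'v \<Rightarrow> 'v \<Rightarrow> complex" where j: "emb M j" by (rule emb_exists[OF k_moduleD(1)[OF gk_moduleD(1)[OF M]]])
  have W: "subspace_of W M" using st unfolding rstable_def by blast
  have "X = {\<zero>\<^bsub>M\<^esub>} \<or> X = W" if X: "gk_submodule P (sub_rep M W e a) X" for X
  proof -
    have 1: "subspace_of X M \<and> X \<subseteq> W"
      using X unfolding gk_submodule_def k_subspace_def subspace_of_sub_rep[OF j W] by blast
    have 2: "\<forall>k\<in>carrier (grp P). \<forall>w\<in>X. kact M (e k) w \<in> X" "\<forall>Y\<in>carrier (alg P). \<forall>w\<in>X. gact M (a Y) w \<in> X"
      using X unfolding gk_submodule_def k_subspace_def by simp_all
    have "rstable M (kmaps P M e \<union> gmaps P M a) X" unfolding rstable_def ball_Un using 1 2 by simp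
    then show ?thesis using irr 1 by blast
  qed
  then show ?thesis
    unfolding irreducible_gk_module_def sub_rep_simps(1,2) using gk_module_sub_rep[OF M mor st] nz by blast
qed

lemma irreducible_finitely_generated:
  assumes V: "irreducible_gk_module P V"
  shows "finitely_generated P V"
proof -
  have cs: "complex_space V" using V unfolding irreducible_gk_module_def gk_module_def k_module_def by blast
  interpret V: module complex_ring V by fact
  have "carrier V \<noteq> {\<zero>\<^bsub>V\<^esub>}" using V unfolding irreducible_gk_module_def by blast
  then obtain v where v: "v \<in> carrier V" "v \<noteq> \<zero>\<^bsub>V\<^esub>" using V.zero_closed by blast
  have "W = carrier V" if "gk_submodule P V W" "{v} \<subseteq> W" for W
  proof -
    have "W = {\<zero>\<^bsub>V\<^esub>} \<or> W = carrier V" using V that(1) unfolding irreducible_gk_module_def by blast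
    then show ?thesis using v that(2) by blast
  qed
  then show ?thesis unfolding finitely_generated_def using v(1) by (intro exI[of _ "{v}"]) blast
qed

section \<open>Finite multiplicities in terms of hom values\<close>

definition represents :: "'k monoid \<Rightarrow> ('k, 'v, 'z) k_rep_scheme \<Rightarrow> ('v \<Rightarrow> 'i \<Rightarrow> complex) \<Rightarrow> (('i \<Rightarrow> complex) \<Rightarrow> 'i \<Rightarrow> complex) set \<Rightarrow> bool" where
  "represents K N j P \<longleftrightarrow> (\<forall>k\<in>carrier K. \<exists>g\<in>P. \<forall>v\<in>carrier N. g (j v) = j (kact N k v)) \<and>
     (\<forall>g\<in>P. fv.lin g \<and> (\<exists>k\<in>carrier K. \<forall>v\<in>carrier N. g (j v) = j (kact N k v)))"

lemma irreducible_k_module_nonzero: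
  assumes "irreducible_k_module K T \<rho>"
  obtains x0 where "x0 \<in> carrier \<rho>" "x0 \<noteq> \<zero>\<^bsub>\<rho>\<^esub>"
proof -
  have cs: "complex_space \<rho>" using assms unfolding irreducible_k_module_def k_module_def by blast
  interpret R: module complex_ring \<rho> by fact
  have "carrier \<rho> \<noteq> {\<zero>\<^bsub>\<rho>\<^esub>}" using assms unfolding irreducible_k_module_def by blast
  then show ?thesis using that R.zero_closed by blast
qed

text \<open>If some homomorphism \<open>f0\<close> does not vanish at \<open>x0\<close>, then
  \<open>j\<close> after \<open>f0\<close> embeds the irreducible \<rho> onto a subspace \<tau>, and
  evaluation at \<open>x0\<close> carries \<open>Hom(\<rho>, N)\<close> into the hom values of
  \<tau>. Otherwise evaluation, which is injective, has zero image.\<close>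

lemma finite_multiplicitiesI:
  fixes N :: "('k, 'v, 'z) k_rep_scheme" and j :: "'v \<Rightarrow> 'i \<Rightarrow> complex"
  assumes act: "\<forall>k\<in>carrier K. linear_map N N (kact N k)" and j: "emb N j" and P: "represents K N j P"
    and fin: "\<And>\<tau> r. fv.irred P \<tau> \<Longrightarrow> fv.fd \<tau> \<Longrightarrow> \<tau> \<subseteq> j ` carrier N \<Longrightarrow> r \<in> \<tau> \<Longrightarrow> r \<noteq> 0 \<Longrightarrow>
      fv.fd (fv.hom_values P \<tau> (j ` carrier N) r)"
  shows "finite_multiplicities K T N"
  unfolding finite_multiplicities_def
proof (intro allI impI, elim conjE)
  fix \<rho> :: "('k, nat \<Rightarrow> complex) k_rep"
  assume \<rho>: "irreducible_k_module K T \<rho>" and fdr: "finite_dim \<rho> (carrier \<rho>)"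
  let ?H = "k_hom_space K \<rho> N" and ?R = "carrier \<rho>"
  have cs: "complex_space \<rho>" and ract: "\<And>k. k \<in> carrier K \<Longrightarrow> linear_map \<rho> \<rho> (kact \<rho> k)"
    using \<rho> unfolding irreducible_k_module_def k_module_def by auto
  obtain x0 where x0: "x0 \<in> ?R" "x0 \<noteq> \<zero>\<^bsub>\<rho>\<^esub>" by (rule irreducible_k_module_nonzero[OF \<rho>])
  have e: "emb ?H (\<lambda>f. j (f x0))" by (rule emb_hom[OF \<rho> j act x0])
  have H: "f \<in> carrier ?H \<longleftrightarrow> f \<in> extensional ?R \<and> linear_map \<rho> N f \<and>
      (\<forall>k\<in>carrier K. \<forall>w\<in>?R. f (kact \<rho> k w) = kact N k (f w))" for f
    by (simp add: k_hom_space_def)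
  have "fv.fd ((\<lambda>f. j (f x0)) ` carrier ?H)"
  proof (cases "\<forall>f\<in>carrier ?H. j (f x0) = 0")
    case True
    have "fv.fd (fv.span ({} :: ('i \<Rightarrow> complex) set))" by (rule fv.fd_span) simp
    then show ?thesis by (rule fv.fd_subset) (use True in \<open>auto simp: fv.span_empty\<close>)
  next
    case False
    then obtain f0 where f0: "f0 \<in> carrier ?H" "j (f0 x0) \<noteq> 0" by blast
    have l0: "linear_map \<rho> N f0" and k0: "\<And>k w. k \<in> carrier K \<Longrightarrow> w \<in> ?R \<Longrightarrow> f0 (kact \<rho> k w) = kact N k (f0 w)"
      using f0(1) unfolding H by blast+
    define i where "i x = j (f0 x)" for x
    have iadd: "i (x \<oplus>\<^bsub>\<rho>\<^esub> y) = i x + i y" if "x \<in> ?R" "y \<in> ?R" for x y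
      unfolding i_def linear_mapD(2)[OF l0 that] using embD(5)[OF j linear_mapD(1)[OF l0 that(1)] linear_mapD(1)[OF l0 that(2)]] .
    have iscale: "i (c \<odot>\<^bsub>\<rho>\<^esub> x) = fscale c (i x)" if "x \<in> ?R" for c x
      unfolding i_def linear_mapD(3)[OF l0 that] using embD(7)[OF j linear_mapD(1)[OF l0 that]] .
    interpret R: module complex_ring \<rho> by fact
    have rs: "subspace_of {x \<in> ?R. i x \<in> X} \<rho>" if X: "fv.subspace X" for X
      unfolding subspace_of_iff[OF cs]
    proof (intro conjI ballI allI)
      have "i \<zero>\<^bsub>\<rho>\<^esub> = i (0 \<odot>\<^bsub>\<rho>\<^esub> \<zero>\<^bsub>\<rho>\<^esub>)" using R.smult_r_null[of 0] by simp
      also have "\<dots> = 0" using iscale[of "\<zero>\<^bsub>\<rho>\<^esub>" 0] by (simp add: fun_eq_iff)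
      finally show "\<zero>\<^bsub>\<rho>\<^esub> \<in> {x \<in> ?R. i x \<in> X}" using fv.subspace_0[OF X] by simp
      show "x \<oplus>\<^bsub>\<rho>\<^esub> y \<in> {x \<in> ?R. i x \<in> X}" if "x \<in> {x \<in> ?R. i x \<in> X}" "y \<in> {x \<in> ?R. i x \<in> X}" for x y
        using that iadd[of x y] fv.subspace_add[OF X] by simp
      show "c \<odot>\<^bsub>\<rho>\<^esub> x \<in> {x \<in> ?R. i x \<in> X}" if "x \<in> {x \<in> ?R. i x \<in> X}" for c x
        using that iscale[of x c] fv.subspace_scale[OF X] R.smult_closed[of c x] by simp
    qed blast
    have irr: "{x \<in> ?R. i x \<in> X} = {\<zero>\<^bsub>\<rho>\<^esub>} \<or> {x \<in> ?R. i x \<in> X} = ?R"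
      if X: "fv.subspace X" and st: "\<And>k x. k \<in> carrier K \<Longrightarrow> x \<in> ?R \<Longrightarrow> i x \<in> X \<Longrightarrow> i (kact \<rho> k x) \<in> X" for X
    proof -
      have "k_subspace K \<rho> {x \<in> ?R. i x \<in> X}"
        unfolding k_subspace_def using rs[OF X] linear_mapD(1)[OF ract] st by blast
      then show ?thesis using \<rho> unfolding irreducible_k_module_def by blast
    qed
    have i0: "i \<zero>\<^bsub>\<rho>\<^esub> = 0" using rs[OF fv.subspace_single_0] unfolding subspace_of_iff[OF cs] by simp
    have ik: "i (kact \<rho> k x) = j (kact N k (f0 x))" if "k \<in> carrier K" "x \<in> ?R" for k x
      by (simp add: i_def k0[OF that])
    \<comment> \<open>The kernel of \<open>i\<close> is a subrepresentation of \<rho> that misses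
      \<open>x0\<close>.\<close>
    have ker: "{x \<in> ?R. i x \<in> {0}} = {\<zero>\<^bsub>\<rho>\<^esub>}"
    proof -
      have st: "i (kact \<rho> k x) \<in> {0}" if k: "k \<in> carrier K" and x: "x \<in> ?R" "i x \<in> {0}" for k x
      proof -
        have z: "f0 x = \<zero>\<^bsub>N\<^esub>" by (rule emb_inj[OF j linear_mapD(1)[OF l0 x(1)] embD(1)[OF j]]) (use x(2) embD(2)[OF j] in \<open>simp add: i_def\<close>)
        obtain p where p: "p \<in> P" "\<forall>v\<in>carrier N. p (j v) = j (kact N k v)" using P k unfolding represents_def by blast
        have lp: "fv.lin p" using P p(1) unfolding represents_def by blast
        have "j (kact N k \<zero>\<^bsub>N\<^esub>) = p 0" using p(2) embD(1,2)[OF j] by force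
        then show ?thesis using ik[OF k x(1)] z fv.lin_0[OF lp] by simp
      qed
      have "{x \<in> ?R. i x \<in> {0}} = {\<zero>\<^bsub>\<rho>\<^esub>} \<or> {x \<in> ?R. i x \<in> {0}} = ?R"
        by (rule irr[OF fv.subspace_single_0 st])
      then show ?thesis using x0(1) f0(2) unfolding i_def by blast
    qed
    have ei: "emb \<rho> i"
      unfolding emb_def
    proof (intro conjI ballI allI)
      show "inj_on i ?R"
      proof (rule inj_onI)
        fix x y assume x: "x \<in> ?R" and y: "y \<in> ?R" and xy: "i x = i y"
        have y': "(- 1) \<odot>\<^bsub>\<rho>\<^esub> y \<in> ?R" using R.smult_closed[of "- 1" y] y by simp
        have "i (x \<oplus>\<^bsub>\<rho>\<^esub> (- 1) \<odot>\<^bsub>\<rho>\<^esub> y) = 0" using iadd[OF x y'] iscale[OF y, of "- 1"] xy by (simp add: fun_eq_iff)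
        then have "x \<oplus>\<^bsub>\<rho>\<^esub> (- 1) \<odot>\<^bsub>\<rho>\<^esub> y = \<zero>\<^bsub>\<rho>\<^esub>" using ker x y' R.a_closed[OF x y'] by blast
        then have "x = \<ominus>\<^bsub>\<rho>\<^esub> ((- 1) \<odot>\<^bsub>\<rho>\<^esub> y)" using R.minus_equality[OF _ y' x] by simp
        also have "\<dots> = \<ominus>\<^bsub>\<rho>\<^esub> (\<ominus>\<^bsub>\<rho>\<^esub> y)" unfolding a_inv_complex[OF cs y] ..
        finally show "x = y" using y by simp
      qed
      show "x \<oplus>\<^bsub>\<rho>\<^esub> y \<in> ?R" if "x \<in> ?R" "y \<in> ?R" for x y using that by simp
      show "c \<odot>\<^bsub>\<rho>\<^esub> x \<in> ?R" if "x \<in> ?R" for c x using that R.smult_closed[of c x] by simp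
    qed (use i0 iadd iscale in simp_all)
    let ?\<tau> = "i ` ?R"
    have sub\<tau>: "fv.subspace ?\<tau>" using emb_carrier_subspace[OF ei] unfolding emb_subspace[OF ei] by blast
    have iN: "i x \<in> j ` carrier N" if "x \<in> ?R" for x unfolding i_def using linear_mapD(1)[OF l0 that] by blast
    have pi: "\<exists>k\<in>carrier K. \<forall>x\<in>?R. p (i x) = i (kact \<rho> k x)" if p: "p \<in> P" for p
    proof -
      obtain k where k: "k \<in> carrier K" "\<forall>v\<in>carrier N. p (j v) = j (kact N k v)" using P p unfolding represents_def by blast
      have "p (i x) = i (kact \<rho> k x)" if x: "x \<in> ?R" for x
        unfolding ik[OF k(1) x] using k(2) linear_mapD(1)[OF l0 x] by (simp add: i_def)
      then show ?thesis using k(1) by blast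
    qed
    have ip: "\<exists>p\<in>P. \<forall>x\<in>?R. p (i x) = i (kact \<rho> k x)" if k: "k \<in> carrier K" for k
    proof -
      obtain p where p: "p \<in> P" "\<forall>v\<in>carrier N. p (j v) = j (kact N k v)" using P k unfolding represents_def by blast
      have "p (i x) = i (kact \<rho> k x)" if x: "x \<in> ?R" for x
        unfolding ik[OF k x] using p(2) linear_mapD(1)[OF l0 x] by (simp add: i_def)
      then show ?thesis using p(1) by blast
    qed
    have st\<tau>: "fv.stable P ?\<tau>"
      unfolding fv.stable_def
    proof (intro conjI ballI)
      fix p w assume p: "p \<in> P" and w: "w \<in> ?\<tau>"
      obtain k where k: "k \<in> carrier K" "\<forall>x\<in>?R. p (i x) = i (kact \<rho> k x)" using pi[OF p] by blast
      obtain x where x: "x \<in> ?R" "w = i x" using w by blast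
      show "p w \<in> ?\<tau>" using k x linear_mapD(1)[OF ract[OF k(1)] x(1)] by simp
    qed (rule sub\<tau>)
    have "fv.irred P ?\<tau>"
      unfolding fv.irred_def
    proof (intro conjI allI impI)
      show "?\<tau> \<noteq> {0}" using x0(1) f0(2) unfolding i_def by blast
      fix X assume X: "fv.stable P X \<and> X \<subseteq> ?\<tau>"
      have alt: "{x \<in> ?R. i x \<in> X} = {\<zero>\<^bsub>\<rho>\<^esub>} \<or> {x \<in> ?R. i x \<in> X} = ?R"
      proof (rule irr)
        show "fv.subspace X" using X fv.stable_subspace by blast
        show "i (kact \<rho> k x) \<in> X" if k: "k \<in> carrier K" and x: "x \<in> ?R" "i x \<in> X" for k x
        proof -
          obtain p where p: "p \<in> P" "\<forall>x\<in>?R. p (i x) = i (kact \<rho> k x)" using ip[OF k] by blast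
          have "p (i x) \<in> X" using X p(1) x(2) unfolding fv.stable_def by blast
          then show ?thesis using p(2) x(1) by simp
        qed
      qed
      have Xi: "X = i ` {x \<in> ?R. i x \<in> X}" using X by blast
      from alt show "X = {0} \<or> X = ?\<tau>"
      proof
        assume h: "{x \<in> ?R. i x \<in> X} = {\<zero>\<^bsub>\<rho>\<^esub>}"
        have "X = {0}" by (subst Xi, subst h) (simp add: i0)
        then show ?thesis ..
      next
        assume h: "{x \<in> ?R. i x \<in> X} = ?R"
        have "X = ?\<tau>" by (subst Xi, subst h) (rule refl)
        then show ?thesis ..
      qed
    qed (rule st\<tau>)
    moreover have "fv.fd ?\<tau>"
    proof -
      obtain B where B: "finite B" "B \<subseteq> ?R" "?R = complex_span \<rho> B" using fdr unfolding finite_dim_def by blast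
      let ?X = "{x \<in> ?R. i x \<in> fv.span (i ` B)}"
      have "B \<subseteq> ?X" using B(2) fv.span_superset[of "i ` B"] by blast
      then have "complex_span \<rho> B \<subseteq> ?X" unfolding complex_span_def using rs[OF fv.subspace_span] by blast
      then have "?\<tau> \<subseteq> fv.span (i ` B)" using B(3) by blast
      then show ?thesis unfolding fv.fd_def using B(1) by blast
    qed
    moreover have "?\<tau> \<subseteq> j ` carrier N" using iN by blast
    moreover have "i x0 \<in> ?\<tau>" using x0(1) by blast
    moreover have "i x0 \<noteq> 0" using f0(2) by (simp add: i_def)
    ultimately have fd: "fv.fd (fv.hom_values P ?\<tau> (j ` carrier N) (i x0))" by (rule fin)
    have "j (f x0) \<in> fv.hom_values P ?\<tau> (j ` carrier N) (i x0)" if f: "f \<in> carrier ?H" for f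
    proof -
      have lf: "linear_map \<rho> N f" and kf: "\<And>k w. k \<in> carrier K \<Longrightarrow> w \<in> ?R \<Longrightarrow> f (kact \<rho> k w) = kact N k (f w)"
        using f unfolding H by blast+
      obtain g where g': "fv.lin g \<and> (\<forall>x\<in>?R. g (i x) = j (f x))" using linear_map_lift[OF ei j lf] ..
      note g = conjunct1[OF g'] conjunct2[OF g']
      have "fv.equivariant P ?\<tau> (j ` carrier N) g"
        unfolding fv.equivariant_def
      proof (intro conjI ballI)
        show "g w \<in> j ` carrier N" if w: "w \<in> ?\<tau>" for w
        proof -
          obtain x where x: "x \<in> ?R" "w = i x" using w by blast
          have "g (i x) = j (f x)" by (rule bspec[OF g(2) x(1)])
          then show ?thesis using linear_mapD(1)[OF lf x(1)] x(2) by simp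
        qed
        fix p w assume p: "p \<in> P" and w: "w \<in> ?\<tau>"
        obtain x where x: "x \<in> ?R" "w = i x" using w by blast
        obtain k where k: "k \<in> carrier K" "\<forall>v\<in>carrier N. p (j v) = j (kact N k v)" using P p unfolding represents_def by blast
        have "p (i x) = i (kact \<rho> k x)"
          unfolding ik[OF k(1) x(1)] using k(2) linear_mapD(1)[OF l0 x(1)] by (simp add: i_def)
        moreover have "g (i (kact \<rho> k x)) = j (f (kact \<rho> k x))"
          by (rule bspec[OF g(2) linear_mapD(1)[OF ract[OF k(1)] x(1)]])
        moreover have "g (i x) = j (f x)" by (rule bspec[OF g(2) x(1)])
        moreover have "p (j (f x)) = j (kact N k (f x))" by (rule bspec[OF k(2) linear_mapD(1)[OF lf x(1)]])
        ultimately show "g (p w) = p (g w)" unfolding x(2) kf[OF k(1) x(1)] by simp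
      qed (rule g(1))
      moreover have "j (f x0) = g (i x0)" by (rule bspec[OF g(2) x0(1), symmetric])
      ultimately show ?thesis unfolding fv.hom_values_def by blast
    qed
    then show ?thesis by (intro fv.fd_subset[OF fd]) blast
  qed
  then show "finite_dim ?H (carrier ?H)" using emb_finite_dim[OF e emb_carrier_subspace[OF e]] by blast
qed

text \<open>Products of two elements of \<open>P\<close> suffice to represent the group, as needed for \<open>K\<^sub>1 \<times> K\<^sub>2\<close>.\<close>

lemma fd_hom_values_of_multiplicities:
  fixes N :: "('k, 'v, 'z) k_rep_scheme" and j :: "'v \<Rightarrow> 'i \<Rightarrow> complex"
  assumes N: "k_module K T N" and T: "topspace T \<subseteq> carrier K" and j: "emb N j"
    and P1: "\<forall>k\<in>carrier K. \<exists>g\<in>P. \<exists>h\<in>P. \<forall>v\<in>carrier N. g (h (j v)) = j (kact N k v)"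
    and P2: "\<forall>g\<in>P. \<exists>k\<in>carrier K. \<forall>v\<in>carrier N. g (j v) = j (kact N k v)"
    and fm: "finite_multiplicities K T N"
    and E: "fv.irred P E" "fv.fd E" "E \<subseteq> j ` carrier N" and e: "e \<in> E" "e \<noteq> 0"
  shows "fv.fd (fv.hom_values P E (j ` carrier N) e)"
proof -
  note cs = k_moduleD(1)[OF N] and act = k_moduleD(2)[OF N] and J = embD[OF j]
  have stE: "\<And>p w. p \<in> P \<Longrightarrow> w \<in> E \<Longrightarrow> p w \<in> E" and sE: "fv.subspace E"
    using fv.irred_stable[OF E(1)] unfolding fv.stable_def by blast+
  obtain C where C: "finite C" "fv.independent C" "C \<subseteq> E" "fv.span C = E" by (rule fv.fd_basis[OF E(2) sE])
  obtain r where r: "\<And>c. c \<in> C \<Longrightarrow> fv.functional (r c)" "\<And>v. v \<in> E \<Longrightarrow> (\<Sum>c\<in>C. fscale (r c v) c) = v"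
    by (rule fv.coordinates[OF C(2)]) (use C(1,4) in blast)
  obtain b where b: "bij_betw b {0..<card C} C" using ex_bij_betw_nat_finite[OF C(1)] ..
  have bC: "b i \<in> C" if "i < card C" for i using b that unfolding bij_betw_def by auto
  \<comment> \<open>The coordinates of \<open>x\<close> as a sequence: they move \<open>E\<close>
    into the type of sequences, over which \<open>finite_multiplicities\<close> quantifies.\<close>
  define h where "h x = (\<lambda>i. if i < card C then r (b i) x else 0)" for x
  have hadd: "h (x + y) = h x + h y" for x y
    by (rule ext) (simp add: h_def fv.functional_add[OF r(1)[OF bC]])
  have hsc: "h (fscale c x) = fscale c (h x)" for c x
    by (rule ext) (simp add: h_def fv.functional_scale[OF r(1)[OF bC]])
  have h0: "h 0 = 0" by (rule ext) (simp add: h_def fv.functional_0[OF r(1)[OF bC]])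
  have hinj: "x = y" if xy: "x \<in> E" "y \<in> E" "h x = h y" for x y
  proof -
    have "r c x = r c y" if c: "c \<in> C" for c
    proof -
      have "c \<in> b ` {0..<card C}" using b c unfolding bij_betw_def by simp
      then obtain i where "c = b i" "i \<in> {0..<card C}" by (rule imageE)
      then show ?thesis using fun_cong[OF xy(3), of i] by (simp add: h_def)
    qed
    then have "(\<Sum>c\<in>C. fscale (r c x) c) = (\<Sum>c\<in>C. fscale (r c y) c)" by simp
    then show ?thesis unfolding r(2)[OF xy(1)] r(2)[OF xy(2)] .
  qed
  define W where "W = {v \<in> carrier N. j v \<in> E}"
  have Ws: "subspace_of W N" unfolding W_def by (rule emb_preimage_subspace[OF j sE])
  note WD = emb_subspaceD[OF j Ws]
  have WN: "v \<in> carrier N" and WE: "j v \<in> E" if "v \<in> W" for v using that by (simp_all add: W_def)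
  have Wk: "kact N k v \<in> W" if k: "k \<in> carrier K" and v: "v \<in> W" for k v
  proof -
    obtain g h where gh: "g \<in> P" "h \<in> P" "\<forall>v\<in>carrier N. g (h (j v)) = j (kact N k v)" using P1 k by blast
    have "g (h (j v)) \<in> E" by (rule stE[OF gh(1) stE[OF gh(2) WE[OF v]]])
    then show ?thesis using gh(3) WN[OF v] linear_mapD(1)[OF act[OF k] WN[OF v]] by (simp add: W_def)
  qed
  obtain ve where ve: "ve \<in> carrier N" "j ve = e" using e(1) E(3) by blast
  have veW: "ve \<in> W" using ve e(1) by (simp add: W_def)
  define s where "s v = h (j v)" for v
  have sinj: "inj_on s W"
    by (rule inj_onI) (rule emb_inj[OF j WN WN hinj[OF WE WE]]; simp add: s_def)
  have s0: "s \<zero>\<^bsub>N\<^esub> = 0" by (simp add: s_def J(2) h0)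
  have sadd: "s (v \<oplus>\<^bsub>N\<^esub> w) = s v + s w" if "v \<in> W" "w \<in> W" for v w
    by (simp add: s_def J(5)[OF WN WN] that hadd)
  have ssc: "s (c \<odot>\<^bsub>N\<^esub> v) = fscale c (s v)" if "v \<in> W" for c v by (simp add: s_def J(7)[OF WN] that hsc)
  define d where "d = inv_into W s"
  have d: "d (s v) = v" if "v \<in> W" for v unfolding d_def using inv_into_f_f[OF sinj that] .
  \<comment> \<open>The part \<open>W\<close> of \<open>N\<close> that embeds onto \<open>E\<close>,
    carried over by \<open>s\<close>; the action is transported through the inverse
    \<open>d\<close>.\<close>
  define \<rho> :: "('k, nat \<Rightarrow> complex) k_rep" where
    "\<rho> = \<lparr>carrier = s ` W, mult = undefined, one = undefined, zero = 0, add = (+), smult = fscale,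
       kact = (\<lambda>k x. s (kact N k (d x)))\<rparr>"
  have \<rho>: "carrier \<rho> = s ` W" "\<zero>\<^bsub>\<rho>\<^esub> = 0" "x \<oplus>\<^bsub>\<rho>\<^esub> y = x + y" "c \<odot>\<^bsub>\<rho>\<^esub> x = fscale c x" for x y c
    by (simp_all add: \<rho>_def)
  have \<rho>k: "kact \<rho> k (s v) = s (kact N k v)" if "v \<in> W" for k v by (simp add: \<rho>_def d[OF that])
  have id\<rho>: "emb \<rho> (\<lambda>x. x)"
    unfolding emb_def \<rho>
  proof (intro conjI ballI allI)
    show "0 \<in> s ` W" using imageI[OF WD(2), of s] unfolding s0 .
    show "x + y \<in> s ` W" if x: "x \<in> s ` W" and y: "y \<in> s ` W" for x y
    proof -
      obtain v w where vw: "v \<in> W" "x = s v" "w \<in> W" "y = s w" using x y by blast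
      show ?thesis unfolding vw(2,4) sadd[OF vw(1,3), symmetric] using WD(3)[OF vw(1,3)] by blast
    qed
    show "fscale c x \<in> s ` W" if x: "x \<in> s ` W" for c x
    proof -
      obtain v where v: "v \<in> W" "x = s v" using x by blast
      show ?thesis unfolding v(2) ssc[OF v(1), symmetric] using WD(4)[OF v(1)] by blast
    qed
  qed simp_all
  have cr: "subspace_of (carrier \<rho>) \<rho>" by (rule emb_carrier_subspace[OF id\<rho>])
  have fd\<rho>: "finite_dim \<rho> (carrier \<rho>)"
  proof -
    let ?T = "{x. h x \<in> fv.span (h ` C)}"
    have "fv.subspace ?T"
      by (rule fv.subspaceI) (simp_all add: hadd hsc h0 fv.span_zero fv.span_add fv.span_scale)
    moreover have "C \<subseteq> ?T" using fv.span_superset[of "h ` C"] by blast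
    ultimately have "E \<subseteq> ?T" using fv.span_minimal[of C ?T] C(4) by blast
    then have "s ` W \<subseteq> fv.span (h ` C)" using WE by (auto simp: s_def)
    then have "fv.fd (s ` W)" unfolding fv.fd_def using C(1) by blast
    then show ?thesis unfolding emb_finite_dim[OF id\<rho> cr] unfolding image_ident \<rho>(1) .
  qed
  have k\<rho>: "k_subspace K \<rho> (carrier \<rho>)"
    unfolding k_subspace_def
  proof (intro conjI ballI)
    fix k x assume k: "k \<in> carrier K" and x: "x \<in> carrier \<rho>"
    obtain v where v: "v \<in> W" "x = s v" using x unfolding \<rho> by blast
    show "kact \<rho> k x \<in> carrier \<rho>" unfolding v(2) \<rho>k[OF v(1)] unfolding \<rho> using Wk[OF k v(1)] by blast
  qed (rule cr)
  have km: "k_module K T \<rho>"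
    unfolding k_module_def
  proof (intro conjI ballI allI impI)
    show "complex_space \<rho>" by (rule emb_module[OF id\<rho>])
    show "linear_map \<rho> \<rho> (kact \<rho> k)" if k: "k \<in> carrier K" for k
      unfolding linear_map_def
    proof (intro conjI ballI allI)
      show "kact \<rho> k \<in> carrier \<rho> \<rightarrow> carrier \<rho>" using k\<rho> k unfolding k_subspace_def by blast
      show "kact \<rho> k (x \<oplus>\<^bsub>\<rho>\<^esub> y) = kact \<rho> k x \<oplus>\<^bsub>\<rho>\<^esub> kact \<rho> k y" if x: "x \<in> carrier \<rho>" and y: "y \<in> carrier \<rho>" for x y
      proof -
        obtain v w where vw: "v \<in> W" "x = s v" "w \<in> W" "y = s w" using x y unfolding \<rho> by blast
        show ?thesis
          unfolding \<rho> vw(2,4) sadd[OF vw(1,3), symmetric] \<rho>k[OF vw(1)] \<rho>k[OF vw(3)] \<rho>k[OF WD(3)[OF vw(1,3)]]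
            sadd[OF Wk[OF k vw(1)] Wk[OF k vw(3)], symmetric] linear_mapD(2)[OF act[OF k] WN[OF vw(1)] WN[OF vw(3)]] ..
      qed
      show "kact \<rho> k (c \<odot>\<^bsub>\<rho>\<^esub> x) = c \<odot>\<^bsub>\<rho>\<^esub> kact \<rho> k x" if x: "x \<in> carrier \<rho>" for c x
      proof -
        obtain v where v: "v \<in> W" "x = s v" using x unfolding \<rho> by blast
        show ?thesis
          unfolding \<rho> v(2) ssc[OF v(1), symmetric] \<rho>k[OF v(1)] \<rho>k[OF WD(4)[OF v(1)]]
            ssc[OF Wk[OF k v(1)], symmetric] linear_mapD(3)[OF act[OF k] WN[OF v(1)]] ..
      qed
    qed
    show "kact \<rho> \<one>\<^bsub>K\<^esub> x = x" if x: "x \<in> carrier \<rho>" for x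
    proof -
      obtain v where v: "v \<in> W" "x = s v" using x unfolding \<rho> by blast
      show ?thesis unfolding v(2) \<rho>k[OF v(1)] k_moduleD(3)[OF N WN[OF v(1)]] ..
    qed
    show "kact \<rho> (k \<otimes>\<^bsub>K\<^esub> l) x = kact \<rho> k (kact \<rho> l x)"
      if k: "k \<in> carrier K" and l: "l \<in> carrier K" and x: "x \<in> carrier \<rho>" for k l x
    proof -
      obtain v where v: "v \<in> W" "x = s v" using x unfolding \<rho> by blast
      show ?thesis
        unfolding v(2) \<rho>k[OF v(1)] \<rho>k[OF Wk[OF l v(1)]] k_moduleD(4)[OF N k l WN[OF v(1)]] ..
    qed
    show "\<exists>U. k_subspace K \<rho> U \<and> finite_dim \<rho> U \<and> x \<in> U" if "x \<in> carrier \<rho>" for x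
      using k\<rho> fd\<rho> that by blast
    fix x f assume x: "x \<in> carrier \<rho>" and f: "linear_map \<rho> complex_line f"
    obtain v where v: "v \<in> W" "x = s v" using x unfolding \<rho> by blast
    have fs: "\<exists>g. linear_map N complex_line g \<and> (\<forall>v\<in>W. g v = f (s v))"
    proof (rule functional_extension[OF j Ws, of "\<lambda>v. f (s v)"])
      show "f (s (v \<oplus>\<^bsub>N\<^esub> w)) = f (s v) + f (s w)" if vw: "v \<in> W" "w \<in> W" for v w
        using linear_mapD(2)[OF f, of "s v" "s w"] vw unfolding sadd[OF vw] \<rho> by (simp add: complex_line_def)
      show "f (s (c \<odot>\<^bsub>N\<^esub> v)) = c * f (s v)" if v: "v \<in> W" for c v
        using linear_mapD(3)[OF f, of "s v" c] v unfolding ssc[OF v] \<rho> by (simp add: complex_line_def)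
    qed blast
    then obtain g where g: "linear_map N complex_line g" "\<forall>v\<in>W. g v = f (s v)" by blast
    have "continuous_map T euclidean (\<lambda>k. g (kact N k v))" by (rule k_moduleD(6)[OF N WN[OF v(1)] g(1)])
    then show "continuous_map T euclidean (\<lambda>k. f (kact \<rho> k x))"
    proof (rule continuous_map_eq)
      fix k assume "k \<in> topspace T"
      then have k: "k \<in> carrier K" using T by blast
      show "g (kact N k v) = f (kact \<rho> k x)" unfolding v(2) \<rho>k[OF v(1)] by (rule bspec[OF g(2) Wk[OF k v(1)]])
    qed
  qed
  have x0: "s ve \<in> carrier \<rho>" "s ve \<noteq> \<zero>\<^bsub>\<rho>\<^esub>"
  proof -
    show "s ve \<in> carrier \<rho>" unfolding \<rho> using veW by blast
    show "s ve \<noteq> \<zero>\<^bsub>\<rho>\<^esub>" using hinj[OF e(1) fv.subspace_0[OF sE]] e(2) by (auto simp: \<rho> s_def ve(2) h0)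
  qed
  have irr: "irreducible_k_module K T \<rho>"
    unfolding irreducible_k_module_def
  proof (intro conjI allI impI)
    show "carrier \<rho> \<noteq> {\<zero>\<^bsub>\<rho>\<^esub>}" using x0 by blast
    fix X assume X: "k_subspace K \<rho> X"
    have Xs: "subspace_of X \<rho>" and Xk: "\<And>k x. k \<in> carrier K \<Longrightarrow> x \<in> X \<Longrightarrow> kact \<rho> k x \<in> X"
      using X unfolding k_subspace_def by blast+
    note XD = emb_subspaceD[OF id\<rho> Xs, unfolded \<rho>]
    define Y where "Y = {v \<in> W. s v \<in> X}"
    have Ys: "subspace_of Y N"
      unfolding subspace_of_iff[OF cs] Y_def
    proof (intro conjI ballI allI)
      show "{v \<in> W. s v \<in> X} \<subseteq> carrier N" using WN by blast
      show "\<zero>\<^bsub>N\<^esub> \<in> {v \<in> W. s v \<in> X}" using WD(2) XD(2) s0 by simp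
      show "v \<oplus>\<^bsub>N\<^esub> w \<in> {v \<in> W. s v \<in> X}" if "v \<in> {v \<in> W. s v \<in> X}" "w \<in> {v \<in> W. s v \<in> X}" for v w
        using that WD(3)[of v w] XD(3)[of "s v" "s w"] sadd[of v w] by simp
      show "c \<odot>\<^bsub>N\<^esub> v \<in> {v \<in> W. s v \<in> X}" if "v \<in> {v \<in> W. s v \<in> X}" for c v
        using that WD(4)[of v c] XD(4)[of "s v" c] ssc[of v c] by simp
    qed
    have "fv.stable P (j ` Y)"
      unfolding fv.stable_def
    proof (intro conjI ballI)
      show "fv.subspace (j ` Y)" using Ys unfolding emb_subspace[OF j] by blast
      fix p w assume p: "p \<in> P" and w: "w \<in> j ` Y"
      obtain v where v: "v \<in> W" "s v \<in> X" "w = j v" using w by (auto simp: Y_def)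
      obtain k where k: "k \<in> carrier K" "\<forall>v\<in>carrier N. p (j v) = j (kact N k v)" using P2 p by blast
      have "kact N k v \<in> Y" using Wk[OF k(1) v(1)] Xk[OF k(1) v(2)] by (simp add: Y_def \<rho>k[OF v(1)])
      then show "p w \<in> j ` Y" using k(2) WN[OF v(1)] v(3) by simp
    qed
    moreover have "j ` Y \<subseteq> E" using WE by (auto simp: Y_def)
    ultimately have alt: "j ` Y = {0} \<or> j ` Y = E" using E(1) unfolding fv.irred_def by blast
    have XY: "X = s ` Y" using XD(1) by (auto simp: Y_def)
    from alt show "X = {\<zero>\<^bsub>\<rho>\<^esub>} \<or> X = carrier \<rho>"
    proof
      assume h: "j ` Y = {0}"
      have "X = h ` (j ` Y)" unfolding XY by (simp add: s_def image_image)
      then show ?thesis unfolding h \<rho> by (simp add: h0)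
    next
      assume h: "j ` Y = E"
      have "X = h ` (j ` Y)" unfolding XY by (simp add: s_def image_image)
      moreover have "s ` W \<subseteq> h ` E" using WE by (auto simp: s_def)
      ultimately show ?thesis using XD(1) unfolding h \<rho> by blast
    qed
  qed (rule km)
  let ?H = "k_hom_space K \<rho> N"
  have eH: "emb ?H (\<lambda>f. j (f (s ve)))" by (rule emb_hom[OF irr j _ x0]) (use act in blast)
  have "finite_dim ?H (carrier ?H)" using fm irr fd\<rho> unfolding finite_multiplicities_def by blast
  then have fdJ: "fv.fd ((\<lambda>f. j (f (s ve))) ` carrier ?H)"
    using emb_finite_dim[OF eH emb_carrier_subspace[OF eH]] by blast
  have "y \<in> (\<lambda>f. j (f (s ve))) ` carrier ?H" if y: "y \<in> fv.hom_values P E (j ` carrier N) e" for y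
  proof -
    obtain g where g: "y = g e" "fv.equivariant P E (j ` carrier N) g" using y unfolding fv.hom_values_def by blast
    have gl: "fv.lin g" and gN: "\<And>w. w \<in> E \<Longrightarrow> g w \<in> j ` carrier N"
      and gp: "\<And>p w. p \<in> P \<Longrightarrow> w \<in> E \<Longrightarrow> g (p w) = p (g w)"
      using g(2) unfolding fv.equivariant_def by simp_all
    define q where "q = inv_into (carrier N) j"
    have q: "j (q z) = z" "q z \<in> carrier N" if "z \<in> j ` carrier N" for z
      unfolding q_def using f_inv_into_f[OF that] inv_into_into[OF that] by simp_all
    \<comment> \<open>The map \<open>g\<close> read on \<rho> and in \<open>N\<close>. Since each
      \<open>k\<close> acts as a product of two elements of \<open>P\<close>, equivariance of
      \<open>g\<close> under \<open>P\<close> makes it a \<open>K\<close>-homomorphism.\<close>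
    define f where "f = (\<lambda>x\<in>carrier \<rho>. q (g (j (d x))))"
    have fx: "f (s v) = q (g (j v))" if "v \<in> W" for v using that by (simp add: f_def \<rho> d)
    have fN: "f (s v) \<in> carrier N" "j (f (s v)) = g (j v)" if "v \<in> W" for v
      unfolding fx[OF that] by (rule q[OF gN[OF WE[OF that]]])+
    have lf: "linear_map \<rho> N f"
      unfolding linear_map_def \<rho>
    proof (intro conjI ballI allI)
      show "f \<in> s ` W \<rightarrow> carrier N" using fN(1) by blast
      show "f (x + y) = f x \<oplus>\<^bsub>N\<^esub> f y" if x: "x \<in> s ` W" and y: "y \<in> s ` W" for x y
      proof -
        obtain v w where vw: "v \<in> W" "x = s v" "w \<in> W" "y = s w" using x y by blast
        show ?thesis
          unfolding vw(2,4) sadd[OF vw(1,3), symmetric]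
          by (rule emb_inj[OF j])
            (simp_all add: fN WD(3) J(4,5) WN vw(1,3) fv.lin_add[OF gl])
      qed
      show "f (fscale c x) = c \<odot>\<^bsub>N\<^esub> f x" if x: "x \<in> s ` W" for c x
      proof -
        obtain v where v: "v \<in> W" "x = s v" using x by blast
        show ?thesis
          unfolding v(2) ssc[OF v(1), symmetric]
          by (rule emb_inj[OF j])
            (simp_all add: fN WD(4) J(6,7) WN v(1) fv.lin_scale[OF gl])
      qed
    qed
    have "f (kact \<rho> k x) = kact N k (f x)" if k: "k \<in> carrier K" and x: "x \<in> carrier \<rho>" for k x
    proof -
      obtain v where v: "v \<in> W" "x = s v" using x unfolding \<rho> by blast
      obtain a b where ab: "a \<in> P" "b \<in> P" "\<forall>v\<in>carrier N. a (b (j v)) = j (kact N k v)" using P1 k by blast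
      have "j (f (s (kact N k v))) = g (j (kact N k v))" by (rule fN(2)[OF Wk[OF k v(1)]])
      also have "\<dots> = g (a (b (j v)))" using bspec[OF ab(3) WN[OF v(1)]] by simp
      also have "\<dots> = a (b (g (j v)))"
        unfolding gp[OF ab(1) stE[OF ab(2) WE[OF v(1)]]] gp[OF ab(2) WE[OF v(1)]] ..
      also have "\<dots> = a (b (j (f (s v))))" unfolding fN(2)[OF v(1)] ..
      also have "\<dots> = j (kact N k (f (s v)))" by (rule bspec[OF ab(3) fN(1)[OF v(1)]])
      finally have "f (s (kact N k v)) = kact N k (f (s v))"
        by (rule emb_inj[OF j fN(1)[OF Wk[OF k v(1)]] linear_mapD(1)[OF act[OF k] fN(1)[OF v(1)]]])
      then show ?thesis unfolding v(2) \<rho>k[OF v(1)] .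
    qed
    then have "f \<in> carrier ?H" using lf by (simp add: k_hom_space_def f_def)
    moreover have "y = j (f (s ve))" unfolding fN(2)[OF veW] g(1) ve(2) ..
    ultimately show ?thesis unfolding image_iff by (intro bexI[of _ f])
  qed
  then show ?thesis by (intro fv.fd_subset[OF fdJ] subsetI)
qed

section \<open>Modules over a product of pairs\<close>

text \<open>What restriction to one factor uses about the other: the zero of the Lie algebra and the
  identity of the group behave neutrally, and the constant curve with zero velocity is a tangent.
  Compactness is included for the bounds on orbits.\<close>

definition pair_ok :: "('x, 'k) gk_pair \<Rightarrow> bool" where
  "pair_ok P \<longleftrightarrow> group (grp P) \<and> topspace (ktop P) = carrier (grp P) \<and> compact_space (ktop P) \<and>
     \<zero>\<^bsub>alg P\<^esub> \<in> carrier (alg P) \<and>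
     (\<forall>X\<in>carrier (alg P). X \<oplus>\<^bsub>alg P\<^esub> \<zero>\<^bsub>alg P\<^esub> = X \<and> \<zero>\<^bsub>alg P\<^esub> \<oplus>\<^bsub>alg P\<^esub> X = X \<and>
        bracket (alg P) X \<zero>\<^bsub>alg P\<^esub> = \<zero>\<^bsub>alg P\<^esub> \<and> bracket (alg P) \<zero>\<^bsub>alg P\<^esub> X = \<zero>\<^bsub>alg P\<^esub> \<and>
        adj P \<one>\<^bsub>grp P\<^esub> X = X) \<and>
     (\<forall>c. c \<odot>\<^bsub>alg P\<^esub> \<zero>\<^bsub>alg P\<^esub> = \<zero>\<^bsub>alg P\<^esub>) \<and> (\<forall>k\<in>carrier (grp P). adj P k \<zero>\<^bsub>alg P\<^esub> = \<zero>\<^bsub>alg P\<^esub>) \<and>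
     (\<lambda>t. \<one>\<^bsub>grp P\<^esub>, \<zero>\<^bsub>alg P\<^esub>) \<in> tangents P \<and>
     (\<forall>\<gamma> X. (\<gamma>, X) \<in> tangents P \<longrightarrow> range \<gamma> \<subseteq> carrier (grp P) \<and> X \<in> carrier (alg P))"

lemma pair_okD:
  assumes "pair_ok P"
  shows "group (grp P)" "topspace (ktop P) = carrier (grp P)" "compact_space (ktop P)"
    "\<zero>\<^bsub>alg P\<^esub> \<in> carrier (alg P)"
    "X \<in> carrier (alg P) \<Longrightarrow> X \<oplus>\<^bsub>alg P\<^esub> \<zero>\<^bsub>alg P\<^esub> = X" "X \<in> carrier (alg P) \<Longrightarrow> \<zero>\<^bsub>alg P\<^esub> \<oplus>\<^bsub>alg P\<^esub> X = X"
    "X \<in> carrier (alg P) \<Longrightarrow> bracket (alg P) X \<zero>\<^bsub>alg P\<^esub> = \<zero>\<^bsub>alg P\<^esub>"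
    "X \<in> carrier (alg P) \<Longrightarrow> bracket (alg P) \<zero>\<^bsub>alg P\<^esub> X = \<zero>\<^bsub>alg P\<^esub>"
    "X \<in> carrier (alg P) \<Longrightarrow> adj P \<one>\<^bsub>grp P\<^esub> X = X"
    "c \<odot>\<^bsub>alg P\<^esub> \<zero>\<^bsub>alg P\<^esub> = \<zero>\<^bsub>alg P\<^esub>" "k \<in> carrier (grp P) \<Longrightarrow> adj P k \<zero>\<^bsub>alg P\<^esub> = \<zero>\<^bsub>alg P\<^esub>"
    "(\<lambda>t. \<one>\<^bsub>grp P\<^esub>, \<zero>\<^bsub>alg P\<^esub>) \<in> tangents P"
    "(\<gamma>, Y) \<in> tangents P \<Longrightarrow> range \<gamma> \<subseteq> carrier (grp P)" "(\<gamma>, Y) \<in> tangents P \<Longrightarrow> Y \<in> carrier (alg P)"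
  using assms unfolding pair_ok_def by simp_all

lemma pair_product_simps [simp]:
  "grp (pair_product P Q) = grp P \<times>\<times> grp Q" "ktop (pair_product P Q) = prod_topology (ktop P) (ktop Q)"
  "carrier (alg (pair_product P Q)) = carrier (alg P) \<times> carrier (alg Q)"
  "(X, Y) \<oplus>\<^bsub>alg (pair_product P Q)\<^esub> (X', Y') = (X \<oplus>\<^bsub>alg P\<^esub> X', Y \<oplus>\<^bsub>alg Q\<^esub> Y')"
  "c \<odot>\<^bsub>alg (pair_product P Q)\<^esub> (X, Y) = (c \<odot>\<^bsub>alg P\<^esub> X, c \<odot>\<^bsub>alg Q\<^esub> Y)"
  "bracket (alg (pair_product P Q)) (X, Y) (X', Y') = (bracket (alg P) X X', bracket (alg Q) Y Y')"
  "adj (pair_product P Q) (k, l) (X, Y) = (adj P k X, adj Q l Y)"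
  by (simp_all add: pair_product_def lie_product_def)

lemma pair_product_tangents:
  "(\<gamma>, X) \<in> tangents P \<Longrightarrow> (\<delta>, Y) \<in> tangents Q \<Longrightarrow> (\<lambda>t. (\<gamma> t, \<delta> t), (X, Y)) \<in> tangents (pair_product P Q)"
  by (auto simp: pair_product_def)

text \<open>The second factor stays at the identity and at zero, where all its operations are
  neutral; a tangent is paired with the constant curve.\<close>

lemma pair_mor_left:
  assumes P: "pair_ok P" and Q: "pair_ok Q"
  shows "pair_mor P (pair_product P Q) (\<lambda>k. (k, \<one>\<^bsub>grp Q\<^esub>)) (\<lambda>X. (X, \<zero>\<^bsub>alg Q\<^esub>))"
proof -
  note p = pair_okD[OF P] and q = pair_okD[OF Q]
  interpret K: group "grp P" by (rule p(1))
  interpret L: group "grp Q" by (rule q(1))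
  have "continuous_map (ktop P) (prod_topology (ktop P) (ktop Q)) (\<lambda>k. (k, \<one>\<^bsub>grp Q\<^esub>))"
    by (rule continuous_map_pairedI) (simp_all add: q(2))
  then show ?thesis
    unfolding pair_mor_def pair_product_simps
    by (intro conjI ballI allI impI)
      (simp_all add: p(2) q(4,5,7,9,10) q(5)[OF q(4)] q(7)[OF q(4)] inv_DirProd[OF p(1) q(1)] q(11)
        pair_product_tangents[OF _ q(12)] p(13,14))
qed

lemma pair_mor_right:
  assumes P: "pair_ok P" and Q: "pair_ok Q"
  shows "pair_mor Q (pair_product P Q) (\<lambda>l. (\<one>\<^bsub>grp P\<^esub>, l)) (\<lambda>Y. (\<zero>\<^bsub>alg P\<^esub>, Y))"
proof -
  note p = pair_okD[OF P] and q = pair_okD[OF Q]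
  interpret K: group "grp P" by (rule p(1))
  interpret L: group "grp Q" by (rule q(1))
  have "continuous_map (ktop Q) (prod_topology (ktop P) (ktop Q)) (\<lambda>l. (\<one>\<^bsub>grp P\<^esub>, l))"
    by (rule continuous_map_pairedI) (simp_all add: p(2))
  then show ?thesis
    unfolding pair_mor_def pair_product_simps
    by (intro conjI ballI allI impI)
      (simp_all add: q(2) p(4,5,7,9,10) p(5)[OF p(4)] p(7)[OF p(4)] inv_DirProd[OF p(1) q(1)] p(11)
        pair_product_tangents[OF p(12)] q(13,14))
qed

locale pair_module =
  fixes P :: "('x, 'k) gk_pair" and Q :: "('y, 'l) gk_pair" and M :: "('x \<times> 'y, 'k \<times> 'l, 'v) gk_rep"
  assumes P: "pair_ok P" and Q: "pair_ok Q" and M: "gk_module (pair_product P Q) M"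
begin

abbreviation e1 where "e1 \<equiv> \<lambda>k. (k, \<one>\<^bsub>grp Q\<^esub>)"
abbreviation e2 where "e2 \<equiv> \<lambda>l. (\<one>\<^bsub>grp P\<^esub>, l)"
abbreviation a1 where "a1 \<equiv> \<lambda>X. (X, \<zero>\<^bsub>alg Q\<^esub>)"
abbreviation a2 where "a2 \<equiv> \<lambda>Y. (\<zero>\<^bsub>alg P\<^esub>, Y)"
abbreviation S1 where "S1 \<equiv> kmaps P M e1 \<union> gmaps P M a1"
abbreviation S2 where "S2 \<equiv> kmaps Q M e2 \<union> gmaps Q M a2"

lemmas p = pair_okD[OF P] and q = pair_okD[OF Q] and GM = gk_moduleD[OF M] and KM = k_moduleD[OF gk_moduleD(1)[OF M]]

sublocale K: group "grp P" by (rule p(1))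
sublocale L: group "grp Q" by (rule q(1))

lemma kl: "k \<in> carrier (grp P) \<Longrightarrow> l \<in> carrier (grp Q) \<Longrightarrow> linear_map M M (kact M (k, l))"
  using KM(2)[of "(k, l)"] by simp

lemma gl: "X \<in> carrier (alg P) \<Longrightarrow> Y \<in> carrier (alg Q) \<Longrightarrow> linear_map M M (gact M (X, Y))"
  using GM(2)[of "(X, Y)"] by simp

lemma linear_S1: "\<forall>s\<in>S1. linear_map M M s" and linear_S2: "\<forall>s\<in>S2. linear_map M M s"
  by (simp_all add: ball_Un kl gl p(4) q(4))

lemma S_members:
  "k \<in> carrier (grp P) \<Longrightarrow> kact M (e1 k) \<in> S1" "X \<in> carrier (alg P) \<Longrightarrow> gact M (a1 X) \<in> S1"
  "l \<in> carrier (grp Q) \<Longrightarrow> kact M (e2 l) \<in> S2" "Y \<in> carrier (alg Q) \<Longrightarrow> gact M (a2 Y) \<in> S2"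
  by simp_all

lemma kmul:
  assumes "k \<in> carrier (grp P)" "k' \<in> carrier (grp P)" "l \<in> carrier (grp Q)" "l' \<in> carrier (grp Q)" "v \<in> carrier M"
  shows "kact M (k, l) (kact M (k', l') v) = kact M (k \<otimes>\<^bsub>grp P\<^esub> k', l \<otimes>\<^bsub>grp Q\<^esub> l') v"
  using KM(4)[of "(k, l)" "(k', l')" v] assms by simp

lemma kone: "v \<in> carrier M \<Longrightarrow> kact M (\<one>\<^bsub>grp P\<^esub>, \<one>\<^bsub>grp Q\<^esub>) v = v"
  using KM(3)[of v] by simp

lemma kact_split:
  assumes "k \<in> carrier (grp P)" "l \<in> carrier (grp Q)" "v \<in> carrier M"
  shows "kact M (k, l) v = kact M (e1 k) (kact M (e2 l) v)" "kact M (k, l) v = kact M (e2 l) (kact M (e1 k) v)"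
  using kmul[of k "\<one>\<^bsub>grp P\<^esub>" "\<one>\<^bsub>grp Q\<^esub>" l v] kmul[of "\<one>\<^bsub>grp P\<^esub>" k l "\<one>\<^bsub>grp Q\<^esub>" v] assms by simp_all

lemma gact_split:
  assumes "X \<in> carrier (alg P)" "Y \<in> carrier (alg Q)" "v \<in> carrier M"
  shows "gact M (X, Y) v = gact M (a1 X) v \<oplus>\<^bsub>M\<^esub> gact M (a2 Y) v"
  using GM(3)[of "(X, \<zero>\<^bsub>alg Q\<^esub>)" "(\<zero>\<^bsub>alg P\<^esub>, Y)" v] assms p(4,5) q(4,6) by simp

lemma gact_zero:
  assumes v: "v \<in> carrier M"
  shows "gact M (\<zero>\<^bsub>alg P\<^esub>, \<zero>\<^bsub>alg Q\<^esub>) v = \<zero>\<^bsub>M\<^esub>"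
proof -
  interpret V: module complex_ring M by (rule KM(1))
  have g: "gact M (\<zero>\<^bsub>alg P\<^esub>, \<zero>\<^bsub>alg Q\<^esub>) v \<in> carrier M" by (rule linear_mapD(1)[OF gl[OF p(4) q(4)] v])
  have "gact M (\<zero>\<^bsub>alg P\<^esub>, \<zero>\<^bsub>alg Q\<^esub>) v = 0 \<odot>\<^bsub>M\<^esub> gact M (\<zero>\<^bsub>alg P\<^esub>, \<zero>\<^bsub>alg Q\<^esub>) v"
    using GM(4)[of "(\<zero>\<^bsub>alg P\<^esub>, \<zero>\<^bsub>alg Q\<^esub>)" v 0] v p(4,10) q(4,10) by simp
  also have "\<dots> = \<zero>\<^bsub>M\<^esub>" using V.smult_l_null[OF g] by simp
  finally show ?thesis .
qed

text \<open>Covariance of the Lie algebra action under conjugation, for an element fixed by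
  \<open>adj\<close>. A group element of one factor and a Lie algebra element of the other form such
  a pair.\<close>

lemma commute_gk:
  assumes z: "kl \<in> carrier (grp P) \<times> carrier (grp Q)" "Z \<in> carrier (alg P) \<times> carrier (alg Q)" "adj (pair_product P Q) kl Z = Z"
    and v: "v \<in> carrier M"
  shows "gact M Z (kact M kl v) = kact M kl (gact M Z v)"
proof -
  obtain k l where kl': "kl = (k, l)" "k \<in> carrier (grp P)" "l \<in> carrier (grp Q)" using z(1) by blast
  have c: "kact M kl v \<in> carrier M" unfolding kl'(1) by (rule linear_mapD(1)[OF kl[OF kl'(2,3)] v])
  have "inv\<^bsub>grp P \<times>\<times> grp Q\<^esub> kl = (inv\<^bsub>grp P\<^esub> k, inv\<^bsub>grp Q\<^esub> l)" unfolding kl'(1) by (rule inv_DirProd[OF p(1) q(1) kl'(2,3)])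
  then have "kact M (inv\<^bsub>grp P \<times>\<times> grp Q\<^esub> kl) (kact M kl v) = v"
    using kmul[of "inv\<^bsub>grp P\<^esub> k" k "inv\<^bsub>grp Q\<^esub> l" l v] kl' v kone[OF v] by simp
  then show ?thesis using GM(6)[of kl Z "kact M kl v"] z c by simp
qed

lemma commute:
  assumes s: "s \<in> S1" and u: "u \<in> S2" and v: "v \<in> carrier M"
  shows "u (s v) = s (u v)"
proof -
  have kk: "kact M (e2 l) (kact M (e1 k) v) = kact M (e1 k) (kact M (e2 l) v)"
    if "k \<in> carrier (grp P)" "l \<in> carrier (grp Q)" for k l
    using kact_split[OF that v] by simp
  have kg: "gact M (a2 Y) (kact M (e1 k) v) = kact M (e1 k) (gact M (a2 Y) v)"
    if "k \<in> carrier (grp P)" "Y \<in> carrier (alg Q)" for k Y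
    by (rule commute_gk) (simp_all add: that p(4,11) q(9) v)
  have gk: "kact M (e2 l) (gact M (a1 X) v) = gact M (a1 X) (kact M (e2 l) v)"
    if "X \<in> carrier (alg P)" "l \<in> carrier (grp Q)" for X l
    by (rule commute_gk[symmetric]) (simp_all add: that q(4,11) p(9) v)
  have gg: "gact M (a2 Y) (gact M (a1 X) v) = gact M (a1 X) (gact M (a2 Y) v)"
    if X: "X \<in> carrier (alg P)" and Y: "Y \<in> carrier (alg Q)" for X Y
  proof -
    obtain j :: "'v \<Rightarrow> 'v \<Rightarrow> complex" where j: "emb M j" by (rule emb_exists[OF KM(1)])
    let ?x = "gact M (a1 X) (gact M (a2 Y) v)" and ?y = "gact M (a2 Y) (gact M (a1 X) v)"
    note l1 = linear_mapD(1)[OF gl[OF X q(4)]] and l2 = linear_mapD(1)[OF gl[OF p(4) Y]]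
    have c: "?x \<in> carrier M" "?y \<in> carrier M" by (rule l1[OF l2[OF v]]) (rule l2[OF l1[OF v]])
    \<comment> \<open>The bracket of \<open>(X, 0)\<close> and \<open>(0, Y)\<close> is the zero
      element, which acts as zero.\<close>
    have "?x \<ominus>\<^bsub>M\<^esub> ?y = \<zero>\<^bsub>M\<^esub>"
      using GM(5)[of "a1 X" "a2 Y" v] X Y v p(4,7) q(4,8) gact_zero[OF v] by simp
    then have "?x \<oplus>\<^bsub>M\<^esub> (- 1) \<odot>\<^bsub>M\<^esub> ?y = \<zero>\<^bsub>M\<^esub>" unfolding a_minus_def a_inv_complex[OF KM(1) c(2)] .
    then have "j ?x + fscale (- 1) (j ?y) = 0"
      using embD(5)[OF j c(1) embD(6)[OF j c(2)], of "- 1"] embD(7)[OF j c(2), of "- 1"] embD(2)[OF j] by simp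
    then have "j ?x = j ?y" by (simp add: fun_eq_iff)
    then show ?thesis by (rule emb_inj[OF j c, symmetric])
  qed
  have sc: "(\<exists>k\<in>carrier (grp P). s = kact M (e1 k)) \<or> (\<exists>X\<in>carrier (alg P). s = gact M (a1 X))"
    using s unfolding Un_iff image_iff .
  have uc: "(\<exists>l\<in>carrier (grp Q). u = kact M (e2 l)) \<or> (\<exists>Y\<in>carrier (alg Q). u = gact M (a2 Y))"
    using u unfolding Un_iff image_iff .
  from sc uc show ?thesis
    by (elim disjE bexE) (simp_all only: kk kg gk gg)
qed

text \<open>\<open>(k, l)\<close> is the product of \<open>(k, 1)\<close> and \<open>(1, l)\<close>,
  and \<open>(X, Y)\<close> is the sum of \<open>(X, 0)\<close> and \<open>(0, Y)\<close>. Hence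
  irreducibility of \<open>M\<close> over the product is irreducibility under
  \<open>S1 \<union> S2\<close>.\<close>

lemma submodule_of_rstable:
  assumes X: "rstable M (S1 \<union> S2) X"
  shows "gk_submodule (pair_product P Q) M X"
proof -
  obtain j :: "'v \<Rightarrow> 'v \<Rightarrow> complex" where j: "emb M j" by (rule emb_exists[OF KM(1)])
  note Xs = conjunct1[OF X[unfolded rstable_def]] and X2 = conjunct2[OF X[unfolded rstable_def]]
  have st: "s w \<in> X" if "s \<in> S1 \<union> S2" "w \<in> X" for s w using bspec[OF bspec[OF X2 that(1)] that(2)] .
  note XD = emb_subspaceD[OF j Xs]
  have k: "kact M (k, l) w \<in> X" if kl: "k \<in> carrier (grp P)" "l \<in> carrier (grp Q)" "w \<in> X" for k l w
  proof -
    have w: "w \<in> carrier M" using that(3) XD(1) by blast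
    show ?thesis unfolding kact_split(1)[OF kl(1,2) w] by (rule st[OF UnI1[OF S_members(1)[OF kl(1)]] st[OF UnI2[OF S_members(3)[OF kl(2)]] kl(3)]])
  qed
  have g: "gact M (Y, Z) w \<in> X" if YZ: "Y \<in> carrier (alg P)" "Z \<in> carrier (alg Q)" "w \<in> X" for Y Z w
  proof -
    have w: "w \<in> carrier M" using that(3) XD(1) by blast
    show ?thesis unfolding gact_split[OF YZ(1,2) w] by (rule XD(3)[OF st[OF UnI1[OF S_members(2)[OF YZ(1)]] YZ(3)] st[OF UnI2[OF S_members(4)[OF YZ(2)]] YZ(3)]])
  qed
  show ?thesis unfolding gk_submodule_def k_subspace_def using Xs k g by auto
qed

end

section \<open>Realizing the algebraic tensor product\<close>

lemma free_space_simps [simp]: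
  "carrier (free_space S) = {\<phi>. finite {p. \<phi> p \<noteq> 0} \<and> {p. \<phi> p \<noteq> 0} \<subseteq> S}" "\<zero>\<^bsub>free_space S\<^esub> = 0"
  "\<phi> \<oplus>\<^bsub>free_space S\<^esub> \<psi> = \<phi> + \<psi>" "c \<odot>\<^bsub>free_space S\<^esub> \<phi> = fscale c \<phi>"
  by (simp_all add: free_space_def fun_eq_iff)

lemma emb_free_space: "emb (free_space S) (\<lambda>\<phi>. \<phi>)"
proof -
  have "{p. (\<phi> + \<psi>) p \<noteq> 0} \<subseteq> {p. \<phi> p \<noteq> 0} \<union> {p. \<psi> p \<noteq> 0}" for \<phi> \<psi> :: "'a \<Rightarrow> complex" by auto
  then have "\<phi> + \<psi> \<in> carrier (free_space S)" if "\<phi> \<in> carrier (free_space S)" "\<psi> \<in> carrier (free_space S)" for \<phi> \<psi>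
    using that unfolding free_space_simps by (blast intro: finite_subset)
  moreover have "{p. fscale c \<phi> p \<noteq> 0} \<subseteq> {p. \<phi> p \<noteq> 0}" for c and \<phi> :: "'a \<Rightarrow> complex" by auto
  then have "fscale c \<phi> \<in> carrier (free_space S)" if "\<phi> \<in> carrier (free_space S)" for c \<phi>
    using that unfolding free_space_simps by (blast intro: finite_subset)
  moreover have "0 \<in> carrier (free_space S)" by simp
  ultimately show ?thesis unfolding emb_def free_space_simps(2-4) by simp
qed

lemma single_free_space: "p \<in> S \<Longrightarrow> single p \<in> carrier (free_space S)"
proof -
  assume "p \<in> S"
  moreover have "{q. single p q \<noteq> 0} = {p}" by (auto simp: single_def)
  ultimately show ?thesis by simp
qed

lemma sum_apply: "(\<Sum>p\<in>A. f p) q = (\<Sum>p\<in>A. f p q :: complex)"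
  by (induction A rule: infinite_finite_induct) simp_all

lemma finite_expansion:
  assumes "finite {p. \<phi> p \<noteq> 0}"
  shows "(\<Sum>p | \<phi> p \<noteq> 0. fscale (\<phi> p) (single p)) = \<phi>"
proof
  fix q
  have "(\<Sum>p | \<phi> p \<noteq> 0. fscale (\<phi> p) (single p)) q = (\<Sum>p | \<phi> p \<noteq> 0. if p = q then \<phi> q else 0)"
    unfolding sum_apply by (rule sum.cong) (auto simp: single_def)
  also have "\<dots> = \<phi> q" using assms by (simp add: sum.delta')
  finally show "(\<Sum>p | \<phi> p \<noteq> 0. fscale (\<phi> p) (single p)) q = \<phi> q" .
qed

lemma complex_span_eq:
  assumes j: "emb V j" and B: "B \<subseteq> carrier V"
  shows "j ` complex_span V B = fv.span (j ` B)"
proof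
  have V: "subspace_of (carrier V) V" by (rule emb_carrier_subspace[OF j])
  have sub: "fv.span (j ` B) \<subseteq> j ` carrier V"
    by (rule fv.span_minimal) (use V B in \<open>auto simp: emb_subspace[OF j]\<close>)
  let ?W = "{v \<in> carrier V. j v \<in> fv.span (j ` B)}"
  have "subspace_of ?W V" by (rule emb_preimage_subspace[OF j fv.subspace_span])
  moreover have "B \<subseteq> ?W" using B fv.span_superset[of "j ` B"] by blast
  ultimately have "complex_span V B \<subseteq> ?W" unfolding complex_span_def by blast
  then show "j ` complex_span V B \<subseteq> fv.span (j ` B)" by blast
  show "fv.span (j ` B) \<subseteq> j ` complex_span V B"
  proof
    fix x assume x: "x \<in> fv.span (j ` B)"
    then obtain v where v: "v \<in> carrier V" "x = j v" using sub by blast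
    have "v \<in> W" if W: "subspace_of W V \<and> B \<subseteq> W" for W
    proof -
      have WV: "W \<subseteq> carrier V" "fv.subspace (j ` W)" using W unfolding emb_subspace[OF j] by blast+
      have "fv.span (j ` B) \<subseteq> j ` W" by (rule fv.span_minimal[OF _ WV(2)]) (use W in blast)
      then have "j v \<in> j ` W" using x v(2) by blast
      then show ?thesis using inj_on_image_mem_iff[OF embD(3)[OF j] v(1) WV(1)] by blast
    qed
    then have "v \<in> complex_span V B" unfolding complex_span_def by blast
    then show "x \<in> j ` complex_span V B" using v(2) by blast
  qed
qed

text \<open>Compares the quotient of the free space by the relations with an internal tensor product
  \<open>U\<close>, through the linear map \<Phi> that sends a pair to its product. The internal
  \<open>t\<close> takes the vector of the second module first, since in the factorization the hom
  space comes first and carries the second factor.\<close>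

locale tensor_model =
  fixes M1 :: "(complex, 'v, 'x) module_scheme" and M2 :: "(complex, 'w, 'y) module_scheme"
    and j1 :: "'v \<Rightarrow> 'i \<Rightarrow> complex" and j2 :: "'w \<Rightarrow> 'i \<Rightarrow> complex" and t and U
  assumes j1: "emb M1 j1" and j2: "emb M2 j2" and t: "fv.tensor t (j2 ` carrier M2) (j1 ` carrier M1) U"
begin

abbreviation F where "F \<equiv> tensor_free M1 M2"
abbreviation N where "N \<equiv> tensor_relations M1 M2"

definition pure where "pure p = t (j2 (snd p)) (j1 (fst p))"

definition \<Phi> where "\<Phi> \<phi> = (\<Sum>p | \<phi> p \<noteq> 0. fscale (\<phi> p) (pure p))"

lemma bil: "fv.bilin t (j2 ` carrier M2) (j1 ` carrier M1)" and
  spanU: "fv.span {t x y | x y. x \<in> j2 ` carrier M2 \<and> y \<in> j1 ` carrier M1} = U"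
  using t unfolding fv.tensor_def by blast+

lemma pure_bil:
  assumes "v \<in> carrier M1" "w \<in> carrier M2"
  shows "v' \<in> carrier M1 \<Longrightarrow> pure (v \<oplus>\<^bsub>M1\<^esub> v', w) = pure (v, w) + pure (v', w)"
    "w' \<in> carrier M2 \<Longrightarrow> pure (v, w \<oplus>\<^bsub>M2\<^esub> w') = pure (v, w) + pure (v, w')"
    "pure (c \<odot>\<^bsub>M1\<^esub> v, w) = fscale c (pure (v, w))" "pure (v, c \<odot>\<^bsub>M2\<^esub> w) = fscale c (pure (v, w))"
proof -
  have a: "j1 v \<in> j1 ` carrier M1" "j2 w \<in> j2 ` carrier M2" using assms by blast+
  note bb = fv.bilinD[OF bil a(2,1)]
  show "pure (v \<oplus>\<^bsub>M1\<^esub> v', w) = pure (v, w) + pure (v', w)" if "v' \<in> carrier M1"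
    using bb(3)[OF imageI[OF that]] embD(5)[OF j1 assms(1) that] by (simp add: pure_def)
  show "pure (v, w \<oplus>\<^bsub>M2\<^esub> w') = pure (v, w) + pure (v, w')" if "w' \<in> carrier M2"
    using bb(1)[OF imageI[OF that]] embD(5)[OF j2 assms(2) that] by (simp add: pure_def)
  show "pure (c \<odot>\<^bsub>M1\<^esub> v, w) = fscale c (pure (v, w))"
    using bb(4) embD(7)[OF j1 assms(1)] by (simp add: pure_def)
  show "pure (v, c \<odot>\<^bsub>M2\<^esub> w) = fscale c (pure (v, w))"
    using bb(2) embD(7)[OF j2 assms(2)] by (simp add: pure_def)
qed

lemma \<Phi>_superset:
  assumes "finite A" "{p. \<phi> p \<noteq> 0} \<subseteq> A"
  shows "\<Phi> \<phi> = (\<Sum>p\<in>A. fscale (\<phi> p) (pure p))"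
  unfolding \<Phi>_def by (rule sum.mono_neutral_left) (use assms in \<open>auto simp: fun_eq_iff\<close>)

lemma \<Phi>_add:
  assumes "\<phi> \<in> carrier F" "\<psi> \<in> carrier F"
  shows "\<Phi> (\<phi> + \<psi>) = \<Phi> \<phi> + \<Phi> \<psi>"
proof -
  let ?A = "{p. \<phi> p \<noteq> 0} \<union> {p. \<psi> p \<noteq> 0}"
  have A: "finite ?A" using assms by simp
  have "\<Phi> (\<phi> + \<psi>) = (\<Sum>p\<in>?A. fscale ((\<phi> + \<psi>) p) (pure p))" by (rule \<Phi>_superset[OF A]) auto
  also have "\<dots> = (\<Sum>p\<in>?A. fscale (\<phi> p) (pure p)) + (\<Sum>p\<in>?A. fscale (\<psi> p) (pure p))"
    unfolding sum.distrib[symmetric] by (rule sum.cong) (simp_all add: fun_eq_iff algebra_simps)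
  also have "\<dots> = \<Phi> \<phi> + \<Phi> \<psi>" by (subst (1 2) \<Phi>_superset[OF A]) auto
  finally show ?thesis .
qed

lemma \<Phi>_scale:
  assumes "\<phi> \<in> carrier F"
  shows "\<Phi> (fscale c \<phi>) = fscale c (\<Phi> \<phi>)"
proof -
  have A: "finite {p. \<phi> p \<noteq> 0}" using assms by simp
  have "\<Phi> (fscale c \<phi>) = (\<Sum>p | \<phi> p \<noteq> 0. fscale (fscale c \<phi> p) (pure p))" by (rule \<Phi>_superset[OF A]) auto
  also have "\<dots> = fscale c (\<Phi> \<phi>)" unfolding \<Phi>_def fv.scale_sum_right by (simp add: fun_eq_iff mult.assoc)
  finally show ?thesis .
qed

lemma \<Phi>_single: "\<Phi> (single p) = pure p"
proof -
  have "{q. single p q \<noteq> 0} = {p}" by (auto simp: single_def)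
  then show ?thesis by (simp add: \<Phi>_def single_def fun_eq_iff)
qed

lemma F_closed: "0 \<in> carrier F" "\<phi> \<in> carrier F \<Longrightarrow> \<psi> \<in> carrier F \<Longrightarrow> \<phi> + \<psi> \<in> carrier F" "\<phi> \<in> carrier F \<Longrightarrow> fscale c \<phi> \<in> carrier F"
  using embD(1,4,6)[OF emb_free_space] unfolding free_space_simps(2-4) by blast+

lemma \<Phi>_zero: "\<Phi> 0 = 0"
  by (simp add: \<Phi>_def)

lemma \<Phi>_sum:
  assumes "\<And>p. p \<in> A \<Longrightarrow> h p \<in> carrier F"
  shows "(\<Sum>p\<in>A. fscale (c p) (h p)) \<in> carrier F \<and> \<Phi> (\<Sum>p\<in>A. fscale (c p) (h p)) = (\<Sum>p\<in>A. fscale (c p) (\<Phi> (h p)))"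
  using assms
proof (induction A rule: infinite_finite_induct)
  case (insert a A)
  have a: "h a \<in> carrier F" and IH: "(\<Sum>p\<in>A. fscale (c p) (h p)) \<in> carrier F"
    "\<Phi> (\<Sum>p\<in>A. fscale (c p) (h p)) = (\<Sum>p\<in>A. fscale (c p) (\<Phi> (h p)))" using insert.IH insert.prems by blast+
  show ?case
    unfolding sum.insert[OF insert.hyps] \<Phi>_add[OF F_closed(3)[OF a] IH(1)] \<Phi>_scale[OF a] IH(2)
    using F_closed(2)[OF F_closed(3)[OF a] IH(1)] by blast
qed (use F_closed(1) \<Phi>_zero in \<open>simp_all del: free_space_simps\<close>)

lemma \<Phi>_kernel_subspace: "fv.subspace {\<phi> \<in> carrier F. \<Phi> \<phi> = 0}"
  by (rule fv.subspaceI) (use F_closed \<Phi>_zero \<Phi>_add \<Phi>_scale in \<open>simp_all del: free_space_simps\<close>)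

text \<open>The generators exactly as written in \<open>tensor_relations\<close>, so that folding
  this definition there exposes a span.\<close>

definition relators where
  "relators =
     {\<lambda>p. single (v \<oplus>\<^bsub>M1\<^esub> v', w) p - single (v, w) p - single (v', w) p | v v' w.
         v \<in> carrier M1 \<and> v' \<in> carrier M1 \<and> w \<in> carrier M2} \<union>
     {\<lambda>p. single (v, w \<oplus>\<^bsub>M2\<^esub> w') p - single (v, w) p - single (v, w') p | v w w'.
         v \<in> carrier M1 \<and> w \<in> carrier M2 \<and> w' \<in> carrier M2} \<union>
     {\<lambda>p. single (c \<odot>\<^bsub>M1\<^esub> v, w) p - c * single (v, w) p | c v w.
         v \<in> carrier M1 \<and> w \<in> carrier M2} \<union>
     {\<lambda>p. single (v, c \<odot>\<^bsub>M2\<^esub> w) p - c * single (v, w) p | c v w.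
         v \<in> carrier M1 \<and> w \<in> carrier M2}"

lemma relators_cases:
  assumes "\<rho> \<in> relators"
  obtains
    (add1) v v' w where "v \<in> carrier M1" "v' \<in> carrier M1" "w \<in> carrier M2"
      "\<rho> = single (v \<oplus>\<^bsub>M1\<^esub> v', w) + fscale (- 1) (single (v, w)) + fscale (- 1) (single (v', w))"
  | (add2) v w w' where "v \<in> carrier M1" "w \<in> carrier M2" "w' \<in> carrier M2"
      "\<rho> = single (v, w \<oplus>\<^bsub>M2\<^esub> w') + fscale (- 1) (single (v, w)) + fscale (- 1) (single (v, w'))"
  | (scale1) c v w where "v \<in> carrier M1" "w \<in> carrier M2"
      "\<rho> = single (c \<odot>\<^bsub>M1\<^esub> v, w) + fscale (- c) (single (v, w))"
  | (scale2) c v w where "v \<in> carrier M1" "w \<in> carrier M2"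
      "\<rho> = single (v, c \<odot>\<^bsub>M2\<^esub> w) + fscale (- c) (single (v, w))"
proof -
  have e: "(\<lambda>p. f p - g p - h p) = f + fscale (- 1) g + fscale (- 1) h" "(\<lambda>p. f p - c * g p) = f + fscale (- c) g"
    for f g h :: "'v \<times> 'w \<Rightarrow> complex" and c by (simp_all add: fun_eq_iff)
  show ?thesis using assms add1 add2 scale1 scale2 unfolding relators_def e by (elim UnE CollectE exE conjE) auto
qed

lemma \<Phi>_combination:
  assumes "a \<in> carrier F" "b \<in> carrier F"
  shows "a + fscale k b \<in> carrier F" "\<Phi> (a + fscale k b) = \<Phi> a + fscale k (\<Phi> b)"
  by (rule F_closed(2)[OF assms(1) F_closed(3)[OF assms(2)]])
    (simp only: \<Phi>_add[OF assms(1) F_closed(3)[OF assms(2)]] \<Phi>_scale[OF assms(2)])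

lemma relators_kernel:
  assumes "\<rho> \<in> relators"
  shows "\<rho> \<in> carrier F \<and> \<Phi> \<rho> = 0"
  using assms
proof (cases rule: relators_cases)
  have s: "single (v, w) \<in> carrier F" if "v \<in> carrier M1" "w \<in> carrier M2" for v w
    by (rule single_free_space) (use that in blast)
  note C = \<Phi>_combination
  {
    case (add1 v v' w)
    note a = s[OF embD(4)[OF j1 add1(1,2)] add1(3)] and b = s[OF add1(1,3)] and c = s[OF add1(2,3)]
    show ?thesis
      unfolding add1(4) C(2)[OF C(1)[OF a b] c] C(2)[OF a b] \<Phi>_single pure_bil(1)[OF add1(1,3,2)]
      by (intro conjI C(1)[OF C(1)[OF a b] c]) (simp add: fun_eq_iff)
  next
    case (add2 v w w')
    note a = s[OF add2(1) embD(4)[OF j2 add2(2,3)]] and b = s[OF add2(1,2)] and c = s[OF add2(1,3)]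
    show ?thesis
      unfolding add2(4) C(2)[OF C(1)[OF a b] c] C(2)[OF a b] \<Phi>_single pure_bil(2)[OF add2(1,2,3)]
      by (intro conjI C(1)[OF C(1)[OF a b] c]) (simp add: fun_eq_iff)
  next
    case (scale1 c v w)
    note a = s[OF embD(6)[OF j1 scale1(1)] scale1(2)] and b = s[OF scale1(1,2)]
    show ?thesis
      unfolding scale1(3) C(2)[OF a b] \<Phi>_single pure_bil(3)[OF scale1(1,2)]
      by (intro conjI C(1)[OF a b]) (simp add: fun_eq_iff)
  next
    case (scale2 c v w)
    note a = s[OF scale2(1) embD(6)[OF j2 scale2(2)]] and b = s[OF scale2(1,2)]
    show ?thesis
      unfolding scale2(3) C(2)[OF a b] \<Phi>_single pure_bil(4)[OF scale2(1,2)]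
      by (intro conjI C(1)[OF a b]) (simp add: fun_eq_iff)
  }
qed

lemma N_span: "N = fv.span relators"
proof -
  have "relators \<subseteq> carrier F" using relators_kernel by blast
  from complex_span_eq[OF emb_free_space this]
  show ?thesis unfolding tensor_relations_def relators_def[symmetric] image_ident .
qed

text \<open>A functional vanishing on the relators is a bilinear form, so it factors through \<open>t\<close>.\<close>

lemma N_eq_kernel: "N = {\<phi> \<in> carrier F. \<Phi> \<phi> = 0}"
proof
  show "N \<subseteq> {\<phi> \<in> carrier F. \<Phi> \<phi> = 0}"
    unfolding N_span by (rule fv.span_minimal[OF _ \<Phi>_kernel_subspace]) (use relators_kernel in blast)
  show "{\<phi> \<in> carrier F. \<Phi> \<phi> = 0} \<subseteq> N"
  proof (rule subsetI, rule ccontr)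
    fix \<phi> assume \<phi>: "\<phi> \<in> {\<phi> \<in> carrier F. \<Phi> \<phi> = 0}" and n: "\<phi> \<notin> N"
    have \<phi>F: "\<phi> \<in> carrier F" and \<phi>0: "\<Phi> \<phi> = 0" using \<phi> by blast+
    have "\<exists>f. fv.functional f \<and> (\<forall>x\<in>fv.span relators. f x = 0) \<and> f \<phi> = 1"
    proof (rule fv.separate[OF fv.subspace_span n[unfolded N_span]])
      fix g :: "('v \<times> 'w \<Rightarrow> complex) \<Rightarrow> complex"
      assume "fv.functional g" "\<And>x. x \<in> fv.span relators \<Longrightarrow> g x = 0" "g \<phi> = 1"
      then show ?thesis by (intro exI[of _ g]) simp
    qed
    then obtain f where f: "fv.functional f" "\<forall>x\<in>fv.span relators. f x = 0" "f \<phi> = 1" by blast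
    have fr: "f \<rho> = 0" if "\<rho> \<in> relators" for \<rho> by (rule bspec[OF f(2) fv.span_base[OF that]])
    note FA = fv.functional_add[OF f(1)] fv.functional_scale[OF f(1)]
    have e: "(\<lambda>p. f p - g p - h p) = f + fscale (- 1) g + fscale (- 1) h" "(\<lambda>p. f p - c * g p) = f + fscale (- c) g"
      for f g h :: "'v \<times> 'w \<Rightarrow> complex" and c by (simp_all add: fun_eq_iff)
    have b1: "f (single (v \<oplus>\<^bsub>M1\<^esub> v', w)) = f (single (v, w)) + f (single (v', w))"
      if "v \<in> carrier M1" "v' \<in> carrier M1" "w \<in> carrier M2" for v v' w
    proof -
      have "(\<lambda>p. single (v \<oplus>\<^bsub>M1\<^esub> v', w) p - single (v, w) p - single (v', w) p) \<in> relators"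
        unfolding relators_def using that by blast
      from fr[OF this] show ?thesis unfolding e FA by (simp add: algebra_simps)
    qed
    have b2: "f (single (v, w \<oplus>\<^bsub>M2\<^esub> w')) = f (single (v, w)) + f (single (v, w'))"
      if "v \<in> carrier M1" "w \<in> carrier M2" "w' \<in> carrier M2" for v w w'
    proof -
      have "(\<lambda>p. single (v, w \<oplus>\<^bsub>M2\<^esub> w') p - single (v, w) p - single (v, w') p) \<in> relators"
        unfolding relators_def using that by blast
      from fr[OF this] show ?thesis unfolding e FA by (simp add: algebra_simps)
    qed
    have b3: "f (single (c \<odot>\<^bsub>M1\<^esub> v, w)) = c * f (single (v, w))" if "v \<in> carrier M1" "w \<in> carrier M2" for c v w
    proof -
      have "(\<lambda>p. single (c \<odot>\<^bsub>M1\<^esub> v, w) p - c * single (v, w) p) \<in> relators"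
        unfolding relators_def using that by blast
      from fr[OF this] show ?thesis unfolding e FA by (simp add: algebra_simps)
    qed
    have b4: "f (single (v, c \<odot>\<^bsub>M2\<^esub> w)) = c * f (single (v, w))" if "v \<in> carrier M1" "w \<in> carrier M2" for c v w
    proof -
      have "(\<lambda>p. single (v, c \<odot>\<^bsub>M2\<^esub> w) p - c * single (v, w) p) \<in> relators"
        unfolding relators_def using that by blast
      from fr[OF this] show ?thesis unfolding e FA by (simp add: algebra_simps)
    qed
    \<comment> \<open>A nonzero vector that turns the scalar form given by \<open>f\<close> into one
      with values in the ambient space, where the universal property of \<open>t\<close> is
      stated.\<close>
    let ?u = "(\<lambda>_. 1) :: 'i \<Rightarrow> complex"
    define d1 where "d1 = inv_into (carrier M1) j1"
    define d2 where "d2 = inv_into (carrier M2) j2"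
    have d1: "d1 (j1 v) = v" if "v \<in> carrier M1" for v unfolding d1_def using inv_into_f_f[OF embD(3)[OF j1] that] .
    have d2: "d2 (j2 v) = v" if "v \<in> carrier M2" for v unfolding d2_def using inv_into_f_f[OF embD(3)[OF j2] that] .
    define \<beta> where "\<beta> x y = fscale (f (single (d1 y, d2 x))) ?u" for x y
    have \<beta>: "\<beta> (j2 w) (j1 v) = fscale (f (single (v, w))) ?u" if "v \<in> carrier M1" "w \<in> carrier M2" for v w
      by (simp add: \<beta>_def d1 d2 that)
    have "fv.bilin \<beta> (j2 ` carrier M2) (j1 ` carrier M1)"
    proof (rule fv.bilinI)
      fix x x' y c assume x: "x \<in> j2 ` carrier M2" and y: "y \<in> j1 ` carrier M1"
      obtain w v where wv: "w \<in> carrier M2" "x = j2 w" "v \<in> carrier M1" "y = j1 v" using x y by blast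
      show "\<beta> (fscale c x) y = fscale c (\<beta> x y)"
        unfolding wv(2,4) embD(7)[OF j2 wv(1), symmetric] \<beta>[OF wv(3,1)] \<beta>[OF wv(3) embD(6)[OF j2 wv(1)]] b4[OF wv(3,1)]
        by (simp add: fun_eq_iff)
      show "\<beta> x (fscale c y) = fscale c (\<beta> x y)"
        unfolding wv(2,4) embD(7)[OF j1 wv(3), symmetric] \<beta>[OF wv(3,1)] \<beta>[OF embD(6)[OF j1 wv(3)] wv(1)] b3[OF wv(3,1)]
        by (simp add: fun_eq_iff)
      {
        assume "x' \<in> j2 ` carrier M2"
        then obtain w' where w': "w' \<in> carrier M2" "x' = j2 w'" by blast
        show "\<beta> (x + x') y = \<beta> x y + \<beta> x' y"
          unfolding wv(2,4) w'(2) embD(5)[OF j2 wv(1) w'(1), symmetric] \<beta>[OF wv(3,1)] \<beta>[OF wv(3) w'(1)]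
            \<beta>[OF wv(3) embD(4)[OF j2 wv(1) w'(1)]] b2[OF wv(3,1) w'(1)]
          by (simp add: fun_eq_iff)
      }
    next
      fix x y y' assume x: "x \<in> j2 ` carrier M2" and y: "y \<in> j1 ` carrier M1" and y': "y' \<in> j1 ` carrier M1"
      obtain w v v' where wv: "w \<in> carrier M2" "x = j2 w" "v \<in> carrier M1" "y = j1 v" "v' \<in> carrier M1" "y' = j1 v'"
        using x y y' by blast
      show "\<beta> x (y + y') = \<beta> x y + \<beta> x y'"
        unfolding wv(2,4,6) embD(5)[OF j1 wv(3,5), symmetric] \<beta>[OF wv(3,1)] \<beta>[OF wv(5,1)]
          \<beta>[OF embD(4)[OF j1 wv(3,5)] wv(1)] b1[OF wv(3,5,1)]
        by (simp add: fun_eq_iff)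
    qed
    then have "\<exists>g. fv.lin g \<and> (\<forall>x\<in>j2 ` carrier M2. \<forall>y\<in>j1 ` carrier M1. g (t x y) = \<beta> x y)"
      using t unfolding fv.tensor_def by blast
    then obtain g where g: "fv.lin g" "\<forall>x\<in>j2 ` carrier M2. \<forall>y\<in>j1 ` carrier M1. g (t x y) = \<beta> x y" by blast
    have gp: "g (pure p) = fscale (f (single p)) ?u" if p: "p \<in> carrier M1 \<times> carrier M2" for p
    proof -
      obtain v w where vw: "p = (v, w)" "v \<in> carrier M1" "w \<in> carrier M2" using p by blast
      show ?thesis unfolding vw(1) \<beta>[OF vw(2,3), symmetric] pure_def using g(2) vw(2,3) by simp
    qed
    have fin: "finite {p. \<phi> p \<noteq> 0}" and supp: "{p. \<phi> p \<noteq> 0} \<subseteq> carrier M1 \<times> carrier M2" using \<phi>F by simp_all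
    have "g (\<Phi> \<phi>) = (\<Sum>p | \<phi> p \<noteq> 0. fscale (\<phi> p) (g (pure p)))"
      unfolding \<Phi>_def fv.lin_sum[OF g(1)] fv.lin_scale[OF g(1)] ..
    also have "\<dots> = (\<Sum>p | \<phi> p \<noteq> 0. fscale (\<phi> p) (fscale (f (single p)) ?u))"
      by (rule sum.cong[OF refl], subst gp) (use supp in blast, rule refl)
    also have "\<dots> = fscale (\<Sum>p | \<phi> p \<noteq> 0. \<phi> p * f (single p)) ?u"
      by (simp add: fun_eq_iff sum_apply)
    also have "(\<Sum>p | \<phi> p \<noteq> 0. \<phi> p * f (single p)) = f (\<Sum>p | \<phi> p \<noteq> 0. fscale (\<phi> p) (single p))"
      unfolding fv.functional_sum[OF f(1)] FA(2) ..
    also have "\<dots> = 1" unfolding finite_expansion[OF fin] by (rule f(3))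
    \<comment> \<open>Evaluation at an arbitrary index; \<open>?u\<close> is \<open>1\<close>
      everywhere.\<close>
    finally have "g (\<Phi> \<phi>) undefined = fscale 1 ?u undefined" by (rule fun_cong)
    moreover have "g (\<Phi> \<phi>) = 0" unfolding \<phi>0 by (rule fv.lin_0[OF g(1)])
    ultimately show False by simp
  qed
qed

end

context tensor_model
begin

text \<open>By \<open>N_eq_kernel\<close> the cosets of \<open>N\<close> are the fibres of \<Phi>
  over \<open>U\<close>. An element of the quotient is thus named by a vector of \<open>U\<close>,
  without a choice of representative.\<close>

definition fibre where "fibre u = {\<phi> \<in> carrier F. \<Phi> \<phi> = u}"

lemma fibre_self: "\<phi> \<in> carrier F \<Longrightarrow> \<phi> \<in> fibre (\<Phi> \<phi>)"
  unfolding fibre_def by blast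

lemma fibre_translate:
  assumes "\<psi> \<in> fibre (u + \<Phi> \<phi>)" and \<phi>: "\<phi> \<in> carrier F"
  shows "\<exists>n\<in>fibre u. \<psi> = n + \<phi>"
proof -
  have \<psi>: "\<psi> \<in> carrier F" "\<Phi> \<psi> = u + \<Phi> \<phi>" using assms(1) unfolding fibre_def by blast+
  have "\<psi> + fscale (- 1) \<phi> \<in> fibre u"
    using \<Phi>_combination[OF \<psi>(1) \<phi>, of "- 1"] unfolding fibre_def \<psi>(2) by (simp add: fun_eq_iff)
  moreover have "\<psi> = (\<psi> + fscale (- 1) \<phi>) + \<phi>" by (simp add: fun_eq_iff)
  ultimately show ?thesis by blast
qed

lemma fibre_add: "\<psi> \<in> fibre u \<Longrightarrow> \<phi> \<in> fibre u' \<Longrightarrow> \<psi> + \<phi> \<in> fibre (u + u')"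
  unfolding fibre_def using F_closed(2) \<Phi>_add by (simp del: free_space_simps)

lemma coset_eq_fibre:
  assumes \<phi>: "\<phi> \<in> carrier F"
  shows "N +>\<^bsub>F\<^esub> \<phi> = fibre (\<Phi> \<phi>)"
proof -
  have N: "N = fibre 0" unfolding N_eq_kernel fibre_def ..
  have "fibre (\<Phi> \<phi>) = (\<Union>h\<in>fibre 0. {h + \<phi>})"
  proof
    show "fibre (\<Phi> \<phi>) \<subseteq> (\<Union>h\<in>fibre 0. {h + \<phi>})" using fibre_translate[of _ 0 \<phi>] \<phi> by auto
    show "(\<Union>h\<in>fibre 0. {h + \<phi>}) \<subseteq> fibre (\<Phi> \<phi>)" using fibre_add[OF _ fibre_self[OF \<phi>], of _ 0] by auto
  qed
  then show ?thesis unfolding a_r_coset_def' free_space_simps(3) N by simp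
qed

lemma \<Phi>_range: "\<Phi> ` carrier F = U"
proof
  have pU: "pure p \<in> U" if p: "p \<in> carrier M1 \<times> carrier M2" for p
    unfolding spanU[symmetric] pure_def
    by (intro fv.span_base CollectI exI[of _ "j2 (snd p)"] exI[of _ "j1 (fst p)"]) (use p in auto)
  have Us: "fv.subspace U" unfolding spanU[symmetric] by (rule fv.subspace_span)
  show "\<Phi> ` carrier F \<subseteq> U"
  proof (rule image_subsetI)
    fix \<phi> assume \<phi>: "\<phi> \<in> carrier F"
    have supp: "{p. \<phi> p \<noteq> 0} \<subseteq> carrier M1 \<times> carrier M2" using \<phi> by simp
    show "\<Phi> \<phi> \<in> U" unfolding \<Phi>_def
      by (rule fv.subspace_sum[OF Us], rule fv.subspace_scale[OF Us], rule pU) (use supp in blast)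
  qed
  have s: "fv.subspace (\<Phi> ` carrier F)"
  proof (rule fv.subspaceI)
    show "0 \<in> \<Phi> ` carrier F" using imageI[OF F_closed(1), of \<Phi>] unfolding \<Phi>_zero .
    show "x + y \<in> \<Phi> ` carrier F" if x: "x \<in> \<Phi> ` carrier F" and y: "y \<in> \<Phi> ` carrier F" for x y
    proof -
      obtain \<phi> \<psi> where h: "\<phi> \<in> carrier F" "x = \<Phi> \<phi>" "\<psi> \<in> carrier F" "y = \<Phi> \<psi>" using x y by blast
      show ?thesis unfolding h(2,4) \<Phi>_add[OF h(1,3), symmetric] by (rule imageI[OF F_closed(2)[OF h(1,3)]])
    qed
    show "fscale c x \<in> \<Phi> ` carrier F" if x: "x \<in> \<Phi> ` carrier F" for c x
    proof -
      obtain \<phi> where h: "\<phi> \<in> carrier F" "x = \<Phi> \<phi>" using x by blast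
      show ?thesis unfolding h(2) \<Phi>_scale[OF h(1), symmetric] by (rule imageI[OF F_closed(3)[OF h(1)]])
    qed
  qed
  have "{t x y | x y. x \<in> j2 ` carrier M2 \<and> y \<in> j1 ` carrier M1} \<subseteq> \<Phi> ` carrier F"
  proof (rule subsetI, elim CollectE exE conjE)
    fix z x y assume z: "z = t x y" and x: "x \<in> j2 ` carrier M2" and y: "y \<in> j1 ` carrier M1"
    obtain v w where vw: "x = j2 w" "w \<in> carrier M2" "y = j1 v" "v \<in> carrier M1" using x y by blast
    have "single (v, w) \<in> carrier F" by (rule single_free_space) (use vw in blast)
    moreover have "z = \<Phi> (single (v, w))" unfolding \<Phi>_single z vw(1,3) by (simp add: pure_def)
    ultimately show "z \<in> \<Phi> ` carrier F" by blast
  qed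
  then show "U \<subseteq> \<Phi> ` carrier F" unfolding spanU[symmetric] by (rule fv.span_minimal[OF _ s])
qed

lemma fibre_nonempty:
  assumes "u \<in> U"
  obtains \<phi> where "\<phi> \<in> carrier F" "\<Phi> \<phi> = u"
proof -
  have "u \<in> \<Phi> ` carrier F" using assms unfolding \<Phi>_range .
  then show ?thesis using that by blast
qed

text \<open>Subtracting one element of the fibre of \<open>u'\<close> moves a member of the left
  side into the fibre of \<open>u\<close>. With an empty fibre of \<open>u'\<close> the right side
  would be empty.\<close>

lemma fibre_sum:
  assumes "u' \<in> U"
  shows "fibre (u + u') = fibre u <+>\<^bsub>F\<^esub> fibre u'"
  unfolding set_add_def' free_space_simps(3)
proof
  obtain \<phi> where \<phi>: "\<phi> \<in> carrier F" "\<Phi> \<phi> = u'" by (rule fibre_nonempty[OF assms])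
  have "\<phi> \<in> fibre u'" using fibre_self[OF \<phi>(1)] unfolding \<phi>(2) .
  then show "fibre (u + u') \<subseteq> (\<Union>h\<in>fibre u. \<Union>k\<in>fibre u'. {h + k})"
  proof (intro subsetI)
    fix \<psi> assume p: "\<phi> \<in> fibre u'" and \<psi>: "\<psi> \<in> fibre (u + u')"
    have "\<exists>n\<in>fibre u. \<psi> = n + \<phi>" by (rule fibre_translate[OF _ \<phi>(1)]) (use \<psi> \<phi>(2) in simp)
    then obtain n where "n \<in> fibre u" "\<psi> = n + \<phi>" by blast
    then show "\<psi> \<in> (\<Union>h\<in>fibre u. \<Union>k\<in>fibre u'. {h + k})" using p by blast
  qed
  show "(\<Union>h\<in>fibre u. \<Union>k\<in>fibre u'. {h + k}) \<subseteq> fibre (u + u')"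
    by (intro UN_least) (simp add: fibre_add)
qed

text \<open>\<open>coset_map\<close> is a union over representatives; here they all give the same
  coset and there is at least one, so the union is that coset.\<close>

lemma coset_map_fibre:
  assumes u: "u \<in> U" and h: "\<And>\<phi>. \<phi> \<in> carrier F \<Longrightarrow> h \<phi> \<in> carrier F \<and> \<Phi> (h \<phi>) = g (\<Phi> \<phi>)"
  shows "coset_map F N h (fibre u) = fibre (g u)"
proof -
  have e: "N +>\<^bsub>F\<^esub> h \<phi> = fibre (g u)" if \<phi>: "\<phi> \<in> fibre u" for \<phi>
  proof -
    have f: "\<phi> \<in> carrier F" "\<Phi> \<phi> = u" using \<phi> unfolding fibre_def by blast+
    show ?thesis using coset_eq_fibre[OF conjunct1[OF h[OF f(1)]]] conjunct2[OF h[OF f(1)]] f(2) by simp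
  qed
  obtain \<phi> where \<phi>: "\<phi> \<in> carrier F" "\<Phi> \<phi> = u" by (rule fibre_nonempty[OF u])
  have m: "\<phi> \<in> fibre u" using fibre_self[OF \<phi>(1)] unfolding \<phi>(2) .
  show ?thesis unfolding coset_map_def using e m by blast
qed

text \<open>\<Phi> intertwines \<open>free_extension h\<close> with \<open>g\<close> as soon as it
  does so on pairs, since both are linear combinations of their values there.\<close>

lemma free_extension_eq:
  assumes p: "\<And>p. p \<in> carrier M1 \<times> carrier M2 \<Longrightarrow> h p \<in> carrier F \<and> \<Phi> (h p) = g (pure p)"
    and g: "fv.lin g" and \<phi>: "\<phi> \<in> carrier F"
  shows "free_extension h \<phi> \<in> carrier F \<and> \<Phi> (free_extension h \<phi>) = g (\<Phi> \<phi>)"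
proof -
  have supp: "{p. \<phi> p \<noteq> 0} \<subseteq> carrier M1 \<times> carrier M2" using \<phi> by simp
  have e: "free_extension h \<phi> = (\<Sum>p | \<phi> p \<noteq> 0. fscale (\<phi> p) (h p))"
    by (simp add: free_extension_def fun_eq_iff sum_apply)
  have hp: "h p \<in> carrier F" "\<Phi> (h p) = g (pure p)" if "p \<in> {p. \<phi> p \<noteq> 0}" for p
    using p[OF subsetD[OF supp that]] by blast+
  note S = \<Phi>_sum[of "{p. \<phi> p \<noteq> 0}" h \<phi>, OF hp(1)]
  have "(\<Sum>p | \<phi> p \<noteq> 0. fscale (\<phi> p) (\<Phi> (h p))) = (\<Sum>p | \<phi> p \<noteq> 0. fscale (\<phi> p) (g (pure p)))"
    by (rule sum.cong[OF refl]) (simp only: hp(2))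
  also have "\<dots> = g (\<Phi> \<phi>)" unfolding \<Phi>_def fv.lin_sum[OF g] fv.lin_scale[OF g] ..
  finally show ?thesis unfolding e using S by simp
qed

end

text \<open>The isomorphism sends \<open>m\<close> to the fibre of \<Phi> over \<open>j m\<close>.
  The hypotheses provide, for each element of the product, one operator \<open>g\<close> that is its
  action on \<open>M\<close> and acts on products as the tensor action does;
  \<open>coset_map_fibre\<close> then matches the two actions.\<close>

lemma gk_tensor_isomorphic:
  fixes M :: "('x \<times> 'y, 'k \<times> 'l, 'v) gk_rep" and M1 :: "('x, 'k, 'u) gk_rep" and M2 :: "('y, 'l, 'w) gk_rep"
    and j :: "'v \<Rightarrow> 'i \<Rightarrow> complex"
  assumes j: "emb M j" and j1: "emb M1 j1" and j2: "emb M2 j2"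
    and t: "fv.tensor t (j2 ` carrier M2) (j1 ` carrier M1) (j ` carrier M)"
    and K: "\<And>k l. k \<in> carrier (grp P) \<Longrightarrow> l \<in> carrier (grp Q) \<Longrightarrow> linear_map M M (kact M (k, l)) \<and>
        (\<forall>v\<in>carrier M1. kact M1 k v \<in> carrier M1) \<and> (\<forall>w\<in>carrier M2. kact M2 l w \<in> carrier M2) \<and>
        (\<exists>g. fv.lin g \<and> (\<forall>m\<in>carrier M. g (j m) = j (kact M (k, l) m)) \<and>
          (\<forall>v\<in>carrier M1. \<forall>w\<in>carrier M2. g (t (j2 w) (j1 v)) = t (j2 (kact M2 l w)) (j1 (kact M1 k v))))"
    and A: "\<And>X Y. X \<in> carrier (alg P) \<Longrightarrow> Y \<in> carrier (alg Q) \<Longrightarrow> linear_map M M (gact M (X, Y)) \<and>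
        (\<forall>v\<in>carrier M1. gact M1 X v \<in> carrier M1) \<and> (\<forall>w\<in>carrier M2. gact M2 Y w \<in> carrier M2) \<and>
        (\<exists>g. fv.lin g \<and> (\<forall>m\<in>carrier M. g (j m) = j (gact M (X, Y) m)) \<and>
          (\<forall>v\<in>carrier M1. \<forall>w\<in>carrier M2.
             g (t (j2 w) (j1 v)) = t (j2 w) (j1 (gact M1 X v)) + t (j2 (gact M2 Y w)) (j1 v)))"
  shows "gk_isomorphic (pair_product P Q) M (gk_tensor M1 M2)"
proof -
  interpret tensor_model M1 M2 j1 j2 t "j ` carrier M" by unfold_locales (fact j1 j2 t)+
  define T where "T m = fibre (j m)" for m
  let ?V = "gk_tensor M1 M2"
  have V: "carrier ?V = a_rcosets\<^bsub>F\<^esub> N" "A \<oplus>\<^bsub>?V\<^esub> B = A <+>\<^bsub>F\<^esub> B" "c \<odot>\<^bsub>?V\<^esub> A = coset_map F N ((\<odot>\<^bsub>F\<^esub>) c) A"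
    "kact ?V (k, l) = coset_map F N (free_extension (\<lambda>(v, w). single (kact M1 k v, kact M2 l w)))"
    "gact ?V (X, Y) = coset_map F N (free_extension (\<lambda>(v, w) p. single (gact M1 X v, w) p + single (v, gact M2 Y w) p))"
    for A B c k l X Y
    by (simp_all add: gk_tensor_def Let_def)
  have jm: "j m \<in> j ` carrier M" if "m \<in> carrier M" for m using that by blast
  have car: "carrier ?V = T ` carrier M"
  proof -
    have "carrier ?V = (\<lambda>\<phi>. N +>\<^bsub>F\<^esub> \<phi>) ` carrier F" unfolding V A_RCOSETS_def' by blast
    also have "\<dots> = (\<lambda>\<phi>. fibre (\<Phi> \<phi>)) ` carrier F" by (rule image_cong[OF refl]) (rule coset_eq_fibre)
    also have "\<dots> = fibre ` (\<Phi> ` carrier F)" unfolding image_image ..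
    also have "\<dots> = T ` carrier M" unfolding \<Phi>_range image_image T_def ..
    finally show ?thesis .
  qed
  have inj: "inj_on T (carrier M)"
  proof (rule inj_onI)
    fix m m' assume m: "m \<in> carrier M" "m' \<in> carrier M" "T m = T m'"
    obtain \<phi> where \<phi>: "\<phi> \<in> carrier F" "\<Phi> \<phi> = j m" by (rule fibre_nonempty[OF jm[OF m(1)]])
    have "\<phi> \<in> fibre (j m')" using fibre_self[OF \<phi>(1)] m(3) unfolding \<phi>(2) T_def by simp
    then have "j m = j m'" using \<phi>(2) unfolding fibre_def by simp
    then show "m = m'" by (rule emb_inj[OF j m(1,2)])
  qed
  have sF: "single (v, w) \<in> carrier F" if "v \<in> carrier M1" "w \<in> carrier M2" for v w
    by (rule single_free_space) (use that in blast)
  have lin: "linear_map M ?V T"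
    unfolding linear_map_def
  proof (intro conjI ballI allI)
    show "T \<in> carrier M \<rightarrow> carrier ?V" unfolding car by blast
    show "T (m \<oplus>\<^bsub>M\<^esub> m') = T m \<oplus>\<^bsub>?V\<^esub> T m'" if m: "m \<in> carrier M" "m' \<in> carrier M" for m m'
      unfolding V T_def embD(5)[OF j m] by (rule fibre_sum[OF jm[OF m(2)]])
    show "T (c \<odot>\<^bsub>M\<^esub> m) = c \<odot>\<^bsub>?V\<^esub> T m" if m: "m \<in> carrier M" for c m
      unfolding V T_def embD(7)[OF j m]
    proof (rule coset_map_fibre[OF jm[OF m], symmetric])
      show "c \<odot>\<^bsub>F\<^esub> \<phi> \<in> carrier F \<and> \<Phi> (c \<odot>\<^bsub>F\<^esub> \<phi>) = fscale c (\<Phi> \<phi>)" if \<phi>: "\<phi> \<in> carrier F" for \<phi>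
        unfolding free_space_simps(4) using F_closed(3)[OF \<phi>] \<Phi>_scale[OF \<phi>] by blast
    qed
  qed
  have ka: "T (kact M (k, l) m) = kact ?V (k, l) (T m)"
    if k: "k \<in> carrier (grp P)" and l: "l \<in> carrier (grp Q)" and m: "m \<in> carrier M" for k l m
  proof -
    note H = K[OF k l]
    from conjunct2[OF conjunct2[OF conjunct2[OF H]]] obtain g where
      g0: "fv.lin g \<and> (\<forall>m\<in>carrier M. g (j m) = j (kact M (k, l) m)) \<and>
      (\<forall>v\<in>carrier M1. \<forall>w\<in>carrier M2. g (t (j2 w) (j1 v)) = t (j2 (kact M2 l w)) (j1 (kact M1 k v)))" by (rule exE)
    note g = conjunct1[OF g0] conjunct1[OF conjunct2[OF g0]] conjunct2[OF conjunct2[OF g0]]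
    let ?h = "\<lambda>(v, w). single (kact M1 k v, kact M2 l w)"
    have hp: "?h p \<in> carrier F \<and> \<Phi> (?h p) = g (pure p)" if p: "p \<in> carrier M1 \<times> carrier M2" for p
    proof -
      obtain v w where vw: "p = (v, w)" "v \<in> carrier M1" "w \<in> carrier M2" using p by blast
      have "kact M1 k v \<in> carrier M1" "kact M2 l w \<in> carrier M2" using H vw(2,3) by simp_all
      from sF[OF this] show ?thesis using g(3) vw by (simp add: \<Phi>_single pure_def del: free_space_simps)
    qed
    have "coset_map F N (free_extension ?h) (fibre (j m)) = fibre (g (j m))"
      by (rule coset_map_fibre[OF jm[OF m]]) (rule free_extension_eq[OF hp g(1)])
    then show ?thesis unfolding V T_def using g(2) m by simp
  qed
  have ga: "T (gact M (X, Y) m) = gact ?V (X, Y) (T m)"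
    if X: "X \<in> carrier (alg P)" and Y: "Y \<in> carrier (alg Q)" and m: "m \<in> carrier M" for X Y m
  proof -
    note H = A[OF X Y]
    from conjunct2[OF conjunct2[OF conjunct2[OF H]]] obtain g where
      g0: "fv.lin g \<and> (\<forall>m\<in>carrier M. g (j m) = j (gact M (X, Y) m)) \<and>
      (\<forall>v\<in>carrier M1. \<forall>w\<in>carrier M2. g (t (j2 w) (j1 v)) = t (j2 w) (j1 (gact M1 X v)) + t (j2 (gact M2 Y w)) (j1 v))" by (rule exE)
    note g = conjunct1[OF g0] conjunct1[OF conjunct2[OF g0]] conjunct2[OF conjunct2[OF g0]]
    let ?h = "\<lambda>(v, w) p. single (gact M1 X v, w) p + single (v, gact M2 Y w) p"
    have hp: "?h p \<in> carrier F \<and> \<Phi> (?h p) = g (pure p)" if p: "p \<in> carrier M1 \<times> carrier M2" for p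
    proof -
      obtain v w where vw: "p = (v, w)" "v \<in> carrier M1" "w \<in> carrier M2" using p by blast
      have c: "gact M1 X v \<in> carrier M1" "gact M2 Y w \<in> carrier M2" using H vw(2,3) by simp_all
      have e: "?h p = single (gact M1 X v, w) + single (v, gact M2 Y w)" by (simp add: vw(1) fun_eq_iff)
      note s = sF[OF c(1) vw(3)] sF[OF vw(2) c(2)]
      have "\<Phi> (?h p) = g (pure p)" unfolding e \<Phi>_add[OF s] \<Phi>_single using g(3) vw by (simp add: pure_def)
      moreover have "?h p \<in> carrier F" unfolding e by (rule F_closed(2)[OF s])
      ultimately show ?thesis by blast
    qed
    have "coset_map F N (free_extension ?h) (fibre (j m)) = fibre (g (j m))"
      by (rule coset_map_fibre[OF jm[OF m]]) (rule free_extension_eq[OF hp g(1)])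
    then show ?thesis unfolding V T_def using g(2) m by simp
  qed
  have "bij_betw T (carrier M) (carrier ?V)" unfolding bij_betw_def using inj car by simp
  moreover have "\<forall>k\<in>carrier (grp (pair_product P Q)). \<forall>m\<in>carrier M. T (kact M k m) = kact ?V k (T m)"
    using ka by (auto simp: pair_product_def)
  moreover have "\<forall>X\<in>carrier (alg (pair_product P Q)). \<forall>m\<in>carrier M. T (gact M X m) = gact ?V X (T m)"
    using ga by (auto simp: pair_product_def lie_product_def)
  ultimately show ?thesis unfolding gk_isomorphic_def using lin by blast
qed

section \<open>Factorization of irreducible modules\<close>

context pair_module
begin

lemma lifts_apply:
  assumes j: "emb M j" and S: "\<forall>s\<in>S. linear_map M M s" and s: "s \<in> S"
  shows "\<exists>g\<in>lifts j M S. \<forall>v\<in>carrier M. g (j v) = j (s v)"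
proof (rule lifts_exists[OF j bspec[OF S s] s])
  fix g assume "g \<in> lifts j M S" "\<And>v. v \<in> carrier M \<Longrightarrow> g (j v) = j (s v)"
  then show ?thesis by (intro bexI[of _ g]) simp_all
qed

lemma linear_K1: "\<forall>s\<in>kmaps P M e1. linear_map M M s" and linear_K2: "\<forall>s\<in>kmaps Q M e2. linear_map M M s"
  by (simp_all add: kl)

lemma K1_apply: "emb M j \<Longrightarrow> k \<in> carrier (grp P) \<Longrightarrow>
    \<exists>g\<in>lifts j M (kmaps P M e1). \<forall>v\<in>carrier M. g (j v) = j (kact M (e1 k) v)"
  by (rule lifts_apply[OF _ linear_K1]) simp_all

lemma K2_apply: "emb M j \<Longrightarrow> l \<in> carrier (grp Q) \<Longrightarrow>
    \<exists>g\<in>lifts j M (kmaps Q M e2). \<forall>v\<in>carrier M. g (j v) = j (kact M (e2 l) v)"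
  by (rule lifts_apply[OF _ linear_K2]) simp_all

lemma K1_act: "g \<in> lifts j M (kmaps P M e1) \<Longrightarrow> \<exists>k\<in>carrier (grp P). \<forall>v\<in>carrier M. g (j v) = j (kact M (e1 k) v)"
  and K2_act: "g \<in> lifts j M (kmaps Q M e2) \<Longrightarrow> \<exists>l\<in>carrier (grp Q). \<forall>v\<in>carrier M. g (j v) = j (kact M (e2 l) v)"
  unfolding lifts_def by blast+

text \<open>A functional along an orbit is a continuous function on the compact group, hence
  bounded.\<close>

lemma bounded_orbit:
  assumes j: "emb M j" and v: "v \<in> j ` carrier M" and f: "fv.functional f"
  shows "\<exists>D. \<forall>g\<in>lifts j M (kmaps P M e1). cmod (f (g v)) \<le> D"
proof -
  obtain m where m: "m \<in> carrier M" "v = j m" using v by blast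
  have "continuous_map (prod_topology (ktop P) (ktop Q)) euclidean (\<lambda>kl. f (j (kact M kl m)))"
    using KM(6)[OF m(1) functional_pullback[OF j f]] by simp
  moreover have "continuous_map (ktop P) (prod_topology (ktop P) (ktop Q)) e1"
    by (rule continuous_map_pairedI) (simp_all add: q(2))
  ultimately have "continuous_map (ktop P) euclidean ((\<lambda>kl. f (j (kact M kl m))) \<circ> e1)"
    by (rule continuous_map_compose[rotated])
  then have "compactin euclidean (((\<lambda>kl. f (j (kact M kl m))) \<circ> e1) ` topspace (ktop P))"
    by (rule image_compactin[rotated]) (use p(3) in \<open>simp add: compact_space_def\<close>)
  then have "bounded (((\<lambda>kl. f (j (kact M kl m))) \<circ> e1) ` carrier (grp P))"
    unfolding p(2) compactin_euclidean_iff by (rule compact_imp_bounded)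
  then obtain D where D: "\<forall>x\<in>((\<lambda>kl. f (j (kact M kl m))) \<circ> e1) ` carrier (grp P). norm x \<le> D"
    unfolding bounded_iff by blast
  have "cmod (f (g v)) \<le> D" if g: "g \<in> lifts j M (kmaps P M e1)" for g
  proof -
    obtain k where k: "k \<in> carrier (grp P)" "\<forall>v\<in>carrier M. g (j v) = j (kact M (e1 k) v)" by (rule bexE[OF K1_act[OF g]])
    show ?thesis using D k m by simp
  qed
  then show ?thesis by blast
qed

lemma commuting:
  assumes j: "emb M j" and irr: "irreducible_gk_module (pair_product P Q) M"
    and fm: "finite_multiplicities (grp (pair_product P Q)) (ktop (pair_product P Q)) M"
  shows "commuting_pair fscale (lifts j M S1) (lifts j M S2) (lifts j M (kmaps P M e1)) (lifts j M (kmaps Q M e2)) (j ` carrier M)"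
proof -
  let ?A = "lifts j M S1" and ?B = "lifts j M S2" and ?K1 = "lifts j M (kmaps P M e1)" and ?K2 = "lifts j M (kmaps Q M e2)"
  have kc: "kact M (e1 k) m \<in> carrier M" if "k \<in> carrier (grp P)" "m \<in> carrier M" for k m
    by (rule linear_mapD(1)[OF kl[OF that(1) L.one_closed] that(2)])
  have lc: "kact M (e2 l) m \<in> carrier M" if "l \<in> carrier (grp Q)" "m \<in> carrier M" for l m
    by (rule linear_mapD(1)[OF kl[OF K.one_closed that(1)] that(2)])
  show ?thesis
  proof (unfold_locales)
    show "\<forall>a\<in>?A. fv.lin a" "\<forall>b\<in>?B. fv.lin b" by (rule lifts_lin)+
    show "?K1 \<subseteq> ?A" "?K2 \<subseteq> ?B" unfolding lifts_Un by (rule Un_upper1)+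
    show "b (a x) = a (b x)" if a: "a \<in> ?A" and b: "b \<in> ?B" and x: "x \<in> j ` carrier M" for a b x
    proof -
      obtain m where m: "m \<in> carrier M" "x = j m" using x by blast
      have "\<exists>s\<in>S1. \<forall>v\<in>carrier M. a (j v) = j (s v)" using a unfolding lifts_def mem_Collect_eq by (rule conjunct2)
      then obtain s where s: "s \<in> S1" "\<forall>v\<in>carrier M. a (j v) = j (s v)" by (rule bexE)
      have "\<exists>s\<in>S2. \<forall>v\<in>carrier M. b (j v) = j (s v)" using b unfolding lifts_def mem_Collect_eq by (rule conjunct2)
      then obtain u where u: "u \<in> S2" "\<forall>v\<in>carrier M. b (j v) = j (u v)" by (rule bexE)
      have c: "s m \<in> carrier M" "u m \<in> carrier M"
        using linear_mapD(1)[OF bspec[OF linear_S1 s(1)] m(1)] linear_mapD(1)[OF bspec[OF linear_S2 u(1)] m(1)] .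
      show ?thesis
        unfolding m(2) bspec[OF s(2) m(1)] bspec[OF u(2) m(1)] bspec[OF s(2) c(2)] bspec[OF u(2) c(1)] commute[OF s(1) u(1) m(1)] ..
    qed
    show "fv.irred (?A \<union> ?B) (j ` carrier M)"
    proof -
      have lin: "\<forall>s\<in>S1 \<union> S2. linear_map M M s" unfolding ball_Un[of S1 S2] using linear_S1 linear_S2 by (rule conjI)
      have "rstable M (S1 \<union> S2) (carrier M)"
        unfolding rstable_def using emb_carrier_subspace[OF j] linear_mapD(1)[OF bspec[OF lin]] by simp
      moreover have "X = {\<zero>\<^bsub>M\<^esub>} \<or> X = carrier M" if X: "rstable M (S1 \<union> S2) X \<and> X \<subseteq> carrier M" for X
        using irr submodule_of_rstable[OF conjunct1[OF X]] unfolding irreducible_gk_module_def by blast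
      moreover have "carrier M \<noteq> {\<zero>\<^bsub>M\<^esub>}" using irr unfolding irreducible_gk_module_def by blast
      ultimately have "fv.irred (lifts j M (S1 \<union> S2)) (j ` carrier M)"
        unfolding irred_lifts[OF j lin order_refl] by blast
      then show ?thesis unfolding lifts_Un[of j M S1 S2] .
    qed
    show "?K1 \<noteq> {}" using K1_apply[OF j K.one_closed] by blast
    show "\<exists>h\<in>?K1. \<forall>x\<in>j ` carrier M. h (g x) = x \<and> g (h x) = x" if g: "g \<in> ?K1" for g
    proof -
      obtain k where k: "k \<in> carrier (grp P)" "\<forall>v\<in>carrier M. g (j v) = j (kact M (e1 k) v)" by (rule bexE[OF K1_act[OF g]])
      let ?i = "inv\<^bsub>grp P\<^esub> k"
      have i: "?i \<in> carrier (grp P)" using k(1) by simp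
      obtain h where h: "h \<in> ?K1" "\<forall>v\<in>carrier M. h (j v) = j (kact M (e1 ?i) v)" by (rule bexE[OF K1_apply[OF j i]])
      have "h (g (j m)) = j m \<and> g (h (j m)) = j m" if m: "m \<in> carrier M" for m
        unfolding bspec[OF k(2) m] bspec[OF h(2) m] bspec[OF h(2) kc[OF k(1) m]] bspec[OF k(2) kc[OF i m]]
          kmul[OF i k(1) L.one_closed L.one_closed m] kmul[OF k(1) i L.one_closed L.one_closed m]
        using kone[OF m] k(1) by simp
      then show ?thesis using h(1) by (intro bexI[of _ h]) simp_all
    qed
    show "\<exists>m\<in>?K1. \<forall>x\<in>j ` carrier M. m x = h (g x)" if h: "h \<in> ?K1" and g: "g \<in> ?K1" for h g
    proof -
      obtain k where k: "k \<in> carrier (grp P)" "\<forall>v\<in>carrier M. g (j v) = j (kact M (e1 k) v)" by (rule bexE[OF K1_act[OF g]])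
      obtain k' where k': "k' \<in> carrier (grp P)" "\<forall>v\<in>carrier M. h (j v) = j (kact M (e1 k') v)" by (rule bexE[OF K1_act[OF h]])
      have kk: "k' \<otimes>\<^bsub>grp P\<^esub> k \<in> carrier (grp P)" using k(1) k'(1) by simp
      obtain m where m: "m \<in> ?K1" "\<forall>v\<in>carrier M. m (j v) = j (kact M (e1 (k' \<otimes>\<^bsub>grp P\<^esub> k)) v)" by (rule bexE[OF K1_apply[OF j kk]])
      have "m (j v) = h (g (j v))" if v: "v \<in> carrier M" for v
        unfolding bspec[OF m(2) v] bspec[OF k(2) v] bspec[OF k'(2) kc[OF k(1) v]] kmul[OF k'(1) k(1) L.one_closed L.one_closed v]
        by simp
      then show ?thesis using m(1) by (intro bexI[of _ m]) simp_all
    qed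
    show "\<exists>D. \<forall>g\<in>?K1. cmod (f (g x)) \<le> D" if "x \<in> j ` carrier M" "fv.functional f" for x f
      by (rule bounded_orbit[OF j that])
    show "\<exists>V. fv.stable (?K1 \<union> ?K2) V \<and> fv.fd V \<and> V \<subseteq> j ` carrier M \<and> x \<in> V" if x: "x \<in> j ` carrier M" for x
    proof -
      obtain m where m: "m \<in> carrier M" "x = j m" using x by blast
      obtain W where W: "k_subspace (grp P \<times>\<times> grp Q) M W" "finite_dim M W" "m \<in> W" using KM(5)[OF m(1)] by auto
      have Ws: "subspace_of W M" and Wk: "\<forall>k\<in>carrier (grp P \<times>\<times> grp Q). \<forall>w\<in>W. kact M k w \<in> W"
        using W(1) unfolding k_subspace_def by blast+
      have WM: "W \<subseteq> carrier M" by (rule emb_subspaceD(1)[OF j Ws])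
      have lin: "\<forall>s\<in>kmaps P M e1 \<union> kmaps Q M e2. linear_map M M s"
        unfolding ball_Un[of "kmaps P M e1" "kmaps Q M e2"] using linear_K1 linear_K2 by (rule conjI)
      have "rstable M (kmaps P M e1 \<union> kmaps Q M e2) W" unfolding rstable_def ball_Un using Ws Wk by simp
      then have "fv.stable (?K1 \<union> ?K2) (j ` W)" using stable_lifts[OF j lin WM] unfolding lifts_Un by blast
      moreover have "fv.fd (j ` W)" using W(2) emb_finite_dim[OF j Ws] by blast
      ultimately show ?thesis using WM W(3) m(2) by blast
    qed
    show "fv.fd (fv.hom_values (?K1 \<union> ?K2) E (j ` carrier M) e)"
      if E: "fv.irred (?K1 \<union> ?K2) E" "fv.fd E" "E \<subseteq> j ` carrier M" "e \<in> E" "e \<noteq> 0" for E e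
    proof (rule fd_hom_values_of_multiplicities[OF gk_moduleD(1)[OF M] _ j _ _ fm E])
      show "topspace (ktop (pair_product P Q)) \<subseteq> carrier (grp (pair_product P Q))" by (simp add: p(2) q(2))
      show "\<forall>kl\<in>carrier (grp (pair_product P Q)). \<exists>g\<in>?K1 \<union> ?K2. \<exists>h\<in>?K1 \<union> ?K2. \<forall>v\<in>carrier M. g (h (j v)) = j (kact M kl v)"
      proof
        fix z assume "z \<in> carrier (grp (pair_product P Q))"
        then obtain k l where z: "z = (k, l)" "k \<in> carrier (grp P)" "l \<in> carrier (grp Q)" by auto
        obtain g where g: "g \<in> ?K1" "\<forall>v\<in>carrier M. g (j v) = j (kact M (e1 k) v)" by (rule bexE[OF K1_apply[OF j z(2)]])
        obtain h where h: "h \<in> ?K2" "\<forall>v\<in>carrier M. h (j v) = j (kact M (e2 l) v)" by (rule bexE[OF K2_apply[OF j z(3)]])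
        have "g (h (j v)) = j (kact M z v)" if v: "v \<in> carrier M" for v
          unfolding bspec[OF h(2) v] bspec[OF g(2) lc[OF z(3) v]] z(1) kact_split(1)[OF z(2,3) v] ..
        then show "\<exists>g\<in>?K1 \<union> ?K2. \<exists>h\<in>?K1 \<union> ?K2. \<forall>v\<in>carrier M. g (h (j v)) = j (kact M z v)"
          by (intro bexI[of _ g] bexI[of _ h] ballI UnI1[OF g(1)] UnI2[OF h(1)])
      qed
      show "\<forall>g\<in>?K1 \<union> ?K2. \<exists>k\<in>carrier (grp (pair_product P Q)). \<forall>v\<in>carrier M. g (j v) = j (kact M k v)"
      proof
        fix g assume "g \<in> ?K1 \<union> ?K2"
        then show "\<exists>k\<in>carrier (grp (pair_product P Q)). \<forall>v\<in>carrier M. g (j v) = j (kact M k v)"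
        proof
          assume g: "g \<in> ?K1"
          obtain k where k: "k \<in> carrier (grp P)" "\<forall>v\<in>carrier M. g (j v) = j (kact M (e1 k) v)" by (rule bexE[OF K1_act[OF g]])
          show ?thesis using k by (intro bexI[of _ "e1 k"]) simp_all
        next
          assume g: "g \<in> ?K2"
          obtain k where k: "k \<in> carrier (grp Q)" "\<forall>v\<in>carrier M. g (j v) = j (kact M (e2 k) v)" by (rule bexE[OF K2_act[OF g]])
          show ?thesis using k by (intro bexI[of _ "e2 k"]) simp_all
        qed
      qed
    qed
  qed
qed

end

context pair_module
begin

theorem decomposition:
  assumes irr: "irreducible_gk_module (pair_product P Q) M"
    and fm: "finite_multiplicities (grp (pair_product P Q)) (ktop (pair_product P Q)) M"
  shows "\<exists>(M1 :: ('x, 'k, 'v) gk_rep) (M2 :: ('y, 'l, 'v) gk_rep).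
    irreducible_gk_module P M1 \<and> admissible P M1 \<and> irreducible_gk_module Q M2 \<and> admissible Q M2 \<and>
    gk_isomorphic (pair_product P Q) M (gk_tensor M1 M2)"
proof -
  obtain j :: "'v \<Rightarrow> 'v \<Rightarrow> complex" where j: "emb M j" by (rule emb_exists[OF KM(1)])
  let ?A = "lifts j M S1" and ?B = "lifts j M S2" and ?K1 = "lifts j M (kmaps P M e1)" and ?K2 = "lifts j M (kmaps Q M e2)"
  interpret C: commuting_pair fscale ?A ?B ?K1 ?K2 "j ` carrier M" by (rule commuting[OF j irr fm])
  obtain t X Y where
    f: "fv.tensor t X Y (j ` carrier M) \<and> fv.irred ?A Y \<and> fv.irred ?B X \<and> X \<subseteq> j ` carrier M \<and> Y \<subseteq> j ` carrier M \<and>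
     (\<forall>a\<in>?A. \<forall>x\<in>X. \<forall>y\<in>Y. a (t x y) = t x (a y)) \<and> (\<forall>b\<in>?B. \<forall>x\<in>X. \<forall>y\<in>Y. b (t x y) = t (b x) y) \<and>
     (\<forall>\<tau> r. fv.irred ?K1 \<tau> \<longrightarrow> fv.fd \<tau> \<longrightarrow> \<tau> \<subseteq> Y \<longrightarrow> r \<in> \<tau> \<longrightarrow> r \<noteq> 0 \<longrightarrow> fv.fd (fv.hom_values ?K1 \<tau> Y r)) \<and>
     (\<forall>\<tau> r. fv.irred ?K2 \<tau> \<longrightarrow> fv.fd \<tau> \<longrightarrow> \<tau> \<subseteq> X \<longrightarrow> r \<in> \<tau> \<longrightarrow> r \<noteq> 0 \<longrightarrow> fv.fd (fv.hom_values ?K2 \<tau> X r))"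
    using C.factorization by (elim exE) (rule that)
  note t = conjunct1[OF f] and f1 = conjunct2[OF f]
  note irrY = conjunct1[OF f1] and f2 = conjunct2[OF f1]
  note irrX = conjunct1[OF f2] and f3 = conjunct2[OF f2]
  note XM = conjunct1[OF f3] and f4 = conjunct2[OF f3]
  note YM = conjunct1[OF f4] and f5 = conjunct2[OF f4]
  note ta = conjunct1[OF f5] and f6 = conjunct2[OF f5]
  note tb = conjunct1[OF f6] and f7 = conjunct2[OF f6]
  note fdY = conjunct1[OF f7] and fdX = conjunct2[OF f7]
  \<comment> \<open>The tensor factors pulled back to the carrier of \<open>M\<close>:
    \<open>W1\<close> comes from \<open>Y\<close>, on which the first factor acts, and
    \<open>W2\<close> from the hom space \<open>X\<close>.\<close>
  define W1 where "W1 = {v \<in> carrier M. j v \<in> Y}"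
  define W2 where "W2 = {v \<in> carrier M. j v \<in> X}"
  have im: "j ` {v \<in> carrier M. j v \<in> Z} = Z" if Z: "Z \<subseteq> j ` carrier M" for Z
  proof
    show "Z \<subseteq> j ` {v \<in> carrier M. j v \<in> Z}"
    proof
      fix z assume z: "z \<in> Z"
      then have "z \<in> j ` carrier M" using Z by (rule subsetD[rotated])
      then obtain v where "z = j v" "v \<in> carrier M" by (rule imageE)
      then show "z \<in> j ` {v \<in> carrier M. j v \<in> Z}" using z by simp
    qed
  qed (rule image_subsetI, simp)
  have W1: "W1 \<subseteq> carrier M" "j ` W1 = Y" and W2: "W2 \<subseteq> carrier M" "j ` W2 = X"
    unfolding W1_def W2_def im[OF XM] im[OF YM] by simp_all
  have s1: "rstable M S1 W1 \<and> W1 \<noteq> {\<zero>\<^bsub>M\<^esub>} \<and> (\<forall>Z. rstable M S1 Z \<and> Z \<subseteq> W1 \<longrightarrow> Z = {\<zero>\<^bsub>M\<^esub>} \<or> Z = W1)"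
    using irrY unfolding W1(2)[symmetric] irred_lifts[OF j linear_S1 W1(1)] .
  have s2: "rstable M S2 W2 \<and> W2 \<noteq> {\<zero>\<^bsub>M\<^esub>} \<and> (\<forall>Z. rstable M S2 Z \<and> Z \<subseteq> W2 \<longrightarrow> Z = {\<zero>\<^bsub>M\<^esub>} \<or> Z = W2)"
    using irrX unfolding W2(2)[symmetric] irred_lifts[OF j linear_S2 W2(1)] .
  note st1 = conjunct1[OF s1] and st2 = conjunct1[OF s2]
  note W1s = rstableD[OF st1] and W2s = rstableD[OF st2]
  let ?M1 = "sub_rep M W1 e1 a1" and ?M2 = "sub_rep M W2 e2 a2"
  have I1: "irreducible_gk_module P ?M1"
    by (rule irreducible_sub_rep[OF M pair_mor_left[OF P Q] st1 conjunct1[OF conjunct2[OF s1]] conjunct2[OF conjunct2[OF s1]]])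
  have I2: "irreducible_gk_module Q ?M2"
    by (rule irreducible_sub_rep[OF M pair_mor_right[OF P Q] st2 conjunct1[OF conjunct2[OF s2]] conjunct2[OF conjunct2[OF s2]]])
  have G1: "gk_module P ?M1" and G2: "gk_module Q ?M2"
    using conjunct1[OF I1[unfolded irreducible_gk_module_def]] conjunct1[OF I2[unfolded irreducible_gk_module_def]] .
  have J1: "emb ?M1 j" and J2: "emb ?M2 j" by (rule emb_sub_rep[OF j W1s(1)], rule emb_sub_rep[OF j W2s(1)])
  have c1: "v \<in> carrier M" "j v \<in> Y" if "v \<in> W1" for v using that by (simp_all add: W1_def)
  have c2: "v \<in> carrier M" "j v \<in> X" if "v \<in> W2" for v using that by (simp_all add: W2_def)
  have "finite_multiplicities (grp P) (ktop P) ?M1"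
  proof (rule finite_multiplicitiesI[OF _ J1])
    show "\<forall>k\<in>carrier (grp P). linear_map ?M1 ?M1 (kact ?M1 k)"
      using k_moduleD(2)[OF gk_moduleD(1)[OF G1]] by (intro ballI)
    show "represents (grp P) ?M1 j ?K1"
      unfolding represents_def sub_rep_simps
    proof (intro conjI ballI)
      fix k assume k: "k \<in> carrier (grp P)"
      show "\<exists>g\<in>?K1. \<forall>v\<in>W1. g (j v) = j (kact M (e1 k) v)"
        by (rule bexE[OF K1_apply[OF j k]]) (use c1(1) in \<open>blast\<close>)
    next
      fix g assume g: "g \<in> ?K1"
      show "fv.lin g" by (rule bspec[OF lifts_lin g])
      show "\<exists>k\<in>carrier (grp P). \<forall>v\<in>W1. g (j v) = j (kact M (e1 k) v)"
        by (rule bexE[OF K1_act[OF g]]) (use c1(1) in \<open>blast\<close>)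
    qed
    show "fv.fd (fv.hom_values ?K1 \<tau> (j ` carrier ?M1) r)"
      if "fv.irred ?K1 \<tau>" "fv.fd \<tau>" "\<tau> \<subseteq> j ` carrier ?M1" "r \<in> \<tau>" "r \<noteq> 0" for \<tau> r
      using fdY that unfolding sub_rep_simps W1(2) by simp
  qed
  then have A1: "admissible P ?M1" unfolding admissible_def using G1 irreducible_finitely_generated[OF I1] by simp
  have "finite_multiplicities (grp Q) (ktop Q) ?M2"
  proof (rule finite_multiplicitiesI[OF _ J2])
    show "\<forall>k\<in>carrier (grp Q). linear_map ?M2 ?M2 (kact ?M2 k)"
      using k_moduleD(2)[OF gk_moduleD(1)[OF G2]] by (intro ballI)
    show "represents (grp Q) ?M2 j ?K2"
      unfolding represents_def sub_rep_simps
    proof (intro conjI ballI)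
      fix k assume k: "k \<in> carrier (grp Q)"
      show "\<exists>g\<in>?K2. \<forall>v\<in>W2. g (j v) = j (kact M (e2 k) v)"
        by (rule bexE[OF K2_apply[OF j k]]) (use c2(1) in \<open>blast\<close>)
    next
      fix g assume g: "g \<in> ?K2"
      show "fv.lin g" by (rule bspec[OF lifts_lin g])
      show "\<exists>k\<in>carrier (grp Q). \<forall>v\<in>W2. g (j v) = j (kact M (e2 k) v)"
        by (rule bexE[OF K2_act[OF g]]) (use c2(1) in \<open>blast\<close>)
    qed
    show "fv.fd (fv.hom_values ?K2 \<tau> (j ` carrier ?M2) r)"
      if "fv.irred ?K2 \<tau>" "fv.fd \<tau>" "\<tau> \<subseteq> j ` carrier ?M2" "r \<in> \<tau>" "r \<noteq> 0" for \<tau> r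
      using fdX that unfolding sub_rep_simps W2(2) by simp
  qed
  then have A2: "admissible Q ?M2" unfolding admissible_def using G2 irreducible_finitely_generated[OF I2] by simp
  have taW: "a (t (j w) (j v)) = t (j w) (a (j v))" if "a \<in> ?A" "v \<in> W1" "w \<in> W2" for a v w
    using ta that(1) c1(2)[OF that(2)] c2(2)[OF that(3)] by simp
  have tbW: "b (t (j w) (j v)) = t (b (j w)) (j v)" if "b \<in> ?B" "v \<in> W1" "w \<in> W2" for b v w
    using tb that(1) c1(2)[OF that(2)] c2(2)[OF that(3)] by simp
  have "gk_isomorphic (pair_product P Q) M (gk_tensor ?M1 ?M2)"
  proof (rule gk_tensor_isomorphic[OF j J1 J2, of t])
    show "fv.tensor t (j ` carrier ?M2) (j ` carrier ?M1) (j ` carrier M)"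
      unfolding sub_rep_simps W1(2) W2(2) by (rule t)
  next
    fix k l assume k: "k \<in> carrier (grp P)" and l: "l \<in> carrier (grp Q)"
    obtain g1 where g1: "g1 \<in> ?K1" "\<forall>v\<in>carrier M. g1 (j v) = j (kact M (e1 k) v)" by (rule bexE[OF K1_apply[OF j k]])
    obtain g2 where g2: "g2 \<in> ?K2" "\<forall>v\<in>carrier M. g2 (j v) = j (kact M (e2 l) v)" by (rule bexE[OF K2_apply[OF j l]])
    have g12: "g1 \<in> ?A" "g2 \<in> ?B" unfolding lifts_Un using g1(1) g2(1) by simp_all
    \<comment> \<open>On a product, \<open>g2\<close> acts on the first argument of \<open>t\<close>
      and \<open>g1\<close> on the second.\<close>
    let ?g = "\<lambda>x. g1 (g2 x)"
    have lin: "fv.lin ?g" by (rule fv.lin_compose[OF bspec[OF lifts_lin g1(1)] bspec[OF lifts_lin g2(1)]])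
    have gm: "?g (j m) = j (kact M (k, l) m)" if m: "m \<in> carrier M" for m
      unfolding bspec[OF g2(2) m] bspec[OF g1(2) linear_mapD(1)[OF kl[OF K.one_closed l] m]] kact_split(1)[OF k l m] ..
    have gt: "?g (t (j w) (j v)) = t (j (kact M (e2 l) w)) (j (kact M (e1 k) v))" if v: "v \<in> W1" and w: "w \<in> W2" for v w
      unfolding tbW[OF g12(2) v w] bspec[OF g2(2) c2(1)[OF w]] taW[OF g12(1) v W2s(2)[OF l w]] bspec[OF g1(2) c1(1)[OF v]] ..
    show "linear_map M M (kact M (k, l)) \<and>
        (\<forall>v\<in>carrier ?M1. kact ?M1 k v \<in> carrier ?M1) \<and> (\<forall>w\<in>carrier ?M2. kact ?M2 l w \<in> carrier ?M2) \<and>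
        (\<exists>g. fv.lin g \<and> (\<forall>m\<in>carrier M. g (j m) = j (kact M (k, l) m)) \<and>
          (\<forall>v\<in>carrier ?M1. \<forall>w\<in>carrier ?M2. g (t (j w) (j v)) = t (j (kact ?M2 l w)) (j (kact ?M1 k v))))"
      unfolding sub_rep_simps
      by (intro conjI ballI exI[of _ ?g] kl[OF k l] W1s(2)[OF k] W2s(2)[OF l] lin gm gt)
  next
    fix Z T assume Z: "Z \<in> carrier (alg P)" and T: "T \<in> carrier (alg Q)"
    obtain g1 where g1: "g1 \<in> ?A" "\<forall>v\<in>carrier M. g1 (j v) = j (gact M (a1 Z) v)"
      by (rule bexE[OF lifts_apply[OF j linear_S1 S_members(2)[OF Z]]])
    obtain g2 where g2: "g2 \<in> ?B" "\<forall>v\<in>carrier M. g2 (j v) = j (gact M (a2 T) v)"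
      by (rule bexE[OF lifts_apply[OF j linear_S2 S_members(4)[OF T]]])
    \<comment> \<open>The Lie algebra acts on a tensor product by the Leibniz rule, so operators are
      added here where those of the group were composed.\<close>
    let ?g = "\<lambda>x. g1 x + g2 x"
    have lin: "fv.lin ?g" by (rule fv.lin_plus[OF bspec[OF lifts_lin g1(1)] bspec[OF lifts_lin g2(1)]])
    have gm: "?g (j m) = j (gact M (Z, T) m)" if m: "m \<in> carrier M" for m
      unfolding bspec[OF g2(2) m] bspec[OF g1(2) m] gact_split[OF Z T m]
        embD(5)[OF j linear_mapD(1)[OF gl[OF Z q(4)] m] linear_mapD(1)[OF gl[OF p(4) T] m]] ..
    have gt: "?g (t (j w) (j v)) = t (j w) (j (gact M (a1 Z) v)) + t (j (gact M (a2 T) w)) (j v)"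
      if v: "v \<in> W1" and w: "w \<in> W2" for v w
      unfolding tbW[OF g2(1) v w] bspec[OF g2(2) c2(1)[OF w]] taW[OF g1(1) v w] bspec[OF g1(2) c1(1)[OF v]] ..
    show "linear_map M M (gact M (Z, T)) \<and>
        (\<forall>v\<in>carrier ?M1. gact ?M1 Z v \<in> carrier ?M1) \<and> (\<forall>w\<in>carrier ?M2. gact ?M2 T w \<in> carrier ?M2) \<and>
        (\<exists>g. fv.lin g \<and> (\<forall>m\<in>carrier M. g (j m) = j (gact M (Z, T) m)) \<and>
          (\<forall>v\<in>carrier ?M1. \<forall>w\<in>carrier ?M2.
             g (t (j w) (j v)) = t (j w) (j (gact ?M1 Z v)) + t (j (gact ?M2 T w)) (j v)))"
      unfolding sub_rep_simps
      by (intro conjI ballI exI[of _ ?g] gl[OF Z T] W1s(3)[OF Z] W2s(3)[OF T] lin gm gt)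
  qed
  then show ?thesis using I1 A1 I2 A2 by (intro exI[of _ ?M1] exI[of _ ?M2] conjI)
qed

end

text \<open>Complexification works componentwise, so the claims on zero reduce to those for the real
  Lie algebra; compactness of \<open>K\<close> becomes compactness of its subspace topology.\<close>

lemma pair_ok_pair_of:
  assumes G: "is_lie_group G" and K: "compact_subgroup G K"
  shows "pair_ok (pair_of G K)"
proof -
  have gr: "group G" and top: "topspace (gtop G) = carrier G" using G by (simp_all add: is_lie_group_def)
  interpret group G by (rule gr)
  have sub: "subgroup K G" and cpt: "compactin (gtop G) K" using K by (simp_all add: compact_subgroup_def)
  have KG: "k \<in> carrier G" if "k \<in> K" for k using subgroup.mem_carrier[OF sub that] .
  let ?K = "\<lparr>carrier = K, mult = mult G, one = one G\<rparr>"
  have gK: "group ?K"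
  proof (rule groupI)
    show "\<exists>y\<in>carrier ?K. y \<otimes>\<^bsub>?K\<^esub> x = \<one>\<^bsub>?K\<^esub>" if "x \<in> carrier ?K" for x
      using that subgroup.m_inv_closed[OF sub, of x] l_inv[OF KG, of x] by auto
  qed (use KG in \<open>auto simp: subgroup.m_closed[OF sub] subgroup.one_closed[OF sub] m_assoc\<close>)
  have tK: "topspace (subtopology (gtop G) K) = K"
    using KG unfolding topspace_subtopology top by blast
  have cK: "compact_space (subtopology (gtop G) K)" by (rule compact_space_subtopology[OF cpt])
  have rng: "range \<gamma> \<subseteq> K \<and> X \<in> carrier (complexification (Lie G))" if "(\<gamma>, X) \<in> tangents (pair_of G K)" for \<gamma> X
    using that Lie_zero_closed[OF G] by (auto simp: pair_of_def complexification_def one_parameter_subgroup_def)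
  have triv: "(\<lambda>t. \<one>\<^bsub>G\<^esub>, (\<zero>\<^bsub>Lie G\<^esub>, \<zero>\<^bsub>Lie G\<^esub>)) \<in> tangents (pair_of G K)"
    using one_parameter_subgroup_trivial[OF G] subgroup.one_closed[OF sub] by (auto simp: pair_of_def)
  note L = Lie_zero_closed[OF G] Lie_add_zero[OF G] Lie_scale_zero[OF G] Lie_bracket_zero[OF G] Ad_zero[OF G] Ad_one[OF G]
  show ?thesis
    unfolding pair_ok_def
  proof (intro conjI ballI allI impI)
    show "range \<gamma> \<subseteq> carrier (grp (pair_of G K))" "X \<in> carrier (alg (pair_of G K))"
      if "(\<gamma>, X) \<in> tangents (pair_of G K)" for \<gamma> X
      using rng[OF that] by (simp_all add: pair_of_def)
    show "(\<lambda>t. \<one>\<^bsub>grp (pair_of G K)\<^esub>, \<zero>\<^bsub>alg (pair_of G K)\<^esub>) \<in> tangents (pair_of G K)"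
      using triv by (simp add: pair_of_def complexification_def)
  qed (use gK tK cK KG in \<open>auto simp: pair_of_def complexification_def L\<close>)
qed

theorem theorem1p1:
  fixes G1 :: "'a lie_group" and K1 :: "'a set"
    and G2 :: "'b lie_group" and K2 :: "'b set"
    and M :: "(('a derivation \<times> 'a derivation) \<times> ('b derivation \<times> 'b derivation),
               'a \<times> 'b, 'v) gk_rep"
  assumes "real_reductive_group G1" and "maximal_compact_subgroup G1 K1"
    and "real_reductive_group G2" and "maximal_compact_subgroup G2 K2"
    and "irreducible_gk_module (pair_product (pair_of G1 K1) (pair_of G2 K2)) M"
    and "admissible (pair_product (pair_of G1 K1) (pair_of G2 K2)) M"
  shows "\<exists>(M1 :: ('a derivation \<times> 'a derivation, 'a, 'v) gk_rep)
           (M2 :: ('b derivation \<times> 'b derivation, 'b, 'v) gk_rep).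
           irreducible_gk_module (pair_of G1 K1) M1 \<and> admissible (pair_of G1 K1) M1 \<and>
           irreducible_gk_module (pair_of G2 K2) M2 \<and> admissible (pair_of G2 K2) M2 \<and>
           gk_isomorphic (pair_product (pair_of G1 K1) (pair_of G2 K2)) M (gk_tensor M1 M2)"
proof -
  have ok: "pair_ok (pair_of G K)" if "real_reductive_group G" "maximal_compact_subgroup G K" for G :: "'g lie_group" and K
    by (rule pair_ok_pair_of) (use that in \<open>simp_all add: real_reductive_group_def maximal_compact_subgroup_def\<close>)
  interpret pair_module "pair_of G1 K1" "pair_of G2 K2" M
    by unfold_locales (use ok[OF assms(1,2)] ok[OF assms(3,4)] assms(5) in \<open>simp_all add: irreducible_gk_module_def\<close>)
  show ?thesis by (rule decomposition[OF assms(5)]) (use assms(6) in \<open>simp only: admissible_def\<close>)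
qed

end
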